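(* Let $\mathcal{N}_{A\to BC}$ be a quantum broadcast channel (a completely positive trace-preserving map on finite-dimensional systems) from a sender Alice ($A$) to receivers Bob ($B$) and Charlie ($C$). If the rate tuple $(E_{AB},E_{AC},E_{BC},E_{ABC},K_{AB},K_{AC},K_{BC},K_{ABC})$ is achievable, then there exists a pure state $\phi_{RA}$, with $\omega_{RBC}\equiv\mathcal{N}_{A\to BC}(\phi_{RA})$, such that \begin{align*} E_{AB}+K_{AB}+E_{BC}+K_{BC}+E_{ABC}+K_{ABC}&\le E_{\mathrm{sq}}(RC;B)_\omega,\\ E_{AC}+K_{AC}+E_{BC}+K_{BC}+E_{ABC}+K_{ABC}&\le E_{\mathrm{sq}}(RB;C)_\omega,\\ E_{AB}+K_{AB}+E_{AC}+K_{AC}+E_{ABC}+K_{ABC}&\le E_{\mathrm{sq}}(R;BC)_\omega,\\ E_{AB}+K_{AB}+E_{AC}+K_{AC}+E_{BC}+K_{BC}+\tfrac32\left(E_{ABC}+K_{ABC}\right)&\le \min\left\{E_{\mathrm{sq}}(R;B;C)_\omega,\ \widetilde{E}_{\mathrm{sq}}(R;B;C)_\omega\right\}. \end{align*} Moreover, the system $R$ can be taken to have dimension no larger than that of the channel input $A$.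
   Context: Entropies are von Neumann entropies, $H(X|E)\equiv H(XE)-H(E)$. For a state $\rho_{A_1\cdots A_mE}$ define $I(A_1;\cdots;A_m|E)_\rho=\sum_{i=1}^m H(A_i|E)_\rho-H(A_1\cdots A_m|E)_\rho$ and $\widetilde I(A_1;\cdots;A_m|E)_\rho=\sum_{i=1}^m H(A_{[m]\setminus\{i\}}|E)_\rho-(m-1)H(A_1\cdots A_m|E)_\rho$, where $A_{[m]\setminus\{i\}}$ denotes all systems except $A_i$. For a state $\rho_{A_1\cdots A_m}$, $E_{\mathrm{sq}}(A_1;\cdots;A_m)_\rho=\frac12\inf I(A_1;\cdots;A_m|E)_\omega$ and $\widetilde E_{\mathrm{sq}}(A_1;\cdots;A_m)_\rho=\frac12\inf \widetilde I(A_1;\cdots;A_m|E)_\omega$, the infima being over all extensions $\omega_{A_1\cdots A_mE}$ of $\rho$ (i.e. $\mathrm{Tr}_E\,\omega=\rho$). Semicolons separate parties; juxtaposed systems (e.g. $RC$) are grouped into a single party. For two parties both measures equal the usual squashed entanglement. A GHZ (maximally entangled) state of $\log d$ entangled bits on parties $X_1,\dots,X_k$ is $|\Phi\rangle=d^{-1/2}\sum_{i=0}^{d-1}|i\rangle_{X_1}\cdots|i\rangle_{X_k}$. A private state of $\log d$ private bits on parties $X_1,\dots,X_k$ (each holding a key system $X_j$ of dimension $d$ and a shield system $X_j'$) is a state of the form $U(\Phi_{X_1\cdots X_k}\otimes\rho_{X_1'\cdots X_k'})U^\dagger$ with $\Phi$ a GHZ state of Schmidt rank $d$ and $U=\sum_{i_1,\dots,i_k}|i_1\cdots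 i_k\rangle\langle i_1\cdots i_k|_{X_1\cdots X_k}\otimes U^{i_1\cdots i_k}_{X_1'\cdots X_k'}$ with each $U^{i_1\cdots i_k}$ unitary. Protocol: an $(n,\varepsilon)$ protocol for this tuple consists of: a round of LOCC among Alice, Bob, Charlie preparing a state on $A_1$ and local scratch registers; then for $i=1,\dots,n$, Alice sends system $A_i$ through $\mathcal{N}_{A\to BC}$ (Bob receiving $B_i$, Charlie $C_i$), followed by a round of LOCC (which prepares $A_{i+1}$ if $i<n$); the final LOCC round outputs a finite-dimensional state $\Omega_{ABC}$ satisfying $\|\Omega_{ABC}-\Psi_{ABC}\|_1\le\varepsilon$, where $\Psi_{ABC}$ is the tensor product, on distinct subsystems, of GHZ states shared by $\{A,B\},\{A,C\},\{B,C\},\{A,B,C\}$ containing $nE_{AB},nE_{AC},nE_{BC},nE_{ABC}$ entangled bits respectively, and private states shared by $\{A,B\},\{A,C\},\{B,C\},\{A,B,C\}$ containing $nK_{AB},nK_{AC},nK_{BC},nK_{ABC}$ private bits respectively. The tuple is achievable if for every $\varepsilon>0$ and all sufficiently large $n$ such a protocol exists. *)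

theory Defs
  imports Complex_Main "Jordan_Normal_Form.Matrix"
begin

text \<open>A state on the tensor factors with dimensions ds = [d0,...,d(k-1)] is a
  complex matrix of size prod_list ds; factor 0 is the most significant digit.
  Grouping consecutive factors into one system is therefore free.\<close>

fun digits :: "nat list \<Rightarrow> nat \<Rightarrow> nat list" where
  "digits [] i = []"
| "digits (d # ds) i = (i div prod_list ds) mod d # digits ds i"

fun undigits :: "nat list \<Rightarrow> nat list \<Rightarrow> nat" where
  "undigits [] xs = 0"
| "undigits (d # ds) xs = hd xs * prod_list ds + undigits ds (tl xs)"

definition cmtrace :: "complex mat \<Rightarrow> complex" where
  "cmtrace A = (\<Sum>i<dim_row A. A $$ (i, i))"

definition adj :: "complex mat \<Rightarrow> complex mat" where
  "adj A = mat (dim_col A) (dim_row A) (\<lambda>(i, j). cnj (A $$ (j, i)))"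

definition outer :: "complex vec \<Rightarrow> complex mat" where
  "outer v = mat (dim_vec v) (dim_vec v) (\<lambda>(i, j). v $ i * cnj (v $ j))"

definition kron :: "complex mat \<Rightarrow> complex mat \<Rightarrow> complex mat" where
  "kron A B = mat (dim_row A * dim_row B) (dim_col A * dim_col B)
     (\<lambda>(i, j). A $$ (i div dim_row B, j div dim_col B) * B $$ (i mod dim_row B, j mod dim_col B))"

fun kron_list :: "complex mat list \<Rightarrow> complex mat" where
  "kron_list [] = 1\<^sub>m 1"
| "kron_list (A # As) = kron A (kron_list As)"

definition msum :: "nat \<Rightarrow> complex mat list \<Rightarrow> complex mat" where
  "msum n As = foldr (+) As (0\<^sub>m n n)"

definition kept_pos :: "nat list \<Rightarrow> nat set \<Rightarrow> nat list" where
  "kept_pos ds S = filter (\<lambda>j. j \<in> S) [0..<length ds]"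

definition traced_pos :: "nat list \<Rightarrow> nat set \<Rightarrow> nat list" where
  "traced_pos ds S = filter (\<lambda>j. j \<notin> S) [0..<length ds]"

definition merge_digits :: "nat list \<Rightarrow> nat set \<Rightarrow> nat list \<Rightarrow> nat list \<Rightarrow> nat list" where
  "merge_digits ds S a c =
     map (\<lambda>j. if j \<in> S then a ! card {k\<in>S. k < j} else c ! card {k. k < j \<and> k \<notin> S}) [0..<length ds]"

definition ptrace_keep :: "nat list \<Rightarrow> nat set \<Rightarrow> complex mat \<Rightarrow> complex mat" where
  "ptrace_keep ds S \<rho> =
    (let K = map ((!) ds) (kept_pos ds S); T = map ((!) ds) (traced_pos ds S)
     in mat (prod_list K) (prod_list K)
          (\<lambda>(i, j). \<Sum>t<prod_list T.
              \<rho> $$ (undigits ds (merge_digits ds S (digits K i) (digits T t)),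
                     undigits ds (merge_digits ds S (digits K j) (digits T t)))))"

text \<open>Reordering of tensor factors: new factor k is old factor (\<pi> ! k).\<close>

definition perm_state :: "nat list \<Rightarrow> nat list \<Rightarrow> complex mat \<Rightarrow> complex mat" where
  "perm_state ds \<pi> \<rho> =
    (let ds' = map ((!) ds) \<pi>;
         old = (\<lambda>i. undigits ds (map (\<lambda>p. digits ds' i ! (LEAST k. \<pi> ! k = p)) [0..<length ds]))
     in mat (prod_list ds) (prod_list ds) (\<lambda>(i, j). \<rho> $$ (old i, old j)))"

definition apply_on :: "nat list \<Rightarrow> nat \<Rightarrow> (complex mat \<Rightarrow> complex mat) \<Rightarrow> nat \<Rightarrow> complex mat \<Rightarrow> complex mat" where
  "apply_on ds k Lam d' \<rho> =
    (let pre = prod_list (take k ds); dk = ds ! k; post = prod_list (drop (Suc k) ds);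
         blk = (\<lambda>i j i' j'. mat dk dk (\<lambda>(u, v). \<rho> $$ ((i * dk + u) * post + j, (i' * dk + v) * post + j')))
     in mat (pre * d' * post) (pre * d' * post)
          (\<lambda>(x, y). Lam (blk (x div (d' * post)) (x mod post) (y div (d' * post)) (y mod post))
                      $$ ((x div post) mod d', (y div post) mod d')))"

definition psd :: "complex mat \<Rightarrow> bool" where
  "psd A \<longleftrightarrow> dim_row A = dim_col A \<and>
     (\<forall>v \<in> carrier_vec (dim_row A).
        (let z = (\<Sum>i<dim_row A. cnj (v $ i) * (A *\<^sub>v v) $ i) in Im z = 0 \<and> Re z \<ge> 0))"

definition density :: "nat \<Rightarrow> complex mat \<Rightarrow> bool" where
  "density n \<rho> \<longleftrightarrow> \<rho> \<in> carrier_mat n n \<and> psd \<rho> \<and> cmtrace \<rho> = 1"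

definition unitary :: "nat \<Rightarrow> complex mat \<Rightarrow> bool" where
  "unitary n U \<longleftrightarrow> U \<in> carrier_mat n n \<and> adj U * U = 1\<^sub>m n \<and> U * adj U = 1\<^sub>m n"

definition unit_vector :: "nat \<Rightarrow> complex vec \<Rightarrow> bool" where
  "unit_vector n v \<longleftrightarrow> v \<in> carrier_vec n \<and> (\<Sum>i<n. (cmod (v $ i))\<^sup>2) = 1"

definition lin_map :: "nat \<Rightarrow> nat \<Rightarrow> (complex mat \<Rightarrow> complex mat) \<Rightarrow> bool" where
  "lin_map din dout Lam \<longleftrightarrow>
     (\<forall>X \<in> carrier_mat din din. Lam X \<in> carrier_mat dout dout) \<and>
     (\<forall>X \<in> carrier_mat din din. \<forall>Y \<in> carrier_mat din din. \<forall>a b :: complex.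
        Lam (a \<cdot>\<^sub>m X + b \<cdot>\<^sub>m Y) = a \<cdot>\<^sub>m Lam X + b \<cdot>\<^sub>m Lam Y)"

definition cp_map :: "nat \<Rightarrow> nat \<Rightarrow> (complex mat \<Rightarrow> complex mat) \<Rightarrow> bool" where
  "cp_map din dout Lam \<longleftrightarrow> lin_map din dout Lam \<and>
     (\<forall>k. \<forall>X \<in> carrier_mat (k * din) (k * din). psd X \<longrightarrow> psd (apply_on [k, din] 1 Lam dout X))"

definition tp_map :: "nat \<Rightarrow> (complex mat \<Rightarrow> complex mat) \<Rightarrow> bool" where
  "tp_map din Lam \<longleftrightarrow> (\<forall>X \<in> carrier_mat din din. cmtrace (Lam X) = cmtrace X)"

definition cptp :: "nat \<Rightarrow> nat \<Rightarrow> (complex mat \<Rightarrow> complex mat) \<Rightarrow> bool" where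
  "cptp din dout Lam \<longleftrightarrow> cp_map din dout Lam \<and> tp_map din Lam"

definition spec_decomp :: "complex mat \<Rightarrow> (nat \<Rightarrow> real) \<Rightarrow> complex mat \<Rightarrow> bool" where
  "spec_decomp A lam U \<longleftrightarrow> (let n = dim_row A in
     A \<in> carrier_mat n n \<and> unitary n U \<and>
     A = U * mat_diag n (\<lambda>i. complex_of_real (lam i)) * adj U)"

definition eta :: "real \<Rightarrow> real" where
  "eta x = (if x \<le> 0 then 0 else - x * log 2 x)"

definition vn_entropy :: "complex mat \<Rightarrow> real" where
  "vn_entropy \<rho> = (SOME h. \<exists>lam U. spec_decomp \<rho> lam U \<and> h = (\<Sum>i<dim_row \<rho>. eta (lam i)))"

definition trace_norm :: "complex mat \<Rightarrow> real" where
  "trace_norm X = (SOME s. \<exists>mu U. spec_decomp (adj X * X) mu U \<and> s = (\<Sum>i<dim_col X. sqrt (mu i)))"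

definition Hsub :: "nat list \<Rightarrow> nat set \<Rightarrow> complex mat \<Rightarrow> real" where
  "Hsub ds S \<rho> = vn_entropy (ptrace_keep ds S \<rho>)"

definition condH :: "nat list \<Rightarrow> nat set \<Rightarrow> nat \<Rightarrow> complex mat \<Rightarrow> real" where
  "condH ds X e \<omega> = Hsub ds (X \<union> {e}) \<omega> - Hsub ds {e} \<omega>"

text \<open>I(A_1;...;A_m|E) where party i consists of the factors parts!i and E is factor e.\<close>
definition cmi :: "nat list \<Rightarrow> nat set list \<Rightarrow> nat \<Rightarrow> complex mat \<Rightarrow> real" where
  "cmi ds parts e \<omega> =
     (\<Sum>i<length parts. condH ds (parts ! i) e \<omega>) - condH ds (\<Union>(set parts)) e \<omega>"

definition cmi_tilde :: "nat list \<Rightarrow> nat set list \<Rightarrow> nat \<Rightarrow> complex mat \<Rightarrow> real" where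
  "cmi_tilde ds parts e \<omega> =
     (\<Sum>i<length parts. condH ds (\<Union>j\<in>{j. j < length parts \<and> j \<noteq> i}. parts ! j) e \<omega>)
     - real (length parts - 1) * condH ds (\<Union>(set parts)) e \<omega>"

definition extensions :: "nat list \<Rightarrow> complex mat \<Rightarrow> (nat \<times> complex mat) set" where
  "extensions ds \<rho> = {(dE, \<omega>). 0 < dE \<and> density (prod_list (ds @ [dE])) \<omega> \<and>
                         ptrace_keep (ds @ [dE]) {..<length ds} \<omega> = \<rho>}"

definition Esq :: "nat list \<Rightarrow> nat set list \<Rightarrow> complex mat \<Rightarrow> real" where
  "Esq ds parts \<rho> = 1/2 * Inf ((\<lambda>(dE, \<omega>). cmi (ds @ [dE]) parts (length ds) \<omega>) ` extensions ds \<rho>)"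

definition Esq_tilde :: "nat list \<Rightarrow> nat set list \<Rightarrow> complex mat \<Rightarrow> real" where
  "Esq_tilde ds parts \<rho> = 1/2 * Inf ((\<lambda>(dE, \<omega>). cmi_tilde (ds @ [dE]) parts (length ds) \<omega>) ` extensions ds \<rho>)"

definition ghz_vec :: "nat \<Rightarrow> nat \<Rightarrow> complex vec" where
  "ghz_vec k d = vec (d ^ k) (\<lambda>x. if \<exists>i<d. digits (replicate k d) x = replicate k i
                                   then complex_of_real (1 / sqrt (real d)) else 0)"

definition ghz :: "nat \<Rightarrow> nat \<Rightarrow> complex mat" where
  "ghz k d = outer (ghz_vec k d)"

text \<open>Shield data: shield dimensions (one per party), shield state, twisting unitaries
  indexed by the key index in [0, d^k).\<close>
type_synonym shield = "nat list \<times> complex mat \<times> (nat \<Rightarrow> complex mat)"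

definition valid_shield :: "nat \<Rightarrow> nat \<Rightarrow> shield \<Rightarrow> bool" where
  "valid_shield k d sh = (case sh of (ss, \<sigma>, V) \<Rightarrow>
      length ss = k \<and> density (prod_list ss) \<sigma> \<and> (\<forall>i < d ^ k. unitary (prod_list ss) (V i)))"

text \<open>Private state on factors (key_1..key_k, shield_1..shield_k).\<close>
definition private_state :: "nat \<Rightarrow> nat \<Rightarrow> shield \<Rightarrow> complex mat" where
  "private_state k d sh = (case sh of (ss, \<sigma>, V) \<Rightarrow>
     (let S = prod_list ss; D = d ^ k;
          U = mat (D * S) (D * S) (\<lambda>(x, y). if x div S = y div S then V (x div S) $$ (x mod S, y mod S) else 0)
      in U * kron (ghz k d) \<sigma> * adj U))"

text \<open>A component of the target: factor dims, owner of each factor (0=A,1=B,2=C), state.\<close>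
type_synonym component = "nat list \<times> nat list \<times> complex mat"

definition ghz_comp :: "nat list \<Rightarrow> nat \<Rightarrow> component" where
  "ghz_comp ps d = (replicate (length ps) d, ps, ghz (length ps) d)"

definition priv_comp :: "nat list \<Rightarrow> nat \<Rightarrow> shield \<Rightarrow> component" where
  "priv_comp ps d sh = (replicate (length ps) d @ fst sh, ps @ ps, private_state (length ps) d sh)"

definition comp_dims :: "component list \<Rightarrow> nat list" where
  "comp_dims cs = concat (map fst cs)"

definition comp_owners :: "component list \<Rightarrow> nat list" where
  "comp_owners cs = concat (map (fst \<circ> snd) cs)"

definition owner_order :: "component list \<Rightarrow> nat list" where
  "owner_order cs = (let os = comp_owners cs; idx = [0..<length os] in
      filter (\<lambda>j. os ! j = 0) idx @ filter (\<lambda>j. os ! j = 1) idx @ filter (\<lambda>j. os ! j = 2) idx)"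

definition joint_state :: "component list \<Rightarrow> complex mat" where
  "joint_state cs = perm_state (comp_dims cs) (owner_order cs) (kron_list (map (snd \<circ> snd) cs))"

definition party_dim :: "component list \<Rightarrow> nat \<Rightarrow> nat" where
  "party_dim cs p = prod_list (map fst (filter (\<lambda>x. snd x = p) (zip (comp_dims cs) (comp_owners cs))))"

definition party_dims :: "component list \<Rightarrow> nat list" where
  "party_dims cs = [party_dim cs 0, party_dim cs 1, party_dim cs 2]"

definition bdim :: "nat \<Rightarrow> real \<Rightarrow> nat" where
  "bdim n r = nat \<lceil>2 powr (real n * r)\<rceil>"

definition target_comps ::
  "nat \<Rightarrow> real \<Rightarrow> real \<Rightarrow> real \<Rightarrow> real \<Rightarrow> real \<Rightarrow> real \<Rightarrow> real \<Rightarrow> real \<Rightarrow> (nat \<Rightarrow> shield) \<Rightarrow> component list" where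
  "target_comps n eAB eAC eBC eABC kAB kAC kBC kABC sh =
     [ghz_comp [0,1] (bdim n eAB), ghz_comp [0,2] (bdim n eAC),
      ghz_comp [1,2] (bdim n eBC), ghz_comp [0,1,2] (bdim n eABC),
      priv_comp [0,1] (bdim n kAB) (sh 0), priv_comp [0,2] (bdim n kAC) (sh 1),
      priv_comp [1,2] (bdim n kBC) (sh 2), priv_comp [0,1,2] (bdim n kABC) (sh 3)]"

definition valid_shields :: "nat \<Rightarrow> real \<Rightarrow> real \<Rightarrow> real \<Rightarrow> real \<Rightarrow> (nat \<Rightarrow> shield) \<Rightarrow> bool" where
  "valid_shields n kAB kAC kBC kABC sh \<longleftrightarrow>
     valid_shield 2 (bdim n kAB) (sh 0) \<and> valid_shield 2 (bdim n kAC) (sh 1) \<and>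
     valid_shield 2 (bdim n kBC) (sh 2) \<and> valid_shield 3 (bdim n kABC) (sh 3)"

text \<open>Finite-round LOCC among the parties (one local system per party, dims ds):
  either nothing, or some party p applies a local instrument (E x), x < m, announces x,
  and the parties continue with an LOCC map (L x) depending on x.\<close>
inductive locc :: "nat list \<Rightarrow> nat list \<Rightarrow> (complex mat \<Rightarrow> complex mat) \<Rightarrow> bool" where
  locc_id: "locc ds ds (\<lambda>\<rho>. \<rho>)"
| locc_round:
    "\<lbrakk> p < length ds; 0 < m;
       \<forall>x<m. cp_map (ds ! p) (d' x) (E x);
       \<forall>X \<in> carrier_mat (ds ! p) (ds ! p). (\<Sum>x<m. cmtrace (E x X)) = cmtrace X;
       \<forall>x<m. locc (ds[p := d' x]) ds' (L x) \<rbrakk>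
     \<Longrightarrow> locc ds ds' (\<lambda>\<rho>. msum (prod_list ds') (map (\<lambda>x. L x (apply_on ds p (E x) (d' x) \<rho>)) [0..<m]))"

text \<open>One use of N_{A->BC}: Alice's system is A_i (x) A', state on [dA*a', b, c];
  output on Alice A', Bob B_old (x) B_i, Charlie C_old (x) C_i.\<close>
definition chan_step ::
  "(complex mat \<Rightarrow> complex mat) \<Rightarrow> nat \<Rightarrow> nat \<Rightarrow> nat \<Rightarrow> nat \<Rightarrow> nat \<Rightarrow> nat \<Rightarrow> complex mat \<Rightarrow> complex mat" where
  "chan_step N dA dB dC a' b c \<rho> =
     perm_state [dB, dC, a', b, c] [2, 3, 0, 4, 1] (apply_on [dA, a', b, c] 0 N (dB * dC) \<rho>)"

inductive reach for N :: "complex mat \<Rightarrow> complex mat" and dA dB dC :: nat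
  where
  reach_0: "locc [1, 1, 1] ds L \<Longrightarrow> reach N dA dB dC 0 ds (L (1\<^sub>m 1))"
| reach_Suc: "\<lbrakk> reach N dA dB dC k [dA * a', b, c] \<rho>; locc [a', b * dB, c * dC] ds L \<rbrakk>
     \<Longrightarrow> reach N dA dB dC (Suc k) ds (L (chan_step N dA dB dC a' b c \<rho>))"

definition achievable ::
  "(complex mat \<Rightarrow> complex mat) \<Rightarrow> nat \<Rightarrow> nat \<Rightarrow> nat \<Rightarrow>
   real \<Rightarrow> real \<Rightarrow> real \<Rightarrow> real \<Rightarrow> real \<Rightarrow> real \<Rightarrow> real \<Rightarrow> real \<Rightarrow> bool" where
  "achievable N dA dB dC eAB eAC eBC eABC kAB kAC kBC kABC \<longleftrightarrow>
    (\<forall>\<epsilon>>0. \<exists>n0. \<forall>n\<ge>n0. \<exists>sh \<Omega>.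
       valid_shields n kAB kAC kBC kABC sh \<and>
       (let cs = target_comps n eAB eAC eBC eABC kAB kAC kBC kABC sh in
          reach N dA dB dC n (party_dims cs) \<Omega> \<and>
          trace_norm (\<Omega> - joint_state cs) \<le> \<epsilon>))"

end

theory Submission
 imports Defs "Jordan_Normal_Form.Spectral_Radius"
begin

text \<open>Keep the state of Alice, Bob and Charlie pure by two environments E and F that both receive a copy of every classical
 message. On this pure state each of the four conditional informations (given E) is, by strong subadditivity, not increased
 by LOCC, and one use of the channel raises it by at most its value for any isometric dilation into BCEF, applied to the
 channel input. It is concave in that input, so n uses contribute at most n times the value at the average input.
 At the end, a state close to private states has large values of all four: untwisting decouples the shields and the
 environments from the keys, and Fano's inequality controls the key copies. Letting n grow, the average inputs have a limit
 point; its purification is the required state, since every extension of the channel output arises, up to an isometry on the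
 environment, from some dilation.\<close>


text \<open>One input state has to serve all extensions of the channel output. The accumulated input
  operator is therefore fixed by the protocol before any dilation is considered, and every later
  estimate holds for all dilations. Two environments are used because E alone does not purify the
  parties: with F, a conditional information is a sum of conditional entropies of the passive
  parties, to which strong subadditivity applies directly, and exchanging E and F turns I into its
  tilde version. A message known to both environments makes the state block diagonal, so the
  branches of a protocol add up. All quantities are homogeneous of degree one in the unnormalised
  state; concavity thus reads as superadditivity, inputs are summed, and the division by n is done
  once at the end. The cost of inaccuracy is of order eps n plus a constant, so it disappears on
  division by n followed by eps to 0. Systems are maps on a finite index set, which turns regrouping
  into a change of maps. The factor 1/2 of the squashed measures answers to a key being counted on
  both sides of a cut; in the three-party quantities a key shared by three counts three times,
  whence 3/2.\<close>

abbreviation Tms (infixr "><" 80) where "A >< B == A \<times> B"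

abbreviation iff (infixr "<->" 25) where "P <-> Q == P = Q"

abbreviation tends (infix "---->" 60) where "f ----> l == f \<longlonglongrightarrow> l"

abbreviation nsq :: "'k set => ('k => complex) => real" where "nsq K f == SUM k:K. (cmod (f k))^2"

abbreviation dl where "dl i j == if i = j then 1 else 0"

abbreviation same where "PROP same K p q == (!!k l. k : K ==> l : K ==> p k = p l <-> q k = q l)"

type_synonym 'r state = "(nat * nat * nat) * 'r => complex"

lemmas sum_distribs = sum_distrib_left sum_distrib_right

section \<open>Rearranging nested finite sums\<close>

lemma sum_rotl: "(SUM a:A. SUM b:B. SUM c:C. f a b c) = (SUM b:B. SUM c:C. SUM a:A. f a b c)"
 by (subst sum.swap) (intro sum.cong refl sum.swap)

lemma sum_rotl4: "(SUM a:A. SUM b:B. SUM c:C. SUM d:D. f a b c d) = (SUM b:B. SUM c:C. SUM d:D. SUM a:A. f a b c d)"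
 by (subst sum.swap) (intro sum.cong refl sum_rotl)

lemma sum_rotl5: "(SUM a:A. SUM b:B. SUM c:C. SUM d:D. SUM e:E. f a b c d e) = (SUM b:B. SUM c:C. SUM d:D. SUM e:E. SUM a:A. f a b c d e)"
 by (subst sum.swap) (intro sum.cong refl sum_rotl4)

lemmas sum_swap4 = trans[OF sum_rotl4 sum_rotl4]

lemma sum_swap2: "(SUM a:A. SUM b:B. SUM c:C. SUM d:D. f a b c d) = (SUM c:C. SUM a:A. SUM d:D. SUM b:B. f a b c d)"
 by (subst (2) sum.swap) (intro sum.cong refl sum_rotl[symmetric] sum_rotl trans[OF sum.swap])

lemmas sum_perm = sum_rotl sum_rotl[symmetric] sum_swap4 trans[OF sum_swap4 sum.swap] sum_swap2 sum_rotl5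

text \<open>Conjugating a Gram kernel is the same as applying the two maps to the vectors that
  generate it. In this form Kraus operators and isometries are moved onto purifications.\<close>

lemma gram_apply:
 "(SUM i:I. SUM j:I'. K i * (SUM r:R. p i r * cnj (q j r)) * cnj (L j))
  = (SUM r:R. (SUM i:I. K i * p i r) * cnj (SUM j:I'. L j * q j r))"
proof -
 have "(SUM i:I. SUM j:I'. K i * (SUM r:R. p i r * cnj (q j r)) * cnj (L j)) = (SUM i:I. SUM j:I'. SUM r:R. (K i * p i r) * cnj (L j * q j r))"
  by (simp add: sum_distribs mult_ac)
 also have "... = (SUM r:R. SUM i:I. SUM j:I'. (K i * p i r) * cnj (L j * q j r))"
  by (intro sum.cong refl sum_perm)
 finally show ?thesis unfolding cnj_sum sum_product .
qed

section \<open>Spectral decompositions\<close>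

text \<open>Operators are kernels on an arbitrary finite index set. An enumeration turns the kernel
  into a matrix, whose spectrum is nonempty over the complex numbers; the eigenvector is read back
  through the inverse enumeration.\<close>

lemma kernel_eigenvector:
 fixes rho :: "'x => 'x => complex"
 assumes "finite X" "X ~= {}"
 shows "EX l v. (EX x:X. v x ~= 0) & (ALL x:X. (SUM y:X. rho x y * v y) = l * v x)"
proof -
 define n where "n = card X"
 have n0: "0 < n" using assms by (simp add: n_def card_gt_0_iff)
 obtain f where f: "bij_betw f {..<n} X"
  using ex_bij_betw_nat_finite[OF assms(1)] by (auto simp: n_def lessThan_atLeast0)
 define A where "A = mat n n (%(i,j). rho (f i) (f j))"
 have A: "A : carrier_mat n n" by (simp add: A_def)
 have "spectrum A ~= {}" using spectrum_non_empty[OF A n0] .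
 then obtain l where "eigenvalue A l" by (auto simp: spectrum_def)
 then obtain w where w: "w : carrier_vec n" "w ~= 0\<^sub>v n" "A *\<^sub>v w = l \<cdot>\<^sub>v w"
  using A by (auto simp: eigenvalue_def eigenvector_def)
 define g where "g = inv_into {..<n} f"
 have gf: "g (f i) = i" if "i < n" for i using f that by (simp add: g_def bij_betw_def)
 define v where "v = (%x. w $ g x)"
 obtain i where i: "i < n" "w $ i ~= 0" using w(1,2) by (metis carrier_vecD eq_vecI index_zero_vec(1,2))
 have "v (f i) ~= 0" "f i : X" using i gf f by (auto simp: v_def bij_betw_def)
 moreover have "(SUM y:X. rho x y * v y) = l * v x" if "x : X" for x
 proof -
  obtain j where j: "j < n" "x = f j" using f \<open>x \<in> X\<close> by (auto simp: bij_betw_def)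
  have "(SUM y:X. rho x y * v y) = (SUM i<n. rho x (f i) * v (f i))"
   by (rule sum.reindex_bij_betw[OF f, symmetric])
  also have "... = (SUM i<n. A $$ (j,i) * w $ i)"
   by (intro sum.cong) (auto simp: v_def gf A_def j)
  also have "... = (A *\<^sub>v w) $ j" using j w(1) A
   by (auto simp: scalar_prod_def lessThan_atLeast0 intro!: sum.cong)
  also have "... = l * v x" using w j by (simp add: v_def gf)
  finally show ?thesis .
 qed
 ultimately show ?thesis by blast
qed

definition onb :: "'x set => ('x => 'x => complex) => bool" where
 "onb X u <-> (ALL i:X. ALL j:X. (SUM x:X. u i x * cnj (u j x)) = dl i j) &
   (ALL x:X. ALL y:X. (SUM k:X. u k x * cnj (u k y)) = dl x y)"

text \<open>Eigenvalues and eigenvectors are indexed by \<open>X\<close> itself, so a spectrum with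
  multiplicities needs no ordering, and bijections of index sets carry decompositions along.\<close>

definition specd :: "'x set => ('x => 'x => complex) => ('x => real) => ('x => 'x => complex) => bool" where
 "specd X rho r u <-> finite X & onb X u &
   (ALL x:X. ALL y:X. rho x y = (SUM k:X. of_real (r k) * u k x * cnj (u k y)))"

lemma sum_delta_left:
 "finite X ==> x : X ==> (SUM y:X. (dl x y) * f y) = (f x :: complex)"
 by (simp add: if_distrib[of "%t. t * _"] cong: if_cong)

lemma sum_delta_right:
 "finite X ==> x : X ==> (SUM y:X. f y * dl y x) = (f x :: complex)"
 by (simp add: if_distrib[of "%t. _ * t"] cong: if_cong)

text \<open>The reflection that exchanges the unit vectors \<open>v\<close> and e_a. It is Hermitian
  and its own inverse; such an exchange requires the inner product of the two vectors, which is
  given by \<open>v a\<close>, to be real.\<close>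

lemma householder:
 fixes v :: "'x => complex"
 assumes X: "finite X" "a : X" and v: "(SUM x:X. v x * cnj (v x)) = 1" and va: "Im (v a) = 0"
 shows "EX H. (ALL x:X. ALL y:X. H y x = cnj (H x y)) &
   (ALL x:X. ALL y:X. (SUM z:X. H x z * H z y) = dl x y) & (ALL x:X. H x a = v x)"
proof (cases "ALL x:X. v x = dl x a")
 case True
 show ?thesis
  by (rule exI[of _ "%x y. if x = y then 1 else 0"])
   (use True X in \<open>auto simp: if_distrib[of "%t. t * _"] cong: if_cong\<close>)
next
 case False
 define e where "e = (%x. if x = a then 1 else 0 :: complex)"
 define w where "w = (%x. v x - e x)"
 define c where "c = 1 - v a"
 have cc: "cnj c = c" using va by (simp add: c_def complex_eq_iff)
 have wn: "(SUM x:X. w x * cnj (w x)) = 2 * c"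
 proof -
  have "(SUM x:X. w x * cnj (w x)) = (SUM x:X. v x * cnj (v x)) - (SUM x:X. v x * e x) - (SUM x:X. e x * cnj (v x)) + (SUM x:X. e x)"
   unfolding sum_subtractf[symmetric] sum.distrib[symmetric]
   by (rule sum.cong) (auto simp: w_def e_def algebra_simps)
  also have "... = 1 - v a - cnj (v a) + 1"
   using X v by (simp add: e_def if_distrib[of "%t. t * _"] if_distrib[of "%t. _ * t"] cong: if_cong)
  also have "... = 2 * c" using va by (simp add: c_def complex_eq_iff)
  finally show ?thesis .
 qed
 have "c ~= 0"
 proof
  assume "c = 0"
  hence "(SUM x:X. w x * cnj (w x)) = 0" using wn by simp
  hence "(SUM x:X. complex_of_real ((cmod (w x))^2)) = 0" by (simp only: complex_norm_square)
  hence "nsq X w = 0" by (metis of_real_eq_0_iff of_real_sum)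
  hence "ALL x:X. w x = 0" using X by (simp add: sum_nonneg_eq_0_iff)
  thus False using False by (auto simp: w_def e_def)
 qed
 \<comment> \<open>The squared norm of \<open>w\<close> is \<open>2 * c\<close>, so this is the
   reflection 1 - 2 |w><w| / <w,w>.\<close>
 define H where "H = (%x y. (dl x y) - w x * cnj (w y) / c)"
 have "H y x = cnj (H x y)" for x y by (simp add: H_def cc)
 moreover have "(SUM z:X. H x z * H z y) = dl x y" if "x : X" "y : X" for x y
 proof -
  have "H x z * H z y = dl x z * (dl z y)
    - (dl x z) * (w z * cnj (w y) / c) - (w x * cnj (w z) / c) * (dl z y)
    + w x * cnj (w y) / (c * c) * (w z * cnj (w z))" for z
   by (simp add: H_def divide_inverse algebra_simps)
  hence "(SUM z:X. H x z * H z y) = dl x y - w x * cnj (w y) / c - w x * cnj (w y) / c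
    + w x * cnj (w y) / (c * c) * (SUM z:X. w z * cnj (w z))"
   using that X by (simp only: sum.distrib sum_subtractf sum_delta_left sum_delta_right sum_distrib_left)
  also have "... = dl x y" using \<open>c \<noteq> 0\<close> by (simp add: wn field_simps)
  finally show ?thesis .
 qed
 moreover have "H x a = v x" if "x : X" for x
 proof -
  have "cnj (w a) = - c" using va by (simp add: w_def e_def c_def complex_eq_iff)
  thus ?thesis using \<open>c \<noteq> 0\<close> by (simp add: H_def w_def e_def)
 qed
 ultimately show ?thesis by blast
qed

lemma sum_prod4:
 "(SUM p:A. a p) * (r * (SUM q:B. b q)) = (SUM p:A. SUM q:B. a p * (r * b q :: complex))"
 by (simp only: sum_distrib_left[of r] sum_product)

text \<open>Induction on the index set: a reflection rotates a unit eigenvector onto the basis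
  vector of the new index \<open>a\<close>. The rotated Hermitian kernel splits off row and column
  \<open>a\<close>, and the rest lives on the smaller set.\<close>

lemma spectral_theorem:
 fixes rho :: "'x => 'x => complex"
 assumes "finite X" "ALL x:X. ALL y:X. cnj (rho x y) = rho y x"
 shows "EX r u. specd X rho r u"
 using assms
proof (induction X arbitrary: rho rule: finite_induct)
 case empty
 show ?case by (simp add: specd_def onb_def)
next
 case (insert a X)
 define Y where "Y = insert a X"
 have fin: "finite Y" and aY: "a : Y" using insert by (auto simp: Y_def)
 have herm: "rho y x = cnj (rho x y)" if "x : Y" "y : Y" for x y using insert.prems that unfolding Y_def by metis
 obtain l v0 where v0: "EX x:Y. v0 x ~= 0" "ALL x:Y. (SUM y:Y. rho x y * v0 y) = l * v0 x"
  using kernel_eigenvector[OF fin, of rho] aY by blast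
 define nn where "nn = nsq Y v0"
 have nn: "nn > 0" unfolding nn_def
 proof -
  obtain x where "x : Y" "v0 x ~= 0" using v0(1) by blast
  thus "0 < (nsq Y v0)" using fin by (intro sum_pos2[of _ x]) auto
 qed
 \<comment> \<open>The phase makes the component at \<open>a\<close> real, as the reflection
   requires.\<close>
 define ph where "ph = (if v0 a = 0 then 1 else cnj (v0 a) / of_real (cmod (v0 a)))"
 have ph: "ph * cnj ph = 1" "Im (ph * v0 a) = 0"
 proof -
  have *: "cnj z * z = (of_real (cmod z))^2" "z * cnj z = (of_real (cmod z))^2" for z
   using complex_norm_square[of z] by (simp_all add: mult.commute)
  show "ph * cnj ph = 1" by (auto simp: ph_def * power2_eq_square norm_divide)
  have "ph * v0 a = of_real (cmod (v0 a))" by (auto simp: ph_def * power2_eq_square)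
  thus "Im (ph * v0 a) = 0" by simp
 qed
 define v where "v = (%x. ph * v0 x / of_real (sqrt nn))"
 have vn: "(SUM x:Y. v x * cnj (v x)) = 1"
 proof -
  have "v x * cnj (v x) = of_real ((cmod (v0 x))^2 / nn)" for x
  proof -
   have "v x * cnj (v x) = (ph * cnj ph) * (v0 x * cnj (v0 x)) / (of_real (sqrt nn) * of_real (sqrt nn))"
    by (simp add: v_def mult_ac)
   also have "of_real (sqrt nn) * of_real (sqrt nn) = complex_of_real nn"
    using nn by (simp only: of_real_mult[symmetric]) simp
   finally show ?thesis using nn ph complex_norm_square[of "v0 x"] by simp
  qed
  hence "(SUM x:Y. v x * cnj (v x)) = of_real (SUM x:Y. (cmod (v0 x))^2 / nn)"
   by (simp only: of_real_sum)
  also have "... = 1" using nn by (simp only: nn_def[symmetric] sum_divide_distrib[symmetric]) simp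
  finally show ?thesis .
 qed
 have va: "Im (v a) = 0" using ph(2) by (simp add: v_def)
 have ve: "(SUM y:Y. rho x y * v y) = l * v x" if "x : Y" for x
 proof -
  have "(SUM y:Y. rho x y * v y) = ph / of_real (sqrt nn) * (SUM y:Y. rho x y * v0 y)"
   unfolding sum_distrib_left by (rule sum.cong) (auto simp: v_def)
  thus ?thesis using v0(2) that by (simp add: v_def)
 qed
 obtain H where H: "ALL x:Y. ALL y:Y. H y x = cnj (H x y)"
   "ALL x:Y. ALL y:Y. (SUM z:Y. H x z * H z y) = dl x y" "ALL x:Y. H x a = v x"
  using householder[OF fin aY vn va] by blast
 have Hc: "cnj (H x y) = H y x" if "x : Y" "y : Y" for x y using H(1) that by (metis)
 have hc: "cnj (rho x y) = rho y x" if "x : Y" "y : Y" for x y by (rule herm[OF that, symmetric])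
 define tau where "tau = (%x y. SUM z:Y. SUM z':Y. H x z * rho z z' * H z' y)"
 have tauh: "tau y x = cnj (tau x y)" if "x : Y" "y : Y" for x y
 proof -
  have "cnj (tau x y) = (SUM z:Y. SUM z':Y. H z x * rho z' z * H y z')"
   unfolding tau_def cnj_sum
   by (intro sum.cong) (auto simp: Hc hc that)
  also have "... = tau y x" unfolding tau_def
   by (subst sum.swap) (simp only: mult_ac)
  finally show ?thesis by simp
 qed
 have taua: "tau x a = (if x = a then l else 0)" if "x : Y" for x
 proof -
  have "tau x a = (SUM z:Y. H x z * (SUM z':Y. rho z z' * v z'))"
   unfolding tau_def sum_distrib_left by (intro sum.cong) (use H(3) in "auto simp: mult.assoc")
  also have "... = (SUM z:Y. l * (H x z * H z a))"
   by (intro sum.cong) (use ve H(3) in "auto simp: mult_ac")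
  also have "... = l * dl x a" using H(2) that aY by (simp only: sum_distrib_left[symmetric])
  finally show ?thesis by simp
 qed
 \<comment> \<open>The eigenvalue is a diagonal entry of the rotated Hermitian kernel, hence
   real.\<close>
 have lc: "cnj l = l" using tauh[OF aY aY, symmetric] unfolding taua[OF aY] by (simp only: refl if_True)
 hence lr: "of_real (Re l) = l" by (simp add: complex_eq_iff)
 have "EX r u. specd X tau r u" by (intro insert.IH ballI tauh[symmetric]) (simp_all add: Y_def)
 then obtain r u where ru: "specd X tau r u" by blast
 define r' where "r' = r(a := Re l)"
 define u' where "u' = (%k x. if k = a | x = a then if x = k then 1 else 0 else u k x)"
 have ne: "x ~= a" if "x : X" for x using insert that by auto
 have u': "onb Y u'"
  using ru insert.hyps unfolding Y_def specd_def onb_def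
  by (auto simp: u'_def ne intro!: sum.neutral cong: sum.cong)
 have taud: "tau x y = (SUM k:Y. of_real (r' k) * u' k x * cnj (u' k y))" if "x : Y" "y : Y" for x y
 proof -
  have ay: "tau a y = (if y = a then l else 0)" unfolding tauh[OF that(2) aY] taua[OF that(2)] by (simp add: lc)
  have s: "(SUM k:Y. of_real (r' k) * u' k x * cnj (u' k y)) = of_real (r' a) * u' a x * cnj (u' a y) + (SUM k:X. of_real (r k) * u' k x * cnj (u' k y))"
   using insert.hyps unfolding Y_def by (auto simp: r'_def intro!: sum.cong)
  have "x : X ==> y : X ==> (SUM k:X. of_real (r k) * u' k x * cnj (u' k y)) = tau x y"
   using ru unfolding specd_def by (auto simp: u'_def ne intro!: sum.cong)
  moreover have "x = a | y = a ==> (SUM k:X. of_real (r k) * u' k x * cnj (u' k y)) = 0"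
   by (intro sum.neutral) (use insert.hyps in "auto simp: u'_def ne")
  ultimately show ?thesis using that ay taua[OF that(1)] lr unfolding s
   by (auto simp: Y_def u'_def r'_def ne)
 qed
 define w where "w = (%k x. SUM z:Y. H x z * u' k z)"
 have on1: "!!i j. i : Y ==> j : Y ==> (SUM x:Y. u' i x * cnj (u' j x)) = dl i j"
  and on2: "!!x y. x : Y ==> y : Y ==> (SUM k:Y. u' k x * cnj (u' k y)) = dl x y"
  using u' unfolding onb_def by blast+
 have wo: "(SUM x:Y. w i x * cnj (w j x)) = dl i j" if ij: "i : Y" "j : Y" for i j
 proof -
  have "(SUM x:Y. w i x * cnj (w j x)) = (SUM x:Y. SUM z:Y. SUM z':Y. H z' x * H x z * (u' i z * cnj (u' j z')))"
   unfolding w_def cnj_sum sum_product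
   by (intro sum.cong) (auto simp: Hc mult_ac)
  also have "... = (SUM z:Y. SUM z':Y. SUM x:Y. H z' x * H x z * (u' i z * cnj (u' j z')))"
   by (subst sum.swap) (intro sum.cong refl sum.swap)
  also have "... = (SUM z:Y. SUM z':Y. (dl z z') * (u' i z * cnj (u' j z')))"
   by (intro sum.cong refl) (simp add: sum_distrib_right[symmetric] H(2))
  also have "... = (SUM z:Y. u' i z * cnj (u' j z))"
   by (intro sum.cong refl) (simp only: sum_delta_left[OF fin])
  finally show ?thesis using on1 ij by simp
 qed
 have wexp: "(SUM k:Y. c k * (w k x * cnj (w k y))) = (SUM z:Y. SUM z':Y. H x z * (SUM k:Y. c k * (u' k z * cnj (u' k z'))) * H z' y)"
  if xy: "x : Y" "y : Y" for x y and c :: "'x => complex"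
 proof -
  have "(SUM k:Y. c k * (w k x * cnj (w k y))) = (SUM k:Y. SUM z:Y. SUM z':Y. H x z * (c k * (u' k z * cnj (u' k z'))) * H z' y)"
   unfolding w_def cnj_sum sum_product
   unfolding sum_distrib_left
   by (intro sum.cong) (auto simp: Hc xy mult_ac)
  also have "... = (SUM z:Y. SUM z':Y. SUM k:Y. H x z * (c k * (u' k z * cnj (u' k z'))) * H z' y)"
   by (subst sum.swap) (intro sum.cong refl sum.swap)
  finally show ?thesis by (simp only: sum_distribs)
 qed
 have wc: "(SUM k:Y. w k x * cnj (w k y)) = dl x y" if xy: "x : Y" "y : Y" for x y
 proof -
  have "(SUM k:Y. w k x * cnj (w k y)) = (SUM z:Y. SUM z':Y. (dl z z') * (H x z * H z' y))"
   unfolding wexp[OF xy, of "%_. 1", unfolded mult_1_left]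
   by (intro sum.cong refl) (simp add: on2)
  also have "... = (SUM z:Y. H x z * H z y)" by (intro sum.cong refl) (simp only: sum_delta_left[OF fin])
  finally show ?thesis using H(2) xy by simp
 qed
 have wr: "rho x y = (SUM k:Y. of_real (r' k) * (w k x * cnj (w k y)))" if xy: "x : Y" "y : Y" for x y
 proof -
  have "(SUM k:Y. of_real (r' k) * (w k x * cnj (w k y))) = (SUM z:Y. SUM z':Y. H x z * tau z z' * H z' y)"
   unfolding wexp[OF xy] by (intro sum.cong refl) (simp add: taud mult.assoc)
  also have "... = (SUM z:Y. SUM z':Y. SUM p:Y. SUM q:Y. (H x z * H z p) * (rho p q * (H q z' * H z' y)))"
   unfolding tau_def sum_distribs by (intro sum.cong refl) (simp only: mult_ac)
  also have "... = (SUM p:Y. SUM q:Y. SUM z:Y. SUM z':Y. (H x z * H z p) * (rho p q * (H q z' * H z' y)))"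
   by (rule sum_swap4)
  also have "... = (SUM p:Y. SUM q:Y. (SUM z:Y. H x z * H z p) * (rho p q * (SUM z':Y. H q z' * H z' y)))"
   by (intro sum.cong refl) (rule sum_prod4[symmetric])
  also have "... = (SUM p:Y. SUM q:Y. (dl x p) * (rho p q * dl q y))"
   by (intro sum.cong refl) (simp only: H(2)[rule_format] xy)
  also have "... = (SUM p:Y. (dl x p) * rho p y)"
   by (intro sum.cong refl) (simp only: mult.assoc[symmetric] sum_delta_right[OF fin xy(2)])
  also have "... = rho x y" by (rule sum_delta_left[OF fin xy(1)])
  finally show ?thesis by (rule sym)
 qed
 have "specd Y rho r' w"
  unfolding specd_def onb_def mult.assoc by (intro conjI ballI fin wo wc wr)
 thus ?case unfolding Y_def by blast
qed

section \<open>Monotonicity of the relative entropy\<close>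

definition ip :: "'x set => ('x => complex) => ('x => complex) => complex" where
 "ip X f g = (SUM x:X. cnj (f x) * g x)"

lemma onb_orth: "onb X u ==> i : X ==> j : X ==> (SUM x:X. u i x * cnj (u j x)) = dl i j"
 by (simp add: onb_def)

lemma onb_complete: "onb X u ==> x : X ==> y : X ==> (SUM k:X. u k x * cnj (u k y)) = dl x y"
 by (simp add: onb_def)

lemma ip_cnj: "cnj (ip X f g) = ip X g f"
 by (simp add: ip_def mult.commute)

lemma ip_orth: "onb X u ==> i : X ==> j : X ==> ip X (u i) (u j) = dl i j"
 using onb_orth[of X u j i] by (auto simp: ip_def mult.commute)

lemma specdD:
 assumes "specd X rho r u"
 shows "finite X" "onb X u" "x : X ==> y : X ==> rho x y = (SUM k:X. of_real (r k) * u k x * cnj (u k y))"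
 using assms by (auto simp: specd_def)

lemma parseval:
 assumes "onb X u" "finite X"
 shows "(SUM k:X. ip X f (u k) * ip X (u k) g) = ip X f g"
proof -
 have "(SUM k:X. ip X f (u k) * ip X (u k) g) = (SUM k:X. SUM x:X. SUM y:X. (u k x * cnj (u k y)) * (cnj (f x) * g y))"
  unfolding ip_def sum_product by (intro sum.cong refl) (simp only: mult_ac)
 also have "... = (SUM x:X. SUM y:X. SUM k:X. (u k x * cnj (u k y)) * (cnj (f x) * g y))"
  by (subst sum.swap) (intro sum.cong refl sum.swap)
 also have "... = (SUM x:X. SUM y:X. (dl x y) * (cnj (f x) * g y))"
  by (intro sum.cong refl) (simp add: onb_complete[OF assms(1)] flip: sum_distrib_right)
 also have "... = ip X f g"
  unfolding ip_def by (intro sum.cong refl) (simp only: sum_delta_left[OF assms(2)])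
 finally show ?thesis .
qed

lemma cmod_sq: "z * cnj z = of_real ((cmod z)^2)" "cnj z * z = of_real ((cmod z)^2)"
 using complex_norm_square[of z] by (simp_all add: mult.commute)

lemma parseval_norm:
 assumes "onb X u" "finite X"
 shows "nsq X (%k. ip X (u k) g) = nsq X g"
proof -
 have "complex_of_real (nsq X (%k. ip X (u k) g)) = (SUM k:X. ip X g (u k) * ip X (u k) g)"
  unfolding of_real_sum by (intro sum.cong refl) (metis cmod_sq(2) ip_cnj)
 also have "... = complex_of_real (nsq X g)"
  unfolding parseval[OF assms] unfolding ip_def of_real_sum by (simp only: cmod_sq)
 finally show ?thesis by (simp only: of_real_eq_iff)
qed

lemma onb_cnj: "onb X u ==> onb X (%k x. cnj (u k x))"
proof -
 assume u: "onb X u"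
 have "(SUM x:X. cnj (u i x) * cnj (cnj (u j x))) = dl i j" if "i : X" "j : X" for i j
  using arg_cong[OF onb_orth[OF u that], of cnj] by simp
 moreover have "(SUM k:X. cnj (u k i) * cnj (cnj (u k j))) = dl i j" if "i : X" "j : X" for i j
  using arg_cong[OF onb_complete[OF u that], of cnj] by simp
 ultimately show ?thesis unfolding onb_def by blast
qed

lemma parseval_norm':
 assumes "onb X u" "finite X"
 shows "nsq X (%k. SUM x:X. g x * u k x) = nsq X g"
 using parseval_norm[OF onb_cnj[OF assms(1)] assms(2), of g] by (simp add: ip_def mult.commute)

definition coef :: "'x set => ('x => 'x => complex) => ('x => 'x => complex) => ('x => 'x => complex) => 'x => 'x => complex" where
 "coef Z v u X j i = ip Z (v j) (%z. SUM y:Z. X z y * u i y)"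

text \<open>In operator terms 2 Tr(X^H rho) - Tr(X^H sigma X) - t Tr(X rho X^H), with ^H for the
  adjoint. The maximum of its real part over \<open>X\<close> is the quadratic form of the inverse
  of (L_sigma + t R_rho) at rho, where L and R are left and right multiplication. Integrated over
  \<open>t\<close> this yields the relative entropy.\<close>

definition test_fun :: "'x set => real => ('x => 'x => complex) => ('x => 'x => complex) => ('x => 'x => complex) => complex" where
 "test_fun Z t rho sigma X = 2 * (SUM z:Z. SUM y:Z. cnj (X z y) * rho z y)
   - (SUM z:Z. SUM z':Z. SUM y:Z. cnj (X z y) * sigma z z' * X z' y)
   - of_real t * (SUM z:Z. SUM z':Z. SUM y:Z. X y z * rho z z' * cnj (X y z'))"

text \<open>In the eigenbases of the two operators the functional decouples into one quadratic
  polynomial for each pair of eigenvectors, which can be maximised separately.\<close>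

lemma test_fun_coef:
 assumes rho: "specd Z rho p u" and sigma: "specd Z sigma q v"
 shows "Re (test_fun Z t rho sigma X) = (SUM i:Z. SUM j:Z. 2 * p i * Re (cnj (coef Z v u X j i) * ip Z (v j) (u i)) - (q j + t * p i) * (cmod (coef Z v u X j i))^2)"
proof -
 note fin = specdD(1)[OF rho] and u = specdD(2)[OF rho] and v = specdD(2)[OF sigma]
 let ?x = "coef Z v u X" and ?Xu = "%i z. SUM y:Z. X z y * u i y"
 have 1: "(SUM z:Z. SUM y:Z. cnj (X z y) * rho z y) = (SUM i:Z. SUM j:Z. of_real (p i) * (cnj (?x j i) * ip Z (v j) (u i)))"
 proof -
  have "(SUM z:Z. SUM y:Z. cnj (X z y) * rho z y) = (SUM z:Z. SUM y:Z. SUM i:Z. of_real (p i) * (cnj (X z y * u i y) * u i z))"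
   by (intro sum.cong refl) (simp add: specdD(3)[OF rho] sum_distrib_left mult_ac)
  also have "... = (SUM i:Z. SUM z:Z. SUM y:Z. of_real (p i) * (cnj (X z y * u i y) * u i z))"
   by (intro sum.cong refl sum_perm)
  also have "... = (SUM i:Z. of_real (p i) * ip Z (?Xu i) (u i))"
   by (simp add: ip_def sum_distribs)
  also have "... = (SUM i:Z. of_real (p i) * (SUM j:Z. cnj (?x j i) * ip Z (v j) (u i)))"
   by (simp only: coef_def ip_cnj parseval[OF v fin])
  finally show ?thesis by (simp add: sum_distrib_left)
 qed
 have quad: "(SUM z:Z. SUM z':Z. SUM y:Z. cnj (X z y) * s z z' * X z' y) = (SUM j:Z. SUM i:Z. of_real (q j * (cmod (coef Z v u X j i))^2))"
  if s: "specd Z s q v" and u: "onb Z u" for s q u v X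
 proof -
  define g where "g = (%j y. SUM z:Z. cnj (v j z) * X z y)"
  have xg: "coef Z v u X j i = (SUM y:Z. g j y * u i y)" for i j
   unfolding g_def coef_def ip_def sum_distribs by (subst sum.swap) (simp only: mult.assoc)
  have "(SUM z:Z. SUM z':Z. SUM y:Z. cnj (X z y) * s z z' * X z' y)
    = (SUM z:Z. SUM z':Z. SUM y:Z. SUM j:Z. of_real (q j) * (cnj (cnj (v j z) * X z y) * (cnj (v j z') * X z' y)))"
   by (intro sum.cong refl) (simp add: specdD(3)[OF s] sum_distribs mult_ac)
  also have "... = (SUM j:Z. SUM y:Z. SUM z:Z. SUM z':Z. of_real (q j) * (cnj (cnj (v j z) * X z y) * (cnj (v j z') * X z' y)))"
   by (intro sum.cong refl sum_perm)
  also have "... = (SUM j:Z. SUM y:Z. of_real (q j) * (cnj (g j y) * g j y))"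
   unfolding g_def cnj_sum sum_product by (simp only: sum_distrib_left)
  also have "... = (SUM j:Z. of_real (q j * nsq Z (g j)))"
   by (simp only: cmod_sq of_real_mult of_real_sum sum_distrib_left)
  also have "... = (SUM j:Z. of_real (q j * (SUM i:Z. (cmod (coef Z v u X j i))^2)))"
   by (simp only: xg parseval_norm'[OF u fin])
  finally show ?thesis by (simp only: sum_distrib_left of_real_sum)
 qed
 have 2: "(SUM z:Z. SUM z':Z. SUM y:Z. cnj (X z y) * sigma z z' * X z' y) = (SUM i:Z. SUM j:Z. of_real (q j * (cmod (?x j i))^2))"
  unfolding quad[OF sigma u] by (rule sum.swap)
 have "coef Z u v (%z y. cnj (X y z)) i j = cnj (?x j i)" for i j
  unfolding coef_def ip_def cnj_sum sum_distrib_left complex_cnj_mult by (subst sum.swap) (simp add: mult_ac)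
 hence 3: "(SUM z:Z. SUM z':Z. SUM y:Z. X y z * rho z z' * cnj (X y z')) = (SUM i:Z. SUM j:Z. of_real (p i * (cmod (?x j i))^2))"
  using quad[OF rho v, of "%z y. cnj (X y z)"] by simp
 show ?thesis unfolding test_fun_def 1 2 3
  by (simp add: sum_subtractf sum_distrib_left sum.distrib algebra_simps)
qed

lemma coef_surj:
 assumes u: "onb Z u" and v: "onb Z v" and fin: "finite Z" and ij: "i : Z" "j : Z"
 shows "coef Z v u (%z y. SUM i:Z. SUM j:Z. x j i * v j z * cnj (u i y)) j i = x j i"
proof -
 have 1: "(SUM y:Z. (SUM i':Z. SUM j':Z. x j' i' * v j' z * cnj (u i' y)) * u i y) = (SUM j':Z. x j' i * v j' z)" for z
 proof -
  have "(SUM y:Z. (SUM i':Z. SUM j':Z. x j' i' * v j' z * cnj (u i' y)) * u i y)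
   = (SUM i':Z. SUM y:Z. (u i y * cnj (u i' y)) * (SUM j':Z. x j' i' * v j' z))"
   unfolding sum_distrib_right by (subst sum.swap) (simp add: sum_distrib_left mult_ac)
  also have "... = (SUM i':Z. (dl i i') * (SUM j':Z. x j' i' * v j' z))"
   by (intro sum.cong refl) (simp add: onb_orth[OF u ij(1)] flip: sum_distrib_right)
  finally show ?thesis by (simp only: sum_delta_left[OF fin ij(1)])
 qed
 have "coef Z v u (%z y. SUM i:Z. SUM j:Z. x j i * v j z * cnj (u i y)) j i = (SUM j':Z. SUM z:Z. cnj (v j z) * v j' z * x j' i)"
  unfolding coef_def ip_def 1 sum_distrib_left by (subst sum.swap) (simp add: mult_ac)
 also have "... = (SUM j':Z. (dl j j') * x j' i)"
  using ip_orth[OF v ij(2)] by (intro sum.cong refl) (simp add: ip_def flip: sum_distrib_right)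
 finally show ?thesis by (simp only: sum_delta_left[OF fin ij(2)])
qed


lemma completing_square:
 assumes "w > 0"
 shows "2 * p * Re (cnj x * s) - w * (cmod x)^2 <= (cmod s)^2 * p^2 / w"
proof -
 have "Re (cnj x * s) <= cmod x * cmod s & - (cmod x * cmod s) <= Re (cnj x * s)"
  using abs_Re_le_cmod[of "cnj x * s"] by (simp add: norm_mult abs_le_iff)
 hence "\<bar>Re (cnj x * s)\<bar> <= cmod x * cmod s" by (simp add: abs_le_iff)
 hence "\<bar>p * Re (cnj x * s)\<bar> <= \<bar>p\<bar> * (cmod x * cmod s)"
  unfolding abs_mult by (intro mult_left_mono) auto
 hence "p * Re (cnj x * s) <= \<bar>p\<bar> * (cmod x * cmod s)" by linarith
 moreover have "0 <= (w * cmod x - \<bar>p\<bar> * cmod s)^2" by simp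
 hence "2 * w * (\<bar>p\<bar> * (cmod x * cmod s)) <= w * w * (cmod x)^2 + (cmod s)^2 * p^2"
  by (simp add: power2_eq_square algebra_simps)
 hence "2 * (\<bar>p\<bar> * (cmod x * cmod s)) <= w * (cmod x)^2 + (cmod s)^2 * p^2 / w"
  using assms by (simp add: field_simps)
 ultimately show ?thesis by linarith
qed

lemma completing_square_eq:
 assumes "w > 0"
 shows "2 * p * Re (cnj (s * of_real (p / w)) * s) - w * (cmod (s * of_real (p / w)))^2 = (cmod s)^2 * p^2 / w"
proof -
 have "Re (cnj (s * of_real (p / w)) * s) = (cmod s)^2 * p / w"
 proof -
  have "cnj (s * of_real (p / w)) * s = of_real (p / w) * (cnj s * s)" by simp
  also have "... = of_real (p / w * (cmod s)^2)" by (simp only: cmod_sq of_real_mult)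
  finally show ?thesis by (simp only: Re_complex_of_real) (simp add: mult.commute)
 qed
 moreover have "(cmod (s * of_real (p / w)))^2 = (cmod s)^2 * p^2 / w^2"
  using assms by (simp add: norm_mult norm_divide power_mult_distrib power_divide)
 ultimately show ?thesis using assms by (simp add: power2_eq_square field_simps)
qed

definition overlap :: "'x set => ('x => 'x => complex) => ('x => 'x => complex) => 'x => 'x => real" where
 "overlap Z u v i j = (cmod (ip Z (v j) (u i)))^2"

lemma test_fun_le:
 assumes rho: "specd Z rho p u" and sigma: "specd Z sigma q v"
  and p: "!!i. i : Z ==> p i >= 0" and q: "!!j. j : Z ==> q j > 0" and t: "t >= 0"
 shows "Re (test_fun Z t rho sigma X) <= (SUM i:Z. SUM j:Z. overlap Z u v i j * (p i)^2 / (q j + t * p i))"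
 unfolding test_fun_coef[OF rho sigma] overlap_def
proof (intro sum_mono completing_square)
 fix i j assume "i : Z" "j : Z" thus "0 < q j + t * p i" using p[of i] q[of j] t by (simp add: add_pos_nonneg)
qed

lemma test_fun_attained:
 assumes rho: "specd Z rho p u" and sigma: "specd Z sigma q v"
  and p: "!!i. i : Z ==> p i >= 0" and q: "!!j. j : Z ==> q j > 0" and t: "t >= 0"
 shows "EX X. Re (test_fun Z t rho sigma X) = (SUM i:Z. SUM j:Z. overlap Z u v i j * (p i)^2 / (q j + t * p i))"
proof -
 define x where "x = (%j i. ip Z (v j) (u i) * of_real (p i / (q j + t * p i)))"
 define X where "X = (%z y. SUM i:Z. SUM j:Z. x j i * v j z * cnj (u i y))"
 have "Re (test_fun Z t rho sigma X) = (SUM i:Z. SUM j:Z. overlap Z u v i j * (p i)^2 / (q j + t * p i))"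
  unfolding test_fun_coef[OF rho sigma] overlap_def
 proof (intro sum.cong refl)
  fix i j assume ij: "i : Z" "j : Z"
  have w: "0 < q j + t * p i" using ij p[of i] q[of j] t by (simp add: add_pos_nonneg)
  have c: "coef Z v u X j i = ip Z (v j) (u i) * of_real (p i / (q j + t * p i))"
   unfolding X_def using coef_surj[OF specdD(2)[OF rho] specdD(2)[OF sigma] specdD(1)[OF rho] ij, of x] by (simp only: x_def)
  show "2 * p i * Re (cnj (coef Z v u X j i) * ip Z (v j) (u i)) - (q j + t * p i) * (cmod (coef Z v u X j i))^2
   = (cmod (ip Z (v j) (u i)))^2 * (p i)^2 / (q j + t * p i)"
   unfolding c by (rule completing_square_eq[OF w])
 qed
 thus ?thesis by blast
qed

lemma sum_Times: "(SUM k:Z >< B. f k) = (SUM z:Z. SUM b:B. f (z, b))"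
 by (simp add: sum.cartesian_product)

text \<open>Testing the marginals with \<open>X\<close> is testing the joint operators with X tensor
  1. Hence the maximum for the marginals is at most the maximum for the joint operators, which is
  the source of monotonicity.\<close>

lemma test_fun_lift:
 assumes fin: "finite B"
  and rho: "!!z y. z : Z ==> y : Z ==> rhos z y = (SUM b:B. rho (z, b) (y, b))"
  and sigma: "!!z y. z : Z ==> y : Z ==> sigmas z y = (SUM b:B. sigma (z, b) (y, b))"
 shows "test_fun (Z >< B) t rho sigma (%k l. if snd k = snd l then X (fst k) (fst l) else 0) = test_fun Z t rhos sigmas X"
proof -
 let ?X = "%X k l. if snd k = snd l then X (fst k) (fst l) else 0"
 have 1: "(SUM z:Z><B. SUM y:Z><B. cnj (?X X z y) * rho z y) = (SUM z:Z. SUM y:Z. cnj (X z y) * rhos z y)"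
 proof -
  have "(SUM z:Z><B. SUM y:Z><B. cnj (?X X z y) * rho z y) = (SUM z:Z. SUM b:B. SUM y:Z. cnj (X z y) * rho (z,b) (y,b))"
   using fin by (simp add: sum_Times if_distrib[of cnj] if_distrib[of "%x. x * _"] cong: if_cong)
  also have "... = (SUM z:Z. SUM y:Z. SUM b:B. cnj (X z y) * rho (z,b) (y,b))" by (intro sum.cong refl sum.swap)
  also have "... = (SUM z:Z. SUM y:Z. cnj (X z y) * rhos z y)" by (simp add: rho sum_distrib_left)
  finally show ?thesis .
 qed
 have quad: "(SUM z:Z><B. SUM z':Z><B. SUM y:Z><B. cnj (?X Y z y) * s z z' * ?X Y z' y) = (SUM z:Z. SUM z':Z. SUM y:Z. cnj (Y z y) * ss z z' * Y z' y)"
  if "!!z y. z : Z ==> y : Z ==> ss z y = (SUM b:B. s (z, b) (y, b))" for ss s Y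
 proof -
  have "(SUM z:Z><B. SUM z':Z><B. SUM y:Z><B. cnj (?X Y z y) * s z z' * ?X Y z' y)
   = (SUM z:Z. SUM b:B. SUM z':Z. SUM b':B. SUM y:Z. SUM c:B. if b = c then (if b' = c then cnj (Y z y) * s (z,b) (z',b') * Y z' y else 0) else 0)"
   unfolding sum_Times by (intro sum.cong refl) auto
  also have "... = (SUM z:Z. SUM b:B. SUM z':Z. SUM b':B. SUM y:Z. if b' = b then cnj (Y z y) * s (z,b) (z',b') * Y z' y else 0)"
   by (intro sum.cong refl) (simp add: fin)
  also have "... = (SUM z:Z. SUM b:B. SUM z':Z. SUM y:Z. SUM b':B. if b' = b then cnj (Y z y) * s (z,b) (z',b') * Y z' y else 0)"
   by (intro sum.cong refl sum.swap)
  also have "... = (SUM z:Z. SUM b:B. SUM z':Z. SUM y:Z. cnj (Y z y) * s (z,b) (z',b) * Y z' y)"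
   by (intro sum.cong refl) (simp add: fin)
  also have "... = (SUM z:Z. SUM z':Z. SUM y:Z. SUM b:B. cnj (Y z y) * s (z,b) (z',b) * Y z' y)"
   by (intro sum.cong refl sum_perm)
  also have "... = (SUM z:Z. SUM z':Z. SUM y:Z. cnj (Y z y) * ss z z' * Y z' y)"
   by (intro sum.cong refl) (simp add: that sum_distribs)
  finally show ?thesis .
 qed
 have 2: "(SUM z:Z><B. SUM z':Z><B. SUM y:Z><B. ?X X y z * rho z z' * cnj (?X X y z')) = (SUM z:Z. SUM z':Z. SUM y:Z. X y z * rhos z z' * cnj (X y z'))"
  by (rule trans[OF _ quad[of rhos rho "%z y. cnj (X y z)", OF rho, unfolded complex_cnj_cnj]]) (intro sum.cong refl, auto)
 have 3: "(SUM z:Z><B. SUM z':Z><B. SUM y:Z><B. cnj (?X X z y) * sigma z z' * ?X X z' y) = (SUM z:Z. SUM z':Z. SUM y:Z. cnj (X z y) * sigmas z z' * X z' y)"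
  by (rule quad) (erule (1) sigma)
 show ?thesis unfolding test_fun_def 1 2 3 ..
qed

lemma overlap_sum:
 assumes "onb Z v" "onb Z u" "finite Z" "i : Z"
 shows "(SUM j:Z. overlap Z u v i j) = 1"
proof -
 have "nsq Z (u i) = 1"
 proof -
  have "complex_of_real (nsq Z (u i)) = 1"
   using onb_orth[OF assms(2,4,4)] unfolding of_real_sum cmod_sq(1)[symmetric] by simp
  thus ?thesis by (simp only: of_real_eq_1_iff)
 qed
 thus ?thesis unfolding overlap_def parseval_norm[OF assms(1,3)] .
qed

text \<open>Let F(T) be the sum of overlap times p ln (q + T p). As T grows, F(T) - (sum of p) ln T
  tends to the sum of p ln p, while F(0) is the cross term; the relative entropy is thus the
  regularised increase of F. The derivative of F is the maximum of the test functional, and for the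
  joint operators it dominates the one for the marginals.\<close>

lemma relative_entropy_mono:
 assumes fin: "finite Z" "finite B"
  and rho: "specd (Z >< B) rho p u" and sigma: "specd (Z >< B) sigma q v"
  and rhos: "specd Z rhos ps us" and sigmas: "specd Z sigmas qs vs"
  and p: "!!i. i : Z >< B ==> p i >= 0" "!!i. i : Z ==> ps i >= 0"
  and q: "!!i. i : Z >< B ==> q i > 0" "!!i. i : Z ==> qs i > 0"
  and rhom: "!!z y. z : Z ==> y : Z ==> rhos z y = (SUM b:B. rho (z, b) (y, b))"
  and sigmam: "!!z y. z : Z ==> y : Z ==> sigmas z y = (SUM b:B. sigma (z, b) (y, b))"
  and tr: "(SUM i:Z><B. p i) = (SUM i:Z. ps i)"
 shows "(SUM i:Z. ps i * ln (ps i)) - (SUM i:Z. SUM j:Z. overlap Z us vs i j * ps i * ln (qs j))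
   <= (SUM i:Z><B. p i * ln (p i)) - (SUM i:Z><B. SUM j:Z><B. overlap (Z><B) u v i j * p i * ln (q j))"
proof -
 let ?W = "Z >< B"
 have finW: "finite ?W" using fin by simp
 define Fb where "Fb = (%T. SUM i:?W. SUM j:?W. overlap ?W u v i j * p i * ln (q j + T * p i))"
 define Fs where "Fs = (%T. SUM i:Z. SUM j:Z. overlap Z us vs i j * ps i * ln (qs j + T * ps i))"
 have der: "((%T. Fb T - Fs T) has_real_derivative
   (SUM i:?W. SUM j:?W. overlap ?W u v i j * (p i)^2 / (q j + T * p i)) - (SUM i:Z. SUM j:Z. overlap Z us vs i j * (ps i)^2 / (qs j + T * ps i))) (at T)"
  if "T >= 0" for T
 proof -
  have *: "((%T. c * a * ln (b + T * a)) has_real_derivative c * a^2 / (b + T * a)) (at T)" if "b > 0" "a >= 0" for a b c :: real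
  proof -
   have "b + T * a > 0" using that \<open>T \<ge> 0\<close> by (simp add: add_pos_nonneg)
   thus ?thesis by (auto intro!: derivative_eq_intros simp: power2_eq_square)
  qed
  show ?thesis unfolding Fb_def Fs_def using p q by (intro DERIV_diff DERIV_sum *) auto
 qed
 have le: "(SUM i:Z. SUM j:Z. overlap Z us vs i j * (ps i)^2 / (qs j + T * ps i)) <= (SUM i:?W. SUM j:?W. overlap ?W u v i j * (p i)^2 / (q j + T * p i))"
  if T0: "T >= 0" for T
 proof -
  obtain X where X: "Re (test_fun Z T rhos sigmas X) = (SUM i:Z. SUM j:Z. overlap Z us vs i j * (ps i)^2 / (qs j + T * ps i))"
   using test_fun_attained[OF rhos sigmas p(2) q(2) T0] by blast
  have lift: "test_fun Z T rhos sigmas X = test_fun (Z >< B) T rho sigma (%k l. if snd k = snd l then X (fst k) (fst l) else 0)"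
   by (rule test_fun_lift[symmetric, OF fin(2)]; (rule rhom sigmam; assumption))
  show ?thesis unfolding X[symmetric] lift
   by (rule test_fun_le[OF rho sigma _ _ T0]; (rule p q; assumption))
 qed
 \<comment> \<open>Natural arguments are enough, since only the limit at infinity is used
   afterwards.\<close>
 have mono: "Fb 0 - Fs 0 <= Fb (real n) - Fs (real n)" for n
 proof (rule DERIV_nonneg_imp_nondecreasing[where f="%T. Fb T - Fs T"])
  fix T :: real assume "0 <= T" "T <= real n"
  hence t: "0 <= T" by simp
  show "EX y. ((%T. Fb T - Fs T) has_real_derivative y) (at T) & 0 <= y"
   by (rule exI, rule conjI, rule der[OF t], simp only: diff_ge_0_iff_ge le[OF t])
 qed simp
 \<comment> \<open>The divergent ln n is split off from each summand; a vanishing eigenvalue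
   \<open>a\<close> contributes zero throughout.\<close>
 have lim1: "(%n. c * a * ln (b + real n * a) - c * a * ln (real n)) ----> c * (a * ln a)" if "b > 0" "a >= 0" for a b c :: real
 proof (cases "a = 0")
  case False
  hence a: "a > 0" using that by simp
  have "(%n. c * a * ln (b / real n + a)) ----> c * a * ln (0 + a)"
   using a by (intro tendsto_intros lim_const_over_n) auto
  moreover have "\<forall>\<^sub>F n in sequentially. c * a * ln (b / real n + a) = c * a * ln (b + real n * a) - c * a * ln (real n)"
   using eventually_gt_at_top[of 0]
  proof eventually_elim
   case (elim n)
   have "b / real n + a = (b + real n * a) / real n" using elim by (simp add: field_simps)
   moreover have "b + real n * a > 0" using that by (simp add: add_pos_nonneg)
   ultimately have "ln (b / real n + a) = ln (b + real n * a) - ln (real n)" using elim by (auto simp add: ln_div)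
   thus ?case by (simp only: right_diff_distrib)
  qed
  ultimately show ?thesis by (simp add: mult.assoc tendsto_cong)
 qed simp
 have c1: "(SUM j:?W. overlap ?W u v i j) = 1" if "i : ?W" for i
  using overlap_sum[OF specdD(2)[OF sigma] specdD(2)[OF rho] finW that] .
 have c2: "(SUM j:Z. overlap Z us vs i j) = 1" if "i : Z" for i
  using overlap_sum[OF specdD(2)[OF sigmas] specdD(2)[OF rhos] fin(1) that] .
 have L1: "(%n. Fb (real n) - (SUM i:?W. p i) * ln (real n)) ----> (SUM i:?W. p i * ln (p i))"
 proof -
  have "(%n. SUM i:?W. SUM j:?W. overlap ?W u v i j * p i * ln (q j + real n * p i) - overlap ?W u v i j * p i * ln (real n))
    ----> (SUM i:?W. SUM j:?W. overlap ?W u v i j * (p i * ln (p i)))"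
   by (intro tendsto_sum lim1 q p)
  moreover have "(SUM i:?W. SUM j:?W. overlap ?W u v i j * (p i * ln (p i))) = (SUM i:?W. p i * ln (p i))"
   by (intro sum.cong refl) (simp add: c1 flip: sum_distrib_right)
  moreover have "(SUM i:?W. SUM j:?W. overlap ?W u v i j * p i * ln (q j + real n * p i) - overlap ?W u v i j * p i * ln (real n))
    = Fb (real n) - (SUM i:?W. p i) * ln (real n)" for n
  proof -
   have "(SUM i:?W. SUM j:?W. overlap ?W u v i j * p i * ln (real n)) = (SUM i:?W. p i * ln (real n))"
    by (intro sum.cong refl) (simp add: c1 flip: sum_distrib_right)
   thus ?thesis by (simp add: Fb_def sum_subtractf sum_distrib_right)
  qed
  ultimately show ?thesis by simp
 qed
 have L2: "(%n. Fs (real n) - (SUM i:Z. ps i) * ln (real n)) ----> (SUM i:Z. ps i * ln (ps i))"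
 proof -
  have "(%n. SUM i:Z. SUM j:Z. overlap Z us vs i j * ps i * ln (qs j + real n * ps i) - overlap Z us vs i j * ps i * ln (real n))
    ----> (SUM i:Z. SUM j:Z. overlap Z us vs i j * (ps i * ln (ps i)))"
   by (intro tendsto_sum lim1 q p)
  moreover have "(SUM i:Z. SUM j:Z. overlap Z us vs i j * (ps i * ln (ps i))) = (SUM i:Z. ps i * ln (ps i))"
   by (intro sum.cong refl) (simp add: c2 flip: sum_distrib_right)
  moreover have "(SUM i:Z. SUM j:Z. overlap Z us vs i j * ps i * ln (qs j + real n * ps i) - overlap Z us vs i j * ps i * ln (real n))
    = Fs (real n) - (SUM i:Z. ps i) * ln (real n)" for n
  proof -
   have "(SUM i:Z. SUM j:Z. overlap Z us vs i j * ps i * ln (real n)) = (SUM i:Z. ps i * ln (real n))"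
    by (intro sum.cong refl) (simp add: c2 flip: sum_distrib_right)
   thus ?thesis by (simp add: Fs_def sum_subtractf sum_distrib_right)
  qed
  ultimately show ?thesis by simp
 qed
 have "(%n. (Fb (real n) - (SUM i:?W. p i) * ln (real n)) - (Fs (real n) - (SUM i:Z. ps i) * ln (real n)))
   ----> (SUM i:?W. p i * ln (p i)) - (SUM i:Z. ps i * ln (ps i))"
  by (intro tendsto_diff L1 L2)
 \<comment> \<open>The divergent terms cancel because the joint state and its marginal have the same
   trace.\<close>
 hence "(%n. Fb (real n) - Fs (real n)) ----> (SUM i:?W. p i * ln (p i)) - (SUM i:Z. ps i * ln (ps i))"
  by (simp add: tr algebra_simps)
 hence "Fb 0 - Fs 0 <= (SUM i:?W. p i * ln (p i)) - (SUM i:Z. ps i * ln (ps i))"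
  by (rule LIMSEQ_le_const) (use mono in blast)
 thus ?thesis unfolding Fb_def Fs_def by simp
qed

section \<open>Entropy and strong subadditivity\<close>

definition gram :: "'y set => ('x => 'y => complex) => 'x => 'x => complex" where
 "gram Y M x x' = (SUM y:Y. M x y * cnj (M x' y))"

text \<open>The value rests on a choice of spectral decomposition. For Gram kernels it is
  independent of the choice by \<open>ent_gram_eq\<close>, and every state that occurs has a Gram
  kernel.\<close>

definition ent :: "'x set => ('x => 'x => complex) => real" where
 "ent X rho = (SOME h. EX r u. specd X rho r u & h = (SUM k:X. eta (r k)))"

lemma gram_hermitian: "cnj (gram Y M x y) = gram Y M y x"
 by (simp add: gram_def mult.commute)

lemma specd_gram_exists: "finite X ==> EX r u. specd X (gram Y M) r u"
 by (rule spectral_theorem) (auto simp: gram_hermitian)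

text \<open>\<open>d\<close> transports the weights \<open>p\<close> to the weights \<open>q\<close>
  and moves mass only between equal values, so each nonzero value occurs equally often in both
  families.\<close>

lemma coupling_sum_eq:
 fixes d :: "'i => 'j => real"
 assumes "!!i. i : I ==> (SUM j:J. d i j) = p i" "!!j. j : J ==> (SUM i:I. d i j) = q j"
  "!!i j. i : I ==> j : J ==> d i j ~= 0 ==> p i = q j" "f 0 = (0::real)"
 shows "(SUM i:I. f (p i)) = (SUM j:J. f (q j))"
proof -
 \<comment> \<open>At \<open>x = 0\<close> both sides vanish, the right one by its factor and the
   left one by assumption; this lets \<open>f\<close> be spread over the transported mass.\<close>
 have f: "f x = x * (f x / x)" for x using assms(4) by simp
 have "(SUM i:I. f (p i)) = (SUM i:I. SUM j:J. d i j * (f (p i) / p i))"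
  by (intro sum.cong refl) (metis assms(1) f sum_distrib_right)
 also have "... = (SUM i:I. SUM j:J. d i j * (f (q j) / q j))"
  by (intro sum.cong refl) (use assms(3) in fastforce)
 also have "... = (SUM j:J. SUM i:I. d i j * (f (q j) / q j))" by (rule sum.swap)
 also have "... = (SUM j:J. f (q j))"
  by (intro sum.cong refl) (metis assms(2) f sum_distrib_right)
 finally show ?thesis .
qed

lemma specd_left_eigen:
 assumes s: "specd X rho p u" and i: "i : X" and y: "y : X"
 shows "(SUM x:X. cnj (u i x) * rho x y) = of_real (p i) * cnj (u i y)"
proof -
 have "(SUM x:X. cnj (u i x) * rho x y) = (SUM x:X. SUM k:X. cnj (u i x) * u k x * (of_real (p k) * cnj (u k y)))"
  by (intro sum.cong refl) (simp add: specdD(3)[OF s] y sum_distrib_left mult_ac)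
 also have "... = (SUM k:X. (dl i k) * (of_real (p k) * cnj (u k y)))"
  using ip_orth[OF specdD(2)[OF s] i]
  by (subst sum.swap) (intro sum.cong refl, simp add: ip_def flip: sum_distrib_right)
 finally show ?thesis by (simp only: sum_delta_left[OF specdD(1)[OF s] i])
qed

lemma specd_quadratic:
 assumes s: "specd X rho p u" and i: "i : X"
 shows "(SUM x:X. SUM y:X. cnj (u i x) * rho x y * u i y) = of_real (p i)"
proof -
 have "(SUM x:X. SUM y:X. cnj (u i x) * rho x y * u i y) = (SUM y:X. (SUM x:X. cnj (u i x) * rho x y) * u i y)"
  unfolding sum_distrib_right by (rule sum.swap)
 also have "... = (SUM y:X. of_real (p i) * (cnj (u i y) * u i y))"
  by (intro sum.cong refl) (simp add: specd_left_eigen[OF s i])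
 also have "... = of_real (p i) * ip X (u i) (u i)" by (simp add: ip_def sum_distrib_left)
 finally show ?thesis using ip_orth[OF specdD(2)[OF s] i i] by simp
qed

definition schmidt :: "'x set => 'y set => ('x => 'y => complex) => ('x => complex) => ('y => complex) => complex" where
 "schmidt X Y M f g = (SUM x:X. SUM y:Y. cnj (f x) * M x y * cnj (g y))"

lemma schmidt_swap: "schmidt Y X (%y x. M x y) g f = schmidt X Y M f g"
 unfolding schmidt_def by (subst sum.swap) (simp add: mult_ac)

lemma schmidt_marginal:
 assumes s: "specd X (gram Y M) p u" and i: "i : X" and w: "onb Y w" and Y: "finite Y"
 shows "nsq Y (%j. schmidt X Y M (u i) (w j)) = p i"
proof -
 define a where "a = (%y. SUM x:X. cnj (u i x) * M x y)"
 have "schmidt X Y M (u i) (w j) = ip Y (w j) a" for j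
  unfolding schmidt_def ip_def a_def sum_distrib_left by (subst sum.swap) (simp add: mult_ac)
 hence "nsq Y (%j. schmidt X Y M (u i) (w j)) = nsq Y a"
  by (simp only: parseval_norm[OF w Y])
 moreover have "complex_of_real (nsq Y a) = of_real (p i)"
 proof -
  have "complex_of_real (nsq Y a) = (SUM y:Y. SUM x:X. SUM x':X. cnj (u i x) * (M x y * cnj (M x' y)) * u i x')"
   unfolding of_real_sum cmod_sq(1)[symmetric] a_def cnj_sum sum_product by (simp add: mult_ac)
  also have "... = (SUM x:X. SUM x':X. SUM y:Y. cnj (u i x) * (M x y * cnj (M x' y)) * u i x')"
   by (intro sum.cong refl sum_perm)
  also have "... = (SUM x:X. SUM x':X. cnj (u i x) * gram Y M x x' * u i x')"
   by (simp only: gram_def sum_distribs)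
  finally show ?thesis by (simp only: specd_quadratic[OF s i])
 qed
 ultimately show ?thesis by (simp only: of_real_eq_iff)
qed

lemma specd_gram_nonneg:
 assumes "specd X (gram Y M) p u" "i : X" "finite Y"
 shows "0 <= p i"
proof -
 obtain w where "onb Y w" using specd_gram_exists[of Y X "%y x. M x y"] assms(3) specdD(2) by blast
 from schmidt_marginal[OF assms(1,2) this assms(3)] show ?thesis by (metis (no_types, lifting) sum_nonneg zero_le_power2)
qed

text \<open>The right-hand side treats the two marginals alike. Compared with its mirror image it
  forces the eigenvalues on both sides to agree wherever the Schmidt element is nonzero.\<close>

lemma schmidt_eigen:
 assumes s: "specd X (gram Y M) p u" and i: "i : X"
 shows "of_real (p i) * schmidt X Y M (u i) g = (SUM x:X. SUM x':X. SUM y:Y. SUM y':Y. cnj (u i x) * (M x y' * cnj (M x' y')) * (M x' y * cnj (g y)))"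
proof -
 have "of_real (p i) * schmidt X Y M (u i) g = (SUM x':X. SUM y:Y. (SUM x:X. cnj (u i x) * gram Y M x x') * (M x' y * cnj (g y)))"
  unfolding schmidt_def sum_distrib_left by (intro sum.cong refl) (simp add: specd_left_eigen[OF s i])
 also have "... = (SUM x':X. SUM y:Y. SUM x:X. SUM y':Y. cnj (u i x) * (M x y' * cnj (M x' y')) * (M x' y * cnj (g y)))"
  by (simp only: gram_def sum_distribs)
 also have "... = (SUM x:X. SUM x':X. SUM y:Y. SUM y':Y. cnj (u i x) * (M x y' * cnj (M x' y')) * (M x' y * cnj (g y)))"
  by (intro sum.cong refl sum_perm)
 finally show ?thesis .
qed

text \<open>The squared matrix elements of the amplitude matrix between the two eigenbases form a
  coupling of the two spectra. Any pair of eigenbases will do, so degenerate eigenvalues need no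
  special care.\<close>

lemma schmidt_spectrum:
 assumes s: "specd X (gram Y M) p u" and t: "specd Y (gram X (%y x. M x y)) q w" and f: "f 0 = (0::real)"
 shows "(SUM i:X. f (p i)) = (SUM j:Y. f (q j))"
proof (rule coupling_sum_eq[where d="%i j. (cmod (schmidt X Y M (u i) (w j)))^2" and f=f])
 show "nsq Y (%j. schmidt X Y M (u i) (w j)) = p i" if "i : X" for i
  by (rule schmidt_marginal[OF s that specdD(2,1)[OF t]])
 show "nsq X (%i. schmidt X Y M (u i) (w j)) = q j" if "j : Y" for j
  using schmidt_marginal[OF t that specdD(2,1)[OF s]] by (simp only: schmidt_swap[of Y X M])
next
 fix i j assume ij: "i : X" "j : Y" and nz: "(cmod (schmidt X Y M (u i) (w j)))^2 ~= 0"
 have "of_real (q j) * schmidt X Y M (u i) (w j)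
   = (SUM y:Y. SUM y':Y. SUM x:X. SUM x':X. cnj (w j y) * (M x' y * cnj (M x' y')) * (M x y' * cnj (u i x)))"
  using schmidt_eigen[OF t ij(2), of "u i"] by (simp only: schmidt_swap[of Y X M])
 also have "... = (SUM x:X. SUM x':X. SUM y:Y. SUM y':Y. cnj (w j y) * (M x' y * cnj (M x' y')) * (M x y' * cnj (u i x)))"
  by (intro sum.cong refl sum_perm)
 also have "... = of_real (p i) * schmidt X Y M (u i) (w j)"
  unfolding schmidt_eigen[OF s ij(1)] by (simp only: mult_ac)
 finally show "p i = q j" using nz by simp
qed (rule f)

lemma eta_0 [simp]: "eta 0 = 0" by (simp add: eta_def)

text \<open>Two decompositions of one marginal are compared through a fixed decomposition of the
  complementary marginal.\<close>

lemma ent_gram_eq: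
 assumes s: "specd X (gram Y M) r u" and Y: "finite Y"
 shows "ent X (gram Y M) = (SUM k:X. eta (r k))"
proof -
 obtain q w where t: "specd Y (gram X (%y x. M x y)) q w" using specd_gram_exists[OF Y] by blast
 have "EX r u. specd X (gram Y M) r u & ent X (gram Y M) = (SUM k:X. eta (r k))"
  unfolding ent_def by (rule someI_ex) (use s in blast)
 then obtain r' u' where s': "specd X (gram Y M) r' u'" "ent X (gram Y M) = (SUM k:X. eta (r' k))" by blast
 show ?thesis unfolding s'(2) schmidt_spectrum[where f=eta, OF s'(1) t eta_0] schmidt_spectrum[where f=eta, OF s t eta_0] ..
qed

lemma ent_swap:
 assumes "finite X" "finite Y"
 shows "ent X (gram Y M) = ent Y (gram X (%y x. M x y))"
proof -
 obtain p u where s: "specd X (gram Y M) p u" using specd_gram_exists[OF assms(1)] by blast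
 obtain q w where t: "specd Y (gram X (%y x. M x y)) q w" using specd_gram_exists[OF assms(2)] by blast
 show ?thesis unfolding ent_gram_eq[OF s assms(2)] ent_gram_eq[OF t assms(1)] schmidt_spectrum[where f=eta, OF s t eta_0] ..
qed

lemma specd_cong: "(!!x y. x : X ==> y : X ==> rho x y = rho' x y) ==> specd X rho r u = specd X rho' r u"
 by (simp add: specd_def)

lemma ent_cong: "(!!x y. x : X ==> y : X ==> rho x y = rho' x y) ==> ent X rho = ent X rho'"
 unfolding ent_def by (subst specd_cong[of X rho rho']) auto

text \<open>Padding with zero amplitudes. Enlarging the traced side only adds vanishing summands;
  the kept side is enlarged after passing to the complementary marginal, where it becomes the traced
  one.\<close>

lemma ent_gram_mono:
 assumes "finite X'" "finite Y'" "X \<subseteq> X'" "Y \<subseteq> Y'"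
  and "!!x y. x : X' - X ==> y : Y' ==> M x y = 0" "!!x y. x : X' ==> y : Y' - Y ==> M x y = 0"
 shows "ent X (gram Y M) = ent X' (gram Y' M)"
proof -
 have fin: "finite X" "finite Y" using assms finite_subset by blast+
 have "ent X (gram Y M) = ent X (gram Y' M)"
  by (rule ent_cong) (use assms in "auto simp: gram_def intro!: sum.mono_neutral_left")
 also have "... = ent Y' (gram X (%y x. M x y))" by (rule ent_swap) (use fin assms in auto)
 also have "... = ent Y' (gram X' (%y x. M x y))"
  by (rule ent_cong) (use assms in "auto simp: gram_def intro!: sum.mono_neutral_left")
 also have "... = ent X' (gram Y' M)" by (rule ent_swap[symmetric]) (use assms in auto)
 finally show ?thesis .
qed

lemma specd_reindex:
 assumes g: "bij_betw g X' X" and s: "specd X rho r u"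
 shows "specd X' (%x y. rho (g x) (g y)) (%k. r (g k)) (%k x. u (g k) (g x))"
proof -
 have re: "(SUM x:X'. f (g x)) = (SUM x:X. f x)" for f :: "_ => complex" by (rule sum.reindex_bij_betw[OF g])
 have inj: "g x = g y <-> x = y" if "x : X'" "y : X'" for x y using g that by (auto simp: bij_betw_def inj_on_def)
 have gm: "g x : X" if "x : X'" for x using g that by (auto simp: bij_betw_def)
 have f: "finite X'" using g specdD(1)[OF s] by (simp add: bij_betw_finite)
 show ?thesis unfolding specd_def onb_def
  using re[of "%x. u (g _) x * cnj (u (g _) x)"]
  by (simp add: f re[of "%x. u _ x * cnj (u _ x)"] re[of "%k. u k _ * cnj (u k _)"] re[of "%k. of_real (r k) * u k _ * cnj (u k _)"]
    gm inj onb_orth[OF specdD(2)[OF s]] onb_complete[OF specdD(2)[OF s]] specdD(3)[OF s])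
qed

lemma ent_reindex:
 assumes g: "bij_betw g X' X" and h: "bij_betw h Y' Y" and fin: "finite X" "finite Y"
 shows "ent X' (gram Y' (%x y. M (g x) (h y))) = ent X (gram Y M)"
proof -
 obtain r u where s: "specd X (gram Y M) r u" using specd_gram_exists[OF fin(1)] by blast
 have fY: "finite Y'" using h fin by (simp add: bij_betw_finite)
 have gr: "gram Y' (%x y. M (g x) (h y)) = (%x y. gram Y M (g x) (g y))"
  unfolding gram_def by (intro ext) (rule sum.reindex_bij_betw[OF h])
 have s': "specd X' (gram Y' (%x y. M (g x) (h y))) (%k. r (g k)) (%k x. u (g k) (g x))"
  unfolding gr by (rule specd_reindex[OF g s])
 show ?thesis unfolding ent_gram_eq[OF s fin(2)] ent_gram_eq[OF s' fY] by (rule sum.reindex_bij_betw[OF g])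
qed

lemma overlap_weight:
 assumes s: "specd Z rho p u"
 shows "(SUM i:Z. overlap Z u v i j * p i) = Re (SUM x:Z. SUM y:Z. cnj (v j x) * rho x y * v j y)"
proof -
 have "(SUM x:Z. SUM y:Z. cnj (v j x) * rho x y * v j y)
   = (SUM x:Z. SUM y:Z. SUM i:Z. of_real (p i) * ((cnj (v j x) * u i x) * cnj (cnj (v j y) * u i y)))"
  by (intro sum.cong refl) (simp add: specdD(3)[OF s] sum_distribs mult_ac)
 also have "... = (SUM i:Z. SUM x:Z. SUM y:Z. of_real (p i) * ((cnj (v j x) * u i x) * cnj (cnj (v j y) * u i y)))"
  by (intro sum.cong refl sum_perm)
 also have "... = (SUM i:Z. of_real (p i) * (ip Z (v j) (u i) * cnj (ip Z (v j) (u i))))"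
  unfolding ip_def cnj_sum sum_product by (simp only: sum_distrib_left)
 also have "... = of_real (SUM i:Z. overlap Z u v i j * p i)"
  by (simp only: cmod_sq overlap_def of_real_sum of_real_mult mult.commute)
 finally show ?thesis by simp
qed

lemma specd_trace:
 assumes s: "specd X rho r u"
 shows "(SUM k:X. r k) = Re (SUM x:X. rho x x)"
proof -
 have "(SUM x:X. rho x x) = (SUM x:X. SUM k:X. of_real (r k) * (u k x * cnj (u k x)))"
  by (intro sum.cong refl) (simp add: specdD(3)[OF s] mult.assoc)
 also have "... = (SUM k:X. of_real (r k) * (SUM x:X. u k x * cnj (u k x)))"
  by (subst sum.swap) (simp add: sum_distrib_left)
 also have "... = of_real (SUM k:X. r k)"
  by (simp add: onb_orth[OF specdD(2)[OF s]])
 finally show ?thesis by simp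
qed

text \<open>The product of the standard basis of the first factor with \<open>w\<close>, carried
  back along \<open>h\<close>.\<close>

definition prod_basis :: "('z => 'a * 'k) => ('k => 'k => complex) => 'z => 'z => complex" where
 "prod_basis h w j z = (if fst (h j) = fst (h z) then w (snd (h j)) (snd (h z)) else 0)"

lemma bij_pair_sum:
 assumes "bij_betw h Z (A >< K)"
 shows "(SUM z:Z. f (h z)) = (SUM a:A. SUM k:K. f (a, k))"
 by (simp only: sum.reindex_bij_betw[OF assms] sum_Times)

text \<open>The kernel is that of 1 tensor (tau + c 1). For positive semidefinite tau and c > 0 the
  shift makes all its eigenvalues positive, as monotonicity of the relative entropy demands of its
  second argument.\<close>

lemma specd_prod_shift:
 assumes h: "bij_betw h Z (A >< K)" and A: "finite A" and s: "specd K tau r w"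
 shows "specd Z (%x y. if fst (h x) = fst (h y) then tau (snd (h x)) (snd (h y)) + (if snd (h x) = snd (h y) then of_real c else 0) else 0)
   (%j. r (snd (h j)) + c) (prod_basis h w)"
proof -
 note K = specdD(1)[OF s] and w = specdD(2)[OF s]
 have re: "(SUM z:Z. f (h z)) = (SUM a:A. SUM k:K. f (a, k))" for f :: "_ => complex" by (rule bij_pair_sum[OF h])
 have hm: "fst (h z) : A" "snd (h z) : K" if "z : Z" for z using bij_betw_apply[OF h that] by (simp_all add: mem_Times_iff)
 have inj: "x = y <-> fst (h x) = fst (h y) & snd (h x) = snd (h y)" if "x : Z" "y : Z" for x y
  using h that by (auto simp: bij_betw_def inj_on_def prod_eq_iff)
 have fin: "finite Z" using h A K by (simp add: bij_betw_finite)
 have ifif: "(if P then a else 0) * (if Q then b else 0) = (if P & Q then a * b else (0::complex))" for P Q a b by simp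
 have if0: "(SUM k:K. if P then f k else 0) = (if P then sum f K else 0)" for P and f :: "_ => complex" by simp
 have o1: "(SUM x:Z. prod_basis h w i x * cnj (prod_basis h w j x)) = dl i j" if "i : Z" "j : Z" for i j
 proof -
  define F where "F = (%(a, k). if a = fst (h i) then (if fst (h i) = fst (h j) then w (snd (h i)) k * cnj (w (snd (h j)) k) else 0) else 0)"
  have "(SUM x:Z. prod_basis h w i x * cnj (prod_basis h w j x)) = (SUM x:Z. F (h x))"
   unfolding prod_basis_def F_def by (intro sum.cong refl) (auto simp: case_prod_unfold)
  also have "... = (SUM a:A. SUM k:K. if a = fst (h i) then (if fst (h i) = fst (h j) then w (snd (h i)) k * cnj (w (snd (h j)) k) else 0) else 0)"
   unfolding re by (simp add: F_def)
  also have "... = (if fst (h i) = fst (h j) then (SUM k:K. w (snd (h i)) k * cnj (w (snd (h j)) k)) else 0)"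
   using A hm that by (simp add: if0)
  also have "... = dl i j" using that hm by (simp add: onb_orth[OF w] inj)
  finally show ?thesis .
 qed
 have o2: "(SUM k:Z. c' (snd (h k)) * prod_basis h w k x * cnj (prod_basis h w k y)) = (if fst (h x) = fst (h y) then (SUM k:K. c' k * w k (snd (h x)) * cnj (w k (snd (h y)))) else 0)"
  if "x : Z" "y : Z" for x y c'
 proof -
  define F where "F = (%(a, k). if a = fst (h x) then (if fst (h x) = fst (h y) then c' k * w k (snd (h x)) * cnj (w k (snd (h y))) else 0) else 0)"
  have "(SUM k:Z. c' (snd (h k)) * prod_basis h w k x * cnj (prod_basis h w k y)) = (SUM k:Z. F (h k))"
   unfolding prod_basis_def F_def by (intro sum.cong refl) (auto simp: case_prod_unfold)
  also have "... = (SUM a:A. SUM k:K. if a = fst (h x) then (if fst (h x) = fst (h y) then c' k * w k (snd (h x)) * cnj (w k (snd (h y))) else 0) else 0)"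
   unfolding re by (simp add: F_def)
  also have "... = (if fst (h x) = fst (h y) then (SUM k:K. c' k * w k (snd (h x)) * cnj (w k (snd (h y)))) else 0)"
   using A hm that by (simp add: if0)
  finally show ?thesis .
 qed
 have o3: "(SUM k:Z. prod_basis h w k x * cnj (prod_basis h w k y)) = dl x y" if "x : Z" "y : Z" for x y
  using o2[OF that, of "%_. 1"] that hm by (simp add: onb_complete[OF w] inj)
 have o4: "(if fst (h x) = fst (h y) then tau (snd (h x)) (snd (h y)) + (if snd (h x) = snd (h y) then of_real c else 0) else 0)
  = (SUM k:Z. of_real (r (snd (h k)) + c) * prod_basis h w k x * cnj (prod_basis h w k y))" if "x : Z" "y : Z" for x y
 proof -
  have "(SUM k:K. of_real (r k + c) * w k (snd (h x)) * cnj (w k (snd (h y)))) = tau (snd (h x)) (snd (h y)) + of_real c * (SUM k:K. w k (snd (h x)) * cnj (w k (snd (h y))))"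
   using that hm by (simp add: specdD(3)[OF s] sum.distrib sum_distrib_left algebra_simps)
  thus ?thesis unfolding o2[OF that, of "%k. of_real (r k + c)"]
   using that hm by (simp add: onb_complete[OF w])
 qed
 show ?thesis unfolding specd_def onb_def by (intro conjI ballI fin o1 o3 o4)
qed

text \<open>An observable 1 tensor L(tau) sees only the marginal on \<open>K\<close>. That marginal
  is tau itself, so the cross term of the relative entropy reduces to a sum over the spectrum of
  tau.\<close>

lemma cross_entropy_prod:
 assumes h: "bij_betw h Z (A >< K)" and A: "finite A" and s: "specd K tau r w" and t: "specd Z rho p u"
  and R: "!!x y. x : Z ==> y : Z ==> rho x y = R (h x) (h y)"
  and tau: "!!k l. k : K ==> l : K ==> tau k l = (SUM a:A. R (a, k) (a, l))"
 shows "(SUM i:Z. SUM j:Z. overlap Z u (prod_basis h w) i j * p i * L (snd (h j))) = (SUM k:K. L k * r k)"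
proof -
 note K = specdD(1)[OF s] and w = specdD(2)[OF s]
 have re: "(SUM z:Z. f (h z)) = (SUM a:A. SUM k:K. f (a, k))" for f :: "_ => complex" by (rule bij_pair_sum[OF h])
 have re': "(SUM z:Z. f (h z)) = (SUM a:A. SUM k:K. f (a, k))" for f :: "_ => real" by (rule bij_pair_sum[OF h])
 have hm: "fst (h z) : A" "snd (h z) : K" if "z : Z" for z using bij_betw_apply[OF h that] by (simp_all add: mem_Times_iff)
 have if0: "(SUM k:K. if P then f k else 0) = (if P then sum f K else 0)" for P and f :: "_ => complex" by simp
 have if1: "(SUM k:A. if P then f k else 0) = (if P then sum f A else 0)" for P and f :: "_ => complex" by simp
 define G where "G = (%a k. Re (SUM l:K. SUM m:K. cnj (w k l) * R (a, l) (a, m) * w k m))"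
 have "(SUM i:Z. SUM j:Z. overlap Z u (prod_basis h w) i j * p i * L (snd (h j)))
   = (SUM j:Z. (SUM i:Z. overlap Z u (prod_basis h w) i j * p i) * L (snd (h j)))"
  by (subst sum.swap) (simp only: sum_distrib_right)
 also have "... = (SUM j:Z. G (fst (h j)) (snd (h j)) * L (snd (h j)))"
 proof (intro sum.cong refl arg_cong2[where f="(*)"])
  fix j assume j: "j : Z"
  define F where "F = (%x y. if fst x = fst (h j) then if fst y = fst (h j) then cnj (w (snd (h j)) (snd x)) * R x y * w (snd (h j)) (snd y) else 0 else 0)"
  have "(SUM x:Z. SUM y:Z. cnj (prod_basis h w j x) * rho x y * prod_basis h w j y)
   = (SUM x:Z. SUM y:Z. F (h x) (h y))"
   by (intro sum.cong refl) (auto simp: prod_basis_def R F_def case_prod_unfold)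
  also have "... = (SUM x:Z. SUM b:A. SUM m:K. F (h x) (b, m))" by (intro sum.cong refl re)
  also have "... = (SUM a:A. SUM l:K. SUM b:A. SUM m:K. F (a, l) (b, m))" by (rule re[of "%y. SUM b:A. SUM m:K. F y (b, m)"])
  also have "... = (SUM a:A. SUM l:K. SUM b:A. SUM m:K. (if a = fst (h j) then if b = fst (h j) then cnj (w (snd (h j)) l) * R (a, l) (b, m) * w (snd (h j)) m else 0 else 0))"
   unfolding F_def fst_conv snd_conv ..
  also have "... = (SUM l:K. SUM m:K. cnj (w (snd (h j)) l) * R (fst (h j), l) (fst (h j), m) * w (snd (h j)) m)"
   using A hm[OF j] by (simp add: if0 if1)
  finally show "(SUM i:Z. overlap Z u (prod_basis h w) i j * p i) = G (fst (h j)) (snd (h j))"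
   unfolding overlap_weight[OF t] G_def by simp
 qed
 also have "... = (SUM a:A. SUM k:K. G a k * L k)" by (rule re'[of "%x. G (fst x) (snd x) * L (snd x)", simplified])
 also have "... = (SUM k:K. (SUM a:A. G a k) * L k)" by (subst sum.swap) (simp only: sum_distrib_right)
 also have "... = (SUM k:K. r k * L k)"
 proof (intro sum.cong refl arg_cong2[where f="(*)"])
  fix k assume k: "k : K"
  have "(SUM a:A. SUM l:K. SUM m:K. cnj (w k l) * R (a, l) (a, m) * w k m) = (SUM l:K. SUM m:K. SUM a:A. cnj (w k l) * R (a, l) (a, m) * w k m)"
   by (intro sum.cong refl sum_perm)
  also have "... = (SUM l:K. SUM m:K. cnj (w k l) * tau l m * w k m)"
   by (intro sum.cong refl) (simp add: tau sum_distribs)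
  also have "... = of_real (r k)" by (rule specd_quadratic[OF s k])
  finally show "(SUM a:A. G a k) = r k" unfolding G_def by (metis Re_complex_of_real Re_sum)
 qed
 finally show ?thesis by (simp add: mult.commute)
qed

lemma eta_ln: "0 <= r ==> eta r = - (r * ln r) / ln 2"
 by (auto simp: eta_def log_def)

lemma gram_prod: "gram (Y >< B) M x x' = (SUM b:B. SUM y:Y. M x (y, b) * cnj (M x' (y, b)))"
 unfolding gram_def sum_Times by (rule sum.swap)

lemma gram_trace_nonneg: "Re (SUM x:X. gram Y M x x) = (SUM x:X. SUM y:Y. (cmod (M x y))^2)"
 by (simp add: gram_def cmod_sq)

lemma tendsto_mult_ln_shift:
 assumes "(r::real) >= 0"
 shows "(%n. r * ln (r + c / real (Suc n))) ----> r * ln r"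
proof (cases "r = 0")
 case False
 have "(%n. c / real (Suc n)) ----> 0" using LIMSEQ_Suc[OF lim_const_over_n[of c]] by simp
 hence "(%n. r * ln (r + c / real (Suc n))) ----> r * ln (r + 0)"
  using False by (intro tendsto_intros) auto
 thus ?thesis by simp
qed simp

text \<open>Strong subadditivity is monotonicity of the relative entropy between the state of ABE and
 the operator 1 on A times the state of BE, the latter shifted by a multiple of 1 to make it invertible.\<close>

lemma strong_subadditivity:
 fixes psi :: "'a => 'b => 'e => 'f => complex"
 assumes fin: "finite A" "finite B" "finite E" "finite F"
 shows "ent ((A >< E) >< B) (gram F (%((a, e), b) f. psi a b e f)) + ent E (gram (F >< (A >< B)) (%e (f, a, b). psi a b e f))
  <= ent (A >< E) (gram (F >< B) (%(a, e) (f, b). psi a b e f)) + ent (E >< B) (gram (F >< A) (%(e, b) (f, a). psi a b e f))"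
proof -
 let ?Z = "A >< E"
 define rho where "rho = gram F (%((a, e), b) f. psi a b e f)"
 define rhos where "rhos = gram (F >< B) (%(a, e) (f, b). psi a b e f)"
 define tau where "tau = gram (F >< A) (%(e, b) (f, a). psi a b e f)"
 define taus where "taus = gram (F >< (A >< B)) (%e (f, a, b). psi a b e f)"
 obtain p u where s: "specd (?Z >< B) rho p u" unfolding rho_def using specd_gram_exists fin by (metis finite_cartesian_product)
 obtain ps us where ss: "specd ?Z rhos ps us" unfolding rhos_def using specd_gram_exists fin by (metis finite_cartesian_product)
 obtain r w where t: "specd (E >< B) tau r w" unfolding tau_def using specd_gram_exists fin by (metis finite_cartesian_product)
 obtain rs ws where ts: "specd E taus rs ws" unfolding taus_def using specd_gram_exists fin by metis
 have p: "p i >= 0" if "i : ?Z >< B" for i using specd_gram_nonneg[OF s[unfolded rho_def] that fin(4)] .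
 have ps: "ps i >= 0" if "i : ?Z" for i using specd_gram_nonneg[OF ss[unfolded rhos_def] that] fin by simp
 have r: "r i >= 0" if "i : E >< B" for i using specd_gram_nonneg[OF t[unfolded tau_def] that] fin by simp
 have rs: "rs i >= 0" if "i : E" for i using specd_gram_nonneg[OF ts[unfolded taus_def] that] fin by simp
 define h :: "('a * 'e) * 'b => 'a * 'e * 'b" where "h = (%((a, e), b). (a, (e, b)))"
 have h: "bij_betw h (?Z >< B) (A >< (E >< B))"
  by (rule bij_betwI[where g="%(a, (e, b)). ((a, e), b)"]) (auto simp: h_def)
 have hid: "bij_betw (%z. z) ?Z (A >< E)" by (simp add: bij_betw_def)
 \<comment> \<open>The shift is \<open>c\<close> on EB and \<open>card B * c\<close> on E, because
   tracing out B multiplies the identity by the dimension of B. An empty B makes all weights vanish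
   and is treated apart.\<close>
 have key: "(SUM i:?Z. ps i * ln (ps i)) - (SUM e:E. ln (rs e + real (card B) * c) * rs e)
   <= (SUM i:?Z >< B. p i * ln (p i)) - (SUM k:E >< B. ln (r k + c) * r k)" if c: "c > 0" for c
 proof (cases "B = {}")
  case True
  hence "ps i = 0" if "i : ?Z" for i
  proof -
   have "(SUM i:?Z. ps i) = 0" unfolding specd_trace[OF ss] rhos_def gram_trace_nonneg using True by simp
   thus ?thesis using ps that fin sum_nonneg_eq_0_iff[of ?Z ps] by blast
  qed
  moreover have "rs i = 0" if "i : E" for i
  proof -
   have "(SUM i:E. rs i) = 0" unfolding specd_trace[OF ts] taus_def gram_trace_nonneg using True by simp
   thus ?thesis using rs that fin by (simp add: sum_nonneg_eq_0_iff)
  qed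
  ultimately show ?thesis using True by simp
 next
  case False
  hence cB: "real (card B) > 0" using fin by (simp add: card_gt_0_iff)
  define sigma where "sigma = (%x y. if fst (h x) = fst (h y) then tau (snd (h x)) (snd (h y)) + (if snd (h x) = snd (h y) then of_real c else 0) else 0)"
  define sigmas where "sigmas = (%(x::'a * 'e) y. if fst x = fst y then taus (snd x) (snd y) + (if snd x = snd y then of_real (real (card B) * c) else 0) else 0)"
  have sigma: "specd (?Z >< B) sigma (%j. r (snd (h j)) + c) (prod_basis h w)"
   unfolding sigma_def by (rule specd_prod_shift[OF h fin(1) t])
  have sigmas: "specd ?Z sigmas (%j. rs (snd j) + real (card B) * c) (prod_basis (%z. z) ws)"
   unfolding sigmas_def by (rule specd_prod_shift[OF hid fin(1) ts])
  have m1: "rhos z y = (SUM b:B. rho (z, b) (y, b))" for z y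
   unfolding rhos_def rho_def gram_prod unfolding gram_def by (simp add: case_prod_unfold)
  have m2: "taus e e' = (SUM b:B. tau (e, b) (e', b))" for e e'
  proof -
   have "taus e e' = (SUM (a,b):A><B. SUM f:F. psi a b e f * cnj (psi a b e' f))"
    unfolding taus_def gram_prod by (simp add: case_prod_unfold)
   also have "... = (SUM b:B. SUM a:A. SUM f:F. psi a b e f * cnj (psi a b e' f))"
    unfolding sum.cartesian_product[symmetric] by (rule sum.swap)
   also have "... = (SUM b:B. tau (e, b) (e', b))" unfolding tau_def gram_prod by simp
   finally show ?thesis .
  qed
  have m3: "sigmas z y = (SUM b:B. sigma (z, b) (y, b))" for z y
  proof -
   have "(SUM b:B. sigma (z, b) (y, b)) = (SUM b:B. if fst z = fst y then tau (snd z, b) (snd y, b) + (if snd z = snd y then of_real c else 0) else 0)"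
    by (intro sum.cong refl) (auto simp: sigma_def h_def case_prod_unfold)
   thus ?thesis unfolding sigmas_def m2 by (auto simp: sum.distrib)
  qed
  have tr: "(SUM i:?Z><B. p i) = (SUM i:?Z. ps i)"
   unfolding specd_trace[OF s] specd_trace[OF ss] unfolding sum_Times[of _ ?Z B] m1 ..
  have "(SUM i:?Z. ps i * ln (ps i)) - (SUM i:?Z. SUM j:?Z. overlap ?Z us (prod_basis (%z. z) ws) i j * ps i * ln (rs (snd j) + real (card B) * c))
   <= (SUM i:?Z><B. p i * ln (p i)) - (SUM i:?Z><B. SUM j:?Z><B. overlap (?Z><B) u (prod_basis h w) i j * p i * ln (r (snd (h j)) + c))"
  proof (rule relative_entropy_mono[OF _ fin(2) s sigma ss sigmas])
   show "0 < r (snd (h i)) + c" if "i : ?Z >< B" for i using r that c by (auto simp: h_def intro!: add_nonneg_pos)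
   show "0 < rs (snd i) + real (card B) * c" if "i : ?Z" for i using rs that c cB by (auto intro!: add_nonneg_pos)
  qed (use fin p ps m1 m3 tr in auto)
  moreover have "(SUM i:?Z. SUM j:?Z. overlap ?Z us (prod_basis (%z. z) ws) i j * ps i * ln (rs (snd j) + real (card B) * c))
    = (SUM e:E. ln (rs e + real (card B) * c) * rs e)"
  proof (rule cross_entropy_prod[OF hid fin(1) ts ss, where R = rhos and L = "%e. ln (rs e + real (card B) * c)"])
   show "taus k l = (SUM a:A. rhos (a, k) (a, l))" for k l
    unfolding taus_def rhos_def gram_prod by (simp add: case_prod_unfold sum_Times)
  qed simp
  moreover have "(SUM i:?Z><B. SUM j:?Z><B. overlap (?Z><B) u (prod_basis h w) i j * p i * ln (r (snd (h j)) + c))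
    = (SUM k:E >< B. ln (r k + c) * r k)"
  proof (rule cross_entropy_prod[OF h fin(1) t s, where R = "%(a,e,b) (a',e',b'). rho ((a,e),b) ((a',e'),b')" and L = "%k. ln (r k + c)"])
   show "tau k l = (SUM a:A. (case (a, k) of (a, e, b) => %(a', e', b'). rho ((a, e), b) ((a', e'), b')) (a, l))" for k l
    unfolding tau_def rho_def gram_prod unfolding gram_def by (simp add: case_prod_unfold)
  qed (auto simp: h_def)
  ultimately show ?thesis by simp
 qed
 \<comment> \<open>The shift is removed along 1/(n+1); a vanishing eigenvalue is harmless since its
   term is zero for every shift.\<close>
 have lim: "(%n. (SUM k:K. ln (q k + d / real (Suc n)) * q k)) ----> (SUM k:K. ln (q k) * q k)"
  if "!!k. k : K ==> q k >= 0" for K :: "'k set" and q d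
  using tendsto_mult_ln_shift[of "q _" d] that by (intro tendsto_sum) (simp add: mult.commute)
 have "(SUM i:?Z. ps i * ln (ps i)) - (SUM e:E. ln (rs e) * rs e) <= (SUM i:?Z >< B. p i * ln (p i)) - (SUM k:E >< B. ln (r k) * r k)"
 proof (rule LIMSEQ_le)
  show "(%n. (SUM i:?Z. ps i * ln (ps i)) - (SUM e:E. ln (rs e + real (card B) / real (Suc n)) * rs e)) ----> (SUM i:?Z. ps i * ln (ps i)) - (SUM e:E. ln (rs e) * rs e)"
   by (intro tendsto_diff tendsto_const lim rs)
  show "(%n. (SUM i:?Z >< B. p i * ln (p i)) - (SUM k:E >< B. ln (r k + 1 / real (Suc n)) * r k)) ----> (SUM i:?Z >< B. p i * ln (p i)) - (SUM k:E >< B. ln (r k) * r k)"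
   by (intro tendsto_diff tendsto_const lim r)
  show "EX N. ALL n>=N. (SUM i:?Z. ps i * ln (ps i)) - (SUM e:E. ln (rs e + real (card B) / real (Suc n)) * rs e) <= (SUM i:?Z >< B. p i * ln (p i)) - (SUM k:E >< B. ln (r k + 1 / real (Suc n)) * r k)"
   using key[of "1 / real (Suc _)"] by (intro exI[of _ 0]) auto
 qed
 hence "(SUM i:?Z >< B. - (p i * ln (p i)) / ln 2) + (SUM e:E. - (rs e * ln (rs e)) / ln 2) <= (SUM i:?Z. - (ps i * ln (ps i)) / ln 2) + (SUM k:E >< B. - (r k * ln (r k)) / ln 2)"
  by (simp add: sum_divide_distrib[symmetric] sum_negf divide_right_mono mult.commute flip: add_divide_distrib diff_divide_distrib)
   (simp add: divide_simps)
 hence "(SUM i:?Z >< B. eta (p i)) + (SUM e:E. eta (rs e)) <= (SUM i:?Z. eta (ps i)) + (SUM k:E >< B. eta (r k))"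
  using p ps r rs by (simp add: eta_ln)
 thus ?thesis
  unfolding rho_def[symmetric] rhos_def[symmetric] tau_def[symmetric] taus_def[symmetric]
  using ent_gram_eq[OF s[unfolded rho_def] fin(4)] ent_gram_eq[OF ss[unfolded rhos_def]] ent_gram_eq[OF t[unfolded tau_def]] ent_gram_eq[OF ts[unfolded taus_def]] fin
  by (simp add: rho_def rhos_def tau_def taus_def)
qed

section \<open>Entropies of the subsystems of a pure state read off by index maps\<close>

definition pf :: "'k set => ('k => 'x) => ('k => 'y) => ('k => complex) => 'x => 'y => complex" where
 "pf K p q psi x y = (SUM k:{k:K. p k = x & q k = y}. psi k)"

text \<open>A pure state on several systems is a function \<open>psi\<close> on a finite index set \<open>K\<close>, and a map on \<open>K\<close> reads off some of the
 systems. \<open>Sv K p q psi\<close> is the entropy of the systems \<open>p\<close> after tracing out the systems \<open>q\<close>; a system that occurs in both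
 is dephased. \<open>Hc K b e q psi\<close> is H(b|e), where \<open>q\<close> is everything else.\<close>

definition Sv :: "'k set => ('k => 'x) => ('k => 'y) => ('k => complex) => real" where
 "Sv K p q psi = ent (p ` K) (gram (q ` K) (pf K p q psi))"

definition Hc :: "'k set => ('k => 'x) => ('k => 'y) => ('k => 'z) => ('k => complex) => real" where
 "Hc K b e q psi = Sv K (%k. (b k, e k)) q psi - Sv K e (%k. (b k, q k)) psi"

text \<open>The reduced kernel written in the amplitudes alone, free of the ranges of
  \<open>p\<close> and \<open>q\<close>. Two presentations of a state have equal entropy as soon as
  these kernels agree.\<close>

definition red :: "'k set => ('k => 'x) => ('k => 'y) => ('k => complex) => 'x => 'x => complex" where
 "red K p q psi u v = (SUM k:K. SUM l:K. if p k = u & p l = v & q k = q l then psi k * cnj (psi l) else 0)"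

lemma pf_0: "x ~: p ` K | y ~: q ` K ==> pf K p q psi x y = 0"
 unfolding pf_def by (rule sum.neutral) auto

lemma pf_swap: "pf K q p psi y x = pf K p q psi x y"
 unfolding pf_def by (rule sum.cong) auto

lemma pf_alt: "finite K ==> pf K p q psi x y = (SUM k:K. if p k = x & q k = y then psi k else 0)"
 unfolding pf_def by (simp add: sum.inter_filter)

lemma gram_pf:
 assumes K: "finite K" and Y: "finite Y" "q ` K \<subseteq> Y"
 shows "gram Y (pf K p q psi) u v = red K p q psi u v"
proof -
 have "gram Y (pf K p q psi) u v = (SUM y:Y. SUM k:K. SUM l:K. if q k = y then (if p k = u & p l = v & q k = q l then psi k * cnj (psi l) else 0) else 0)"
  unfolding gram_def pf_alt[OF K] cnj_sum sum_product by (intro sum.cong refl) auto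
 also have "... = (SUM k:K. SUM l:K. SUM y:Y. if q k = y then (if p k = u & p l = v & q k = q l then psi k * cnj (psi l) else 0) else 0)"
  by (intro sum.cong refl sum_perm)
 also have "... = red K p q psi u v"
  unfolding red_def using Y by (intro sum.cong refl) auto
 finally show ?thesis .
qed

lemma Sv_carrier:
 assumes "finite K" "finite X" "finite Y" "p ` K \<subseteq> X" "q ` K \<subseteq> Y"
 shows "Sv K p q psi = ent X (gram Y (pf K p q psi))"
 unfolding Sv_def by (rule ent_gram_mono) (use assms in "auto simp: pf_0")

lemma Sv_swap: "finite K ==> Sv K p q psi = Sv K q p psi"
proof -
 assume K: "finite K"
 have "pf K q p psi = (%y x. pf K p q psi x y)" by (intro ext) (rule pf_swap)
 thus ?thesis unfolding Sv_def by (simp only:) (rule ent_swap, use K in auto)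
qed

lemma Sv_red_cong:
 assumes "finite K" "finite K'" and "!!u v. red K p q psi u v = red K' p' q' psi' u v"
 shows "Sv K p q psi = Sv K' p' q' psi'"
proof -
 let ?X = "p ` K \<union> p' ` K'"
 have "Sv K p q psi = ent ?X (gram (q ` K) (pf K p q psi))" by (rule Sv_carrier) (use assms in auto)
 also have "... = ent ?X (gram (q' ` K') (pf K' p' q' psi'))"
  by (rule ent_cong) (use assms in "simp add: gram_pf")
 also have "... = Sv K' p' q' psi'" by (rule Sv_carrier[symmetric]) (use assms in auto)
 finally show ?thesis .
qed

lemma Sv_cong:
 assumes "!!k. k : K ==> p k = p' k" "!!k. k : K ==> q k = q' k" "!!k. k : K ==> psi k = psi' k"
 shows "Sv K p q psi = Sv K p' q' psi'"
proof -
 have 1: "p ` K = p' ` K" "q ` K = q' ` K" using assms by (auto intro!: image_cong)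
 have "{k:K. p k = x & q k = y} = {k:K. p' k = x & q' k = y}" for x y using assms by auto
 hence "pf K p q psi = pf K p' q' psi'" unfolding pf_def using assms(3) by (auto intro!: ext sum.cong)
 thus ?thesis unfolding Sv_def 1 by simp
qed

text \<open>Only the partitions of \<open>K\<close> into level sets of \<open>p\<close> and
  \<open>q\<close> matter, not the labels. Regrouping, reordering or dropping redundant components
  of a tuple is always an application of this fact.\<close>

lemma Sv_view:
 assumes K: "finite K" and p: "PROP same K p p'"
  and q: "PROP same K q q'"
 shows "Sv K p q psi = Sv K p' q' psi"
proof -
 define g where "g = (%x. p' (SOME k. k : K & p k = x))"
 define h where "h = (%x. q' (SOME k. k : K & q k = x))"
 have g: "g (p k) = p' k" if "k : K" for k
 proof -
  have "(SOME l. l : K & p l = p k) : K & p (SOME l. l : K & p l = p k) = p k" by (rule someI_ex) (use that in blast)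
  thus ?thesis using p that by (auto simp: g_def)
 qed
 have h: "h (q k) = q' k" if "k : K" for k
 proof -
  have "(SOME l. l : K & q l = q k) : K & q (SOME l. l : K & q l = q k) = q k" by (rule someI_ex) (use that in blast)
  thus ?thesis using q that by (auto simp: h_def)
 qed
 have bg: "bij_betw g (p ` K) (p' ` K)" using p by (auto simp: bij_betw_def inj_on_def g image_image intro!: image_cong)
 have bh: "bij_betw h (q ` K) (q' ` K)" using q by (auto simp: bij_betw_def inj_on_def h image_image intro!: image_cong)
 have pfe: "pf K p q psi x y = pf K p' q' psi (g x) (h y)" if xy: "x : p ` K" "y : q ` K" for x y
 proof -
  obtain k l where "k : K" "l : K" "x = p k" "y = q l" using xy by blast
  hence "{m:K. p m = x & q m = y} = {m:K. p' m = g x & q' m = h y}" using p q by (auto simp: g h)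
  thus ?thesis by (simp add: pf_def)
 qed
 have "Sv K p q psi = ent (p ` K) (gram (q ` K) (%x y. pf K p' q' psi (g x) (h y)))"
  unfolding Sv_def by (rule ent_cong) (auto simp: gram_def pfe)
 also have "... = Sv K p' q' psi" unfolding Sv_def by (rule ent_reindex[OF bg bh]) (use K in auto)
 finally show ?thesis .
qed

lemma Sv_reindex:
 assumes g: "bij_betw g K' K"
 shows "Sv K' (%k. p (g k)) (%k. q (g k)) (%k. psi (g k)) = Sv K p q psi"
proof -
 have im: "(%k. p (g k)) ` K' = p ` K" "(%k. q (g k)) ` K' = q ` K" using g by (auto simp: bij_betw_def image_image)
 have "pf K' (%k. p (g k)) (%k. q (g k)) (%k. psi (g k)) x y = pf K p q psi x y" for x y
  unfolding pf_def
  by (rule sum.reindex_bij_betw) (use g in "auto simp: bij_betw_def inj_on_def")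
 thus ?thesis unfolding Sv_def im by presburger
qed

lemma Hc_view:
 assumes "finite K" and "!!k l. k : K ==> l : K ==> (b k, e k) = (b l, e l) <-> (b' k, e' k) = (b' l, e' l)"
  and "PROP same K e e'"
  and "PROP same K q q'"
  and "!!k l. k : K ==> l : K ==> (b k, q k) = (b l, q l) <-> (b' k, q' k) = (b' l, q' l)"
 shows "Hc K b e q psi = Hc K b' e' q' psi"
 unfolding Hc_def using assms by (intro arg_cong2[where f="(-)"] Sv_view) auto

text \<open>Conditioning on more lowers the entropy. The maps may share components: a component
  present in two places is a register together with its copy, a freedom that the dephasing and
  decoupling estimates exploit.\<close>

lemma ssa:
 assumes K: "finite K"
 shows "Hc K b (%k. (a k, e k)) q psi <= Hc K b e (%k. (a k, q k)) psi"
proof -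
 define A B E F where "A = a ` K" "B = b ` K" "E = e ` K" "F = q ` K"
 have fin: "finite A" "finite B" "finite E" "finite F" using K by (auto simp: A_B_E_F_def)
 define Psi where "Psi = (%alpha \<beta> eps phi. SUM k:K. if a k = alpha & b k = \<beta> & e k = eps & q k = phi then psi k else 0)"
 have pf: "pf K (%k. ((a k, e k), b k)) q psi = (%((a, e), b) f. Psi a b e f)"
  "pf K e (%k. (q k, a k, b k)) psi = (%e (f, a, b). Psi a b e f)"
  "pf K (%k. (a k, e k)) (%k. (q k, b k)) psi = (%(a, e) (f, b). Psi a b e f)"
  "pf K (%k. (e k, b k)) (%k. (q k, a k)) psi = (%(e, b) (f, a). Psi a b e f)"
  by (auto simp: pf_alt[OF K] Psi_def fun_eq_iff intro!: sum.cong)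
 have 1: "ent ((A >< E) >< B) (gram F (%((a, e), b) f. Psi a b e f)) = Sv K (%k. ((a k, e k), b k)) q psi"
  unfolding pf[symmetric] by (subst Sv_carrier[of K "(A >< E) >< B" F "%k. ((a k, e k), b k)" q]) (use K fin in "auto simp: A_B_E_F_def")
 have 2: "ent E (gram (F >< (A >< B)) (%e (f, a, b). Psi a b e f)) = Sv K e (%k. (q k, a k, b k)) psi"
  unfolding pf[symmetric] by (subst Sv_carrier[of K E "F >< (A >< B)" e "%k. (q k, a k, b k)"]) (use K fin in "auto simp: A_B_E_F_def")
 have 3: "ent (A >< E) (gram (F >< B) (%(a, e) (f, b). Psi a b e f)) = Sv K (%k. (a k, e k)) (%k. (q k, b k)) psi"
  unfolding pf[symmetric] by (subst Sv_carrier[of K "A >< E" "F >< B" "%k. (a k, e k)" "%k. (q k, b k)"]) (use K fin in "auto simp: A_B_E_F_def")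
 have 4: "ent (E >< B) (gram (F >< A) (%(e, b) (f, a). Psi a b e f)) = Sv K (%k. (e k, b k)) (%k. (q k, a k)) psi"
  unfolding pf[symmetric] by (subst Sv_carrier[of K "E >< B" "F >< A" "%k. (e k, b k)" "%k. (q k, a k)"]) (use K fin in "auto simp: A_B_E_F_def")
 have "Sv K (%k. ((a k, e k), b k)) q psi = Sv K (%k. (b k, (a k, e k))) q psi"
  "Sv K e (%k. (q k, a k, b k)) psi = Sv K e (%k. (b k, (a k, q k))) psi"
  "Sv K (%k. (a k, e k)) (%k. (q k, b k)) psi = Sv K (%k. (a k, e k)) (%k. (b k, q k)) psi"
  "Sv K (%k. (e k, b k)) (%k. (q k, a k)) psi = Sv K (%k. (b k, e k)) (%k. (a k, q k)) psi"
  by (rule Sv_view[OF K]; auto)+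
 thus ?thesis using strong_subadditivity[OF fin, of Psi] unfolding Hc_def 1 2 3 4 by simp
qed

text \<open>An injective \<open>q\<close> leaves no coherence between different indices, so the
  state seen by \<open>p\<close> is diagonal.\<close>

lemma Sv_classical:
 assumes K: "finite K" and q: "inj_on q K"
 shows "Sv K p q psi = (SUM x:p ` K. eta (SUM k:{k:K. p k = x}. (cmod (psi k))^2))"
proof -
 have "specd (p ` K) (gram (q ` K) (pf K p q psi)) (%x. SUM k:{k:K. p k = x}. (cmod (psi k))^2) (%x y. if x = y then 1 else 0)"
  unfolding specd_def
 proof (intro conjI ballI)
  show "onb (p ` K) (%x y. if x = y then 1 else 0)" using K by (auto simp: onb_def if_distrib[of "%t. t * _"] cong: if_cong)
  fix x y assume xy: "x : p ` K" "y : p ` K"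
  have "red K p q psi x y = (SUM k:K. SUM l:K. if k = l then if p k = x & p k = y then psi k * cnj (psi k) else 0 else 0)"
   unfolding red_def using q by (intro sum.cong refl) (auto simp: inj_on_def)
  also have "... = (SUM k:K. if p k = x & p k = y then psi k * cnj (psi k) else 0)" using K by simp
  also have "... = (if x = y then of_real (SUM k:{k:K. p k = x}. (cmod (psi k))^2) else 0)"
  proof (cases "x = y")
   case True
   have "(SUM k:K. if p k = x then psi k * cnj (psi k) else 0) = (SUM k:{k:K. p k = x}. psi k * cnj (psi k))" by (simp add: K sum.inter_filter)
   thus ?thesis using True by (simp only: cmod_sq of_real_sum simp_thms if_True)
  next
   case False
   thus ?thesis by (auto intro!: sum.neutral)
  qed
  also have "... = (SUM k:p ` K. of_real (SUM k':{k':K. p k' = k}. (cmod (psi k'))^2) * dl k x * cnj (dl k y))"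
   using xy K by (simp add: if_distrib[of "%t. t * _"] if_distrib[of "%t. _ * t"] cong: if_cong)
  finally show "gram (q ` K) (pf K p q psi) x y = (SUM k:p ` K. of_real (SUM k':{k':K. p k' = k}. (cmod (psi k'))^2) * dl k x * cnj (dl k y))"
   using K by (simp add: gram_pf)
 qed (use K in simp)
 thus ?thesis unfolding Sv_def using K by (simp add: ent_gram_eq)
qed

lemma specd_block:
 assumes X: "finite X" and Z: "finite Z" "z ` X \<subseteq> Z"
  and s: "!!c. c : Z ==> specd {x:X. z x = c} rho (r c) (u c)"
  and off: "!!x y. x : X ==> y : X ==> z x ~= z y ==> rho x y = 0"
 shows "specd X rho (%k. r (z k) k) (%k x. if z k = z x then u (z k) k x else 0)"
proof -
 have res: "(SUM k:X. if z k = c then f k else 0) = (SUM k:{k:X. z k = c}. f k)" for c and f :: "_ => complex"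
  using X by (simp add: sum.inter_filter)
 have zZ: "z x : Z" if "x : X" for x using Z that by auto
 have o1: "(SUM x:X. (if z i = z x then u (z i) i x else 0) * cnj (if z j = z x then u (z j) j x else 0)) = dl i j"
  if ij: "i : X" "j : X" for i j
 proof (cases "z i = z j")
  case True
  have "(SUM x:X. (if z i = z x then u (z i) i x else 0) * cnj (if z j = z x then u (z j) j x else 0))
   = (SUM x:X. if z x = z i then u (z i) i x * cnj (u (z i) j x) else 0)" using True by (intro sum.cong refl) auto
  thus ?thesis unfolding res using onb_orth[OF specdD(2)[OF s[OF zZ[OF ij(1)]]], of i j] ij True by simp
 qed (auto intro!: sum.neutral)
 have o2: "(SUM k:X. c k * (if z k = z x then u (z k) k x else 0) * cnj (if z k = z y then u (z k) k y else 0))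
   = (if z x = z y then SUM k:{k:X. z k = z x}. c k * u (z x) k x * cnj (u (z x) k y) else 0)" for x y c
 proof (cases "z x = z y")
  case True
  have "(SUM k:X. c k * (if z k = z x then u (z k) k x else 0) * cnj (if z k = z y then u (z k) k y else 0))
   = (SUM k:X. if z k = z x then c k * u (z x) k x * cnj (u (z x) k y) else 0)" using True by (intro sum.cong refl) auto
  thus ?thesis unfolding res using True by simp
 qed (auto intro!: sum.neutral)
 have o3: "(SUM k:X. (if z k = z x then u (z k) k x else 0) * cnj (if z k = z y then u (z k) k y else 0)) = dl x y"
  if "x : X" "y : X" for x y
  using o2[of "%_. 1" x y] onb_complete[OF specdD(2)[OF s[OF zZ[OF that(1)]]], of x y] that by auto
 have o4: "rho x y = (SUM k:X. of_real (r (z k) k) * (if z k = z x then u (z k) k x else 0) * cnj (if z k = z y then u (z k) k y else 0))"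
  if xy: "x : X" "y : X" for x y
 proof (cases "z x = z y")
  case True
  have "rho x y = (SUM k:{k:X. z k = z x}. of_real (r (z x) k) * u (z x) k x * cnj (u (z x) k y))"
   by (rule specdD(3)[OF s[OF zZ[OF xy(1)]]]) (use xy True in auto)
  thus ?thesis unfolding o2[of "%k. of_real (r (z k) k)"] using True by (auto intro!: sum.cong)
 next
  case False
  thus ?thesis unfolding o2[of "%k. of_real (r (z k) k)"] using off[OF xy] by simp
 qed
 show ?thesis unfolding specd_def onb_def by (intro conjI ballI X o1 o3 o4)
qed

text \<open>A label known both to the kept and to the traced systems makes the reduced state block
  diagonal. Since the blocks are not normalised, their entropies add without a separate term for the
  distribution of the label.\<close>

lemma Sv_block:
 assumes K: "finite K" and Z: "finite Z" "z ` K \<subseteq> Z"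
  and p: "!!k l. k : K ==> l : K ==> p k = p l ==> z k = z l"
  and q: "!!k l. k : K ==> l : K ==> q k = q l ==> z k = z l"
 shows "Sv K p q psi = (SUM c:Z. Sv {k:K. z k = c} p q psi)"
proof -
 let ?K = "%c. {k:K. z k = c}"
 let ?X = "p ` K" and ?rho = "gram (q ` K) (pf K p q psi)"
 define zx where "zx = (%x. z (SOME k. k : K & p k = x))"
 have zx: "zx (p k) = z k" if "k : K" for k
 proof -
  have "(SOME l. l : K & p l = p k) : K & p (SOME l. l : K & p l = p k) = p k" by (rule someI_ex) (use that in blast)
  thus ?thesis unfolding zx_def using p[of "SOME l. l : K & p l = p k" k] that by blast
 qed
 have Xc: "{x : ?X. zx x = c} = p ` ?K c" for c using zx by auto
 have redc: "red K p q psi x y = red (?K c) p q psi x y" if "x : p ` ?K c" "y : p ` ?K c" for x y c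
 proof -
  have zc: "z k = c" if "k : K" "p k = x | p k = y" for k
   using \<open>x \<in> p ` ?K c\<close> \<open>y \<in> p ` ?K c\<close> that zx[of k] unfolding Xc[symmetric] by auto
  have "red (?K c) p q psi x y = (SUM k:?K c. SUM l:K. if p k = x & p l = y & q k = q l then psi k * cnj (psi l) else 0)"
   unfolding red_def by (intro sum.cong refl sum.mono_neutral_left) (use K zc in auto)
  also have "... = red K p q psi x y"
   unfolding red_def by (rule sum.mono_neutral_left) (use K zc in "auto intro!: sum.neutral split: if_splits")
  finally show ?thesis by simp
 qed
 have "EX r u. specd (p ` ?K c) (gram (q ` ?K c) (pf (?K c) p q psi)) r u" for c by (rule specd_gram_exists) (use K in auto)
 then obtain r where "!!c. EX u. specd (p ` ?K c) (gram (q ` ?K c) (pf (?K c) p q psi)) (r c) u" by meson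
 then obtain u where ru: "!!c. specd (p ` ?K c) (gram (q ` ?K c) (pf (?K c) p q psi)) (r c) (u c)" by meson
 have "specd {x : ?X. zx x = c} ?rho (r c) (u c)" for c
 proof -
  have e: "?rho x y = gram (q ` ?K c) (pf (?K c) p q psi) x y" if "x : p ` ?K c" "y : p ` ?K c" for x y
   using K redc[OF that] by (simp add: gram_pf)
  have "specd (p ` ?K c) ?rho (r c) (u c) = specd (p ` ?K c) (gram (q ` ?K c) (pf (?K c) p q psi)) (r c) (u c)"
   by (rule specd_cong) (rule e)
  thus ?thesis unfolding Xc using ru[of c] by simp
 qed
 moreover have "?rho x y = 0" if xy: "x : ?X" "y : ?X" "zx x ~= zx y" for x y
 proof -
  have "~ (p k = x & p l = y & q k = q l)" if "k : K" "l : K" for k l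
   using q[OF that] zx[OF that(1)] zx[OF that(2)] xy(3) by metis
  hence "red K p q psi x y = 0" unfolding red_def by (intro sum.neutral ballI) auto
  thus ?thesis using K by (simp add: gram_pf)
 qed
 ultimately have s: "specd ?X ?rho (%k. r (zx k) k) (%k x. if zx k = zx x then u (zx k) k x else 0)"
  by (intro specd_block[where Z=Z]) (use K Z zx in auto)
 have "Sv K p q psi = (SUM k:?X. eta (r (zx k) k))" unfolding Sv_def by (rule ent_gram_eq[OF s]) (use K in auto)
 also have "... = (SUM c:Z. SUM k:{x:?X. zx x = c}. eta (r (zx k) k))"
  by (rule sum.group[symmetric]) (use K Z zx in auto)
 also have "... = (SUM c:Z. SUM k:p ` ?K c. eta (r c k))" unfolding Xc[symmetric] by (intro sum.cong refl) auto
 also have "... = (SUM c:Z. Sv (?K c) p q psi)" unfolding Sv_def using K by (intro sum.cong refl ent_gram_eq[OF ru, symmetric]) auto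
 finally show ?thesis .
qed

text \<open>\<open>V\<close> acts on a system that is traced out, apart from its key, which the kept
  systems may read. Because \<open>V\<close> never maps one key to another, it commutes with reading
  the key, and the isometry relation removes it from the reduced kernel.\<close>

lemma Sv_isometry:
 fixes V :: "'j => 'i => complex"
 assumes fin: "finite I" "finite J" "finite R"
  and V: "!!i i'. i : I ==> i' : I ==> (SUM j:J. V j i * cnj (V j i')) = dl i i'"
  and key: "!!i j. i : I ==> j : J ==> V j i ~= 0 ==> kappa' j = kappa i"
 shows "Sv (J >< R) (%(j, r). P (kappa' j) r) (%(j, r). (j, Q r)) (%(j, r). SUM i:I. V j i * psi (i, r))
    = Sv (I >< R) (%(i, r). P (kappa i) r) (%(i, r). (i, Q r)) psi"
proof (rule Sv_red_cong)
 fix u v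
 let ?c = "%k k' r r'. P k r = u & P k' r' = v & Q r = Q r'"
 let ?h = "%i i' r r'. if ?c (kappa i) (kappa i') r r' then psi (i, r) * cnj (psi (i', r')) else 0"
  and ?g = "%j r r'. if ?c (kappa' j) (kappa' j) r r' then (SUM i:I. V j i * psi (i, r)) * cnj (SUM i:I. V j i * psi (i, r')) else 0"
 have "red (J >< R) (%(j, r). P (kappa' j) r) (%(j, r). (j, Q r)) (%(j, r). SUM i:I. V j i * psi (i, r)) u v
   = (SUM j:J. SUM r:R. SUM j':J. SUM r':R. if j = j' then ?g j r r' else 0)"
  unfolding red_def sum_Times by (intro sum.cong refl) auto
 also have "... = (SUM j:J. SUM r:R. SUM r':R. SUM j':J. if j = j' then ?g j r r' else 0)"
  by (intro sum.cong refl sum.swap)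
 also have "... = (SUM j:J. SUM r:R. SUM r':R. ?g j r r')"
  using fin by simp
 also have "... = (SUM j:J. SUM r:R. SUM r':R. SUM i:I. SUM i':I. V j i * cnj (V j i') * ?h i i' r r')"
 proof (intro sum.cong refl)
  fix j r r' assume j: "j : J"
  have "?g j r r'
   = (SUM i:I. SUM i':I. if ?c (kappa' j) (kappa' j) r r' then V j i * psi (i, r) * cnj (V j i' * psi (i', r')) else 0)"
   by (auto simp: sum_product)
  also have "... = (SUM i:I. SUM i':I. V j i * cnj (V j i') * ?h i i' r r')"
  proof (intro sum.cong refl)
   fix i i' assume i: "i : I" "i' : I"
   show "(if ?c (kappa' j) (kappa' j) r r' then V j i * psi (i, r) * cnj (V j i' * psi (i', r')) else 0)
    = V j i * cnj (V j i') * ?h i i' r r'"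
    using key[OF i(1) j] key[OF i(2) j] by (cases "V j i = 0 | V j i' = 0") auto
  qed
  finally show "?g j r r'
   = (SUM i:I. SUM i':I. V j i * cnj (V j i') * ?h i i' r r')" .
 qed
 also have "... = (SUM r:R. SUM r':R. SUM i:I. SUM i':I. SUM j:J. V j i * cnj (V j i') * ?h i i' r r')"
  by (intro sum.cong refl sum_perm)
 also have "... = (SUM r:R. SUM r':R. SUM i:I. SUM i':I. if i = i' then ?h i i' r r' else 0)"
  by (intro sum.cong refl) (simp add: V flip: sum_distrib_right)
 also have "... = (SUM i:I. SUM r:R. SUM i':I. SUM r':R. if i = i' then ?h i i' r r' else 0)"
  by (intro sum.cong refl sum_perm)
 also have "... = red (I >< R) (%(i, r). P (kappa i) r) (%(i, r). (i, Q r)) psi u v"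
  unfolding red_def sum_Times by (intro sum.cong refl) auto
 finally show "red (J >< R) (%(j, r). P (kappa' j) r) (%(j, r). (j, Q r)) (%(j, r). SUM i:I. V j i * psi (i, r)) u v
  = red (I >< R) (%(i, r). P (kappa i) r) (%(i, r). (i, Q r)) psi u v" .
qed (use fin in auto)

section \<open>Dephasing, decoupling and fidelity estimates\<close>

lemma cauchy_schwarz_real:
 fixes a b :: "'i => real"
 shows "(SUM i:I. a i * b i)^2 <= (SUM i:I. (a i)^2) * (SUM i:I. (b i)^2)"
proof -
 have "0 <= (SUM i:I. SUM j:I. (a i * b j - a j * b i)^2)" by (intro sum_nonneg) simp
 also have "... = (SUM i:I. SUM j:I. (a i)^2 * (b j)^2) + (SUM i:I. SUM j:I. (a j)^2 * (b i)^2) - 2 * (SUM i:I. SUM j:I. (a i * b i) * (a j * b j))"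
  by (simp add: power2_diff power_mult_distrib sum.distrib sum_subtractf sum_distrib_left mult_ac)
 also have "(SUM i:I. SUM j:I. (a j)^2 * (b i)^2) = (SUM i:I. SUM j:I. (a i)^2 * (b j)^2)" by (rule sum.swap)
 finally show ?thesis by (simp add: power2_eq_square sum_product)
qed

lemma cauchy_schwarz_complex:
 fixes a b :: "'i => complex"
 shows "(cmod (SUM i:I. cnj (a i) * b i))^2 <= nsq I a * nsq I b"
proof -
 have "cmod (SUM i:I. cnj (a i) * b i) <= (SUM i:I. cmod (a i) * cmod (b i))"
  by (rule order_trans[OF norm_sum]) (simp add: norm_mult)
 hence "(cmod (SUM i:I. cnj (a i) * b i))^2 <= (SUM i:I. cmod (a i) * cmod (b i))^2" by (rule power_mono) simp
 thus ?thesis using cauchy_schwarz_real[of "%i. cmod (a i)" "%i. cmod (b i)" I] by linarith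
qed

lemma Sv_const:
 assumes K: "finite K" and q: "inj_on q K"
 shows "Sv K (%_. c) q psi = eta (nsq K psi)"
 unfolding Sv_classical[OF K q] by (cases "K = {}") (auto simp: image_constant_conv)

text \<open>Strong subadditivity with a trivial conditioning system; the norm condition makes its
  entropy \<open>eta 1\<close>, which is zero.\<close>

lemma Sv_subadditive:
 assumes K: "finite K" and inj: "inj_on (%k. (x k, y k, q k)) K" and n: "nsq K psi = 1"
 shows "Sv K (%k. (x k, y k)) q psi <= Sv K x (%k. (y k, q k)) psi + Sv K y (%k. (x k, q k)) psi"
proof -
 have "Sv K (%k. ()) (%k. (x k, y k, q k)) psi = 0" unfolding Sv_const[OF K inj] n by (simp add: eta_def)
 moreover have "Sv K (%k. (x k, (y k, ()))) q psi = Sv K (%k. (x k, y k)) q psi"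
   "Sv K (%k. (y k, ())) (%k. (x k, q k)) psi = Sv K y (%k. (x k, q k)) psi"
   "Sv K (%k. (x k, ())) (%k. (y k, q k)) psi = Sv K x (%k. (y k, q k)) psi"
  by (rule Sv_view[OF K]; auto)+
 ultimately show ?thesis using ssa[OF K, of x y "%_. ()" q psi] unfolding Hc_def by simp
qed

text \<open>Subadditivity of x and y, with two of the three entropies rewritten for the
  complementary systems by purity.\<close>

lemma araki_lieb:
 assumes K: "finite K" and inj: "inj_on (%k. (x k, y k, q k)) K" and n: "nsq K psi = 1"
 shows "Sv K q (%k. (x k, y k)) psi <= Sv K x (%k. (y k, q k)) psi + Sv K (%k. (q k, x k)) y psi"
proof -
 have "Sv K y (%k. (x k, q k)) psi = Sv K y (%k. (q k, x k)) psi" by (rule Sv_view[OF K]) auto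
 thus ?thesis using Sv_subadditive[OF assms] Sv_swap[OF K] by metis
qed

text \<open>The price of dephasing two keys x and y is what each of them leaves undetermined about the other.\<close>

lemma dephasing_bound:
 assumes K: "finite K" and inj: "inj_on (%k. ((o' k, f k), (a k, e k))) K"
  and x: "!!k l. k : K ==> l : K ==> a k = a l ==> x k = x l"
  and y: "!!k l. k : K ==> l : K ==> o' k = o' l ==> y k = y l"
 shows "Sv K (%k. (a k, e k)) (%k. (o' k, f k)) psi >= Sv K (%k. (a k, e k, x k, y k)) (%k. (o' k, f k, x k, y k)) psi
  - (Sv K (%k. (x k, y k)) id psi - Sv K x id psi) - (Sv K (%k. (x k, y k)) id psi - Sv K y id psi)"
proof -
 let ?S = "%p q. Sv K p q psi"
 have inj': "(o' k, f k) = (o' l, f l) & (a k, e k) = (a l, e l) <-> k = l" if "k : K" "l : K" for k l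
  using inj that by (auto simp: inj_on_def)
 have 1: "?S (%k. (x k, (o' k, f k), y k)) (%k. (a k, e k)) = ?S (%k. (a k, e k)) (%k. (x k, o' k, f k))"
  unfolding Sv_swap[OF K, of "%k. (x k, (o' k, f k), y k)"] by (rule Sv_view[OF K]) (use y in blast)+
 have 2: "?S (%k. ((o' k, f k), y k)) (%k. (x k, a k, e k)) = ?S (%k. (a k, e k)) (%k. (o' k, f k))"
  unfolding Sv_swap[OF K, of "%k. ((o' k, f k), y k)"] by (rule Sv_view[OF K]) (use x y in blast)+
 have 3: "?S (%k. (x k, y k)) (%k. ((o' k, f k), (a k, e k))) = ?S (%k. (x k, y k)) id" and 4: "?S y (%k. (x k, (o' k, f k), (a k, e k))) = ?S y id"
  by (rule Sv_view[OF K]; use inj' in auto)+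
 \<comment> \<open>Copying \<open>x\<close> to the other side costs at most H(x|y) of the fully
   measured keys; copying \<open>y\<close> after that, in \<open>B\<close>, costs at most
   H(y|x).\<close>
 have A: "?S (%k. (a k, e k)) (%k. (x k, o' k, f k)) - ?S (%k. (a k, e k)) (%k. (o' k, f k)) <= ?S (%k. (x k, y k)) id - ?S y id"
  using ssa[OF K, of x "%k. (o' k, f k)" y "%k. (a k, e k)" psi] unfolding Hc_def 1 2 3 4 .
 have 5: "?S (%k. (y k, (a k, e k), x k)) (%k. (x k, o' k, f k)) = ?S (%k. (a k, e k, x k, y k)) (%k. (o' k, f k, x k, y k))"
  by (rule Sv_view[OF K]) (use y in blast)+
 have 6: "?S (%k. ((a k, e k), x k)) (%k. (y k, x k, o' k, f k)) = ?S (%k. (a k, e k)) (%k. (x k, o' k, f k))"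
  by (rule Sv_view[OF K]) (use x y in blast)+
 have 7: "?S (%k. (y k, x k)) (%k. ((a k, e k), x k, o' k, f k)) = ?S (%k. (x k, y k)) id" and 8: "?S x (%k. (y k, (a k, e k), x k, o' k, f k)) = ?S x id"
  by (rule Sv_view[OF K]; use inj' in auto)+
 have B: "?S (%k. (a k, e k, x k, y k)) (%k. (o' k, f k, x k, y k)) - ?S (%k. (a k, e k)) (%k. (x k, o' k, f k)) <= ?S (%k. (x k, y k)) id - ?S x id"
  using ssa[OF K, of y "%k. (a k, e k)" x "%k. (x k, o' k, f k)" psi] unfolding Hc_def 5 6 7 8 .
 show ?thesis using A B by linarith
qed

text \<open>If the state of \<open>c\<close> without its copy is nearly pure, \<open>c\<close> is
  almost uncorrelated with the rest, so dephasing it adds its full measured entropy to the entropy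
  of \<open>f\<close>. The defect is twice the entropy of the unmeasured \<open>c\<close>: once from
  strong subadditivity, once from the Araki-Lieb inequality.\<close>

lemma decoupling_bound:
 assumes K: "finite K" and inj: "inj_on (%k. (c k, (s k, g k), f k)) K" and n: "nsq K psi = 1"
 shows "Sv K (%k. (f k, c k)) (%k. (c k, s k, g k)) psi >= Sv K c id psi + Sv K f (%k. (c k, s k, g k)) psi - 2 * Sv K c (%k. ((s k, g k), f k)) psi"
proof -
 have inj': "c k = c l & (s k, g k) = (s l, g l) & f k = f l <-> k = l" if "k : K" "l : K" for k l
  using inj that by (auto simp: inj_on_def)
 have 1: "Sv K (%k. (f k, c k, c k)) (%k. (s k, g k)) psi = Sv K (%k. (f k, c k)) (%k. (s k, g k)) psi"
  by (rule Sv_view[OF K]) auto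
 have 2: "Sv K (%k. (c k, c k)) (%k. (f k, (s k, g k))) psi = Sv K c (%k. ((s k, g k), f k)) psi"
  by (rule Sv_view[OF K]) auto
 have 3: "Sv K c (%k. (f k, c k, s k, g k)) psi = Sv K c id psi"
  by (rule Sv_view[OF K]) (use inj' in auto)
 have "Sv K (%k. (f k, c k)) (%k. (s k, g k)) psi - Sv K c (%k. ((s k, g k), f k)) psi <= Sv K (%k. (f k, c k)) (%k. (c k, s k, g k)) psi - Sv K c id psi"
  using ssa[OF K, of f c c "%k. (s k, g k)" psi] unfolding Hc_def 1 2 3 .
 moreover have "Sv K f (%k. (c k, s k, g k)) psi <= Sv K c (%k. ((s k, g k), f k)) psi + Sv K (%k. (f k, c k)) (%k. (s k, g k)) psi"
  by (rule araki_lieb[OF K inj n])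
 ultimately show ?thesis by linarith
qed

lemma gibbs_inequality:
 assumes "!!s. s : S ==> (p s::real) >= 0" "!!s. s : S ==> r s > 0" "(SUM s:S. r s) <= (SUM s:S. p s)"
 shows "(SUM s:S. eta (p s)) <= (SUM s:S. p s * - log 2 (r s))"
proof -
 have "eta (p s) <= p s * - log 2 (r s) + (r s - p s) / ln 2" if s: "s : S" for s
 proof (cases "p s = 0")
  case True
  thus ?thesis using assms(2)[OF s] by (simp add: divide_nonneg_pos)
 next
  case False
  hence pp: "p s > 0" using assms(1)[OF s] by simp
  have "ln (r s / p s) <= r s / p s - 1" by (rule ln_le_minus_one) (use pp assms(2)[OF s] in simp)
  hence "p s * ln (r s / p s) <= p s * (r s / p s - 1)" using pp by (intro mult_left_mono) auto
  also have "... = r s - p s" using pp by (simp add: field_simps)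
  finally have "p s * (ln (r s) - ln (p s)) <= r s - p s" using pp assms(2)[OF s] by (simp add: ln_div)
  hence "p s * (ln (r s) - ln (p s)) / ln 2 <= (r s - p s) / ln 2" by (rule divide_right_mono) simp
  thus ?thesis using pp by (simp add: eta_def log_def diff_divide_distrib algebra_simps)
 qed
 hence "(SUM s:S. eta (p s)) <= (SUM s:S. p s * - log 2 (r s) + (r s - p s) / ln 2)" by (rule sum_mono)
 also have "... = (SUM s:S. p s * - log 2 (r s)) + ((SUM s:S. r s) - (SUM s:S. p s)) / ln 2"
  by (simp add: sum.distrib sum_subtractf sum_negf flip: sum_divide_distrib)
 also have "... <= (SUM s:S. p s * - log 2 (r s))" using assms(3) by (simp add: divide_nonpos_pos)
 finally show ?thesis .
qed

text \<open>Klein's inequality against the reference state that gives weight one half to \<open>Phi\<close> and spreads the rest uniformly.\<close>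

lemma ent_fidelity:
 fixes N eps :: real
 assumes X: "finite X" "X ~= {}" and Y: "finite Y" and Phi: "nsq X Phi <= 1"
  and n: "(SUM x:X. SUM y:Y. (cmod (M x y))^2) = 1"
  and F: "1 - eps <= nsq Y (%y. SUM x:X. cnj (Phi x) * M x y)"
  and N: "real (card X) <= N"
 shows "ent X (gram Y M) <= 1 + eps * log 2 N"
proof -
 have N1: "1 <= N" using X N by (metis One_nat_def Suc_leI card_gt_0_iff of_nat_1 of_nat_le_iff order_trans)
 obtain p u where s: "specd X (gram Y M) p u" using specd_gram_exists[OF X(1)] by blast
 have p: "0 <= p i" if "i : X" for i by (rule specd_gram_nonneg[OF s that Y])
 have p1: "(SUM i:X. p i) = 1" unfolding specd_trace[OF s] gram_trace_nonneg by (rule n)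
 define c where "c = (%i. (cmod (ip X (u i) Phi))^2)"
 have csum: "(SUM i:X. c i) = nsq X Phi" unfolding c_def by (rule parseval_norm[OF specdD(2)[OF s] X(1)])
 have c: "0 <= c i" "c i <= 1" if "i : X" for i
 proof -
  show "0 <= c i" by (simp add: c_def)
  have "c i <= (SUM i:X. c i)" by (rule member_le_sum) (use that X in "auto simp: c_def")
  thus "c i <= 1" using csum Phi by simp
 qed
 have Fc: "nsq Y (%y. SUM x:X. cnj (Phi x) * M x y) = (SUM i:X. c i * p i)"
 proof -
  have "complex_of_real (nsq Y (%y. SUM x:X. cnj (Phi x) * M x y)) = (SUM y:Y. SUM x:X. SUM x':X. cnj (Phi x) * (M x y * cnj (M x' y)) * Phi x')"
   unfolding of_real_sum cmod_sq(1)[symmetric] cnj_sum sum_product by (simp add: mult_ac)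
  also have "... = (SUM x:X. SUM x':X. SUM y:Y. cnj (Phi x) * (M x y * cnj (M x' y)) * Phi x')"
   by (intro sum.cong refl sum_perm)
  also have "... = (SUM x:X. SUM x':X. cnj (Phi x) * gram Y M x x' * Phi x')"
   by (simp only: gram_def sum_distribs)
  finally have "nsq Y (%y. SUM x:X. cnj (Phi x) * M x y) = Re (SUM x:X. SUM x':X. cnj (Phi x) * gram Y M x x' * Phi x')"
   by (metis Re_complex_of_real)
  also have "... = (SUM i:X. (cmod (ip X Phi (u i)))^2 * p i)"
   using overlap_weight[OF s, of "%_. Phi"] by (simp add: overlap_def)
  also have "... = (SUM i:X. c i * p i)"
   unfolding c_def by (metis complex_mod_cnj ip_cnj)
  finally show ?thesis .
 qed
 \<comment> \<open>In the eigenbasis the reference state has the diagonal c_i / 2 + 1 / (2 N). It is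
   written as a mixture of \<open>x\<close> and \<open>y\<close> so that concavity of the logarithm
   applies.\<close>
 define y where "y = 1 / (2 * N)"
 define x where "x = 1 / 2 + y"
 have y: "0 < y" "y <= 1/2" and x: "1/2 <= x" using N1 by (auto simp: y_def x_def field_simps)
 define r where "r = (%i. c i * x + (1 - c i) * y)"
 have rpos: "0 < r i" if "i : X" for i
 proof -
  have "y <= r i" using c[OF that] y x unfolding r_def x_def by (simp add: algebra_simps)
  thus ?thesis using y by simp
 qed
 have rs: "(SUM i:X. r i) <= 1"
 proof -
  have "(SUM i:X. r i) = (SUM i:X. c i) * (x - y) + real (card X) * y"
   by (simp add: r_def algebra_simps sum.distrib sum_distrib_left sum_subtractf)
  also have "... <= 1 * (x - y) + N * y" using csum Phi y N by (intro add_mono mult_right_mono) (auto simp: x_def)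
  also have "... = 1" using N1 by (simp add: x_def y_def)
  finally show ?thesis .
 qed
 have lr: "- log 2 (r i) <= 1 + (1 - c i) * log 2 N" if i: "i : X" for i
 proof -
  have conc: "c i * ln x + (1 - c i) * ln y <= ln (r i)"
  proof -
   have a: "ln (x / r i) <= x / r i - 1" "ln (y / r i) <= y / r i - 1"
    using rpos[OF i] y x by (auto intro!: ln_le_minus_one)
   have "c i * ln (x / r i) + (1 - c i) * ln (y / r i) <= c i * (x / r i - 1) + (1 - c i) * (y / r i - 1)"
    using a c[OF i] by (intro add_mono mult_left_mono) auto
   also have "... = (c i * x + (1 - c i) * y) / r i - 1" by (simp add: add_divide_distrib diff_divide_distrib algebra_simps)
   also have "... = r i / r i - 1" by (simp add: r_def)
   also have "... = 0" using rpos[OF i] by simp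
   finally show ?thesis using rpos[OF i] y x by (simp add: ln_div algebra_simps)
  qed
  have "c i * log 2 x + (1 - c i) * log 2 y <= log 2 (r i)"
   using divide_right_mono[OF conc, of "ln 2"] by (simp add: log_def add_divide_distrib)
  moreover have "- 1 <= log 2 x"
  proof -
   have "log 2 (1/2) <= log 2 x" using x by (subst log_le_cancel_iff) auto
   thus ?thesis by (simp add: log_divide)
  qed
  moreover have "log 2 y = - 1 - log 2 N" using N1 by (simp add: y_def log_divide log_mult)
  moreover have "c i * (- 1) <= c i * log 2 x" using c[OF i] \<open>- 1 \<le> log 2 x\<close> by (intro mult_left_mono) auto
  ultimately show ?thesis by (simp add: algebra_simps)
 qed
 have "ent X (gram Y M) = (SUM i:X. eta (p i))" by (rule ent_gram_eq[OF s Y])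
 also have "... <= (SUM i:X. p i * - log 2 (r i))" by (rule gibbs_inequality) (use p rpos rs p1 in auto)
 also have "... <= (SUM i:X. p i * (1 + (1 - c i) * log 2 N))" using lr p by (intro sum_mono mult_left_mono) auto
 also have "... = (SUM i:X. p i) + ((SUM i:X. p i) - (SUM i:X. c i * p i)) * log 2 N"
  by (simp add: algebra_simps sum.distrib sum_subtractf sum_distribs)
 also have "... <= 1 + eps * log 2 N" using F N1 unfolding Fc p1 by (intro add_mono mult_right_mono) auto
 finally show ?thesis .
qed

text \<open>An event at least 16 times likelier than in the ideal state must be rare. With q its
  probability, Cauchy-Schwarz bounds the squared overlap from the event by q^2/16 and that from the
  complement by 1 - q. Combined they stay below 1 - q/2, while the fidelity is at least 1 -
  eps.\<close>

lemma fidelity_event: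
 fixes M :: "'x => 'y => complex" and eps :: real
 assumes X: "finite X" and Phi: "nsq X Phi <= 1"
  and n: "(SUM x:X. SUM y:Y. (cmod (M x y))^2) = 1"
  and F: "1 - eps <= nsq Y (%y. SUM x:X. cnj (Phi x) * M x y)" and eps: "0 <= eps"
  and T: "T \<subseteq> X" and w: "16 * nsq T Phi <= (SUM x:T. SUM y:Y. (cmod (M x y))^2)"
 shows "(SUM x:T. SUM y:Y. (cmod (M x y))^2) <= 4 * eps"
proof (cases "(SUM x:T. SUM y:Y. (cmod (M x y))^2) = 0")
 case True
 thus ?thesis using eps by simp
next
 case False
 define q where "q = (SUM x:T. SUM y:Y. (cmod (M x y))^2)"
 have q0: "0 < q" using False unfolding q_def by (metis (no_types, lifting) less_eq_real_def sum_nonneg zero_le_power2)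
 have fT: "finite T" using T X finite_subset by blast
 have spl: "(SUM x:X. f x) = (SUM x:T. f x) + (SUM x:X - T. f x)" for f :: "'x => 'z::comm_monoid_add"
  using sum.subset_diff[OF T X, of f] by (simp add: add.commute)
 have q1: "(SUM x:X - T. SUM y:Y. (cmod (M x y))^2) = 1 - q" using n spl[of "%x. SUM y:Y. (cmod (M x y))^2"] by (simp add: q_def)
 have phic: "nsq (X - T) Phi <= 1"
  using Phi spl[of "%x. (cmod (Phi x))^2"] sum_nonneg[of T "%x. (cmod (Phi x))^2"] by simp
 \<comment> \<open>This is |a+b|^2 <= (1+s) |a|^2 + (1+1/s) |b|^2 with s = 4/q: the overlap from the
   event is small enough to carry the large factor.\<close>
 have sq: "(cmod (a + b))^2 <= (1 + 4/q) * (cmod a)^2 + (1 + q/4) * (cmod b)^2" for a b :: complex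
 proof -
  have "(cmod (a + b))^2 <= (cmod a + cmod b)^2" by (intro power_mono norm_triangle_ineq) simp
  moreover have "0 <= (4/q) * (cmod a - (q/4) * cmod b)^2" using q0 by simp
  moreover have "(4/q) * (cmod a - (q/4) * cmod b)^2 = (4/q) * (cmod a)^2 + (q/4) * (cmod b)^2 - 2 * cmod a * cmod b"
   using q0 by (simp add: power2_eq_square field_simps)
  ultimately show ?thesis by (simp add: power2_sum algebra_simps)
 qed
 have "1 - eps <= nsq Y (%y. SUM x:X. cnj (Phi x) * M x y)" by (rule F)
 also have "... <= (SUM y:Y. (1 + 4/q) * (cmod (SUM x:T. cnj (Phi x) * M x y))^2 + (1 + q/4) * (cmod (SUM x:X-T. cnj (Phi x) * M x y))^2)"
  unfolding spl[of "%x. cnj (Phi x) * M x _"] by (intro sum_mono sq)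
 also have "... <= (SUM y:Y. (1 + 4/q) * ((q / 16) * nsq T (%x. M x y)) + (1 + q/4) * (1 * nsq (X-T) (%x. M x y)))"
 proof (intro sum_mono add_mono mult_left_mono)
  fix y
  show "(cmod (SUM x:T. cnj (Phi x) * M x y))^2 <= (q / 16) * nsq T (%x. M x y)"
   by (rule order_trans[OF cauchy_schwarz_complex], rule mult_right_mono) (use w in "auto simp: q_def sum_nonneg")
  show "(cmod (SUM x:X-T. cnj (Phi x) * M x y))^2 <= 1 * nsq (X-T) (%x. M x y)"
   by (rule order_trans[OF cauchy_schwarz_complex], rule mult_right_mono) (use phic in "auto simp: sum_nonneg")
 qed (use q0 in auto)
 also have "... = (1 + 4/q) * ((q / 16) * q) + (1 + q/4) * (1 - q)"
 proof -
  have "(SUM y:Y. a * (b * f y) + c * (1 * g y)) = a * (b * (SUM y:Y. f y)) + c * (SUM y:Y. g y)" for a b c :: real and f g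
   by (simp add: sum.distrib sum_distrib_left)
  moreover have "(SUM y:Y. SUM x:T. (cmod (M x y))^2) = q" unfolding q_def by (rule sum.swap)
  moreover have "(SUM y:Y. SUM x:X - T. (cmod (M x y))^2) = 1 - q" unfolding q1[symmetric] by (rule sum.swap)
  ultimately show ?thesis by (simp only:)
 qed
 also have "... = q * q / 16 + q / 4 + 1 - 3 * q / 4 - q * q / 4" using q0 by (simp add: field_simps)
 also have "... <= 1 - q / 2" using q0 by (simp add: field_simps)
 finally show ?thesis unfolding q_def using eps by simp
qed

section \<open>States close to private states\<close>

definition wt :: "'k set => ('k => 'x) => ('k => complex) => 'x => real" where
 "wt K v psi x = (SUM k:{k:K. v k = x}. (cmod (psi k))^2)"

lemma wt_nonneg: "0 <= wt K v psi x"
 by (simp add: wt_def sum_nonneg)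

lemma Sv_id: "finite K ==> Sv K p id psi = (SUM x:p ` K. eta (wt K p psi x))"
 using Sv_classical[of K id p psi] by (simp add: wt_def)

lemma wt_sum:
 assumes "finite K"
 shows "(SUM x:v ` K. wt K v psi x * h x) = (SUM k:K. (cmod (psi k))^2 * h (v k))"
proof -
 have "(SUM x:v ` K. wt K v psi x * h x) = (SUM x:v ` K. SUM k:{k:K. v k = x}. (cmod (psi k))^2 * h (v k))"
  unfolding wt_def sum_distrib_right by (intro sum.cong refl) auto
 also have "... = (SUM k:K. (cmod (psi k))^2 * h (v k))" by (rule sum.image_gen[symmetric, OF assms])
 finally show ?thesis .
qed

lemma wt_sum1: "finite K ==> (SUM x:v ` K. wt K v psi x) = nsq K psi"
 using wt_sum[of K v psi "%_. 1"] by simp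

text \<open>Restricting to nonzero amplitudes makes every remaining weight positive, so that
  logarithms of weights can be split in the proof of Fano's inequality.\<close>

lemma Sv_id_support:
 assumes K: "finite K"
 shows "Sv K p id psi = Sv {k:K. psi k ~= 0} p id psi"
proof -
 have w: "wt K p psi x = wt {k:K. psi k ~= 0} p psi x" for x
  unfolding wt_def by (rule sum.mono_neutral_right) (use K in auto)
 have "Sv K p id psi = (SUM x:p ` K. eta (wt {k:K. psi k ~= 0} p psi x))" using K by (simp add: Sv_id w)
 also have "... = (SUM x:p ` {k:K. psi k ~= 0}. eta (wt {k:K. psi k ~= 0} p psi x))"
 proof (rule sum.mono_neutral_right)
  show "ALL x:p ` K - p ` {k : K. psi k ~= 0}. eta (wt {k : K. psi k ~= 0} p psi x) = 0"
  proof
   fix x assume "x : p ` K - p ` {k : K. psi k ~= 0}"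
   hence "{k : {k : K. psi k ~= 0}. p k = x} = {}" by (auto simp: image_iff)
   thus "eta (wt {k : K. psi k ~= 0} p psi x) = 0" unfolding wt_def by (simp only: sum.empty eta_0)
  qed
 qed (use K in auto)
 finally show ?thesis using K by (simp add: Sv_id)
qed

text \<open>Gibbs' inequality against the guess that, given \<open>y\<close>, puts weight one half
  on \<open>g y\<close> and spreads the other half over N values: a correct guess costs at most one
  bit, a wrong one 1 + log N.\<close>

lemma fano_inequality:
 fixes N \<delta> :: real
 assumes K: "finite K" and n: "nsq K psi = 1"
  and err: "(SUM k:{k:K. x k ~= g (y k)}. (cmod (psi k))^2) <= \<delta>" and N: "real (card (x ` K)) <= N"
 shows "Sv K (%k. (x k, y k)) id psi - Sv K y id psi <= 1 + \<delta> * log 2 N"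
proof -
 define L where "L = {k:K. psi k ~= 0}"
 have fL: "finite L" using K by (simp add: L_def)
 have Lpos: "(cmod (psi k))^2 > 0" if "k : L" for k using that by (simp add: L_def)
 have nL: "nsq L psi = 1"
  unfolding n[symmetric] L_def by (rule sum.mono_neutral_left) (use K in auto)
 have "L ~= {}" using nL by auto
 have "card (x ` L) <= card (x ` K)" by (rule card_mono) (use K in "auto simp: L_def")
 moreover have "0 < card (x ` L)" using \<open>L \<noteq> {}\<close> fL by (simp add: card_gt_0_iff)
 ultimately have NL: "real (card (x ` L)) <= N" and N1: "1 <= N" using N by linarith+
 let ?xy = "%k. (x k, y k)"
 define py where "py = wt L y psi"
 define q where "q = (%s. (if fst s = g (snd s) then 1/2 else 0) + 1 / (2 * N))"
 have pyp: "0 < py b" if b: "b : y ` L" for b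
 proof -
  obtain k where "k : L" "b = y k" using b by blast
  thus ?thesis unfolding py_def wt_def using fL Lpos by (intro sum_pos2[of _ k]) auto
 qed
 have qp: "0 < q s" for s using N1 by (auto simp: q_def intro!: add_pos_pos)
 have "(SUM s:?xy ` L. eta (wt L ?xy psi s)) <= (SUM s:?xy ` L. wt L ?xy psi s * - log 2 (py (snd s) * q s))"
 proof (rule gibbs_inequality)
  show "0 < py (snd s) * q s" if "s : ?xy ` L" for s
   by (rule mult_pos_pos[OF pyp qp]) (use that in auto)
  have "(SUM s:?xy ` L. py (snd s) * q s) <= (SUM s:x ` L >< y ` L. py (snd s) * q s)"
  proof (rule sum_mono2)
   show "0 <= py (snd s) * q s" for s
    unfolding py_def by (rule mult_nonneg_nonneg[OF wt_nonneg less_imp_le[OF qp]])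
  qed (use fL in auto)
  also have "... = (SUM b:y ` L. py b * (SUM a:x ` L. q (a, b)))"
   unfolding sum_Times by (subst sum.swap) (simp add: sum_distrib_left)
  also have "... <= (SUM b:y ` L. py b * 1)"
  proof (intro sum_mono mult_left_mono)
   fix b assume "b : y ` L"
   have "(SUM a:x ` L. q (a, b)) = (if g b : x ` L then 1/2 else 0) + real (card (x ` L)) * (1 / (2 * N))"
    using fL by (simp add: q_def sum.distrib)
   also have "... <= 1/2 + N * (1 / (2 * N))" using NL N1 by (intro add_mono mult_right_mono) auto
   also have "... = 1" using N1 by simp
   finally show "(SUM a:x ` L. q (a, b)) <= 1" .
   show "0 <= py b" by (simp add: py_def wt_nonneg)
  qed
  also have "... = (SUM s:?xy ` L. wt L ?xy psi s)" unfolding py_def by (simp add: wt_sum1[OF fL])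
  finally show "(SUM s:?xy ` L. py (snd s) * q s) <= (SUM s:?xy ` L. wt L ?xy psi s)" .
 qed (rule wt_nonneg)
 also have "... = (SUM k:L. (cmod (psi k))^2 * - log 2 (py (y k) * q (x k, y k)))"
  by (subst wt_sum[OF fL]) simp
 also have "... = (SUM k:L. (cmod (psi k))^2 * - log 2 (py (y k))) + (SUM k:L. (cmod (psi k))^2 * - log 2 (q (x k, y k)))"
  unfolding sum.distrib[symmetric]
 proof (intro sum.cong refl)
  fix k assume "k : L"
  hence "py (y k) > 0" using pyp by blast
  thus "(cmod (psi k))^2 * - log 2 (py (y k) * q (x k, y k)) = (cmod (psi k))^2 * - log 2 (py (y k)) + (cmod (psi k))^2 * - log 2 (q (x k, y k))"
   using less_imp_neq[OF qp[of "(x k, y k)"]] by (simp add: log_mult algebra_simps)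
 qed
 also have "(SUM k:L. (cmod (psi k))^2 * - log 2 (py (y k))) = (SUM b:y ` L. eta (wt L y psi b))"
  unfolding wt_sum[OF fL, of y psi "%b. - log 2 (py b)", symmetric]
 proof (intro sum.cong refl)
  fix b assume "b : y ` L"
  from pyp[OF this] show "wt L y psi b * - log 2 (py b) = eta (wt L y psi b)" by (simp add: eta_def py_def)
 qed
 also have "(SUM k:L. (cmod (psi k))^2 * - log 2 (q (x k, y k))) <= (SUM k:L. (cmod (psi k))^2 * (1 + (if x k ~= g (y k) then log 2 N else 0)))"
 proof (intro sum_mono mult_left_mono)
  fix k
  show "- log 2 (q (x k, y k)) <= 1 + (if x k ~= g (y k) then log 2 N else 0)"
  proof (cases "x k = g (y k)")
   case True
   have "log 2 (1/2) <= log 2 (q (x k, y k))" using True N1 qp[of "(x k, y k)"] by (subst log_le_cancel_iff) (auto simp: q_def)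
   thus ?thesis using True by (simp add: log_divide)
  next
   case False
   thus ?thesis using N1 by (simp add: q_def log_divide log_mult)
  qed
 qed simp
 also have "... = 1 + (SUM k:{k:L. x k ~= g (y k)}. (cmod (psi k))^2) * log 2 N"
  using fL nL by (simp add: distrib_left sum.distrib sum.inter_filter sum_distrib_right if_distrib[of "%t. t * _"] if_distrib[of "%t. _ * t"] cong: if_cong)
 also have "... <= 1 + \<delta> * log 2 N"
 proof -
  have "(SUM k:{k:L. x k ~= g (y k)}. (cmod (psi k))^2) <= (SUM k:{k:K. x k ~= g (y k)}. (cmod (psi k))^2)"
   by (rule sum_mono2) (use K in "auto simp: L_def")
  thus ?thesis using err N1 by (intro add_left_mono mult_right_mono) auto
 qed
 finally show ?thesis
  unfolding Sv_id_support[OF K, of _ psi] L_def[symmetric] using fL by (simp add: Sv_id)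
qed

text \<open>Values of weight at most 16/D contribute at least log D - 4 bits per unit of mass, where
  4 = log 16, and they carry mass at least 1 - eps. The factor 16 is that of
  \<open>fidelity_event\<close>.\<close>

lemma near_uniform_entropy:
 fixes D eps :: real
 assumes K: "finite K" and n: "nsq K psi = 1" and D: "1 <= D"
  and T: "(SUM a:{a:x ` K. wt K x psi a > 16 / D}. wt K x psi a) <= eps"
 shows "(1 - eps) * log 2 D - 4 <= Sv K x id psi"
proof -
 let ?w = "wt K x psi" and ?A = "x ` K"
 let ?T = "{a:?A. ?w a > 16 / D}"
 have fA: "finite ?A" using K by simp
 have s1: "(SUM a:?A. ?w a) = 1" using wt_sum1[OF K, of x psi] n by simp
 have le1: "?w a <= 1" if "a : ?A" for a
  using member_le_sum[of a ?A ?w] that fA s1 wt_nonneg[of K x psi] by simp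
 have spl: "(SUM a:?A. f a) = (SUM a:?T. f a) + (SUM a:?A - ?T. f a)" for f :: "_ => real"
  using sum.subset_diff[of ?T ?A f] fA by (simp add: add.commute)
 have "(1 - eps) * log 2 D - 4 <= (SUM a:?A - ?T. ?w a) * log 2 D - 4 * (SUM a:?A - ?T. ?w a)"
 proof -
  have "(SUM a:?A - ?T. ?w a) >= 1 - eps" using spl[of ?w] s1 T by linarith
  moreover have "(SUM a:?A - ?T. ?w a) <= 1" using spl[of ?w] s1 sum_nonneg[of ?T ?w] wt_nonneg[of K x psi] by simp
  moreover have "0 <= log 2 D" using D by simp
  ultimately show ?thesis by (intro diff_mono mult_right_mono) auto
 qed
 also have "... = (SUM a:?A - ?T. ?w a * (log 2 D - 4))" by (simp add: sum_distrib_right sum_distrib_left right_diff_distrib sum_subtractf mult.commute)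
 also have "... <= (SUM a:?A - ?T. eta (?w a))"
 proof (rule sum_mono)
  fix a assume a: "a : ?A - ?T"
  show "?w a * (log 2 D - 4) <= eta (?w a)"
  proof (cases "?w a = 0")
   case False
   hence p: "0 < ?w a" using wt_nonneg[of K x psi a] by simp
   have "log 2 (?w a) <= log 2 (16 / D)" using a p D by (subst log_le_cancel_iff) auto
   also have "... = 4 - log 2 D"
   proof -
    have "log 2 (16::real) = log 2 (2 ^ 4)" by simp
    also have "... = 4" by (subst log_nat_power) auto
    finally show ?thesis using D by (simp add: log_divide)
   qed
   finally have "log 2 D - 4 <= - log 2 (?w a)" by simp
   hence "?w a * (log 2 D - 4) <= ?w a * - log 2 (?w a)" using p by (intro mult_left_mono) auto
   thus ?thesis using p by (simp add: eta_def)
  qed simp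
 qed
 also have "... <= (SUM a:?A. eta (?w a))"
 proof -
  have "0 <= eta (?w a)" if "a : ?A" for a using le1[OF that] by (auto simp: eta_def mult_nonneg_nonpos2 zero_less_mult_iff mult_le_0_iff)
  hence "0 <= (SUM a:?T. eta (?w a))" by (intro sum_nonneg) auto
  thus ?thesis using spl[of "%a. eta (?w a)"] by simp
 qed
 finally show ?thesis using K by (simp add: Sv_id)
qed

lemma isometry_norm:
 fixes V :: "'j => 'i => complex"
 assumes I: "finite I"
  and V: "!!i i'. i : I ==> i' : I ==> (SUM j:J. V j i * cnj (V j i')) = dl i i'"
 shows "nsq J (%j. SUM i:I. V j i * phi i) = nsq I phi"
proof -
 have "complex_of_real (nsq J (%j. SUM i:I. V j i * phi i)) = (SUM j:J. SUM i:I. SUM i':I. V j i * cnj (V j i') * (phi i * cnj (phi i')))"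
  unfolding of_real_sum cmod_sq(1)[symmetric] cnj_sum sum_product by (simp add: mult_ac)
 also have "... = (SUM i:I. SUM i':I. SUM j:J. V j i * cnj (V j i') * (phi i * cnj (phi i')))"
  by (intro sum.cong refl sum_perm)
 also have "... = (SUM i:I. SUM i':I. (dl i i') * (phi i * cnj (phi i')))"
  by (intro sum.cong refl) (simp add: V flip: sum_distrib_right)
 also have "... = (SUM i:I. phi i * cnj (phi i))" by (intro sum.cong refl) (simp only: sum_delta_left[OF I])
 also have "... = complex_of_real (nsq I phi)" by (simp only: cmod_sq of_real_sum)
 finally show ?thesis by (simp only: of_real_eq_iff)
qed

text \<open>A pure state \<open>psi\<close> on \<open>I\<close> and \<open>R\<close> close to a private state: \<open>kappa\<close> reads off the key, \<open>T\<close> undoes the twisting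
 of the shield in each key block, and \<open>Phi\<close> is the ideal key vector.\<close>

locale approx_private =
 fixes I :: "'i set" and R :: "'r set" and psi :: "'i * 'r => complex" and kappa :: "'i => 'c"
  and S :: "'s set" and T :: "'s => 'i => complex" and Phi :: "'c => complex" and eps N :: real
 assumes fin: "finite I" "finite R" "finite S"
  and norm1: "nsq (I >< R) psi = 1"
  and untwist: "!!i i'. i : I ==> i' : I ==> kappa i = kappa i' ==> (SUM s:S. T s i * cnj (T s i')) = dl i i'"
  and ideal: "nsq (kappa ` I) Phi <= 1"
  and fidelity: "1 - eps <= (SUM s:S. SUM r:R. (cmod (SUM i:I. cnj (Phi (kappa i)) * T s i * psi (i, r)))^2)"
  and eps: "0 <= eps" and N: "real (card (kappa ` I)) <= N"
begin

abbreviation "K \<equiv> I >< R"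
definition "J = kappa ` I >< S"
text \<open>Untwisting controlled by the key: an index of \<open>I\<close> is replaced by its key
  together with a shield index.\<close>

definition "V j i = (if kappa i = fst j then T (snd j) i else 0)"
definition "psiu = (%(j, r). SUM i:I. V j i * psi (i, r))"

lemma finK: "finite K" and finJ: "finite J" and finJR: "finite (J >< R)"
 using fin by (auto simp: J_def)

lemma V_isometry: "(SUM j:J. V j i * cnj (V j i')) = dl i i'" if i: "i : I" "i' : I"
proof -
 have "(SUM j:J. V j i * cnj (V j i')) = (SUM c:kappa ` I. SUM s:S. if c = kappa i then if kappa i = kappa i' then T s i * cnj (T s i') else 0 else 0)"
  unfolding J_def sum_Times V_def by (intro sum.cong refl) auto
 also have "... = (SUM c:kappa ` I. if c = kappa i then if kappa i = kappa i' then SUM s:S. T s i * cnj (T s i') else 0 else 0)"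
  by (intro sum.cong refl) auto
 also have "... = (if kappa i = kappa i' then SUM s:S. T s i * cnj (T s i') else 0)" using fin i by simp
 also have "... = dl i i'" using untwist[OF i] by auto
 finally show ?thesis .
qed

text \<open>The kept systems see \<open>I\<close> only through the key, so untwisting can be
  inserted without changing the entropy.\<close>

lemma Sv_untwist:
 "Sv K (%k. P (kappa (fst k)) (snd k)) (%k. (fst k, Q (snd k))) psi = Sv (J >< R) (%k. P (fst (fst k)) (snd k)) (%k. (fst k, Q (snd k))) psiu"
proof -
 have "Sv (J >< R) (%(j, r). P (fst j) r) (%(j, r). (j, Q r)) (%(j, r). SUM i:I. V j i * psi (i, r))
   = Sv K (%(i, r). P (kappa i) r) (%(i, r). (i, Q r)) psi"
  by (rule Sv_isometry[OF fin(1) finJ fin(2) V_isometry, where kappa=kappa and kappa'=fst]) (auto simp: V_def split: if_splits)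
 thus ?thesis unfolding psiu_def by (simp add: case_prod_unfold)
qed

lemma norm_u: "nsq (J >< R) psiu = 1"
proof -
 have "nsq (J >< R) psiu = (SUM r:R. SUM j:J. (cmod (SUM i:I. V j i * psi (i, r)))^2)"
  unfolding sum_Times by (subst sum.swap) (simp add: psiu_def)
 also have "... = (SUM r:R. SUM i:I. (cmod (psi (i, r)))^2)" by (intro sum.cong refl isometry_norm[OF fin(1) V_isometry])
 also have "... = 1" unfolding norm1[symmetric] sum_Times by (rule sum.swap)
 finally show ?thesis .
qed

definition "M c y = psiu ((c, fst y), snd y)"

lemma norm_M: "(SUM c:kappa ` I. SUM y:S >< R. (cmod (M c y))^2) = 1"
 unfolding norm_u[symmetric] J_def sum_Times M_def by simp

lemma fidelity_M: "1 - eps <= nsq (S >< R) (%y. SUM c:kappa ` I. cnj (Phi c) * M c y)"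
proof -
 have "(SUM c:kappa ` I. cnj (Phi c) * M c (s, r)) = (SUM i:I. cnj (Phi (kappa i)) * T s i * psi (i, r))" for s r
 proof -
  have "(SUM c:kappa ` I. cnj (Phi c) * M c (s, r)) = (SUM c:kappa ` I. SUM i:I. if c = kappa i then cnj (Phi (kappa i)) * T s i * psi (i, r) else 0)"
   unfolding M_def psiu_def V_def by (intro sum.cong refl) (auto simp: sum_distrib_left intro!: sum.cong)
  also have "... = (SUM i:I. SUM c:kappa ` I. if c = kappa i then cnj (Phi (kappa i)) * T s i * psi (i, r) else 0)" by (rule sum.swap)
  also have "... = (SUM i:I. cnj (Phi (kappa i)) * T s i * psi (i, r))" using fin by (intro sum.cong refl) simp
  finally show ?thesis .
 qed
 thus ?thesis unfolding sum_Times using fidelity by simp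
qed

text \<open>After untwisting, the key register alone has fidelity at least 1 - eps with the pure
  vector \<open>Phi\<close>; the shield and both environments are traced out.\<close>

lemma key_entropy:
 assumes inj: "inj_on (%r. (g r, f r)) R"
 shows "Sv (J >< R) (%k. fst (fst k)) (%k. ((snd (fst k), g (snd k)), f (snd k))) psiu <= 1 + eps * log 2 N"
proof -
 have "I ~= {}" using norm1 by auto
 have "Sv (J >< R) (%k. fst (fst k)) (%k. ((snd (fst k), g (snd k)), f (snd k))) psiu
  = Sv (J >< R) (%k. fst (fst k)) (%k. (snd (fst k), snd k)) psiu"
  by (rule Sv_view[OF finJR]) (use inj in "auto simp: inj_on_def")
 also have "... = ent (kappa ` I) (gram (S >< R) (pf (J >< R) (%k. fst (fst k)) (%k. (snd (fst k), snd k)) psiu))"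
  by (rule Sv_carrier[OF finJR]) (use fin in "auto simp: J_def")
 also have "... = ent (kappa ` I) (gram (S >< R) M)"
 proof (rule ent_cong)
  have "pf (J >< R) (%k. fst (fst k)) (%k. (snd (fst k), snd k)) psiu c y = M c y" if "c : kappa ` I" "y : S >< R" for c y
  proof -
   have "{k : J >< R. fst (fst k) = c & (snd (fst k), snd k) = y} = {((c, fst y), snd y)}"
    using that by (auto simp: J_def)
   thus ?thesis by (simp add: pf_def M_def)
  qed
  thus "gram (S >< R) (pf (J >< R) (%k. fst (fst k)) (%k. (snd (fst k), snd k)) psiu) c c' = gram (S >< R) M c c'"
   if "c : kappa ` I" "c' : kappa ` I" for c c' using that by (simp add: gram_def)
 qed
 also have "... <= 1 + eps * log 2 N"
  by (rule ent_fidelity[OF _ _ _ ideal norm_M fidelity_M N]) (use fin \<open>I \<noteq> {}\<close> in auto)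
 finally show ?thesis .
qed

text \<open>This is where privacy enters. The untwisted key is nearly pure, hence decoupled from the
  environment \<open>f\<close>, and its dephased copy contributes all of H(key). The views involved
  touch \<open>I\<close> only as a traced system or through its key, so the estimate returns to the
  twisted state.\<close>

lemma decoupled:
 assumes inj: "inj_on (%r. (g r, f r)) R"
 shows "Sv K (%k. (f (snd k), kappa (fst k))) (%k. (fst k, g (snd k))) psi
  >= Sv K (%k. kappa (fst k)) id psi + Sv K (%k. f (snd k)) (%k. (fst k, g (snd k))) psi - 2 * (1 + eps * log 2 N)"
proof -
 have inj': "(g r, f r) = (g r', f r') <-> r = r'" if "r : R" "r' : R" for r r' using inj that by (auto simp: inj_on_def)
 have 1: "Sv K (%k. (f (snd k), kappa (fst k))) (%k. (fst k, g (snd k))) psi = Sv (J >< R) (%k. (f (snd k), fst (fst k))) (%k. (fst (fst k), snd (fst k), g (snd k))) psiu"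
  unfolding Sv_untwist[of "%c r. (f r, c)" g] by (rule Sv_view[OF finJR]) auto
 have 2: "Sv K (%k. f (snd k)) (%k. (fst k, g (snd k))) psi = Sv (J >< R) (%k. f (snd k)) (%k. (fst (fst k), snd (fst k), g (snd k))) psiu"
  unfolding Sv_untwist[of "%c r. f r" g] by (rule Sv_view[OF finJR]) auto
 have "Sv K (%k. kappa (fst k)) id psi = Sv K (%k. kappa (fst k)) (%k. (fst k, snd k)) psi" by (simp add: id_def)
 also have "... = Sv (J >< R) (%k. fst (fst k)) (%k. (fst k, snd k)) psiu" by (rule Sv_untwist[of "%c r. c" "%r. r"])
 finally have 3: "Sv K (%k. kappa (fst k)) id psi = Sv (J >< R) (%k. fst (fst k)) id psiu" by (simp add: id_def)
 have "inj_on (%k. (fst (fst k), (snd (fst k), g (snd k)), f (snd k))) (J >< R)"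
  by (rule inj_onI) (use inj in "auto simp: inj_on_def")
 from decoupling_bound[OF finJR this norm_u] show ?thesis unfolding 1 2 3
  by (rule order_trans[rotated]) (intro diff_mono order_refl mult_left_mono key_entropy[OF inj], simp)
qed

text \<open>Untwisting acts isometrically inside each key block, so key probabilities may be
  computed before or after it.\<close>

lemma key_weight:
 assumes "C \<subseteq> kappa ` I"
 shows "(SUM c:C. SUM y:S >< R. (cmod (M c y))^2) = (SUM k:{k:K. kappa (fst k) : C}. (cmod (psi k))^2)"
proof -
 have b: "nsq S (%s. M c (s, r)) = (SUM i:{i:I. kappa i = c}. (cmod (psi (i, r)))^2)" for c r
 proof -
  have "M c (s, r) = (SUM i:{i:I. kappa i = c}. T s i * psi (i, r))" for s
   using fin by (simp add: M_def psiu_def V_def sum.inter_filter if_distrib[of "%t. t * _"] cong: if_cong)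
  thus ?thesis by (simp only:) (rule isometry_norm, use fin untwist in auto)
 qed
 have fC: "finite C" using assms fin finite_subset by blast
 have "(SUM c:C. SUM y:S >< R. (cmod (M c y))^2) = (SUM c:C. SUM r:R. SUM i:{i:I. kappa i = c}. (cmod (psi (i, r)))^2)"
  unfolding sum_Times b[symmetric] by (intro sum.cong refl sum.swap)
 also have "... = (SUM c:C. SUM i:{i:I. kappa i = c}. SUM r:R. (cmod (psi (i, r)))^2)" by (intro sum.cong refl sum.swap)
 also have "... = (SUM c:C. SUM i:{i:{i:I. kappa i : C}. kappa i = c}. SUM r:R. (cmod (psi (i, r)))^2)"
  by (intro sum.cong) auto
 also have "... = (SUM i:{i:I. kappa i : C}. SUM r:R. (cmod (psi (i, r)))^2)"
  by (rule sum.group) (use fin fC in auto)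
 also have "... = (SUM k:{i:I. kappa i : C} >< R. (cmod (psi k))^2)" by (simp add: sum_Times)
 also have "{i:I. kappa i : C} >< R = {k:K. kappa (fst k) : C}" by auto
 finally show ?thesis .
qed

lemma rare_key_event:
 assumes C: "C \<subseteq> kappa ` I" and w: "16 * nsq C Phi <= (SUM k:{k:K. kappa (fst k) : C}. (cmod (psi k))^2)"
 shows "(SUM k:{k:K. kappa (fst k) : C}. (cmod (psi k))^2) <= 4 * eps"
 unfolding key_weight[OF C, symmetric]
 by (rule fidelity_event[OF _ ideal norm_M fidelity_M eps C]) (use fin w key_weight[OF C] in auto)

text \<open>Here \<open>x\<close> is the part of the key held by \<open>alpha\<close> and
  \<open>y\<close> the part held by \<open>omega\<close>. Dephasing both costs at most 2 H(xy) -
  H(x) - H(y). H(xy) is the key entropy, Fano's inequality bounds H(xy) - H(y) because ideally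
  \<open>x\<close> is a function of \<open>y\<close>, and near uniformity bounds H(x) from
  below.\<close>

lemma party_bound:
 fixes D :: real
 assumes injI: "inj_on (%i. (alpha i, omega i)) I" and injR: "inj_on (%r. (e r, f r)) R"
  and x: "!!i i'. i : I ==> i' : I ==> alpha i = alpha i' ==> x (kappa i) = x (kappa i')"
  and y: "!!i i'. i : I ==> i' : I ==> omega i = omega i' ==> y (kappa i) = y (kappa i')"
  and xy: "inj_on (%c. (x c, y c)) (kappa ` I)"
  and det: "!!c. c : kappa ` I ==> Phi c ~= 0 ==> x c = g (y c)"
  and D: "1 <= D" and unif: "!!a. (SUM c:{c:kappa ` I. x c = a}. (cmod (Phi c))^2) <= 1 / D"
 shows "Sv K (%k. (alpha (fst k), e (snd k))) (%k. (omega (fst k), f (snd k))) psi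
  >= Sv K (%k. (alpha (fst k), e (snd k), kappa (fst k))) (%k. (omega (fst k), f (snd k), kappa (fst k))) psi
   - Sv K (%k. kappa (fst k)) id psi + ((1 - 4 * eps) * log 2 D - 4) - (1 + 4 * eps * log 2 N)"
proof -
 let ?x = "%k. x (kappa (fst k))" and ?y = "%k. y (kappa (fst k))"
 have kxy: "(x (kappa i), y (kappa i)) = (x (kappa i'), y (kappa i')) <-> kappa i = kappa i'" if "i : I" "i' : I" for i i'
  using xy that by (auto simp: inj_on_def)
 have "inj_on (%k. ((omega (fst k), f (snd k)), (alpha (fst k), e (snd k)))) K"
  using injI injR by (auto simp: inj_on_def)
 from dephasing_bound[OF finK this, of ?x ?y psi] x y
 have 1: "Sv K (%k. (alpha (fst k), e (snd k))) (%k. (omega (fst k), f (snd k))) psi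
  >= Sv K (%k. (alpha (fst k), e (snd k), ?x k, ?y k)) (%k. (omega (fst k), f (snd k), ?x k, ?y k)) psi
  - (Sv K (%k. (?x k, ?y k)) id psi - Sv K ?x id psi) - (Sv K (%k. (?x k, ?y k)) id psi - Sv K ?y id psi)"
  by (auto simp: mem_Times_iff)
 have 2: "Sv K (%k. (alpha (fst k), e (snd k), ?x k, ?y k)) (%k. (omega (fst k), f (snd k), ?x k, ?y k)) psi
   = Sv K (%k. (alpha (fst k), e (snd k), kappa (fst k))) (%k. (omega (fst k), f (snd k), kappa (fst k))) psi"
  by (rule Sv_view[OF finK]) (use kxy in "auto simp: mem_Times_iff")
 have 3: "Sv K (%k. (?x k, ?y k)) id psi = Sv K (%k. kappa (fst k)) id psi"
  by (rule Sv_view[OF finK]) (use kxy in "auto simp: mem_Times_iff")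
 have 4: "Sv K (%k. (?x k, ?y k)) id psi - Sv K ?y id psi <= 1 + 4 * eps * log 2 N"
 proof (rule fano_inequality[OF finK norm1])
  have "{k : K. ?x k ~= g (?y k)} = {k : K. kappa (fst k) : {c : kappa ` I. x c ~= g (y c)}}" by auto
  moreover have "(SUM k:{k : K. kappa (fst k) : {c : kappa ` I. x c ~= g (y c)}}. (cmod (psi k))^2) <= 4 * eps"
  proof (rule rare_key_event)
   have "(SUM c:{c : kappa ` I. x c ~= g (y c)}. (cmod (Phi c))^2) = 0" by (intro sum.neutral) (use det in auto)
   thus "16 * (SUM c:{c : kappa ` I. x c ~= g (y c)}. (cmod (Phi c))^2) <= (SUM k:{k : K. kappa (fst k) : {c : kappa ` I. x c ~= g (y c)}}. (cmod (psi k))^2)"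
    by (simp add: sum_nonneg)
  qed auto
  ultimately show "(SUM k:{k : K. ?x k ~= g (?y k)}. (cmod (psi k))^2) <= 4 * eps" by simp
  have "?x ` K \<subseteq> x ` (kappa ` I)" by auto
  hence "card (?x ` K) <= card (kappa ` I)" using fin by (meson card_image_le card_mono finite_imageI order_trans)
  thus "real (card (?x ` K)) <= N" using N by simp
 qed
 \<comment> \<open>Ideally each value of \<open>x\<close> has weight at most 1/D. The values of
   weight above 16/D therefore form an event to which the factor 16 of the rare events
   applies.\<close>
 have 5: "(1 - 4 * eps) * log 2 D - 4 <= Sv K ?x id psi"
 proof (rule near_uniform_entropy[OF finK norm1 D])
  define A where "A = {a : ?x ` K. wt K ?x psi a > 16 / D}"
  define C where "C = {c : kappa ` I. x c : A}"
  have fA: "finite A" using finK by (simp add: A_def)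
  have wA: "(SUM k:{k:K. kappa (fst k) : C}. (cmod (psi k))^2) = (SUM a:A. wt K ?x psi a)"
  proof -
   have "(SUM a:A. wt K ?x psi a) = (SUM a:A. SUM k:{k:{k:K. kappa (fst k) : C}. ?x k = a}. (cmod (psi k))^2)"
    unfolding wt_def by (intro sum.cong refl) (auto simp: C_def)
   also have "... = (SUM k:{k:K. kappa (fst k) : C}. (cmod (psi k))^2)"
    by (rule sum.group) (use finK fA in "auto simp: C_def")
   finally show ?thesis by simp
  qed
  have "nsq C Phi = (SUM a:A. SUM c:{c:C. x c = a}. (cmod (Phi c))^2)"
   by (rule sum.group[symmetric]) (use fin fA in "auto simp: C_def")
  also have "... <= (SUM a:A. 1 / D)"
  proof (rule sum_mono)
   fix a
   have "(SUM c:{c:C. x c = a}. (cmod (Phi c))^2) <= (SUM c:{c:kappa ` I. x c = a}. (cmod (Phi c))^2)"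
    by (rule sum_mono2) (use fin in "auto simp: C_def")
   thus "(SUM c:{c:C. x c = a}. (cmod (Phi c))^2) <= 1 / D" using unif[of a] by linarith
  qed
  finally have "16 * nsq C Phi <= 16 * (SUM a:A. 1 / D)" by simp
  also have "... = (SUM a:A. 16 / D)" by simp
  also have "... <= (SUM a:A. wt K ?x psi a)" by (intro sum_mono) (auto simp: A_def)
  finally have "(SUM k:{k:K. kappa (fst k) : C}. (cmod (psi k))^2) <= 4 * eps"
   unfolding wA[symmetric] by (intro rare_key_event) (simp_all add: C_def)
  thus "(SUM a:{a : ?x ` K. wt K ?x psi a > 16 / D}. wt K ?x psi a) <= 4 * eps" by (simp add: wA A_def)
 qed
 show ?thesis using 1 4 5 unfolding 2 3 by linarith
qed

end

section \<open>Conditional mutual information of pure states, and its size near private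
  states\<close>

definition bip :: "'k set => ('k => 'x) => ('k => 'y) => ('k => 'e) => ('k => 'f) => ('k => complex) => real" where
 "bip K x y e f psi = Sv K (%k. (x k, e k)) (%k. (y k, f k)) psi + Sv K (%k. (y k, e k)) (%k. (x k, f k)) psi
   - Sv K e (%k. (x k, y k, f k)) psi - Sv K f (%k. (x k, y k, e k)) psi"

definition tri :: "'k set => ('k => 'x) => ('k => 'y) => ('k => 'z) => ('k => 'e) => ('k => 'f) => ('k => complex) => real" where
 "tri K x y z e f psi = Sv K (%k. (x k, e k)) (%k. (y k, z k, f k)) psi + Sv K (%k. (y k, e k)) (%k. (x k, z k, f k)) psi
   + Sv K (%k. (z k, e k)) (%k. (x k, y k, f k)) psi
   - 2 * Sv K e (%k. (x k, y k, z k, f k)) psi - Sv K f (%k. (x k, y k, z k, e k)) psi"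

lemma bip_swap: "finite K ==> bip K x y e f psi = bip K y x e f psi"
proof -
 assume K: "finite K"
 have "Sv K e (%k. (x k, y k, f k)) psi = Sv K e (%k. (y k, x k, f k)) psi"
  "Sv K f (%k. (x k, y k, e k)) psi = Sv K f (%k. (y k, x k, e k)) psi" by (rule Sv_view[OF K]; auto)+
 thus ?thesis unfolding bip_def by linarith
qed

text \<open>On a pure state -H(x|ye) = H(x|f), which turns I(x;y|e) into a sum of two conditional
  entropies of \<open>x\<close>. Operations of \<open>y\<close> are then controlled by discarding
  conditioning systems.\<close>

lemma bip_Hc: "finite K ==> bip K x y e f psi = Hc K x e (%k. (y k, f k)) psi + Hc K x f (%k. (y k, e k)) psi"
 unfolding bip_def Hc_def using Sv_swap[of K "%k. (y k, e k)" "%k. (x k, f k)" psi] by linarith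

lemma tri_swap12: "finite K ==> tri K x y z e f psi = tri K y x z e f psi"
proof -
 assume K: "finite K"
 have "Sv K e (%k. (x k, y k, z k, f k)) psi = Sv K e (%k. (y k, x k, z k, f k)) psi"
  "Sv K f (%k. (x k, y k, z k, e k)) psi = Sv K f (%k. (y k, x k, z k, e k)) psi"
  "Sv K (%k. (z k, e k)) (%k. (x k, y k, f k)) psi = Sv K (%k. (z k, e k)) (%k. (y k, x k, f k)) psi"
   by (rule Sv_view[OF K]; auto)+
 thus ?thesis unfolding tri_def by linarith
qed

lemma tri_swap13: "finite K ==> tri K x y z e f psi = tri K z y x e f psi"
proof -
 assume K: "finite K"
 have "Sv K e (%k. (x k, y k, z k, f k)) psi = Sv K e (%k. (z k, y k, x k, f k)) psi"
  "Sv K f (%k. (x k, y k, z k, e k)) psi = Sv K f (%k. (z k, y k, x k, e k)) psi"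
  "Sv K (%k. (x k, e k)) (%k. (y k, z k, f k)) psi = Sv K (%k. (x k, e k)) (%k. (z k, y k, f k)) psi"
  "Sv K (%k. (y k, e k)) (%k. (x k, z k, f k)) psi = Sv K (%k. (y k, e k)) (%k. (z k, x k, f k)) psi"
  "Sv K (%k. (z k, e k)) (%k. (x k, y k, f k)) psi = Sv K (%k. (z k, e k)) (%k. (y k, x k, f k)) psi"
   by (rule Sv_view[OF K]; auto)+
 thus ?thesis unfolding tri_def by linarith
qed

text \<open>The analogue for three parties: \<open>x\<close>, the party that will act, occurs
  neither as a conditioned nor as a conditioning system.\<close>

lemma tri_Hc: "finite K ==> tri K x y z e f psi = Hc K y e (%k. (x k, z k, f k)) psi + Hc K z e (%k. (x k, y k, f k)) psi
  + Hc K (%k. (y k, z k)) f (%k. (x k, e k)) psi"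
proof -
 assume K: "finite K"
 have "Sv K e (%k. (y k, x k, z k, f k)) psi = Sv K e (%k. (x k, y k, z k, f k)) psi"
  "Sv K e (%k. (z k, x k, y k, f k)) psi = Sv K e (%k. (x k, y k, z k, f k)) psi"
  "Sv K f (%k. ((y k, z k), x k, e k)) psi = Sv K f (%k. (x k, y k, z k, e k)) psi"
  "Sv K (%k. (y k, z k, f k)) (%k. (x k, e k)) psi = Sv K (%k. ((y k, z k), f k)) (%k. (x k, e k)) psi"
   by (rule Sv_view[OF K]; auto)+
 moreover have "Sv K (%k. (x k, e k)) (%k. (y k, z k, f k)) psi = Sv K (%k. (y k, z k, f k)) (%k. (x k, e k)) psi"
  by (rule Sv_swap[OF K])
 ultimately show ?thesis unfolding tri_def Hc_def by linarith
qed

lemma bip_view: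
 assumes K: "finite K" and x: "PROP same K x x'"
  and y: "PROP same K y y'"
  and e: "PROP same K e e'"
  and f: "PROP same K f f'"
 shows "bip K x y e f psi = bip K x' y' e' f' psi"
 unfolding bip_def by (intro arg_cong2[where f="(-)"] arg_cong2[where f="(+)"] Sv_view[OF K]; simp add: x y e f)

context approx_private
begin

text \<open>The shares take values in the key type itself, because an existential quantifier cannot
  range over types; in the application a share is a key with the foreign entries erased. Ideally
  every value of the share has weight at most 1/D.\<close>

definition keyed :: "('i => 'a) => ('i => 'b) => real => bool" where
 "keyed alpha omega D <-> (EX x y g :: 'c => 'c.
   (ALL i:I. ALL i':I. alpha i = alpha i' --> x (kappa i) = x (kappa i')) &
   (ALL i:I. ALL i':I. omega i = omega i' --> y (kappa i) = y (kappa i')) &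
   inj_on (%c. (x c, y c)) (kappa ` I) &
   (ALL c:kappa ` I. Phi c ~= 0 --> x c = g (y c)) & 1 <= D &
   (ALL a. (SUM c:{c:kappa ` I. x c = a}. (cmod (Phi c))^2) <= 1 / D))"

lemma keyed_bound:
 assumes k: "keyed alpha omega D" and injI: "inj_on (%i. (alpha i, omega i)) I" and injR: "inj_on (%r. (e r, f r)) R"
 shows "Sv K (%k. (alpha (fst k), e (snd k))) (%k. (omega (fst k), f (snd k))) psi
  >= Sv K (%k. (alpha (fst k), e (snd k), kappa (fst k))) (%k. (omega (fst k), f (snd k), kappa (fst k))) psi
   - Sv K (%k. kappa (fst k)) id psi + ((1 - 4 * eps) * log 2 D - 4) - (1 + 4 * eps * log 2 N)"
proof -
 obtain x y g where h: "ALL i:I. ALL i':I. alpha i = alpha i' --> x (kappa i) = x (kappa i')"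
   "ALL i:I. ALL i':I. omega i = omega i' --> y (kappa i) = y (kappa i')"
   "inj_on (%c. (x c, y c :: 'c)) (kappa ` I)" "ALL c:kappa ` I. Phi c ~= 0 --> (x c :: 'c) = g (y c)" "1 <= D"
   "ALL a. (SUM c:{c:kappa ` I. x c = a}. (cmod (Phi c))^2) <= 1 / D"
  using k unfolding keyed_def by blast
 show ?thesis
  by (rule party_bound[OF injI injR, where x=x and y=y and g=g]) (use h in blast)+
qed

text \<open>Each party bound gives up H(key) and 5 bits plus 4 eps log N; decoupling one environment
  returns H(key) and gives up 2 bits plus 2 eps log N. Two of each yield the constants 14 and 12.
  Strong subadditivity joins the two dephased party entropies.\<close>

lemma bip_lower:
 assumes k1: "keyed alpha omega D" and k2: "keyed omega alpha D" and injI: "inj_on (%i. (alpha i, omega i)) I" and injR: "inj_on (%r. (e r, f r)) R"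
 shows "bip K (%k. alpha (fst k)) (%k. omega (fst k)) (%k. e (snd k)) (%k. f (snd k)) psi
  >= 2 * (1 - 4 * eps) * log 2 D - 14 - 12 * (eps * log 2 N)"
proof -
 let ?S = "%p q. Sv K p q psi" and ?a = "%k. alpha (fst k)" and ?o = "%k. omega (fst k)" and ?e = "%k. e (snd k)" and ?f = "%k. f (snd k)" and ?k = "%k. kappa (fst k)"
 have injI': "inj_on (%i. (omega i, alpha i)) I" using injI by (auto simp: inj_on_def)
 have injR': "inj_on (%r. (f r, e r)) R" using injR by (auto simp: inj_on_def)
 have ii: "alpha i = alpha i' & omega i = omega i' <-> i = i'" if "i : I" "i' : I" for i i' using injI that by (auto simp: inj_on_def)
 have 1: "?S (%k. (?a k, ?o k, ?e k, ?k k)) (%k. (?f k, ?k k)) = ?S (%k. (?f k, ?k k)) (%k. (fst k, ?e k))"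
  unfolding Sv_swap[OF finK, of "%k. (?f k, ?k k)"] by (rule Sv_view[OF finK]) (use ii in "auto simp: mem_Times_iff")
 have 2: "?S (%k. (?e k, ?k k)) (%k. (?a k, ?o k, ?f k, ?k k)) = ?S (%k. (?e k, ?k k)) (%k. (fst k, ?f k))"
  and 3: "?S ?f (%k. (?a k, ?o k, ?e k)) = ?S ?f (%k. (fst k, ?e k))"
  and 4: "?S ?e (%k. (?a k, ?o k, ?f k)) = ?S ?e (%k. (fst k, ?f k))"
  by (rule Sv_view[OF finK]; use ii in "auto simp: mem_Times_iff")+
 have s: "?S (%k. (?a k, ?o k, ?e k, ?k k)) (%k. (?f k, ?k k)) + ?S (%k. (?e k, ?k k)) (%k. (?a k, ?o k, ?f k, ?k k))
  <= ?S (%k. (?a k, ?e k, ?k k)) (%k. (?o k, ?f k, ?k k))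
   + ?S (%k. (?o k, ?e k, ?k k)) (%k. (?a k, ?f k, ?k k))"
  using ssa[OF finK, of ?a ?o "%k. (?e k, ?k k)" "%k. (?f k, ?k k)" psi] unfolding Hc_def by linarith
 note d1 = decoupled[OF injR] and d2 = decoupled[OF injR']
 have "2 * (1 - 4 * eps) * log 2 D - 14 - 12 * (eps * log 2 N) = ((1 - 4 * eps) * log 2 D - 4) + ((1 - 4 * eps) * log 2 D - 4) - (1 + 4 * eps * log 2 N) - (1 + 4 * eps * log 2 N) - 2 * (1 + eps * log 2 N) - 2 * (1 + eps * log 2 N)"
  by (simp add: algebra_simps)
 thus ?thesis
  using keyed_bound[OF k1 injI injR] keyed_bound[OF k2 injI' injR] s d1 d2 unfolding 1 2 3 4 bip_def by linarith
qed

text \<open>Three party bounds and three decouplings, of \<open>e\<close> twice and of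
  \<open>f\<close> once, give 21 = 15 + 6 and 18 = 12 + 6. Strong subadditivity is applied twice to
  merge the three dephased party entropies.\<close>

lemma tri_lower:
 assumes k1: "keyed alpha (%i. (\<beta> i, \<gamma> i)) D1" and k2: "keyed \<beta> (%i. (alpha i, \<gamma> i)) D2" and k3: "keyed \<gamma> (%i. (alpha i, \<beta> i)) D3"
  and injI: "inj_on (%i. (alpha i, \<beta> i, \<gamma> i)) I" and injR: "inj_on (%r. (e r, f r)) R"
 shows "tri K (%k. alpha (fst k)) (%k. \<beta> (fst k)) (%k. \<gamma> (fst k)) (%k. e (snd k)) (%k. f (snd k)) psi
  >= (1 - 4 * eps) * (log 2 D1 + log 2 D2 + log 2 D3) - 21 - 18 * (eps * log 2 N)"
proof -
 have i1: "inj_on (%i. (alpha i, (\<beta> i, \<gamma> i))) I" and i2: "inj_on (%i. (\<beta> i, (alpha i, \<gamma> i))) I" and i3: "inj_on (%i. (\<gamma> i, (alpha i, \<beta> i))) I"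
  using injI by (auto simp: inj_on_def)
 have injR': "inj_on (%r. (f r, e r)) R" using injR by (auto simp: inj_on_def)
 have ii: "alpha i = alpha i' & \<beta> i = \<beta> i' & \<gamma> i = \<gamma> i' <-> i = i'" if "i : I" "i' : I" for i i' using injI that by (auto simp: inj_on_def)
 let ?S = "%p q. Sv K p q psi"
 let ?a = "%k. alpha (fst k)" and ?b = "%k. \<beta> (fst k)" and ?c = "%k. \<gamma> (fst k)" and ?e = "%k. e (snd k)" and ?f = "%k. f (snd k)" and ?k = "%k. kappa (fst k)"
 have v1: "?S (%k. (?a k, ?e k, ?k k)) (%k. ((?b k, ?c k), ?f k, ?k k)) = ?S (%k. (?a k, ?e k, ?k k)) (%k. (?b k, ?c k, ?f k, ?k k))"
  and v2: "?S (%k. (?b k, ?e k, ?k k)) (%k. ((?a k, ?c k), ?f k, ?k k)) = ?S (%k. (?b k, ?e k, ?k k)) (%k. (?a k, ?c k, ?f k, ?k k))"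
  and v3: "?S (%k. (?c k, ?e k, ?k k)) (%k. ((?a k, ?b k), ?f k, ?k k)) = ?S (%k. (?c k, ?e k, ?k k)) (%k. (?b k, ?a k, ?f k, ?k k))"
  and v4: "?S (%k. (?a k, ?e k)) (%k. ((?b k, ?c k), ?f k)) = ?S (%k. (?a k, ?e k)) (%k. (?b k, ?c k, ?f k))"
  and v5: "?S (%k. (?b k, ?e k)) (%k. ((?a k, ?c k), ?f k)) = ?S (%k. (?b k, ?e k)) (%k. (?a k, ?c k, ?f k))"
  and v6: "?S (%k. (?c k, ?e k)) (%k. ((?a k, ?b k), ?f k)) = ?S (%k. (?c k, ?e k)) (%k. (?a k, ?b k, ?f k))"
  by (rule Sv_view[OF finK]; auto)+
 have s1: "?S (%k. (?b k, ?a k, ?e k, ?k k)) (%k. (?c k, ?f k, ?k k)) + ?S (%k. (?e k, ?k k)) (%k. (?a k, ?b k, ?c k, ?f k, ?k k))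
   <= ?S (%k. (?a k, ?e k, ?k k)) (%k. (?b k, ?c k, ?f k, ?k k)) + ?S (%k. (?b k, ?e k, ?k k)) (%k. (?a k, ?c k, ?f k, ?k k))"
 proof -
  have "?S (%k. (?e k, ?k k)) (%k. (?b k, ?a k, ?c k, ?f k, ?k k)) = ?S (%k. (?e k, ?k k)) (%k. (?a k, ?b k, ?c k, ?f k, ?k k))"
   by (rule Sv_view[OF finK]) auto
  thus ?thesis
   using ssa[OF finK, of ?b ?a "%k. (?e k, ?k k)" "%k. (?c k, ?f k, ?k k)" psi] unfolding Hc_def by linarith
 qed
 have s2: "?S (%k. (?c k, (?b k, ?a k), ?e k, ?k k)) (%k. (?f k, ?k k)) + ?S (%k. (?e k, ?k k)) (%k. (?a k, ?b k, ?c k, ?f k, ?k k))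
   <= ?S (%k. (?b k, ?a k, ?e k, ?k k)) (%k. (?c k, ?f k, ?k k)) + ?S (%k. (?c k, ?e k, ?k k)) (%k. (?b k, ?a k, ?f k, ?k k))"
 proof -
  have "?S (%k. (?e k, ?k k)) (%k. (?c k, (?b k, ?a k), ?f k, ?k k)) = ?S (%k. (?e k, ?k k)) (%k. (?a k, ?b k, ?c k, ?f k, ?k k))"
   "?S (%k. ((?b k, ?a k), ?e k, ?k k)) (%k. (?c k, ?f k, ?k k)) = ?S (%k. (?b k, ?a k, ?e k, ?k k)) (%k. (?c k, ?f k, ?k k))"
   "?S (%k. (?c k, ?e k, ?k k)) (%k. ((?b k, ?a k), ?f k, ?k k)) = ?S (%k. (?c k, ?e k, ?k k)) (%k. (?b k, ?a k, ?f k, ?k k))"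
   by (rule Sv_view[OF finK]; auto)+
  thus ?thesis
   using ssa[OF finK, of ?c "%k. (?b k, ?a k)" "%k. (?e k, ?k k)" "%k. (?f k, ?k k)" psi] unfolding Hc_def by linarith
 qed
 have 1: "?S (%k. (?c k, (?b k, ?a k), ?e k, ?k k)) (%k. (?f k, ?k k)) = ?S (%k. (?f k, ?k k)) (%k. (fst k, ?e k))"
  unfolding Sv_swap[OF finK, of "%k. (?f k, ?k k)"] by (rule Sv_view[OF finK]) (use ii in "auto simp: mem_Times_iff")
 have 2: "?S (%k. (?e k, ?k k)) (%k. (?a k, ?b k, ?c k, ?f k, ?k k)) = ?S (%k. (?e k, ?k k)) (%k. (fst k, ?f k))"
  and 3: "?S ?f (%k. (?a k, ?b k, ?c k, ?e k)) = ?S ?f (%k. (fst k, ?e k))"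
  and 4: "?S ?e (%k. (?a k, ?b k, ?c k, ?f k)) = ?S ?e (%k. (fst k, ?f k))"
  by (rule Sv_view[OF finK]; use ii in "auto simp: mem_Times_iff")+
 note d1 = decoupled[OF injR] and d2 = decoupled[OF injR']
 note b = keyed_bound[OF k1 i1 injR, unfolded v1 v4] keyed_bound[OF k2 i2 injR, unfolded v2 v5] keyed_bound[OF k3 i3 injR, unfolded v3 v6]
 have "(1 - 4 * eps) * (log 2 D1 + log 2 D2 + log 2 D3) - 21 - 18 * (eps * log 2 N)
   = ((1 - 4 * eps) * log 2 D1 - 4) + ((1 - 4 * eps) * log 2 D2 - 4) + ((1 - 4 * eps) * log 2 D3 - 4)
    - (1 + 4 * eps * log 2 N) - (1 + 4 * eps * log 2 N) - (1 + 4 * eps * log 2 N) - 2 * (1 + eps * log 2 N) - 2 * (1 + eps * log 2 N) - 2 * (1 + eps * log 2 N)"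
  by (simp add: algebra_simps)
 thus ?thesis using b s1 s2 d1 d2 unfolding 1 2 3 4 tri_def by linarith
qed

end

section \<open>Local operations and one use of a channel\<close>

lemma Sv_transport:
 assumes K: "finite K" and g: "bij_betw g K' K" and psi: "!!k. k : K' ==> psi' k = psi (g k)"
  and p: "!!k l. k : K' ==> l : K' ==> p' k = p' l <-> p (g k) = p (g l)"
  and q: "!!k l. k : K' ==> l : K' ==> q' k = q' l <-> q (g k) = q (g l)"
 shows "Sv K' p' q' psi' = Sv K p q psi"
proof -
 have K': "finite K'" using K g by (simp add: bij_betw_finite)
 have "Sv K' p' q' psi' = Sv K' p' q' (%k. psi (g k))" by (rule Sv_cong) (use psi in auto)
 also have "... = Sv K' (%k. p (g k)) (%k. q (g k)) (%k. psi (g k))" by (rule Sv_view[OF K' p q])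
 also have "... = Sv K p q psi" by (rule Sv_reindex[OF g])
 finally show ?thesis .
qed

lemma bip_transport:
 assumes K: "finite K" and g: "bij_betw g K' K" and psi: "!!k. k : K' ==> psi' k = psi (g k)"
  and v: "!!k l. k : K' ==> l : K' ==> x' k = x' l <-> x (g k) = x (g l)"
  "!!k l. k : K' ==> l : K' ==> y' k = y' l <-> y (g k) = y (g l)"
  "!!k l. k : K' ==> l : K' ==> e' k = e' l <-> e (g k) = e (g l)"
  "!!k l. k : K' ==> l : K' ==> f' k = f' l <-> f (g k) = f (g l)"
 shows "bip K' x' y' e' f' psi' = bip K x y e f psi"
 unfolding bip_def by (intro arg_cong2[where f="(-)"] arg_cong2[where f="(+)"] Sv_transport[OF K g]; simp add: v psi)

lemma tri_transport:
 assumes K: "finite K" and g: "bij_betw g K' K" and psi: "!!k. k : K' ==> psi' k = psi (g k)"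
  and v: "!!k l. k : K' ==> l : K' ==> x' k = x' l <-> x (g k) = x (g l)"
  "!!k l. k : K' ==> l : K' ==> y' k = y' l <-> y (g k) = y (g l)"
  "!!k l. k : K' ==> l : K' ==> z' k = z' l <-> z (g k) = z (g l)"
  "!!k l. k : K' ==> l : K' ==> e' k = e' l <-> e (g k) = e (g l)"
  "!!k l. k : K' ==> l : K' ==> f' k = f' l <-> f (g k) = f (g l)"
 shows "tri K' x' y' z' e' f' psi' = tri K x y z e f psi"
 unfolding tri_def by (intro arg_cong2[where f="(-)"] arg_cong2[where f="(+)"] arg_cong2[where f="(*)"] refl Sv_transport[OF K g]; simp add: v psi)

lemma bip_block:
 assumes K: "finite K" and Z: "finite Z" "m ` K \<subseteq> Z"
  and e: "!!k l. k : K ==> l : K ==> e k = e l ==> m k = m l"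
  and f: "!!k l. k : K ==> l : K ==> f k = f l ==> m k = m l"
 shows "bip K x y e f psi = (SUM c:Z. bip {k:K. m k = c} x y e f psi)"
proof -
 have "Sv K p q psi = (SUM c:Z. Sv {k:K. m k = c} p q psi)"
  if "!!k l. p k = p l ==> e k = e l" "!!k l. q k = q l ==> f k = f l" for p :: "_ => 'p" and q :: "_ => 'q"
  by (rule Sv_block[OF K Z]) (use e f that in blast)+
 note 1 = this
 have "Sv K p q psi = (SUM c:Z. Sv {k:K. m k = c} p q psi)"
  if "!!k l. p k = p l ==> f k = f l" "!!k l. q k = q l ==> e k = e l" for p :: "_ => 'p" and q :: "_ => 'q"
  by (rule Sv_block[OF K Z]) (use e f that in blast)+
 note 2 = this
 show ?thesis unfolding bip_def sum.distrib sum_subtractf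
  by (intro arg_cong2[where f="(-)"] arg_cong2[where f="(+)"]) (rule 1 2; simp)+
qed

lemma tri_block:
 assumes K: "finite K" and Z: "finite Z" "m ` K \<subseteq> Z"
  and e: "!!k l. k : K ==> l : K ==> e k = e l ==> m k = m l"
  and f: "!!k l. k : K ==> l : K ==> f k = f l ==> m k = m l"
 shows "tri K x y z e f psi = (SUM c:Z. tri {k:K. m k = c} x y z e f psi)"
proof -
 have "Sv K p q psi = (SUM c:Z. Sv {k:K. m k = c} p q psi)"
  if "!!k l. p k = p l ==> e k = e l" "!!k l. q k = q l ==> f k = f l" for p :: "_ => 'p" and q :: "_ => 'q"
  by (rule Sv_block[OF K Z]) (use e f that in blast)+
 note 1 = this
 have "Sv K p q psi = (SUM c:Z. Sv {k:K. m k = c} p q psi)"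
  if "!!k l. p k = p l ==> f k = f l" "!!k l. q k = q l ==> e k = e l" for p :: "_ => 'p" and q :: "_ => 'q"
  by (rule Sv_block[OF K Z]) (use e f that in blast)+
 note 2 = this
 show ?thesis unfolding tri_def sum.distrib sum_subtractf sum_distrib_left[symmetric]
  by (intro arg_cong2[where f="(-)"] arg_cong2[where f="(+)"] arg_cong2[where f="(*)"] refl) (rule 1 2; simp)+
qed

section \<open>Conditional entropies as functions of a mixed state\<close>

definition kent :: "'j set => ('j => 'x) => ('j => 'y) => ('j => 'j => complex) => real" where
 "kent J v w tau = ent (v ` J) (%x y. SUM j:J. SUM j':J. if v j = x & v j' = y & w j = w j' then tau j j' else 0)"

definition kH :: "'j set => ('j => 'x) => ('j => 'y) => ('j => 'z) => ('j => 'j => complex) => real" where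
 "kH J b e q tau = kent J (%j. (b j, e j)) q tau - kent J e (%j. (b j, q j)) tau"

text \<open>This is I(y;xP|e) for a purifying reference P, in the form of \<open>bip_Hc\<close>;
  likewise \<open>ktri\<close> is I(P;y;z|e). The reference is always traced out in these forms, so
  only the kernel \<open>tau\<close> enters.\<close>

definition kbip :: "'j set => ('j => 'x) => ('j => 'y) => ('j => 'e) => ('j => 'f) => ('j => 'j => complex) => real" where
 "kbip J y x e f tau = kH J y e (%j. (x j, f j)) tau + kH J y f (%j. (x j, e j)) tau"

definition ktri :: "'j set => ('j => 'x) => ('j => 'y) => ('j => 'e) => ('j => 'f) => ('j => 'j => complex) => real" where
 "ktri J y z e f tau = kH J y e (%j. (z j, f j)) tau + kH J z e (%j. (y j, f j)) tau + kH J (%j. (y j, z j)) f e tau"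

definition purifies :: "'j set => 'p set => ('j * 'p => complex) => ('j => 'j => complex) => bool" where
 "purifies J P psi tau <-> finite P & (ALL j:J. ALL j':J. tau j j' = (SUM p:P. psi (j, p) * cnj (psi (j', p))))"

lemma ent_empty: "ent {} rho = 0"
 by (simp add: ent_def specd_def onb_def)

lemma Sv_kent:
 fixes v :: "'j => 'b"
 assumes J: "finite J" and P: "purifies J P psi tau"
 shows "Sv (J >< P) (%k. v (fst k)) (%k. (w (fst k), snd k)) psi = kent J v w tau"
proof (cases "P = {}")
 \<comment> \<open>With an empty purifying system the index set is empty, and so is the carrier of
   the entropy on the left, whereas the kernel on the right is zero on the whole image of
   \<open>J\<close>.\<close>
 case True
 define z where "z = (%(x::'b) (y::'b). 0::complex)"
 have e0: "ent X z = 0" if "finite X" for X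
 proof -
  have "z = gram ({}::unit set) (%_ _. 0)" by (simp add: gram_def z_def fun_eq_iff)
  thus ?thesis using ent_swap[OF that, of "{}::unit set" "%_ _. 0"] by (simp add: ent_empty)
 qed
 have "kent J v w tau = ent (v ` J) z" unfolding kent_def z_def
  by (rule ent_cong) (use P True in "auto simp: purifies_def intro!: sum.neutral")
 thus ?thesis using True J e0[of "v ` J"] by (simp add: Sv_def ent_empty)
next
 case False
 have fP: "finite P" using P by (simp add: purifies_def)
 have X: "(%k. v (fst k)) ` (J >< P) = v ` J" using False by force
 show ?thesis unfolding Sv_def kent_def X
 proof (rule ent_cong)
  fix x y
  have "gram ((%k. (w (fst k), snd k)) ` (J >< P)) (pf (J >< P) (%k. v (fst k)) (%k. (w (fst k), snd k)) psi) x y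
   = red (J >< P) (%k. v (fst k)) (%k. (w (fst k), snd k)) psi x y" by (rule gram_pf) (use J fP in auto)
  also have "... = (SUM j:J. SUM p:P. SUM j':J. SUM p':P. if p = p' then if v j = x & v j' = y & w j = w j' then psi (j, p) * cnj (psi (j', p)) else 0 else 0)"
   unfolding red_def sum_Times by (intro sum.cong refl) auto
  also have "... = (SUM j:J. SUM p:P. SUM j':J. if v j = x & v j' = y & w j = w j' then psi (j, p) * cnj (psi (j', p)) else 0)"
   using fP by simp
  also have "... = (SUM j:J. SUM j':J. SUM p:P. if v j = x & v j' = y & w j = w j' then psi (j, p) * cnj (psi (j', p)) else 0)"
   by (intro sum.cong refl sum.swap)
  also have "... = (SUM j:J. SUM j':J. if v j = x & v j' = y & w j = w j' then tau j j' else 0)"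
   using P by (intro sum.cong refl) (auto simp: purifies_def)
  finally show "gram ((%k. (w (fst k), snd k)) ` (J >< P)) (pf (J >< P) (%k. v (fst k)) (%k. (w (fst k), snd k)) psi) x y
   = (SUM j:J. SUM j':J. if v j = x & v j' = y & w j = w j' then tau j j' else 0)" .
 qed
qed

lemma Hc_kH:
 assumes J: "finite J" and P: "purifies J P psi tau"
 shows "Hc (J >< P) (%k. b (fst k)) (%k. e (fst k)) (%k. (q (fst k), snd k)) psi = kH J b e q tau"
proof -
 have fP: "finite P" using P by (simp add: purifies_def)
 have "Sv (J >< P) (%k. e (fst k)) (%k. (b (fst k), q (fst k), snd k)) psi = Sv (J >< P) (%k. e (fst k)) (%k. ((b (fst k), q (fst k)), snd k)) psi"
  by (rule Sv_view) (use J fP in auto)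
 thus ?thesis unfolding Hc_def kH_def Sv_kent[OF J P, symmetric] by simp
qed

lemma purifies_nat:
 assumes "purifies J P psi tau"
 shows "EX n psi'. purifies J {..<n::nat} psi' tau"
proof -
 have P: "finite P" using assms by (simp add: purifies_def)
 obtain f where f: "bij_betw f {..<card P} P" using ex_bij_betw_nat_finite[OF P] by (auto simp: lessThan_atLeast0)
 have "purifies J {..<card P} (%(j, n). psi (j, f n)) tau"
  using assms sum.reindex_bij_betw[OF f, of "%p. psi (_, p) * cnj (psi (_, p))"] by (simp add: purifies_def)
 thus ?thesis by blast
qed

text \<open>Concavity of conditional entropy, without normalisation. The sum is purified by a
  flagged direct sum; conditioning on the flag gives exactly the two summands, and forgetting the
  flag can only raise the conditional entropy.\<close>

lemma kH_superadditive:
 assumes J: "finite J" and P1: "purifies J P1 psi1 tau1" and P2: "purifies J P2 psi2 tau2"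
 shows "kH J b e q tau1 + kH J b e q tau2 <= kH J b e q (%j j'. tau1 j j' + tau2 j j')"
proof -
 define P where "P = Inl ` P1 \<union> Inr ` P2"
 define Psi where "Psi = (%(j, p). case p of Inl p => psi1 (j, p) | Inr p => psi2 (j, p))"
 have fP1: "finite P1" and fP2: "finite P2" and fP: "finite P" using P1 P2 by (auto simp: purifies_def P_def)
 have P: "purifies J P Psi (%j j'. tau1 j j' + tau2 j j')"
  unfolding purifies_def
 proof (intro conjI ballI fP)
  fix j j' assume "j : J" "j' : J"
  have "(SUM p:P. Psi (j, p) * cnj (Psi (j', p))) = (SUM p:Inl ` P1. Psi (j, p) * cnj (Psi (j', p))) + (SUM p:Inr ` P2. Psi (j, p) * cnj (Psi (j', p)))"
   unfolding P_def by (rule sum.union_disjoint) (use fP1 fP2 in auto)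
  also have "... = tau1 j j' + tau2 j j'"
   using P1 P2 \<open>j \<in> J\<close> \<open>j' \<in> J\<close> by (simp add: sum.reindex Psi_def purifies_def)
  finally show "tau1 j j' + tau2 j j' = (SUM p:P. Psi (j, p) * cnj (Psi (j', p)))" by simp
 qed
 let ?K = "J >< P" and ?m = "%k. isl (snd k)"
 have finK: "finite ?K" using J fP by simp
 let ?b = "%k. b (fst k)" and ?e = "%k. e (fst k)" and ?q = "%k. (q (fst k), snd k)"
 have ind: "purifies J ({p:P. isl p = c}) Psi (if c then tau1 else tau2)" for c
 proof -
  have "{p:P. isl p = c} = (if c then Inl ` P1 else Inr ` P2)" by (auto simp: P_def)
  thus ?thesis using P1 P2 by (simp add: purifies_def sum.reindex Psi_def)
 qed
 have kc: "{k:?K. ?m k = c} = J >< {p:P. isl p = c}" for c by auto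
 have "Hc ?K ?b (%k. (?m k, ?e k)) ?q Psi = (SUM c:UNIV. Hc {k:?K. ?m k = c} ?b ?e ?q Psi)"
 proof -
  have 1: "Sv ?K (%k. (?b k, ?m k, ?e k)) ?q Psi = (SUM c:UNIV. Sv {k:?K. ?m k = c} (%k. (?b k, ?m k, ?e k)) ?q Psi)"
   by (rule Sv_block[OF finK]) auto
  have 2: "Sv ?K (%k. (?m k, ?e k)) (%k. (?b k, ?q k)) Psi = (SUM c:UNIV. Sv {k:?K. ?m k = c} (%k. (?m k, ?e k)) (%k. (?b k, ?q k)) Psi)"
   by (rule Sv_block[OF finK]) auto
  have 3: "Sv {k:?K. ?m k = c} (%k. (?b k, ?m k, ?e k)) ?q Psi = Sv {k:?K. ?m k = c} (%k. (?b k, ?e k)) ?q Psi" for c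
   by (rule Sv_view) (use finK in auto)
  have 4: "Sv {k:?K. ?m k = c} (%k. (?m k, ?e k)) (%k. (?b k, ?q k)) Psi = Sv {k:?K. ?m k = c} ?e (%k. (?b k, ?q k)) Psi" for c
   by (rule Sv_view) (use finK in auto)
  show ?thesis unfolding Hc_def 1 2 3 4 by (simp add: sum_subtractf)
 qed
 also have "... = kH J b e q tau1 + kH J b e q tau2"
  unfolding kc Hc_kH[OF J ind] by (simp add: UNIV_bool)
 finally have "kH J b e q tau1 + kH J b e q tau2 = Hc ?K ?b (%k. (?m k, ?e k)) ?q Psi" by simp
 also have "... <= Hc ?K ?b ?e (%k. (?m k, ?q k)) Psi" by (rule ssa[OF finK])
 also have "... = Hc ?K ?b ?e ?q Psi" by (rule Hc_view[OF finK]) auto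
 also have "... = kH J b e q (%j j'. tau1 j j' + tau2 j j')" by (rule Hc_kH[OF J P])
 finally show ?thesis .
qed

lemma kbip_superadditive:
 assumes "finite J" "purifies J P1 psi1 tau1" "purifies J P2 psi2 tau2"
 shows "kbip J y x e f tau1 + kbip J y x e f tau2 <= kbip J y x e f (%j j'. tau1 j j' + tau2 j j')"
 unfolding kbip_def
 using kH_superadditive[OF assms, of y e "%j. (x j, f j)"] kH_superadditive[OF assms, of y f "%j. (x j, e j)"] by linarith

lemma ktri_superadditive:
 assumes "finite J" "purifies J P1 psi1 tau1" "purifies J P2 psi2 tau2"
 shows "ktri J y z e f tau1 + ktri J y z e f tau2 <= ktri J y z e f (%j j'. tau1 j j' + tau2 j j')"
 unfolding ktri_def
 using kH_superadditive[OF assms, of y e "%j. (z j, f j)"] kH_superadditive[OF assms, of z e "%j. (y j, f j)"]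
  kH_superadditive[OF assms, of "%j. (y j, z j)" f e] by linarith

definition apply_fst :: "'i set => ('j => 'i => complex) => ('i * 'r => complex) => 'j * 'r => complex" where
 "apply_fst I V psi = (%(j, r). SUM i:I. V j i * psi (i, r))"

definition conj_kernel :: "'i set => ('j => 'i => complex) => ('i => 'i => complex) => 'j => 'j => complex" where
 "conj_kernel I V sigma j j' = (SUM i:I. SUM i':I. V j i * sigma i i' * cnj (V j' i'))"

lemma purifies_apply:
 assumes "purifies I P psi sigma"
 shows "purifies J P (apply_fst I V psi) (conj_kernel I V sigma)"
 unfolding purifies_def
proof (intro conjI ballI)
 show "finite P" using assms by (simp add: purifies_def)
 fix j j'
 have "(SUM p:P. apply_fst I V psi (j, p) * cnj (apply_fst I V psi (j', p)))
  = (SUM p:P. SUM i:I. SUM i':I. V j i * (psi (i, p) * cnj (psi (i', p))) * cnj (V j' i'))"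
  unfolding apply_fst_def by (simp add: sum_product mult_ac)
 also have "... = (SUM i:I. SUM i':I. SUM p:P. V j i * (psi (i, p) * cnj (psi (i', p))) * cnj (V j' i'))"
  by (intro sum.cong refl sum_perm)
 also have "... = conj_kernel I V sigma j j'"
  unfolding conj_kernel_def using assms by (intro sum.cong refl) (simp add: purifies_def sum_distribs)
 finally show "conj_kernel I V sigma j j' = (SUM p:P. apply_fst I V psi (j, p) * cnj (apply_fst I V psi (j', p)))" by simp
qed

lemma purifies_self: "finite P ==> purifies J P psi (%j j'. SUM p:P. psi (j, p) * cnj (psi (j', p)))"
 by (simp add: purifies_def)

section \<open>Effect of a local isometry on conditional information\<close>

locale local_isometry =
 fixes I :: "'i set" and J :: "'j set" and R :: "'r set" and V :: "'j => 'i => complex" and psi :: "'i * 'r => complex"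
 assumes fin: "finite I" "finite J" "finite R"
  and iso: "!!i i'. i : I ==> i' : I ==> (SUM j:J. V j i * cnj (V j i')) = dl i i'"
begin

lemma finI: "finite (I >< R)" and finJ: "finite (J >< R)" using fin by auto

lemma Sv_rest: "Sv (J >< R) (%k. p (snd k)) (%k. (fst k, q (snd k))) (apply_fst I V psi) = Sv (I >< R) (%k. p (snd k)) (%k. (fst k, q (snd k))) psi"
 using Sv_isometry[OF fin iso, where kappa="%_. ()" and kappa'="%_. ()" and P="%_. p" and Q=q and psi=psi]
 by (simp add: apply_fst_def case_prod_unfold)

lemma Hc_rest: "Hc (J >< R) (%k. b (snd k)) (%k. e (snd k)) (%k. (fst k, q (snd k))) (apply_fst I V psi) = Hc (I >< R) (%k. b (snd k)) (%k. e (snd k)) (%k. (fst k, q (snd k))) psi"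
proof -
 have "Sv (J >< R) (%k. e (snd k)) (%k. (b (snd k), fst k, q (snd k))) phi = Sv (J >< R) (%k. e (snd k)) (%k. (fst k, b (snd k), q (snd k))) phi" for phi
  by (rule Sv_view[OF finJ]) auto
 moreover have "Sv (I >< R) (%k. e (snd k)) (%k. (b (snd k), fst k, q (snd k))) phi = Sv (I >< R) (%k. e (snd k)) (%k. (fst k, b (snd k), q (snd k))) phi" for phi
  by (rule Sv_view[OF finI]) auto
 ultimately show ?thesis unfolding Hc_def
  using Sv_rest[of "%r. (b r, e r)" q] Sv_rest[of e "%r. (b r, q r)"] by simp
qed

text \<open>The conditional entropy of a passive party is unaffected by the isometry as long as the
  output is traced out; handing the outcome \<open>z\<close> to the conditioning system can only
  lower it.\<close>

lemma Hc_measured: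
 assumes "!!k l. k : J >< R ==> l : J >< R ==> q' k = q' l <-> fst k = fst l & q (snd k) = q (snd l)"
 shows "Hc (J >< R) (%k. y (snd k)) (%k. (z (fst k), e (snd k))) q' (apply_fst I V psi) <= Hc (I >< R) (%k. y (snd k)) (%k. e (snd k)) (%k. (fst k, q (snd k))) psi"
proof -
 have "Hc (J >< R) (%k. y (snd k)) (%k. (z (fst k), e (snd k))) q' (apply_fst I V psi)
  <= Hc (J >< R) (%k. y (snd k)) (%k. e (snd k)) (%k. (z (fst k), q' k)) (apply_fst I V psi)" by (rule ssa[OF finJ])
 also have "... = Hc (J >< R) (%k. y (snd k)) (%k. e (snd k)) (%k. (fst k, q (snd k))) (apply_fst I V psi)"
  by (rule Hc_view[OF finJ]) (use assms in auto)
 finally show ?thesis unfolding Hc_rest .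
qed

text \<open>The measuring party keeps \<open>p\<close> and sends the outcome \<open>z\<close> to
  both environments. Together they determine the output index, so the traced side still sees all of
  it.\<close>

lemma bip_measured:
 assumes pz: "inj_on (%j. (p j, z j)) J"
 shows "bip (J >< R) (%k. (p (fst k), x (snd k))) (%k. y (snd k)) (%k. (z (fst k), e (snd k))) (%k. (z (fst k), f (snd k))) (apply_fst I V psi)
  <= bip (I >< R) (%k. (fst k, x (snd k))) (%k. y (snd k)) (%k. e (snd k)) (%k. f (snd k)) psi"
proof -
 have pz': "p j = p j' & z j = z j' <-> j = j'" if "j : J" "j' : J" for j j' using pz that by (auto simp: inj_on_def)
 have 1: "Hc (I >< R) (%k. y (snd k)) (%k. e (snd k)) (%k. ((fst k, x (snd k)), f (snd k))) psi = Hc (I >< R) (%k. y (snd k)) (%k. e (snd k)) (%k. (fst k, x (snd k), f (snd k))) psi" for e :: "'r => 'u" and f :: "'r => 'v"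
  by (rule Hc_view[OF finI]) auto
 show ?thesis unfolding bip_swap[OF finJ, of "%k. (p (fst k), x (snd k))"] bip_swap[OF finI, of "%k. (fst k, x (snd k))"] bip_Hc[OF finJ] bip_Hc[OF finI] 1
  by (intro add_mono Hc_measured) (use pz' in "auto simp: mem_Times_iff")
qed

lemma tri_measured:
 assumes pz: "inj_on (%j. (p j, z j)) J"
 shows "tri (J >< R) (%k. p (fst k)) (%k. x (snd k)) (%k. y (snd k)) (%k. (z (fst k), e (snd k))) (%k. (z (fst k), f (snd k))) (apply_fst I V psi)
  <= tri (I >< R) fst (%k. x (snd k)) (%k. y (snd k)) (%k. e (snd k)) (%k. f (snd k)) psi"
proof -
 have pz': "p j = p j' & z j = z j' <-> j = j'" if "j : J" "j' : J" for j j' using pz that by (auto simp: inj_on_def)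
 have "Hc (J >< R) (%k. (x (snd k), y (snd k))) (%k. (z (fst k), f (snd k))) (%k. (p (fst k), z (fst k), e (snd k))) (apply_fst I V psi)
  <= Hc (I >< R) (%k. (x (snd k), y (snd k))) (%k. f (snd k)) (%k. (fst k, e (snd k))) psi"
  by (rule Hc_measured[where y="%r. (x r, y r)"]) (use pz' in "auto simp: mem_Times_iff")
 moreover have "Hc (J >< R) (%k. x (snd k)) (%k. (z (fst k), e (snd k))) (%k. (p (fst k), y (snd k), z (fst k), f (snd k))) (apply_fst I V psi)
  <= Hc (I >< R) (%k. x (snd k)) (%k. e (snd k)) (%k. (fst k, y (snd k), f (snd k))) psi"
  by (rule Hc_measured[where q="%r. (y r, f r)"]) (use pz' in "auto simp: mem_Times_iff")
 moreover have "Hc (J >< R) (%k. y (snd k)) (%k. (z (fst k), e (snd k))) (%k. (p (fst k), x (snd k), z (fst k), f (snd k))) (apply_fst I V psi)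
  <= Hc (I >< R) (%k. y (snd k)) (%k. e (snd k)) (%k. (fst k, x (snd k), f (snd k))) psi"
  by (rule Hc_measured[where q="%r. (x r, f r)"]) (use pz' in "auto simp: mem_Times_iff")
 ultimately show ?thesis unfolding tri_Hc[OF finJ] tri_Hc[OF finI] by linarith
qed

definition "out = conj_kernel I V (%i i'. SUM r:R. psi (i, r) * cnj (psi (i', r)))"

lemma out_purified: "purifies J R (apply_fst I V psi) out"
 unfolding out_def by (rule purifies_apply) (rule purifies_self[OF fin(3)])

text \<open>A chain rule over the two factors, in which strong subadditivity discards the other half of each conditioning system.\<close>

lemma Hc_channel:
 assumes B: "!!k l. k : J >< R ==> l : J >< R ==> B k = B l <-> y (snd k) = y (snd l) & y2 (fst k) = y2 (fst l)"
  and Q: "!!k l. k : J >< R ==> l : J >< R ==> Q k = Q l <-> q (snd k) = q (snd l) & q2 (fst k) = q2 (fst l)"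
  and E: "!!k l. k : J >< R ==> l : J >< R ==> E k = E l <-> e (snd k) = e (snd l) & e2 (fst k) = e2 (fst l)"
  and injJ: "inj_on (%j. (y2 j, e2 j, q2 j)) J" and injR: "inj_on (%r. (y r, e r, q r)) R"
 shows "Hc (J >< R) B E Q (apply_fst I V psi) <= Hc (I >< R) (%k. y (snd k)) (%k. e (snd k)) (%k. (fst k, q (snd k))) psi + kH J y2 e2 q2 out"
proof -
 let ?phi = "apply_fst I V psi"
 have iJ: "y2 j = y2 j' & e2 j = e2 j' & q2 j = q2 j' <-> j = j'" if "j : J" "j' : J" for j j' using injJ that by (auto simp: inj_on_def)
 have iR: "y j = y j' & e j = e j' & q j = q j' <-> j = j'" if "j : R" "j' : R" for j j' using injR that by (auto simp: inj_on_def)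
 have "Hc (J >< R) B E Q ?phi = Hc (J >< R) (%k. (y (snd k), y2 (fst k))) (%k. (e (snd k), e2 (fst k))) (%k. (q (snd k), q2 (fst k))) ?phi"
  by (rule Hc_view[OF finJ]) (use B Q E in auto)
 also have "... = Hc (J >< R) (%k. y (snd k)) (%k. ((y2 (fst k), e2 (fst k)), e (snd k))) (%k. (q (snd k), q2 (fst k))) ?phi
   + Hc (J >< R) (%k. y2 (fst k)) (%k. (e (snd k), e2 (fst k))) (%k. (y (snd k), q (snd k), q2 (fst k))) ?phi"
 proof -
  have "Sv (J >< R) (%k. ((y (snd k), y2 (fst k)), e (snd k), e2 (fst k))) (%k. (q (snd k), q2 (fst k))) ?phi = Sv (J >< R) (%k. (y (snd k), (y2 (fst k), e2 (fst k)), e (snd k))) (%k. (q (snd k), q2 (fst k))) ?phi"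
   "Sv (J >< R) (%k. ((y2 (fst k), e2 (fst k)), e (snd k))) (%k. (y (snd k), q (snd k), q2 (fst k))) ?phi = Sv (J >< R) (%k. (y2 (fst k), e (snd k), e2 (fst k))) (%k. (y (snd k), q (snd k), q2 (fst k))) ?phi"
   "Sv (J >< R) (%k. (e (snd k), e2 (fst k))) (%k. ((y (snd k), y2 (fst k)), q (snd k), q2 (fst k))) ?phi = Sv (J >< R) (%k. (e (snd k), e2 (fst k))) (%k. (y2 (fst k), y (snd k), q (snd k), q2 (fst k))) ?phi"
   by (rule Sv_view[OF finJ]; auto)+
  thus ?thesis unfolding Hc_def by linarith
 qed
 also have "... <= Hc (J >< R) (%k. y (snd k)) (%k. e (snd k)) (%k. ((y2 (fst k), e2 (fst k)), q (snd k), q2 (fst k))) ?phi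
   + Hc (J >< R) (%k. y2 (fst k)) (%k. e2 (fst k)) (%k. (e (snd k), y (snd k), q (snd k), q2 (fst k))) ?phi"
  by (intro add_mono ssa[OF finJ])
 also have "Hc (J >< R) (%k. y (snd k)) (%k. e (snd k)) (%k. ((y2 (fst k), e2 (fst k)), q (snd k), q2 (fst k))) ?phi
  = Hc (J >< R) (%k. y (snd k)) (%k. e (snd k)) (%k. (fst k, q (snd k))) ?phi"
  by (rule Hc_view[OF finJ]) (use iJ in "auto simp: mem_Times_iff")
 also have "... = Hc (I >< R) (%k. y (snd k)) (%k. e (snd k)) (%k. (fst k, q (snd k))) psi" by (rule Hc_rest)
 also have "Hc (J >< R) (%k. y2 (fst k)) (%k. e2 (fst k)) (%k. (e (snd k), y (snd k), q (snd k), q2 (fst k))) ?phi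
  = Hc (J >< R) (%k. y2 (fst k)) (%k. e2 (fst k)) (%k. (q2 (fst k), snd k)) ?phi"
  by (rule Hc_view[OF finJ]) (use iR in "auto simp: mem_Times_iff")
 also have "... = kH J y2 e2 q2 out" by (rule Hc_kH[OF fin(2) out_purified])
 finally show ?thesis .
qed

text \<open>On the right the channel input \<open>fst k\<close> still belongs to the side of
  \<open>x\<close>, where the sender is. The excess over that value involves the channel output
  alone, purified by all remaining registers.\<close>

lemma bip_channel:
 assumes injJ: "inj_on (%j. (y2 j, x2 j, e2 j, f2 j)) J" and injR: "inj_on (%r. (y r, x r, e r, f r)) R"
 shows "bip (J >< R) (%k. (y (snd k), y2 (fst k))) (%k. (x (snd k), x2 (fst k))) (%k. (e (snd k), e2 (fst k))) (%k. (f (snd k), f2 (fst k))) (apply_fst I V psi)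
  <= bip (I >< R) (%k. y (snd k)) (%k. (fst k, x (snd k))) (%k. e (snd k)) (%k. f (snd k)) psi + kbip J y2 x2 e2 f2 out"
proof -
 have 1: "Hc (I >< R) (%k. y (snd k)) (%k. e (snd k)) (%k. ((fst k, x (snd k)), f (snd k))) psi = Hc (I >< R) (%k. y (snd k)) (%k. e (snd k)) (%k. (fst k, x (snd k), f (snd k))) psi" for e :: "'r => 'u" and f :: "'r => 'v"
  by (rule Hc_view[OF finI]) auto
 have "Hc (J >< R) (%k. (y (snd k), y2 (fst k))) (%k. (e (snd k), e2 (fst k))) (%k. ((x (snd k), x2 (fst k)), f (snd k), f2 (fst k))) (apply_fst I V psi)
  <= Hc (I >< R) (%k. y (snd k)) (%k. e (snd k)) (%k. (fst k, x (snd k), f (snd k))) psi + kH J y2 e2 (%j. (x2 j, f2 j)) out"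
  by (rule Hc_channel[where q="%r. (x r, f r)"]) (use injJ injR in "auto simp: inj_on_def")
 moreover have "Hc (J >< R) (%k. (y (snd k), y2 (fst k))) (%k. (f (snd k), f2 (fst k))) (%k. ((x (snd k), x2 (fst k)), e (snd k), e2 (fst k))) (apply_fst I V psi)
  <= Hc (I >< R) (%k. y (snd k)) (%k. f (snd k)) (%k. (fst k, x (snd k), e (snd k))) psi + kH J y2 f2 (%j. (x2 j, e2 j)) out"
  by (rule Hc_channel[where q="%r. (x r, e r)"]) (use injJ injR in "auto simp: inj_on_def")
 ultimately show ?thesis unfolding bip_Hc[OF finJ] bip_Hc[OF finI] 1 kbip_def by linarith
qed

lemma tri_channel:
 assumes injJ: "inj_on (%j. (y2 j, z2 j, e2 j, f2 j)) J" and injR: "inj_on (%r. (x r, y r, z r, e r, f r)) R"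
 shows "tri (J >< R) (%k. x (snd k)) (%k. (y (snd k), y2 (fst k))) (%k. (z (snd k), z2 (fst k))) (%k. (e (snd k), e2 (fst k))) (%k. (f (snd k), f2 (fst k))) (apply_fst I V psi)
  <= tri (I >< R) (%k. (fst k, x (snd k))) (%k. y (snd k)) (%k. z (snd k)) (%k. e (snd k)) (%k. f (snd k)) psi + ktri J y2 z2 e2 f2 out"
proof -
 have 1: "Hc (I >< R) (%k. y (snd k)) (%k. e (snd k)) (%k. ((fst k, x (snd k)), z (snd k), f (snd k))) psi = Hc (I >< R) (%k. y (snd k)) (%k. e (snd k)) (%k. (fst k, x (snd k), z (snd k), f (snd k))) psi"
  for y :: "'r => 'u" and z :: "'r => 'v" by (rule Hc_view[OF finI]) auto
 have 2: "Hc (I >< R) (%k. (y (snd k), z (snd k))) (%k. f (snd k)) (%k. ((fst k, x (snd k)), e (snd k))) psi = Hc (I >< R) (%k. (y (snd k), z (snd k))) (%k. f (snd k)) (%k. (fst k, x (snd k), e (snd k))) psi"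
  by (rule Hc_view[OF finI]) auto
 have "Hc (J >< R) (%k. (y (snd k), y2 (fst k))) (%k. (e (snd k), e2 (fst k))) (%k. (x (snd k), (z (snd k), z2 (fst k)), f (snd k), f2 (fst k))) (apply_fst I V psi)
  <= Hc (I >< R) (%k. y (snd k)) (%k. e (snd k)) (%k. (fst k, x (snd k), z (snd k), f (snd k))) psi + kH J y2 e2 (%j. (z2 j, f2 j)) out"
  by (rule Hc_channel[where q="%r. (x r, z r, f r)"]) (use injJ injR in "auto simp: inj_on_def")
 moreover have "Hc (J >< R) (%k. (z (snd k), z2 (fst k))) (%k. (e (snd k), e2 (fst k))) (%k. (x (snd k), (y (snd k), y2 (fst k)), f (snd k), f2 (fst k))) (apply_fst I V psi)
  <= Hc (I >< R) (%k. z (snd k)) (%k. e (snd k)) (%k. (fst k, x (snd k), y (snd k), f (snd k))) psi + kH J z2 e2 (%j. (y2 j, f2 j)) out"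
  by (rule Hc_channel[where q="%r. (x r, y r, f r)"]) (use injJ injR in "auto simp: inj_on_def")
 moreover have "Hc (J >< R) (%k. ((y (snd k), y2 (fst k)), z (snd k), z2 (fst k))) (%k. (f (snd k), f2 (fst k))) (%k. (x (snd k), e (snd k), e2 (fst k))) (apply_fst I V psi)
  <= Hc (I >< R) (%k. (y (snd k), z (snd k))) (%k. f (snd k)) (%k. (fst k, x (snd k), e (snd k))) psi + kH J (%j. (y2 j, z2 j)) f2 e2 out"
  by (rule Hc_channel[where y="%r. (y r, z r)" and q="%r. (x r, e r)"]) (use injJ injR in "auto simp: inj_on_def")
 ultimately show ?thesis unfolding tri_Hc[OF finJ] tri_Hc[OF finI] 1 2 ktri_def by linarith
qed

end

section \<open>Kraus operators and purifications of matrices\<close>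

lemma psd_form:
 assumes "A : carrier_mat n n" and "psd A"
 shows "Im (SUM i<n. SUM j<n. cnj (v i) * A $$ (i, j) * v j) = 0" "0 <= Re (SUM i<n. SUM j<n. cnj (v i) * A $$ (i, j) * v j)"
proof -
 let ?q = "(SUM i<n. SUM j<n. cnj (v i) * A $$ (i, j) * v j)"
 have "(SUM i<n. cnj (vec n v $ i) * (A *\<^sub>v vec n v) $ i) = ?q"
  using assms(1) by (intro sum.cong refl) (auto simp: scalar_prod_def sum_distrib_left lessThan_atLeast0 mult.assoc intro!: sum.cong)
 moreover have "ALL w:carrier_vec (dim_row A). Im (SUM i<dim_row A. cnj (w $ i) * (A *\<^sub>v w) $ i) = 0 & 0 <= Re (SUM i<dim_row A. cnj (w $ i) * (A *\<^sub>v w) $ i)"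
  using assms(2) unfolding psd_def Let_def by blast
 hence "Im (SUM i<n. cnj (vec n v $ i) * (A *\<^sub>v vec n v) $ i) = 0 & 0 <= Re (SUM i<n. cnj (vec n v $ i) * (A *\<^sub>v vec n v) $ i)"
  unfolding carrier_matD(1)[OF assms(1)] by (rule bspec) simp
 ultimately show "Im ?q = 0" "0 <= Re ?q"
  by (simp_all only:)
qed

lemma sum_two_points:
 fixes f :: "nat => complex"
 assumes "i < n" "j < n" "i ~= j" "!!k. k ~= i ==> k ~= j ==> f k = 0"
 shows "(SUM k<n. f k) = f i + f j"
proof -
 have "(SUM k<n. f k) = (SUM k:{i, j}. f k)" by (rule sum.mono_neutral_right) (use assms in auto)
 thus ?thesis using assms(3) by simp
qed

text \<open>Positivity includes that the quadratic form is real. Testing it on e_i + c e_j for c =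
  0, 1, -1 and the imaginary unit yields the symmetry of the entries by polarisation.\<close>

lemma psd_hermitian:
 assumes A: "A : carrier_mat n n" "psd A" and ij: "i < n" "j < n"
 shows "cnj (A $$ (i, j)) = A $$ (j, i)"
proof (cases "i = j")
 case True
 define v where "v = (%k. if k = i then 1 else 0 :: complex)"
 have "(SUM k<n. SUM l<n. cnj (v k) * A $$ (k, l) * v l) = (SUM k<n. if k = i then (SUM l<n. if l = i then A $$ (i, i) else 0) else 0)"
  by (intro sum.cong refl) (auto simp: v_def if_distrib[of "%t. _ * t"] cong: if_cong)
 also have "... = A $$ (i, i)" using ij by simp
 finally have "Im (A $$ (i, i)) = 0" using psd_form(1)[OF A, of v] by simp
 thus ?thesis using True by (simp add: complex_eq_iff)
next
 case False
 have q: "Im (A $$ (i, i) + A $$ (i, j) * c + cnj c * A $$ (j, i) + cnj c * A $$ (j, j) * c) = 0" for c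
 proof -
  define v where "v = (%k. if k = i then 1 else if k = j then c else 0)"
  have "(SUM k<n. SUM l<n. cnj (v k) * A $$ (k, l) * v l) = (SUM l<n. cnj (v i) * A $$ (i, l) * v l) + (SUM l<n. cnj (v j) * A $$ (j, l) * v l)"
   by (rule sum_two_points[OF ij False]) (simp add: v_def)
  also have "... = (cnj (v i) * A $$ (i, i) * v i + cnj (v i) * A $$ (i, j) * v j) + (cnj (v j) * A $$ (j, i) * v i + cnj (v j) * A $$ (j, j) * v j)"
   by (intro arg_cong2[where f="(+)"] sum_two_points[OF ij False]) (simp_all add: v_def)
  finally show ?thesis using psd_form(1)[OF A, of v] False by (simp add: v_def)
 qed
 have "Im (A $$ (i, i)) = 0" using q[of 0] by simp
 moreover have "Im (A $$ (j, j)) = 0"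
 proof -
  have "Im (A $$ (i, i) + A $$ (i, j) + A $$ (j, i) + A $$ (j, j)) = 0" "Im (A $$ (i, i) - A $$ (i, j) - A $$ (j, i) + A $$ (j, j)) = 0"
   using q[of 1] q[of "-1"] by simp_all
  thus ?thesis using \<open>Im (A $$ (i, i)) = 0\<close> by simp
 qed
 ultimately have "Im (A $$ (i, j) + A $$ (j, i)) = 0" "Im (A $$ (i, j) * \<i> - \<i> * A $$ (j, i)) = 0"
  using q[of 1] q[of \<i>] by simp_all
 thus ?thesis by (simp add: complex_eq_iff)
qed

lemma psd_purifies:
 assumes A: "A : carrier_mat n n" "psd A"
 shows "EX phi. purifies {..<n} {..<n} phi (%i j. A $$ (i, j))"
proof -
 have "ALL x:{..<n}. ALL y:{..<n}. cnj (A $$ (x, y)) = A $$ (y, x)" using psd_hermitian[OF A] by simp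
 hence "EX r u. specd {..<n} (%i j. A $$ (i, j)) r u" by (rule spectral_theorem[OF finite_lessThan])
 then obtain r u where s: "specd {..<n} (%i j. A $$ (i, j)) r u" by blast
 have r: "0 <= r k" if "k < n" for k
 proof -
  have "(SUM x<n. SUM y<n. cnj (u k x) * A $$ (x, y) * u k y) = of_real (r k)"
   using specd_quadratic[OF s] that by simp
  thus ?thesis using psd_form(2)[OF A, of "u k"] by simp
 qed
 have "purifies {..<n} {..<n} (%(i, k). of_real (sqrt (r k)) * u k i) (%i j. A $$ (i, j))"
  unfolding purifies_def
 proof (intro conjI ballI)
  fix i j assume "i : {..<n}" "j : {..<n}"
  hence "A $$ (i, j) = (SUM k<n. of_real (r k) * u k i * cnj (u k j))" by (rule specdD(3)[OF s])
  also have "... = (SUM p<n. (case (i, p) of (i, k) => of_real (sqrt (r k)) * u k i) * cnj (case (j, p) of (i, k) => of_real (sqrt (r k)) * u k i))"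
  proof (intro sum.cong refl)
   fix k assume "k : {..<n}"
   hence "complex_of_real (r k) = of_real (sqrt (r k)) * of_real (sqrt (r k))"
    using r by (simp only: of_real_mult[symmetric]) simp
   thus "complex_of_real (r k) * u k i * cnj (u k j) = (case (i, k) of (i, k) => of_real (sqrt (r k)) * u k i) * cnj (case (j, k) of (i, k) => of_real (sqrt (r k)) * u k i)"
    by (simp add: mult_ac)
  qed
  finally show "A $$ (i, j) = (SUM p<n. (case (i, p) of (i, k) => of_real (sqrt (r k)) * u k i) * cnj (case (j, p) of (i, k) => of_real (sqrt (r k)) * u k i))" .
 qed simp
 thus ?thesis by blast
qed

lemma purifies_psd:
 assumes A: "A : carrier_mat n n" and P: "purifies {..<n} P phi (%i j. A $$ (i, j))"
 shows "psd A"
 unfolding psd_def Let_def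
proof (intro conjI ballI)
 show "dim_row A = dim_col A" using A by simp
 fix v :: "complex vec" assume v: "v : carrier_vec (dim_row A)"
 let ?q = "(SUM i<dim_row A. cnj (v $ i) * (A *\<^sub>v v) $ i)"
 have "?q = (SUM i<n. SUM j<n. SUM p:P. (cnj (v $ i) * phi (i, p)) * cnj (cnj (v $ j) * phi (j, p)))"
  using A v P by (auto simp: scalar_prod_def sum_distribs lessThan_atLeast0 purifies_def mult_ac intro!: sum.cong)
 also have "... = (SUM p:P. SUM i<n. SUM j<n. (cnj (v $ i) * phi (i, p)) * cnj (cnj (v $ j) * phi (j, p)))"
  by (intro sum.cong refl sum_perm)
 also have "... = (SUM p:P. (SUM i<n. cnj (v $ i) * phi (i, p)) * cnj (SUM j<n. cnj (v $ j) * phi (j, p)))"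
  unfolding cnj_sum sum_product ..
 also have "... = of_real (nsq P (%p. SUM i<n. cnj (v $ i) * phi (i, p)))" by (simp only: cmod_sq of_real_sum)
 finally have e: "?q = of_real (nsq P (%p. SUM i<n. cnj (v $ i) * phi (i, p)))" .
 show "Im ?q = 0" unfolding e by (simp only: Im_complex_of_real)
 show "Re ?q >= 0" unfolding e by (simp only: Re_complex_of_real) (simp add: sum_nonneg)
qed

definition unit_mat :: "nat => nat * nat => complex mat" where
 "unit_mat n p = mat n n (%q. if q = p then 1 else 0)"

text \<open>Linearity is given for combinations of two matrices, so \<open>X\<close> is built up
  entry by entry; the zero matrix is handled as a combination of itself with coefficients 0.\<close>

lemma lin_map_expand:
 assumes L: "lin_map din dout Lam" and X: "X : carrier_mat din din" and uv: "u < dout" "v < dout"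
 shows "Lam X $$ (u, v) = (SUM i<din. SUM j<din. X $$ (i, j) * Lam (unit_mat din (i, j)) $$ (u, v))"
proof -
 define Y where "Y = (%S. mat din din (%q. if q : S then X $$ q else 0))"
 have Yc: "Y S : carrier_mat din din" for S by (simp add: Y_def)
 have Ec: "unit_mat din p : carrier_mat din din" for p by (simp add: unit_mat_def)
 have add: "Lam (a \<cdot>\<^sub>m M + b \<cdot>\<^sub>m M') = a \<cdot>\<^sub>m Lam M + b \<cdot>\<^sub>m Lam M'" if "M : carrier_mat din din" "M' : carrier_mat din din" for a b M M'
  using L that unfolding lin_map_def by blast
 have Lc: "Lam M : carrier_mat dout dout" if "M : carrier_mat din din" for M using L that unfolding lin_map_def by blast
 have "Lam (Y S) $$ (u, v) = (SUM p:S. X $$ p * Lam (unit_mat din p) $$ (u, v))" if "finite S" "S \<subseteq> {..<din} >< {..<din}" for S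
  using that
 proof (induction S rule: finite_induct)
  case empty
  have "Y {} = 0 \<cdot>\<^sub>m Y {} + 0 \<cdot>\<^sub>m Y {}" by (rule eq_matI) (auto simp: Y_def)
  hence "Lam (Y {}) = 0 \<cdot>\<^sub>m Lam (Y {}) + 0 \<cdot>\<^sub>m Lam (Y {})" using add[OF Yc Yc] by metis
  hence "Lam (Y {}) $$ (u, v) = (0 \<cdot>\<^sub>m Lam (Y {}) + 0 \<cdot>\<^sub>m Lam (Y {})) $$ (u, v)" by simp
  also have "... = 0" using Lc[OF Yc, of "{}"] uv by simp
  finally show ?case by simp
 next
  case (insert p S)
  have "Y (insert p S) = X $$ p \<cdot>\<^sub>m unit_mat din p + 1 \<cdot>\<^sub>m Y S"
   by (rule eq_matI) (use insert.hyps in "auto simp: Y_def unit_mat_def")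
  hence "Lam (Y (insert p S)) = X $$ p \<cdot>\<^sub>m Lam (unit_mat din p) + 1 \<cdot>\<^sub>m Lam (Y S)" using add[OF Ec Yc] by metis
  thus ?case using insert Lc[OF Ec, of p] Lc[OF Yc, of S] uv by simp
 qed
 note this[of "{..<din} >< {..<din}"]
 moreover have "Y ({..<din} >< {..<din}) = X" by (rule eq_matI) (use X in "auto simp: Y_def")
 ultimately show ?thesis by (simp add: sum_Times)
qed

lemma divmod3:
 fixes i u j d p :: nat
 assumes "u < d" "j < p"
 shows "((i * d + u) * p + j) div (d * p) = i" "((i * d + u) * p + j) mod p = j" "(((i * d + u) * p + j) div p) mod d = u"
proof -
 show "((i * d + u) * p + j) mod p = j" using assms by simp
 have e: "((i * d + u) * p + j) div p = i * d + u" using assms by simp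
 show "(((i * d + u) * p + j) div p) mod d = u" unfolding e using assms by simp
 have "((i * d + u) * p + j) div (d * p) = (((i * d + u) * p + j) div p) div d"
  by (simp add: div_mult2_eq mult.commute[of d p])
 thus "((i * d + u) * p + j) div (d * p) = i" unfolding e using assms by simp
qed

lemma flat_less2: "i < a ==> u < d ==> i * d + u < a * (d::nat)"
proof -
 assume "i < a" "u < d"
 hence "i * d + u < Suc i * d" by simp
 also have "... <= a * d" using \<open>i < a\<close> by (intro mult_le_mono1) simp
 finally show ?thesis .
qed

lemma flat_less:
 fixes i u j d p a :: nat
 assumes "i < a" "u < d" "j < p"
 shows "(i * d + u) * p + j < a * d * p"
 using assms by (intro flat_less2)

lemma apply_on_entry:
 assumes "pre = prod_list (take k ds)" "dk = ds ! k" "post = prod_list (drop (Suc k) ds)"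
  and "i < pre" "u < d'" "j < post" "i' < pre" "v < d'" "j' < post"
 shows "apply_on ds k Lam d' rho $$ ((i * d' + u) * post + j, (i' * d' + v) * post + j')
  = Lam (mat dk dk (%(u, v). rho $$ ((i * dk + u) * post + j, (i' * dk + v) * post + j'))) $$ (u, v)"
 unfolding apply_on_def Let_def assms(1-3)[symmetric] using assms(4-)
 by (simp add: flat_less divmod3)

text \<open>Choi's theorem: with an ancilla of dimension \<open>din\<close>, complete positivity
  makes the image of the unnormalised maximally entangled projector positive. The columns of a
  purification of this Choi matrix, read as matrices, are the Kraus operators.\<close>

lemma kraus_exists:
 assumes "cp_map din dout Lam"
 shows "EX n K. ALL X:carrier_mat din din. ALL u<dout. ALL v<dout.
   Lam X $$ (u, v) = (SUM y<(n::nat). SUM i<din. SUM j<din. K y u i * X $$ (i, j) * cnj (K y v j))"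
proof -
 have L: "lin_map din dout Lam" using assms by (simp add: cp_map_def)
 define X0 :: "complex mat" where "X0 = mat (din * din) (din * din) (%(i, j). if i div din = i mod din & j div din = j mod din then 1 else 0)"
 have X0: "X0 : carrier_mat (din * din) (din * din)" by (simp add: X0_def)
 have "psd X0"
  by (rule purifies_psd[OF X0, where P="{()}" and phi="%(i, _). if i div din = i mod din then 1 else 0"])
   (auto simp: purifies_def X0_def)
 define C where "C = apply_on [din, din] 1 Lam dout X0"
 have "psd C" using assms X0 \<open>psd X0\<close> unfolding C_def cp_map_def by blast
 have Cc: "C : carrier_mat (din * dout) (din * dout)" by (simp add: C_def apply_on_def Let_def)
 obtain phi where phi: "purifies {..<din * dout} {..<din * dout} phi (%i j. C $$ (i, j))" using psd_purifies[OF Cc \<open>psd C\<close>] by blast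
 define K where "K = (%y u i. phi (i * dout + u, y))"
 have e: "Lam (unit_mat din (i, j)) $$ (u, v) = (SUM y<din * dout. K y u i * cnj (K y v j))" if "i < din" "j < din" "u < dout" "v < dout" for i j u v
 proof -
  have lt: "i * dout + u < din * dout" "j * dout + v < din * dout" using flat_less[of i din u dout 0 1] flat_less[of j din v dout 0 1] that by auto
  have ij: "i * din + i' < din * din" if "i < din" "i' < din" for i i' using flat_less[of i din i' din 0 1] that by auto
  have m: "mat din din (%(u, v). X0 $$ ((i * din + u) * 1 + 0, (j * din + v) * 1 + 0)) = unit_mat din (i, j)"
   by (rule eq_matI) (use that ij in "auto simp: unit_mat_def X0_def")
  have "C $$ ((i * dout + u) * 1 + 0, (j * dout + v) * 1 + 0) = Lam (unit_mat din (i, j)) $$ (u, v)"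
   unfolding C_def m[symmetric] by (rule apply_on_entry) (use that in auto)
  moreover have "C $$ (i * dout + u, j * dout + v) = (SUM y<din * dout. K y u i * cnj (K y v j))"
   using phi lt by (simp add: purifies_def K_def)
  ultimately show ?thesis by simp
 qed
 have "Lam X $$ (u, v) = (SUM y<din * dout. SUM i<din. SUM j<din. K y u i * X $$ (i, j) * cnj (K y v j))"
  if X: "X : carrier_mat din din" and uv: "u < dout" "v < dout" for X u v
 proof -
  have "Lam X $$ (u, v) = (SUM i<din. SUM j<din. SUM y<din * dout. K y u i * X $$ (i, j) * cnj (K y v j))"
   unfolding lin_map_expand[OF L X uv] by (intro sum.cong refl) (simp add: e uv sum_distrib_left mult_ac)
  also have "... = (SUM y<din * dout. SUM i<din. SUM j<din. K y u i * X $$ (i, j) * cnj (K y v j))"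
   by (intro sum.cong refl sum_perm)
  finally show ?thesis .
 qed
 thus ?thesis by blast
qed

section \<open>The four quantities and their monotonicity under LOCC\<close>

definition box :: "nat => nat => nat => (nat * nat * nat) set" where
 "box a b c = {..<a} >< {..<b} >< {..<c}"

lemma finite_box [simp]: "finite (box a b c)"
 by (simp add: box_def)

definition ix :: "nat => nat => nat * nat * nat => nat" where
 "ix b c = (%(x, y, z). (x * b + y) * c + z)"

text \<open>For \<open>psi\<close> pure on ABCEF these are I(B;AC|E), I(C;AB|E), I(A;BC|E) and I(A;B;C|E); exchanging E and F fixes the
 first three and turns the fourth into its tilde version.\<close>

definition qv :: "nat => 'k set => ('k => 'a) => ('k => 'b) => ('k => 'c) => ('k => 'e) => ('k => 'f) => ('k => complex) => real" where
 "qv j K A B C E F psi =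
  (if j = 0 then bip K B (%k. (A k, C k)) E F psi
   else if j = 1 then bip K C (%k. (A k, B k)) E F psi
   else if j = 2 then bip K A (%k. (B k, C k)) E F psi
   else tri K A B C E F psi)"

text \<open>The counterparts for a channel output whose reference plays the part of A. For
  \<open>j = 2\<close> the cut separates BC from the reference alone, hence the unit-valued
  partner.\<close>

definition kq :: "nat => 'j set => ('j => 'b) => ('j => 'c) => ('j => 'e) => ('j => 'f) => ('j => 'j => complex) => real" where
 "kq j J B C E F tau =
  (if j = 0 then kbip J B C E F tau
   else if j = 1 then kbip J C B E F tau
   else if j = 2 then kbip J (%j. (B j, C j)) (%_. ()) E F tau
   else ktri J B C E F tau)"

lemma qv_transport:
 assumes K: "finite K" and g: "bij_betw g K' K" and psi: "!!k. k : K' ==> psi' k = psi (g k)"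
  and v: "!!k l. k : K' ==> l : K' ==> A' k = A' l <-> A (g k) = A (g l)"
  "!!k l. k : K' ==> l : K' ==> B' k = B' l <-> B (g k) = B (g l)"
  "!!k l. k : K' ==> l : K' ==> C' k = C' l <-> C (g k) = C (g l)"
  "!!k l. k : K' ==> l : K' ==> E' k = E' l <-> E (g k) = E (g l)"
  "!!k l. k : K' ==> l : K' ==> F' k = F' l <-> F (g k) = F (g l)"
 shows "qv j K' A' B' C' E' F' psi' = qv j K A B C E F psi"
proof -
 have 1: "bip K' B' (%k. (A' k, C' k)) E' F' psi' = bip K B (%k. (A k, C k)) E F psi"
  by (rule bip_transport[OF K g]; simp add: v psi)
 have 2: "bip K' C' (%k. (A' k, B' k)) E' F' psi' = bip K C (%k. (A k, B k)) E F psi"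
  by (rule bip_transport[OF K g]; simp add: v psi)
 have 3: "bip K' A' (%k. (B' k, C' k)) E' F' psi' = bip K A (%k. (B k, C k)) E F psi"
  by (rule bip_transport[OF K g]; simp add: v psi)
 have 4: "tri K' A' B' C' E' F' psi' = tri K A B C E F psi"
  by (rule tri_transport[OF K g]; simp add: v psi)
 show ?thesis unfolding qv_def by (simp only: 1 2 3 4)
qed

lemma qv_block:
 assumes K: "finite K" and Z: "finite Z" "m ` K \<subseteq> Z"
  and e: "!!k l. k : K ==> l : K ==> E k = E l ==> m k = m l"
  and f: "!!k l. k : K ==> l : K ==> F k = F l ==> m k = m l"
 shows "qv j K A B C E F psi = (SUM c:Z. qv j {k:K. m k = c} A B C E F psi)"
proof -
 have "bip K B (%k. (A k, C k)) E F psi = (SUM c:Z. bip {k:K. m k = c} B (%k. (A k, C k)) E F psi)"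
  by (rule bip_block[OF K Z]) (erule (2) e, erule (2) f)
 moreover have "bip K C (%k. (A k, B k)) E F psi = (SUM c:Z. bip {k:K. m k = c} C (%k. (A k, B k)) E F psi)"
  by (rule bip_block[OF K Z]) (erule (2) e, erule (2) f)
 moreover have "bip K A (%k. (B k, C k)) E F psi = (SUM c:Z. bip {k:K. m k = c} A (%k. (B k, C k)) E F psi)"
  by (rule bip_block[OF K Z]) (erule (2) e, erule (2) f)
 moreover have "tri K A B C E F psi = (SUM c:Z. tri {k:K. m k = c} A B C E F psi)"
  by (rule tri_block[OF K Z]) (erule (2) e, erule (2) f)
 ultimately show ?thesis unfolding qv_def by (cases "j = 0"; cases "j = 1"; cases "j = 2"; simp)
qed

lemma qv_swap12: "finite K ==> qv j K A B C E F psi = qv (if j = 0 then 2 else if j = 2 then 0 else j) K B A C E F psi"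
 using tri_swap12[of K A B C E F psi] bip_view[of K C C "%k. (A k, B k)" "%k. (B k, A k)" E E F F psi] by (auto simp: qv_def)

lemma qv_swap13: "finite K ==> qv j K A B C E F psi = qv (if j = 1 then 2 else if j = 2 then 1 else j) K C B A E F psi"
 using tri_swap13[of K A B C E F psi] bip_view[of K B B "%k. (A k, C k)" "%k. (C k, A k)" E E F F psi]
  bip_view[of K A A "%k. (B k, C k)" "%k. (C k, B k)" E E F F psi] bip_view[of K C C "%k. (A k, B k)" "%k. (B k, A k)" E E F F psi] by (auto simp: qv_def)

context local_isometry
begin

lemma qv_measured:
 assumes pz: "inj_on (%j. (p j, z j)) J"
 shows "qv n (J >< R) (%k. p (fst k)) (%k. B (snd k)) (%k. C (snd k)) (%k. (z (fst k), E (snd k))) (%k. (z (fst k), F (snd k))) (apply_fst I V psi)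
  <= qv n (I >< R) fst (%k. B (snd k)) (%k. C (snd k)) (%k. E (snd k)) (%k. F (snd k)) psi"
proof -
 have 1: "bip (I >< R) (%k. (fst k, ())) (%k. (B (snd k), C (snd k))) (%k. E (snd k)) (%k. F (snd k)) psi = bip (I >< R) fst (%k. (B (snd k), C (snd k))) (%k. E (snd k)) (%k. F (snd k)) psi"
  by (rule bip_view[OF finI]) auto
 have 2: "bip (J >< R) (%k. (p (fst k), ())) (%k. (B (snd k), C (snd k))) (%k. (z (fst k), E (snd k))) (%k. (z (fst k), F (snd k))) phi
  = bip (J >< R) (%k. p (fst k)) (%k. (B (snd k), C (snd k))) (%k. (z (fst k), E (snd k))) (%k. (z (fst k), F (snd k))) phi" for phi
  by (rule bip_view[OF finJ]) auto
 show ?thesis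
  using bip_measured[OF pz, of C B E F] bip_measured[OF pz, of B C E F]
   bip_measured[OF pz, of "%_. ()" "%r. (B r, C r)" E F] tri_measured[OF pz, of B C E F]
  by (simp add: qv_def 1 2 bip_swap[OF finJ, of "%k. B (snd k)"] bip_swap[OF finI, of "%k. B (snd k)"]
   bip_swap[OF finJ, of "%k. C (snd k)"] bip_swap[OF finI, of "%k. C (snd k)"])
qed

lemma qv_channel:
 assumes injJ: "inj_on (%j. (B2 j, C2 j, E2 j, F2 j)) J" and injR: "inj_on (%r. (A r, B r, C r, E r, F r)) R"
 shows "qv n (J >< R) (%k. A (snd k)) (%k. (B (snd k), B2 (fst k))) (%k. (C (snd k), C2 (fst k))) (%k. (E (snd k), E2 (fst k))) (%k. (F (snd k), F2 (fst k))) (apply_fst I V psi)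
  <= qv n (I >< R) (%k. (fst k, A (snd k))) (%k. B (snd k)) (%k. C (snd k)) (%k. E (snd k)) (%k. F (snd k)) psi + kq n J B2 C2 E2 F2 out"
proof -
 let ?F = "(%k. (F (snd k), F2 (fst k)))" and ?E = "(%k. (E (snd k), E2 (fst k)))" and ?V = "apply_fst I V psi"
 consider "n = 0" | "n = 1" | "n = 2" | "n ~= 0" "n ~= 1" "n ~= 2" by blast
 thus ?thesis
proof cases
 case 1
 have "bip (J >< R) (%k. (B (snd k), B2 (fst k))) (%k. ((A (snd k), C (snd k)), C2 (fst k))) ?E ?F (?V)
  <= bip (I >< R) (%k. B (snd k)) (%k. (fst k, A (snd k), C (snd k))) (%k. E (snd k)) (%k. F (snd k)) psi + kbip J B2 C2 E2 F2 out"
  by (rule bip_channel[where x="%r. (A r, C r)"]) (use injJ injR in "auto simp: inj_on_def")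
 moreover have "bip (J >< R) (%k. (B (snd k), B2 (fst k))) (%k. ((A (snd k), C (snd k)), C2 (fst k))) ?E ?F (?V)
  = bip (J >< R) (%k. (B (snd k), B2 (fst k))) (%k. (A (snd k), C (snd k), C2 (fst k))) ?E ?F (?V)"
  by (rule bip_view[OF finJ]) auto
 moreover have "bip (I >< R) (%k. B (snd k)) (%k. (fst k, A (snd k), C (snd k))) (%k. E (snd k)) (%k. F (snd k)) psi
  = bip (I >< R) (%k. B (snd k)) (%k. ((fst k, A (snd k)), C (snd k))) (%k. E (snd k)) (%k. F (snd k)) psi"
  by (rule bip_view[OF finI]) auto
 ultimately show ?thesis using 1 by (simp add: qv_def kq_def)
next
 case 2
 have "bip (J >< R) (%k. (C (snd k), C2 (fst k))) (%k. ((A (snd k), B (snd k)), B2 (fst k))) ?E ?F (?V)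
  <= bip (I >< R) (%k. C (snd k)) (%k. (fst k, A (snd k), B (snd k))) (%k. E (snd k)) (%k. F (snd k)) psi + kbip J C2 B2 E2 F2 out"
  by (rule bip_channel[where x="%r. (A r, B r)"]) (use injJ injR in "auto simp: inj_on_def")
 moreover have "bip (J >< R) (%k. (C (snd k), C2 (fst k))) (%k. ((A (snd k), B (snd k)), B2 (fst k))) ?E ?F (?V)
  = bip (J >< R) (%k. (C (snd k), C2 (fst k))) (%k. (A (snd k), B (snd k), B2 (fst k))) ?E ?F (?V)"
  by (rule bip_view[OF finJ]) auto
 moreover have "bip (I >< R) (%k. C (snd k)) (%k. (fst k, A (snd k), B (snd k))) (%k. E (snd k)) (%k. F (snd k)) psi
  = bip (I >< R) (%k. C (snd k)) (%k. ((fst k, A (snd k)), B (snd k))) (%k. E (snd k)) (%k. F (snd k)) psi"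
  by (rule bip_view[OF finI]) auto
 ultimately show ?thesis using 2 by (simp add: qv_def kq_def)
next
 case 3
 have "bip (J >< R) (%k. ((B (snd k), C (snd k)), (B2 (fst k), C2 (fst k)))) (%k. (A (snd k), ())) ?E ?F (?V)
  <= bip (I >< R) (%k. (B (snd k), C (snd k))) (%k. (fst k, A (snd k))) (%k. E (snd k)) (%k. F (snd k)) psi + kbip J (%j. (B2 j, C2 j)) (%_. ()) E2 F2 out"
  by (rule bip_channel[where y="%r. (B r, C r)"]) (use injJ injR in "auto simp: inj_on_def")
 moreover have "bip (J >< R) (%k. ((B (snd k), C (snd k)), (B2 (fst k), C2 (fst k)))) (%k. (A (snd k), ())) ?E ?F (?V)
  = bip (J >< R) (%k. ((B (snd k), B2 (fst k)), (C (snd k), C2 (fst k)))) (%k. A (snd k)) ?E ?F (?V)"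
  by (rule bip_view[OF finJ]) auto
 ultimately show ?thesis unfolding qv_def kq_def
  using 3 bip_swap[OF finJ, of "%k. ((B (snd k), B2 (fst k)), (C (snd k), C2 (fst k)))" "%k. A (snd k)" "%k. (E (snd k), E2 (fst k))" "%k. (F (snd k), F2 (fst k))" "?V"]
   bip_swap[OF finI, of "%k. (B (snd k), C (snd k))" "%k. (fst k, A (snd k))" "%k. E (snd k)" "%k. F (snd k)" psi] by simp
next
 case 4
 thus ?thesis
  using tri_channel[OF injJ injR] by (simp add: qv_def kq_def)
qed
qed

end

definition qty :: "nat => (nat * nat * nat) set => ('e * 'f) set => ('e * 'f) state => real" where
 "qty j I R psi = qv j (I >< R) (%k. fst (fst k)) (%k. fst (snd (fst k))) (%k. snd (snd (fst k))) (%k. fst (snd k)) (%k. snd (snd k)) psi"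

definition rep :: "nat => nat => nat => complex mat => ('e * 'f) set => ('e * 'f) state => bool" where
 "rep a b c rho R psi <-> rho : carrier_mat (a * b * c) (a * b * c) &
   purifies (box a b c) R psi (%i i'. rho $$ (ix b c i, ix b c i'))"

text \<open>Environment registers are lists that record the history of a protocol, so one type
  serves all rounds. A classical label is prepended to both lists.\<close>

definition tag :: "nat => (nat => (nat list * nat list) set) => (nat list * nat list) set" where
 "tag n R = (%(y, e, f). (y # e, y # f)) ` (SIGMA y:{..<n}. R y)"

lemma finite_tag: "(!!y. y < n ==> finite (R y)) ==> finite (tag n R)"
 by (auto simp: tag_def)

lemma tag_iff: "r : tag n R <-> (EX y e f. r = (y # e, y # f) & y < n & (e, f) : R y)"
 by (force simp: tag_def)

lemma sum_tag:
 assumes "!!y. y < n ==> finite (R y)"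
 shows "(SUM r:tag n R. g r) = (SUM y<n. SUM (e, f):R y. g (y # e, y # f))"
proof -
 have "(SUM r:tag n R. g r) = (SUM (y, e, f):(SIGMA y:{..<n}. R y). g (y # e, y # f))"
  unfolding tag_def by (subst sum.reindex) (auto simp: inj_on_def case_prod_unfold)
 also have "... = (SUM y<n. SUM (e, f):R y. g (y # e, y # f))"
  by (subst sum.Sigma[symmetric]) (use assms in "auto simp: case_prod_unfold")
 finally show ?thesis .
qed

definition merge :: "(nat => 'i * (nat list * nat list) => complex) => 'i * (nat list * nat list) => complex" where
 "merge psi = (%(i, (e, f)). psi (hd e) (i, (tl e, tl f)))"

lemma merge_bij:
 assumes "y < n"
 shows "bij_betw (%(i, (e, f)). (i, (y # e, y # f))) (I >< R y) {k : I >< tag n R. hd (fst (snd k)) = y}"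
 by (rule bij_betwI[where g="%(i, (e, f)). (i, (tl e, tl f))"]) (use assms in "auto simp: tag_iff")

lemma tag_flag: "k : I >< tag n R ==> l : I >< tag n R ==> fst (snd k) = fst (snd l) ==> hd (fst (snd k)) = hd (fst (snd l))"
 "k : I >< tag n R ==> l : I >< tag n R ==> snd (snd k) = snd (snd l) ==> hd (fst (snd k)) = hd (fst (snd l))"
 by (auto simp: tag_iff)

lemma qty_merge:
 assumes I: "finite I" and R: "!!y. y < n ==> finite (R y)"
 shows "qty j I (tag n R) (merge psi) = (SUM y<n. qty j I (R y) (psi y))"
proof -
 let ?K = "I >< tag n R"
 have fK: "finite ?K" using I finite_tag R by blast
 have im: "(%k. hd (fst (snd k))) ` ?K \<subseteq> {..<n}" by (auto simp: tag_iff)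
 have fKc: "finite {k : ?K. hd (fst (snd k)) = y}" for y using fK by simp
 have "qty j I (tag n R) (merge psi) = (SUM y<n. qv j {k : ?K. hd (fst (snd k)) = y} (%k. fst (fst k)) (%k. fst (snd (fst k))) (%k. snd (snd (fst k))) (%k. fst (snd k)) (%k. snd (snd k)) (merge psi))"
  unfolding qty_def by (rule qv_block[OF fK finite_lessThan im]) (rule tag_flag; assumption)+
 also have "... = (SUM y<n. qty j I (R y) (psi y))"
  unfolding qty_def by (intro sum.cong refl qv_transport[OF fKc merge_bij, symmetric]) (auto simp: merge_def)
 finally show ?thesis .
qed

text \<open>The Kraus index is read from the head of the environment list; \<open>tag\<close> has
  put it into both environments, so summing over the environment sums over the Kraus
  operators.\<close>

definition act :: "nat => (nat => nat => nat => complex) => (nat list * nat list) state => (nat list * nat list) state" where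
 "act a K psi = (%((u, v, w), (e, f)). SUM i<a. K (hd e) u i * psi ((i, v, w), (tl e, tl f)))"

text \<open>All Kraus operators of all outcomes form one isometry with output index (u, x, y): new
  system, outcome, Kraus index. Outcome and Kraus index are given to both environments, and the sum
  over outcomes is the block decomposition of the resulting state.\<close>

lemma act_monotone:
 fixes m :: nat
 assumes R: "finite R"
  and K: "!!i i'. i < a ==> i' < a ==> (SUM x<m. SUM y<n x. SUM u<d x. K x y u i * cnj (K x y u i')) = dl i i'"
 shows "(SUM x<m. qty j (box (d x) b c) (tag (n x) (%_. R)) (act a (K x) psi)) <= qty j (box a b c) R psi"
proof -
 define J where "J = (%(x, y, u). (u, x, y)) ` (SIGMA x:{..<m}. SIGMA y:{..<n x}. {..<d x})"
 define V where "V = (%(u, x, y) i. K x y u i)"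
 define R' where "R' = ({..<b} >< {..<c}) >< R"
 define psi0 where "psi0 = (%(i, ((v, w), r)). psi ((i, v, w), r))"
 have fR: "finite R'" using R by (simp add: R'_def)
 have fJ: "finite J" unfolding J_def by (intro finite_imageI finite_SigmaI finite_lessThan)
 have J: "(u, x, y) : J <-> x < m & y < n x & u < d x" for u x y by (force simp: J_def)
 interpret local_isometry "{..<a}" J R' V psi0
 proof
  fix i i' assume i: "i : {..<a}" "i' : {..<a}"
  have "(SUM j:J. V j i * cnj (V j i')) = (SUM (x, y, u):(SIGMA x:{..<m}. SIGMA y:{..<n x}. {..<d x}). K x y u i * cnj (K x y u i'))"
   unfolding J_def by (subst sum.reindex) (auto simp: inj_on_def V_def case_prod_unfold)
  also have "... = (SUM x<m. SUM p:(SIGMA y:{..<n x}. {..<d x}). K x (fst p) (snd p) i * cnj (K x (fst p) (snd p) i'))"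
   by (subst sum.Sigma) (auto simp: case_prod_unfold)
  also have "... = (SUM x<m. SUM y<n x. SUM u<d x. K x y u i * cnj (K x y u i'))"
   by (intro sum.cong refl, subst sum.Sigma) (auto simp: case_prod_unfold)
  finally show "(SUM j:J. V j i * cnj (V j i')) = dl i i'" using K i by simp
 qed (use fJ fR in auto)
 let ?A = "%k. fst (fst k)" and ?B = "%k. fst (fst (snd k))" and ?C = "%k. snd (fst (snd k))"
  and ?E = "%k. (snd (fst k), fst (snd (snd k)))" and ?F = "%k. (snd (fst k), snd (snd (snd k)))"
 let ?K = "%x. {k : J >< R'. fst (snd (fst k)) = x}"
 have "(SUM x<m. qty j (box (d x) b c) (tag (n x) (%_. R)) (act a (K x) psi)) = (SUM x<m. qv j (?K x) ?A ?B ?C ?E ?F (apply_fst {..<a} V psi0))"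
 proof (intro sum.cong refl)
  fix x assume x: "x : {..<m}"
  let ?g = "%((u, v, w), (e, f)). ((u, x, hd e), ((v, w), (tl e, tl f)))"
  have g: "bij_betw ?g (box (d x) b c >< tag (n x) (%_. R)) (?K x)"
   by (rule bij_betwI[where g="%((u, x, y), ((v, w), (e, f))). ((u, v, w), (y # e, y # f))"])
    (use x in "auto simp: box_def tag_iff J R'_def")
  show "qty j (box (d x) b c) (tag (n x) (%_. R)) (act a (K x) psi) = qv j (?K x) ?A ?B ?C ?E ?F (apply_fst {..<a} V psi0)"
   unfolding qty_def
   by (rule qv_transport[OF _ g]) (use finJ in "auto simp: act_def apply_fst_def V_def psi0_def tag_iff")
 qed
 also have "... = qv j (J >< R') ?A ?B ?C ?E ?F (apply_fst {..<a} V psi0)"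
  by (rule qv_block[OF finJ, symmetric]) (auto simp: J)
 also have "... <= qv j ({..<a} >< R') fst ?B ?C (%k. fst (snd (snd k))) (%k. snd (snd (snd k))) psi0"
  by (rule qv_measured) (auto simp: inj_on_def)
 also have "... = qty j (box a b c) R psi"
 proof -
  have g: "bij_betw (%(i, ((v, w), r)). ((i, v, w), r)) ({..<a} >< R') (box a b c >< R)"
   by (rule bij_betwI[where g="%((i, v, w), r). (i, ((v, w), r))"]) (auto simp: box_def R'_def)
  show ?thesis unfolding qty_def
   by (rule qv_transport[OF _ g]) (use R in "auto simp: psi0_def")
 qed
 finally show ?thesis .
qed

lemma msum_carrier:
 assumes "!!x. x < m ==> f x : carrier_mat n n"
 shows "msum n (map f [0..<m]) : carrier_mat n n & (ALL i<n. ALL j<n. msum n (map f [0..<m]) $$ (i, j) = (SUM x<m. f x $$ (i, j)))"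
proof -
 have "foldr (+) (map f xs) (0\<^sub>m n n) : carrier_mat n n & (ALL i<n. ALL j<n. foldr (+) (map f xs) (0\<^sub>m n n) $$ (i, j) = (\<Sum>x\<leftarrow>xs. f x $$ (i, j)))"
  if "ALL x:set xs. f x : carrier_mat n n" for xs
  using that by (induction xs) auto
 from this[of "[0..<m]"] show ?thesis
  using assms unfolding msum_def by (auto simp: interv_sum_list_conv_sum_set_nat lessThan_atLeast0)
qed

lemma kraus_sum:
 assumes R: "finite R"
 shows "(SUM y<n. SUM i<a. SUM j<a'. K y i * (SUM r:R. p i r * cnj (q j r)) * cnj (L y j))
  = (SUM s:tag n (%_. R). (SUM i<a. K (hd (fst s)) i * p i (tl (fst s), tl (snd s))) * cnj (SUM j<a'. L (hd (fst s)) j * q j (tl (fst s), tl (snd s))))"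
proof -
 have "(SUM i<a. SUM j<a'. K y i * (SUM r:R. p i r * cnj (q j r)) * cnj (L y j)) = (SUM r:R. (SUM i<a. K y i * p i r) * cnj (SUM j<a'. L y j * q j r))" for y
 proof -
  have "(SUM i<a. SUM j<a'. K y i * (SUM r:R. p i r * cnj (q j r)) * cnj (L y j)) = (SUM i<a. SUM j<a'. SUM r:R. (K y i * p i r) * cnj (L y j * q j r))"
   by (simp add: sum_distribs mult_ac)
  also have "... = (SUM r:R. SUM i<a. SUM j<a'. (K y i * p i r) * cnj (L y j * q j r))"
   by (intro sum.cong refl sum_perm)
  finally show ?thesis unfolding cnj_sum sum_product .
 qed
 thus ?thesis by (subst sum_tag) (auto simp: R case_prod_unfold)
qed

definition sw12 :: "'r state => 'r state" where
 "sw12 psi = (%((x, y, z), r). psi ((y, x, z), r))"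

definition sw13 :: "'r state => 'r state" where
 "sw13 psi = (%((x, y, z), r). psi ((z, y, x), r))"

lemma sw_invol [simp]: "sw12 (sw12 psi) = psi" "sw13 (sw13 psi) = psi"
 by (auto simp: sw12_def sw13_def)

lemma qty_sw12:
 assumes "finite R"
 shows "qty j (box a b c) R psi = qty (if j = 0 then 2 else if j = 2 then 0 else j) (box b a c) R (sw12 psi)"
proof -
 have g: "bij_betw (%((x, y, z), r). ((y, x, z), r)) (box a b c >< R) (box b a c >< R)"
  by (rule bij_betwI[where g="%((x, y, z), r). ((y, x, z), r)"]) (auto simp: box_def)
 have "qty j (box a b c) R psi = qv j (box b a c >< R) (%k. fst (snd (fst k))) (%k. fst (fst k)) (%k. snd (snd (fst k))) (%k. fst (snd k)) (%k. snd (snd k)) (sw12 psi)"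
  unfolding qty_def by (rule qv_transport[OF _ g]) (use assms in "auto simp: sw12_def")
 also have "... = qty (if j = 0 then 2 else if j = 2 then 0 else j) (box b a c) R (sw12 psi)"
  unfolding qty_def by (rule qv_swap12) (use assms in simp)
 finally show ?thesis .
qed

lemma qty_sw13:
 assumes "finite R"
 shows "qty j (box a b c) R psi = qty (if j = 1 then 2 else if j = 2 then 1 else j) (box c b a) R (sw13 psi)"
proof -
 have g: "bij_betw (%((x, y, z), r). ((z, y, x), r)) (box a b c >< R) (box c b a >< R)"
  by (rule bij_betwI[where g="%((x, y, z), r). ((z, y, x), r)"]) (auto simp: box_def)
 have "qty j (box a b c) R psi = qv j (box c b a >< R) (%k. snd (snd (fst k))) (%k. fst (snd (fst k))) (%k. fst (fst k)) (%k. fst (snd k)) (%k. snd (snd k)) (sw13 psi)"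
  unfolding qty_def by (rule qv_transport[OF _ g]) (use assms in "auto simp: sw13_def")
 also have "... = qty (if j = 1 then 2 else if j = 2 then 1 else j) (box c b a) R (sw13 psi)"
  unfolding qty_def by (rule qv_swap13) (use assms in simp)
 finally show ?thesis .
qed

definition boxl :: "nat list => (nat * nat * nat) set" where
 "boxl ds = box (ds ! 0) (ds ! 1) (ds ! 2)"

definition repl :: "nat list => complex mat => (nat list * nat list) set => (nat list * nat list) state => bool" where
 "repl ds rho R psi <-> length ds = 3 & rep (ds ! 0) (ds ! 1) (ds ! 2) rho R psi"

text \<open>The operations of the other two parties are reduced to those of party 0 by exchanging
  factors; the four quantities are permuted accordingly by \<open>qty_sw12\<close> and
  \<open>qty_sw13\<close>.\<close>

definition actp :: "nat => nat => (nat => nat => nat => complex) => (nat list * nat list) state => (nat list * nat list) state" where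
 "actp p d K psi = (if p = 0 then act d K psi else if p = 1 then sw12 (act d K (sw12 psi)) else sw13 (act d K (sw13 psi)))"

lemma length3: "length ds = 3 <-> (EX a b c. ds = [a, b, c])"
 by (auto simp: length_Suc_conv numeral_3_eq_3)

lemma actp_monotone:
 fixes m :: nat
 assumes ds: "length ds = 3" "p < 3" and R: "finite R"
  and K: "!!i i'. i < ds ! p ==> i' < ds ! p ==> (SUM x<m. SUM y<n x. SUM u<d x. K x y u i * cnj (K x y u i')) = dl i i'"
 shows "(SUM x<m. qty j (boxl (ds[p := d x])) (tag (n x) (%_. R)) (actp p (ds ! p) (K x) psi)) <= qty j (boxl ds) R psi"
proof -
 obtain a b c where abc: "ds = [a, b, c]" using ds(1) unfolding length3 by blast
 have fT: "finite (tag (n x) (%_. R))" for x by (intro finite_tag R)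
 consider "p = 0" | "p = 1" | "p = 2" using ds(2) by linarith
 thus ?thesis
 proof cases
  case 1
  have "(SUM x<m. qty j (box (d x) b c) (tag (n x) (%_. R)) (act a (K x) psi)) <= qty j (box a b c) R psi"
   by (rule act_monotone[OF R]) (use K 1 abc in auto)
  thus ?thesis using 1 by (simp add: abc boxl_def actp_def)
 next
  case 2
  let ?j = "if j = 0 then 2 else if j = 2 then 0 else j"
  have "(SUM x<m. qty ?j (box (d x) a c) (tag (n x) (%_. R)) (act b (K x) (sw12 psi))) <= qty ?j (box b a c) R (sw12 psi)"
   by (rule act_monotone[OF R]) (use K 2 abc in auto)
  thus ?thesis using 2 by (simp add: abc boxl_def actp_def qty_sw12[OF R, of j a b c] qty_sw12[OF fT, of j a])
 next
  case 3
  let ?j = "if j = 1 then 2 else if j = 2 then 1 else j"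
  have "(SUM x<m. qty ?j (box (d x) b a) (tag (n x) (%_. R)) (act c (K x) (sw13 psi))) <= qty ?j (box c b a) R (sw13 psi)"
   by (rule act_monotone[OF R]) (use K 3 abc in auto)
  thus ?thesis using 3 by (simp add: abc boxl_def actp_def qty_sw13[OF R, of j a b c] qty_sw13[OF fT, of j a])
 qed
qed

lemma actp_rep:
 assumes r: "repl ds rho R psi" and p: "p < 3"
  and K: "ALL X:carrier_mat (ds ! p) (ds ! p). ALL u<d. ALL v<d. Lam X $$ (u, v) = (SUM y<n. SUM i<ds ! p. SUM j<ds ! p. K y u i * X $$ (i, j) * cnj (K y v j))"
 shows "repl (ds[p := d]) (apply_on ds p Lam d rho) (tag n (%_. R)) (actp p (ds ! p) K psi)"
proof -
 have "length ds = 3" using r by (simp add: repl_def)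
 then obtain a b c where abc: "ds = [a, b, c]" unfolding length3 by blast
 have P: "purifies (box a b c) R psi (%i i'. rho $$ (ix b c i, ix b c i'))" and R: "finite R"
  using r by (auto simp: repl_def rep_def abc purifies_def)
 have ent: "rho $$ ((x * b + y) * c + z, (x' * b + y') * c + z') = (SUM r:R. psi ((x, y, z), r) * cnj (psi ((x', y', z'), r)))"
  if "x < a" "y < b" "z < c" "x' < a" "y' < b" "z' < c" for x y z x' y' z'
  using P that by (auto simp: purifies_def box_def ix_def)
 have fT: "finite (tag n (%_. R))" by (intro finite_tag R)
 consider "p = 0" | "p = 1" | "p = 2" using p by linarith
 thus ?thesis
 proof cases
  case 1
  have "apply_on [a, b, c] 0 Lam d rho $$ ((u * b + y) * c + z, (v * b + y') * c + z')
   = (SUM s:tag n (%_. R). act a K psi ((u, y, z), s) * cnj (act a K psi ((v, y', z'), s)))"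
   if h: "u < d" "y < b" "z < c" "v < d" "y' < b" "z' < c" for u y z v y' z'
  proof -
   have l: "y * c + z < b * c" "y' * c + z' < b * c" using h by (auto intro: flat_less2)
   have i: "(u * b + y) * c + z = (0 * d + u) * (b * c) + (y * c + z)" for u y z by (simp add: algebra_simps)
   have i2: "(0 * a + u) * (b * c) + (y * c + z) = (u * b + y) * c + z" for u y z by (simp add: algebra_simps)
   have "apply_on [a, b, c] 0 Lam d rho $$ ((u * b + y) * c + z, (v * b + y') * c + z')
    = Lam (mat a a (%(u, v). rho $$ ((0 * a + u) * (b * c) + (y * c + z), (0 * a + v) * (b * c) + (y' * c + z')))) $$ (u, v)"
    unfolding i by (rule apply_on_entry) (use h l in auto)
   also have "... = (SUM k<n. SUM i<a. SUM j<a. K k u i * (SUM r:R. psi ((i, y, z), r) * cnj (psi ((j, y', z'), r))) * cnj (K k v j))"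
    unfolding i2 using K h 1 abc ent by simp
   also have "... = (SUM s:tag n (%_. R). act a K psi ((u, y, z), s) * cnj (act a K psi ((v, y', z'), s)))"
    by (subst kraus_sum[OF R]) (simp add: act_def case_prod_unfold)
   finally show ?thesis .
  qed
  thus ?thesis using fT
   by (auto simp: repl_def rep_def abc 1 actp_def purifies_def box_def ix_def) (simp add: apply_on_def Let_def mult.assoc)
 next
  case 2
  have "apply_on [a, b, c] 1 Lam d rho $$ ((x * d + u) * c + z, (x' * d + v) * c + z')
   = (SUM s:tag n (%_. R). sw12 (act b K (sw12 psi)) ((x, u, z), s) * cnj (sw12 (act b K (sw12 psi)) ((x', v, z'), s)))"
   if h: "x < a" "u < d" "z < c" "x' < a" "v < d" "z' < c" for u x z v x' z'
  proof -
   have "apply_on [a, b, c] 1 Lam d rho $$ ((x * d + u) * c + z, (x' * d + v) * c + z')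
    = Lam (mat b b (%(u, v). rho $$ ((x * b + u) * c + z, (x' * b + v) * c + z'))) $$ (u, v)"
    by (rule apply_on_entry) (use h in auto)
   also have "... = (SUM k<n. SUM i<b. SUM j<b. K k u i * (SUM r:R. psi ((x, i, z), r) * cnj (psi ((x', j, z'), r))) * cnj (K k v j))"
    using K h 2 abc ent by simp
   also have "... = (SUM s:tag n (%_. R). sw12 (act b K (sw12 psi)) ((x, u, z), s) * cnj (sw12 (act b K (sw12 psi)) ((x', v, z'), s)))"
    by (subst kraus_sum[OF R]) (simp add: act_def sw12_def case_prod_unfold)
   finally show ?thesis .
  qed
  thus ?thesis using fT
   by (auto simp: repl_def rep_def abc 2 actp_def purifies_def box_def ix_def) (simp add: apply_on_def Let_def mult.assoc)
 next
  case 3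
  have "apply_on [a, b, c] 2 Lam d rho $$ ((x * b + y) * d + u, (x' * b + y') * d + v)
   = (SUM s:tag n (%_. R). sw13 (act c K (sw13 psi)) ((x, y, u), s) * cnj (sw13 (act c K (sw13 psi)) ((x', y', v), s)))"
   if h: "x < a" "y < b" "u < d" "x' < a" "y' < b" "v < d" for u x y v x' y'
  proof -
   have l: "x * b + y < a * b" "x' * b + y' < a * b" using h by (auto intro: flat_less2)
   have i: "(x * b + y) * d + u = ((x * b + y) * d + u) * 1 + 0" for x y u by simp
   have "apply_on [a, b, c] 2 Lam d rho $$ (((x * b + y) * d + u) * 1 + 0, ((x' * b + y') * d + v) * 1 + 0)
    = Lam (mat c c (%(u, v). rho $$ (((x * b + y) * c + u) * 1 + 0, ((x' * b + y') * c + v) * 1 + 0))) $$ (u, v)"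
    by (rule apply_on_entry) (use h l in "auto simp: numeral_2_eq_2")
   also have "... = (SUM k<n. SUM i<c. SUM j<c. K k u i * (SUM r:R. psi ((x, y, i), r) * cnj (psi ((x', y', j), r))) * cnj (K k v j))"
    using K h 3 abc ent by simp
   also have "... = (SUM s:tag n (%_. R). sw13 (act c K (sw13 psi)) ((x, y, u), s) * cnj (sw13 (act c K (sw13 psi)) ((x', y', v), s)))"
    by (subst kraus_sum[OF R]) (simp add: act_def sw13_def case_prod_unfold)
   finally show ?thesis by simp
  qed
  thus ?thesis using fT
   by (auto simp: repl_def rep_def abc 3 actp_def purifies_def box_def ix_def numeral_2_eq_2) (simp add: apply_on_def Let_def mult.assoc numeral_2_eq_2)
 qed
qed

text \<open>Induction on the protocol tree. The branches are purified separately and merged with the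
  outcome as a label in both environments, so the value of the merged state is the sum over the
  branches.\<close>

lemma locc_monotone:
 assumes "locc ds ds' L" and "repl ds rho R psi"
 shows "EX R' psi'. repl ds' (L rho) R' psi' & (ALL j. qty j (boxl ds') R' psi' <= qty j (boxl ds) R psi)"
 using assms
proof (induction arbitrary: rho R psi rule: locc.induct)
 case (locc_id ds)
 show ?case
 proof (rule exI[of _ R], rule exI[of _ psi], rule conjI)
  show "repl ds rho R psi" by (rule locc_id)
  show "ALL j. qty j (boxl ds) R psi <= qty j (boxl ds) R psi" by (rule allI) (rule order_refl)
 qed
next
 case (locc_round p ds m d' E ds' L)
 have len: "length ds = 3" by (rule conjunct1[OF locc_round.prems[unfolded repl_def]])
 have R: "finite R" by (rule conjunct1[OF conjunct2[OF conjunct2[OF locc_round.prems[unfolded repl_def rep_def purifies_def]]]])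
 have p: "p < 3" using locc_round.hyps(1) len by simp
 let ?d = "ds ! p"
 let ?K = "%n K x. ALL X:carrier_mat ?d ?d. ALL u<d' x. ALL v<d' x. E x X $$ (u, v) = (SUM y<(n::nat). SUM i<?d. SUM j<?d. K y u i * X $$ (i, j) * cnj (K y v j))"
 have "ALL x:{..<m}. EX n K. ?K n K x"
  by (intro ballI kraus_exists) (use locc_round.hyps(3) in blast)
 then obtain n K where nK: "ALL x:{..<m}. ?K (n x) (K x) x" unfolding bchoice_iff by (elim exE)
 have K: "?K (n x) (K x) x" if "x < m" for x using nK that by simp
 have Ec: "E x X : carrier_mat (d' x) (d' x)" if "x < m" "X : carrier_mat ?d ?d" for x X
  using locc_round.hyps(3)[rule_format, OF that(1)] that(2) unfolding cp_map_def lin_map_def by blast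
 \<comment> \<open>Trace preservation of the instrument, evaluated on matrix units, is the
   completeness relation of its Kraus operators.\<close>
 have comp: "(SUM x<m. SUM y<n x. SUM u<d' x. K x y u i * cnj (K x y u i')) = dl i i'" if i: "i < ?d" "i' < ?d" for i i'
 proof -
  let ?X = "unit_mat ?d (i, i')"
  have X: "?X : carrier_mat ?d ?d" by (simp add: unit_mat_def)
  have "cmtrace (E x ?X) = (SUM y<n x. SUM u<d' x. K x y u i * cnj (K x y u i'))" if x: "x < m" for x
  proof -
   have "cmtrace (E x ?X) = (SUM u<d' x. SUM y<n x. SUM k<?d. SUM l<?d. K x y u k * ?X $$ (k, l) * cnj (K x y u l))"
    using Ec[OF x X] K[OF x] X by (simp add: cmtrace_def)
   also have "... = (SUM u<d' x. SUM y<n x. SUM k<?d. SUM l<?d. if k = i then if l = i' then K x y u i * cnj (K x y u i') else 0 else 0)"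
    by (intro sum.cong refl) (auto simp: unit_mat_def)
   also have "... = (SUM u<d' x. SUM y<n x. SUM k<?d. if k = i then K x y u i * cnj (K x y u i') else 0)"
    using i by (intro sum.cong refl) auto
   also have "... = (SUM u<d' x. SUM y<n x. K x y u i * cnj (K x y u i'))" using i by simp
   finally show ?thesis by (subst (asm) sum.swap)
  qed
  hence "(SUM x<m. SUM y<n x. SUM u<d' x. K x y u i * cnj (K x y u i')) = (SUM x<m. cmtrace (E x ?X))" by simp
  also have "... = cmtrace ?X" by (rule locc_round.hyps(4)[rule_format, OF X])
  also have "... = (SUM k<?d. if k = i then if i = i' then 1 else 0 else 0)" unfolding cmtrace_def by (rule sum.cong) (auto simp: unit_mat_def)
  also have "... = dl i i'" using i by simp
  finally show ?thesis .
 qed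
 have step: "repl (ds[p := d' x]) (apply_on ds p (E x) (d' x) rho) (tag (n x) (%_. R)) (actp p ?d (K x) psi)" if "x < m" for x
  by (rule actp_rep[OF locc_round.prems p K[OF that]])
 let ?L = "%x. L x (apply_on ds p (E x) (d' x) rho)"
 let ?S = "%R' psi' x. repl ds' (?L x) R' psi' & (ALL j. qty j (boxl ds') R' psi' <= qty j (boxl (ds[p := d' x])) (tag (n x) (%_. R)) (actp p ?d (K x) psi))"
 have "ALL x:{..<m}. EX R' psi'. ?S R' psi' x"
 proof
  fix x assume "x : {..<m}"
  hence x: "x < m" by simp
  from locc_round.IH[rule_format, OF x] have "!!rho R psi. repl (ds[p := d' x]) rho R psi ==> EX R' psi'. repl ds' (L x rho) R' psi' & (ALL j. qty j (boxl ds') R' psi' <= qty j (boxl (ds[p := d' x])) R psi)" by blast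
  from this[OF step[OF x]] show "EX R' psi'. ?S R' psi' x" .
 qed
 then obtain R' psi' where S: "ALL x:{..<m}. ?S (R' x) (psi' x) x" unfolding bchoice_iff by (elim exE)
 have S1: "repl ds' (?L x) (R' x) (psi' x)"
  and S2: "qty j (boxl ds') (R' x) (psi' x) <= qty j (boxl (ds[p := d' x])) (tag (n x) (%_. R)) (actp p ?d (K x) psi)" if "x < m" for x j
  using S that by simp_all
 have "length ds' = 3" using S1[OF \<open>0 < m\<close>] by (simp add: repl_def)
 then obtain a b c where abc: "ds' = [a, b, c]" unfolding length3 by blast
 have fR': "finite (R' x)" if "x < m" for x using S1[OF that] by (auto simp: repl_def rep_def purifies_def)
 have carr: "?L x : carrier_mat (a * b * c) (a * b * c)" if "x < m" for x
  using S1[OF that] by (auto simp: repl_def rep_def abc)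
 let ?M = "msum (prod_list ds') (map ?L [0..<m])"
 have pl: "prod_list ds' = a * b * c" by (simp add: abc)
 have M: "?M : carrier_mat (a * b * c) (a * b * c)"
  "!!i j. i < a * b * c ==> j < a * b * c ==> ?M $$ (i, j) = (SUM x<m. ?L x $$ (i, j))"
  using msum_carrier[of m ?L "a * b * c", OF carr] unfolding pl by auto
 have "purifies (box a b c) (tag m R') (merge psi') (%i i'. ?M $$ (ix b c i, ix b c i'))"
  unfolding purifies_def
 proof (intro conjI ballI finite_tag fR')
  fix i i' assume i: "i : box a b c" "i' : box a b c"
  have lt: "ix b c i < a * b * c" "ix b c i' < a * b * c" using i by (auto simp: box_def ix_def flat_less)
  have "?M $$ (ix b c i, ix b c i') = (SUM x<m. ?L x $$ (ix b c i, ix b c i'))" by (rule M(2)[OF lt])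
  also have "... = (SUM x<m. SUM r:R' x. psi' x (i, r) * cnj (psi' x (i', r)))"
   by (intro sum.cong refl) (use S1 i in "auto simp: repl_def rep_def purifies_def abc")
  also have "... = (SUM r:tag m R'. merge psi' (i, r) * cnj (merge psi' (i', r)))"
   by (subst sum_tag[OF fR']) (auto simp: merge_def case_prod_unfold)
  finally show "?M $$ (ix b c i, ix b c i') = (SUM r:tag m R'. merge psi' (i, r) * cnj (merge psi' (i', r)))" .
 qed
 hence "repl ds' ?M (tag m R') (merge psi')" using M(1) by (simp add: repl_def rep_def abc)
 moreover have "qty j (boxl ds') (tag m R') (merge psi') <= qty j (boxl ds) R psi" for j
 proof -
  have "qty j (boxl ds') (tag m R') (merge psi') = (SUM x<m. qty j (boxl ds') (R' x) (psi' x))"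
   by (rule qty_merge) (use fR' in "auto simp: boxl_def")
  also have "... <= (SUM x<m. qty j (boxl (ds[p := d' x])) (tag (n x) (%_. R)) (actp p ?d (K x) psi))"
   by (intro sum_mono S2) simp
  also have "... <= qty j (boxl ds) R psi" by (rule actp_monotone[OF len p R comp])
  finally show ?thesis .
 qed
 ultimately show ?case by blast
qed

section \<open>Mixed-radix digits and entries of reordered matrices\<close>

lemma undigits_less: "list_all2 (<) xs ds ==> undigits ds xs < prod_list ds"
proof (induction ds arbitrary: xs)
 case (Cons d ds)
 then obtain y ys where "xs = y # ys" "y < d" "list_all2 (<) ys ds" by (auto simp: list_all2_Cons2)
 thus ?case using Cons.IH[of ys] flat_less2[of y d "undigits ds ys" "prod_list ds"] by simp
qed simp

text \<open>The multiple of \<open>prod_list ds\<close> is carried along for the induction: the tail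
  is decoded from a number that still contains the leading digits.\<close>

lemma digits_undigits: "list_all2 (<) xs ds ==> digits ds (undigits ds xs + k * prod_list ds) = xs"
proof (induction ds arbitrary: xs k)
 case (Cons d ds)
 then obtain y ys where xs: "xs = y # ys" "y < d" "list_all2 (<) ys ds" by (auto simp: list_all2_Cons2)
 have e: "undigits (d # ds) xs + k * prod_list (d # ds) = undigits ds ys + (y + k * d) * prod_list ds"
  by (simp add: xs algebra_simps)
 have "undigits ds ys < prod_list ds" by (rule undigits_less[OF xs(3)])
 hence "(undigits ds ys + (y + k * d) * prod_list ds) div prod_list ds = y + k * d"
  using div_mult_self1[of "prod_list ds" "undigits ds ys" "y + k * d"] by (metis add_0_right div_less not_less_zero)
 hence "(undigits ds ys + (y + k * d) * prod_list ds) div prod_list ds mod d = y" using xs(2) by simp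
 thus ?case unfolding e using Cons.IH[OF xs(3), of "y + k * d"] by (simp add: xs)
qed simp

lemma undigits_digits: "undigits ds (digits ds i) = i mod prod_list ds"
proof (induction ds)
 case (Cons d ds)
 have "i mod (d * prod_list ds) = prod_list ds * (i div prod_list ds mod d) + i mod prod_list ds"
  by (metis mod_mult2_eq mult.commute)
 thus ?case using Cons by (simp add: mult.commute)
qed simp

lemma digits_valid: "0 < prod_list ds ==> list_all2 (<) (digits ds i) ds"
 by (induction ds) auto

lemma least_nth: "distinct \<pi> ==> i < length \<pi> ==> (LEAST k. \<pi> ! k = \<pi> ! i) = i"
proof (rule Least_equality)
 fix y assume "distinct \<pi>" "i < length \<pi>" "\<pi> ! y = \<pi> ! i"
 thus "i <= y" by (cases "y < length \<pi>") (auto simp: nth_eq_iff_index_eq)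
qed simp

lemma prod_list_perm:
 fixes ds :: "nat list"
 assumes "mset \<pi> = mset [0..<length ds]"
 shows "prod_list (map ((!) ds) \<pi>) = prod_list ds"
proof -
 have "prod_list (map ((!) ds) \<pi>) = prod_mset (image_mset ((!) ds) (mset \<pi>))"
  by (simp only: mset_map[symmetric] prod_mset_prod_list)
 also have "... = prod_mset (mset (map ((!) ds) [0..<length ds]))" unfolding assms by simp
 also have "... = prod_list ds" by (simp only: map_nth prod_mset_prod_list)
 finally show ?thesis .
qed

lemma perm_state_entry:
 assumes \<pi>: "mset \<pi> = mset [0..<length ds]" and xs: "list_all2 (<) xs ds" and ys: "list_all2 (<) ys ds"
 shows "perm_state ds \<pi> rho $$ (undigits (map ((!) ds) \<pi>) (map ((!) xs) \<pi>), undigits (map ((!) ds) \<pi>) (map ((!) ys) \<pi>))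
  = rho $$ (undigits ds xs, undigits ds ys)"
proof -
 have set: "set \<pi> = {0..<length ds}" using mset_eq_setD[OF \<pi>] by simp
 have d: "distinct \<pi>" using mset_eq_imp_distinct_iff[OF \<pi>] by simp
 let ?ds = "map ((!) ds) \<pi>"
 have v: "list_all2 (<) (map ((!) zs) \<pi>) ?ds" if "list_all2 (<) zs ds" for zs
  using that set nth_mem[of _ \<pi>] by (fastforce simp: list_all2_conv_all_nth)
 have lt: "undigits ?ds (map ((!) zs) \<pi>) < prod_list ds" if "list_all2 (<) zs ds" for zs
  using undigits_less[OF v[OF that]] unfolding prod_list_perm[OF \<pi>] .
 have dg: "digits ?ds (undigits ?ds (map ((!) zs) \<pi>)) = map ((!) zs) \<pi>" if "list_all2 (<) zs ds" for zs
  using digits_undigits[OF v[OF that], of 0] by simp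
 have old: "map (%p. map ((!) zs) \<pi> ! (LEAST k. \<pi> ! k = p)) [0..<length ds] = zs" if z: "list_all2 (<) zs ds" for zs
 proof (rule nth_equalityI)
  show l: "length (map (%p. map ((!) zs) \<pi> ! (LEAST k. \<pi> ! k = p)) [0..<length ds]) = length zs" using z by (simp add: list_all2_lengthD)
  fix p assume "p < length (map (%p. map ((!) zs) \<pi> ! (LEAST k. \<pi> ! k = p)) [0..<length ds])"
  hence p: "p < length ds" by simp
  hence "p : set \<pi>" using set by simp
  then obtain i where i: "i < length \<pi>" "\<pi> ! i = p" by (auto simp: in_set_conv_nth)
  thus "map (%p. map ((!) zs) \<pi> ! (LEAST k. \<pi> ! k = p)) [0..<length ds] ! p = zs ! p"
   using p least_nth[OF d i(1)] by simp
 qed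
 show ?thesis unfolding perm_state_def Let_def using lt[OF xs] lt[OF ys] by (simp add: dg[OF xs] dg[OF ys] old[OF xs] old[OF ys])
qed

text \<open>The channel output stands in front, in the order B C A' b c; the permutation 2, 3, 0, 4,
  1 puts each new output behind the old register of its owner, giving A' b B c C.\<close>

lemma chan_step_entry:
 assumes "x < a'" "y < b" "z < c" "y2 < dB" "z2 < dC" "x' < a'" "y' < b" "z' < c" "y2' < dB" "z2' < dC"
 shows "chan_step N dA dB dC a' b c rho $$ (ix (b * dB) (c * dC) (x, y * dB + y2, z * dC + z2), ix (b * dB) (c * dC) (x', y' * dB + y2', z' * dC + z2'))
  = N (mat dA dA (%(u, v). rho $$ (ix b c (u * a' + x, y, z), ix b c (v * a' + x', y', z')))) $$ (y2 * dC + z2, y2' * dC + z2')"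
proof -
 let ?ds = "[dB, dC, a', b, c]" and ?\<pi> = "[2, 3, 0, 4, 1::nat]"
 have \<pi>: "mset ?\<pi> = mset [0..<length ?ds]" by (simp add: upt_rec numeral_eq_Suc add_mset_commute)
 have new: "undigits (map ((!) ?ds) ?\<pi>) (map ((!) [y2, z2, x, y, z]) ?\<pi>) = ix (b * dB) (c * dC) (x, y * dB + y2, z * dC + z2)" for x y z y2 z2
  by (simp add: ix_def algebra_simps)
 have old: "undigits ?ds [y2, z2, x, y, z] = (0 * (dB * dC) + (y2 * dC + z2)) * (a' * (b * c)) + ((x * b + y) * c + z)" for x y z y2 z2
  by (simp add: algebra_simps)
 have mid: "(0 * dA + u) * (a' * (b * c)) + ((x * b + y) * c + z) = ix b c (u * a' + x, y, z)" for u x y z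
  by (simp add: ix_def algebra_simps)
 have lt: "(x * b + y) * c + z < a' * (b * c)" "(x' * b + y') * c + z' < a' * (b * c)"
  using assms flat_less[of x a' y b z c] flat_less[of x' a' y' b z' c] by (simp_all add: mult.assoc)
 have "chan_step N dA dB dC a' b c rho $$ (ix (b * dB) (c * dC) (x, y * dB + y2, z * dC + z2), ix (b * dB) (c * dC) (x', y' * dB + y2', z' * dC + z2'))
  = apply_on [dA, a', b, c] 0 N (dB * dC) rho $$ (undigits ?ds [y2, z2, x, y, z], undigits ?ds [y2', z2', x', y', z'])"
  unfolding new[symmetric] chan_step_def by (rule perm_state_entry[OF \<pi>]) (use assms in auto)
 also have "... = N (mat dA dA (%(u, v). rho $$ ((0 * dA + u) * (a' * (b * c)) + ((x * b + y) * c + z), (0 * dA + v) * (a' * (b * c)) + ((x' * b + y') * c + z')))) $$ (y2 * dC + z2, y2' * dC + z2')"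
  unfolding old by (rule apply_on_entry) (use assms lt in "auto intro: flat_less2")
 finally show ?thesis unfolding mid .
qed

lemma sum_flat2: "(SUM x<a * b. f x) = (SUM i<a. SUM j<b. f (i * b + j))" for a b :: nat
proof -
 have "(SUM x<a * b. f x) = (SUM i<a. sum f {i * b..<i * b + b})" by (rule sum.nat_group[symmetric])
 also have "... = (SUM i<a. SUM j<b. f (i * b + j))"
 proof (rule sum.cong[OF refl])
  fix i
  show "sum f {i * b..<i * b + b} = (SUM j<b. f (i * b + j))"
   by (rule sum.reindex_bij_witness[where i="%j. i * b + j" and j="%x. x - i * b"]) auto
 qed
 finally show ?thesis .
qed

lemma prod_list_split: "k < length ds ==> prod_list (ds[k := d]) = prod_list (take k ds) * d * prod_list (drop (Suc k) ds)" for ds :: "nat list"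
 by (simp add: upd_conv_take_nth_drop mult.assoc)

lemma cmtrace_apply_on:
 fixes ds :: "nat list" and m :: nat
 assumes k: "k < length ds" and rho: "rho : carrier_mat (prod_list ds) (prod_list ds)"
  and c: "!!x X. x < m ==> X : carrier_mat (ds ! k) (ds ! k) ==> E x X : carrier_mat (d x) (d x)"
  and tr: "!!X. X : carrier_mat (ds ! k) (ds ! k) ==> (SUM x<m. cmtrace (E x X)) = cmtrace X"
 shows "(SUM x<m. cmtrace (apply_on ds k (E x) (d x) rho)) = cmtrace rho"
proof -
 define p q where "p = prod_list (take k ds)" and "q = prod_list (drop (Suc k) ds)"
 define M where "M = (%i j. mat (ds ! k) (ds ! k) (%(u, v). rho $$ ((i * (ds ! k) + u) * q + j, (i * (ds ! k) + v) * q + j)))"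
 have M: "M i j : carrier_mat (ds ! k) (ds ! k)" for i j by (simp add: M_def)
 have "cmtrace (apply_on ds k (E x) (d x) rho) = (SUM i<p. SUM j<q. cmtrace (E x (M i j)))" if x: "x < m" for x
 proof -
  have "cmtrace (apply_on ds k (E x) (d x) rho) = (SUM y<p * d x * q. apply_on ds k (E x) (d x) rho $$ (y, y))"
   by (simp add: cmtrace_def apply_on_def Let_def p_def q_def)
  also have "... = (SUM i<p. SUM u<d x. SUM j<q. apply_on ds k (E x) (d x) rho $$ ((i * d x + u) * q + j, (i * d x + u) * q + j))"
   unfolding sum_flat2 ..
  also have "... = (SUM i<p. SUM u<d x. SUM j<q. E x (M i j) $$ (u, u))"
   unfolding M_def by (intro sum.cong refl apply_on_entry) (auto simp: p_def q_def)
  also have "... = (SUM i<p. SUM j<q. SUM u<d x. E x (M i j) $$ (u, u))" by (intro sum.cong refl sum.swap)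
  also have "... = (SUM i<p. SUM j<q. cmtrace (E x (M i j)))" using carrier_matD(1)[OF c[OF x M]] by (simp add: cmtrace_def)
  finally show ?thesis .
 qed
 hence "(SUM x<m. cmtrace (apply_on ds k (E x) (d x) rho)) = (SUM x<m. SUM i<p. SUM j<q. cmtrace (E x (M i j)))" by simp
 also have "... = (SUM i<p. SUM j<q. SUM x<m. cmtrace (E x (M i j)))"
  by (subst sum.swap) (intro sum.cong refl sum.swap)
 also have "... = (SUM i<p. SUM j<q. cmtrace (M i j))" by (simp only: tr[OF M])
 also have "... = (SUM i<p. SUM j<q. SUM u<ds ! k. rho $$ ((i * (ds ! k) + u) * q + j, (i * (ds ! k) + u) * q + j))"
  by (simp add: cmtrace_def M_def)
 also have "... = (SUM i<p. SUM u<ds ! k. SUM j<q. rho $$ ((i * (ds ! k) + u) * q + j, (i * (ds ! k) + u) * q + j))" by (intro sum.cong refl sum.swap)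
 also have "... = (SUM y<p * (ds ! k) * q. rho $$ (y, y))" unfolding sum_flat2 ..
 also have "p * (ds ! k) * q = prod_list ds" using prod_list_split[OF k, of "ds ! k"] by (simp add: p_def q_def)
 finally show ?thesis using rho by (simp add: cmtrace_def)
qed

text \<open>\<open>locc_monotone\<close> leaves the norm of the final purification open; the trace
  of the state it represents fixes it.\<close>

lemma locc_trace:
 assumes "locc ds ds' L" and "rho : carrier_mat (prod_list ds) (prod_list ds)"
 shows "L rho : carrier_mat (prod_list ds') (prod_list ds') & cmtrace (L rho) = cmtrace rho"
 using assms
proof (induction arbitrary: rho rule: locc.induct)
 case (locc_id ds)
 thus ?case by simp
next
 case (locc_round p ds m d' E ds' L)
 define A where "A = (%x. apply_on ds p (E x) (d' x) rho)"
 have A: "A x : carrier_mat (prod_list (ds[p := d' x])) (prod_list (ds[p := d' x]))" for x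
  unfolding prod_list_split[OF locc_round.hyps(1)] by (simp add: A_def apply_on_def Let_def)
 have L: "L x (A x) : carrier_mat (prod_list ds') (prod_list ds')" "cmtrace (L x (A x)) = cmtrace (A x)" if "x < m" for x
  using locc_round.IH[rule_format, OF that] A[of x] by blast+
 let ?M = "msum (prod_list ds') (map (%x. L x (A x)) [0..<m])"
 have M: "?M : carrier_mat (prod_list ds') (prod_list ds')"
  and Me: "!!i j. i < prod_list ds' ==> j < prod_list ds' ==> ?M $$ (i, j) = (SUM x<m. L x (A x) $$ (i, j))"
  using msum_carrier[of m "%x. L x (A x)" "prod_list ds'", OF L(1)] by auto
 have "cmtrace ?M = (SUM i<prod_list ds'. SUM x<m. L x (A x) $$ (i, i))" using M Me by (simp add: cmtrace_def)
 also have "... = (SUM x<m. SUM i<prod_list ds'. L x (A x) $$ (i, i))" by (rule sum.swap)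
 also have "... = (SUM x<m. cmtrace (L x (A x)))" unfolding cmtrace_def by (intro sum.cong refl) (use carrier_matD(1)[OF L(1)] in auto)
 also have "... = (SUM x<m. cmtrace (A x))" by (simp add: L(2))
 also have "... = cmtrace rho" unfolding A_def
 proof (rule cmtrace_apply_on[OF locc_round.hyps(1) locc_round.prems])
  fix x and X :: "complex mat" assume "x < m" "X : carrier_mat (ds ! p) (ds ! p)"
  thus "E x X : carrier_mat (d' x) (d' x)"
   using locc_round.hyps(3)[rule_format, OF \<open>x < m\<close>] unfolding cp_map_def lin_map_def by blast
 qed (rule locc_round.hyps(4)[rule_format])
 finally show ?case using M by (simp add: A_def)
qed

lemma repl_trace:
 assumes "repl ds rho R psi"
 shows "cmtrace rho = of_real (nsq (boxl ds >< R) psi)"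
proof -
 obtain a b c where abc: "ds = [a, b, c]" using conjunct1[OF assms[unfolded repl_def]] unfolding length3 by blast
 have r: "rho : carrier_mat (a * b * c) (a * b * c)" "finite R"
  "!!i. i : box a b c ==> rho $$ (ix b c i, ix b c i) = (SUM r:R. psi (i, r) * cnj (psi (i, r)))"
  using assms by (auto simp: repl_def rep_def purifies_def abc)
 have "cmtrace rho = (SUM x<a. SUM y<b. SUM z<c. rho $$ (ix b c (x, y, z), ix b c (x, y, z)))"
  using r(1) unfolding cmtrace_def by (simp add: sum_flat2 ix_def)
 also have "... = (SUM x<a. SUM y<b. SUM z<c. SUM r:R. psi ((x, y, z), r) * cnj (psi ((x, y, z), r)))"
  by (intro sum.cong refl r(3)) (auto simp: box_def)
 also have "... = (SUM k:boxl ds >< R. psi k * cnj (psi k))" by (simp add: boxl_def abc box_def sum_Times)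
 finally show ?thesis by (simp only: cmod_sq of_real_sum)
qed


text \<open>An isometry from A to BCEF that gives \<open>N\<close> after tracing out EF. The
  environment indices form an arbitrary finite set of pairs, so an environment can be enlarged by
  fresh pairs when an extension is completed to a dilation.\<close>

definition dilation :: "(complex mat => complex mat) => nat => nat => nat => (nat * nat) set => (nat * nat * nat * nat => nat => complex) => bool" where
 "dilation N dA dB dC G V <-> finite G &
   (ALL i<dA. ALL i'<dA. (SUM j:{..<dB} >< {..<dC} >< G. V j i * cnj (V j i')) = dl i i') &
   (ALL X:carrier_mat dA dA. ALL b<dB. ALL c<dC. ALL b'<dB. ALL c'<dC.
    N X $$ (b * dC + c, b' * dC + c') = (SUM (e, f):G. SUM i<dA. SUM i'<dA. V (b, c, e, f) i * X $$ (i, i') * cnj (V (b', c', e, f) i')))"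

text \<open>The quantity \<open>n\<close> of the dilated channel output for an input operator
  \<open>sigma\<close> of any trace, purified by a reference.\<close>

definition dq :: "nat => nat => nat => nat => (nat * nat) set => (nat * nat * nat * nat => nat => complex) => (nat => nat => complex) => real" where
 "dq n dA dB dC G V sigma = kq n ({..<dB} >< {..<dC} >< G) fst (%j. fst (snd j)) (%j. fst (snd (snd j))) (%j. snd (snd (snd j))) (conj_kernel {..<dA} V sigma)"

lemma flat_eq: "u < d ==> u' < d ==> i * d + u = i' * d + u' <-> i = i' & u = u'" for d :: nat
 by (metis add.commute div_mult_self1 div_less mod_mult_self1 mod_less add_0_right gr_implies_not0)

lemma flat_split: "x < a * d ==> x div d < a" "x < a * d ==> x mod d < d" for d :: nat
 by (auto simp: less_mult_imp_div_less) (cases "d = 0"; simp)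

definition input_kernel :: "nat => nat => nat => complex mat => nat => nat => complex" where
 "input_kernel a b c rho i i' = (SUM (x, y, z):box a b c. rho $$ (ix b c (i * a + x, y, z), ix b c (i' * a + x, y, z)))"

text \<open>All registers other than the channel input, both environments included, purify that
  input; hence the increase depends on the state only through the reduced kernel of the input. The
  second and third claims allow these kernels to be added up over the uses with known total
  trace.\<close>

lemma chan_monotone:
 assumes dil: "dilation N dA dB dC G V" and r: "repl [dA * a', b, c] rho R psi"
 shows "EX R' psi'. repl [a', b * dB, c * dC] (chan_step N dA dB dC a' b c rho) R' psi' &
  (nsq (boxl [a', b * dB, c * dC] >< R') psi') = nsq (boxl [dA * a', b, c] >< R) psi &
  (ALL n. qty n (boxl [a', b * dB, c * dC]) R' psi' <= qty n (boxl [dA * a', b, c]) R psi + dq n dA dB dC G V (input_kernel a' b c rho))"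
  and "EX (P :: ((nat * nat * nat) * nat list * nat list) set) phi. purifies {..<dA} P phi (input_kernel a' b c rho)"
  and "(SUM i<dA. input_kernel a' b c rho i i) = of_real (nsq (boxl [dA * a', b, c] >< R) psi)"
proof -
 let ?b1 = "boxl [a', b * dB, c * dC]" and ?R0 = "boxl [dA * a', b, c] >< R" and ?b0 = "boxl [dA * a', b, c]" and ?ik = "input_kernel a' b c rho" and ?ch = "chan_step N dA dB dC a' b c rho"
 define J where "J = {..<dB} >< {..<dC} >< G"
 define RR where "RR = box a' b c >< R"
 define psi2 where "psi2 = (%(i, (x, y, z), s). psi ((i * a' + x, y, z), s))"
 have fR: "finite R" and pu: "!!i i'. i : box (dA * a') b c ==> i' : box (dA * a') b c ==> rho $$ (ix b c i, ix b c i') = (SUM r:R. psi (i, r) * cnj (psi (i', r)))"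
  using r by (auto simp: repl_def rep_def purifies_def)
 have fG: "finite G" using dil by (simp add: dilation_def)
 interpret local_isometry "{..<dA}" J RR V psi2
  by unfold_locales (use dil fG fR in "auto simp: J_def RR_def dilation_def")
 have ik: "?ik i i' = (SUM r:RR. psi2 (i, r) * cnj (psi2 (i', r)))" if "i < dA" "i' < dA" for i i'
  unfolding input_kernel_def RR_def sum_Times psi2_def prod.case case_prod_unfold
  by (intro sum.cong refl, subst pu) (use that flat_less2 in "auto simp: box_def")
 show "EX (P :: ((nat * nat * nat) * nat list * nat list) set) phi. purifies {..<dA} P phi (?ik)"
  by (rule exI[of _ RR], rule exI[of _ psi2]) (use ik fin in "auto simp: purifies_def")
 define g :: "nat * (nat * nat * nat) * nat list * nat list => (nat * nat * nat) * nat list * nat list"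
  where "g = (%(i, (x, y, z), s). ((i * a' + x, y, z), s))"
 have g: "bij_betw g ({..<dA} >< RR) (?R0)"
  by (rule bij_betwI[where g="%((x, y, z), s). (x div a', (x mod a', y, z), s)"])
   (auto simp: g_def RR_def boxl_def box_def flat_less2 flat_split)
 have psi2: "psi2 k = psi (g k)" for k by (simp add: psi2_def g_def case_prod_unfold)
 have n2: "nsq (?R0) psi = (SUM k:{..<dA} >< RR. (cmod (psi2 k))^2)"
  unfolding psi2 by (rule sum.reindex_bij_betw[OF g, symmetric])
 have "(SUM i<dA. ?ik i i) = (SUM k:{..<dA} >< RR. psi2 k * cnj (psi2 k))" by (simp add: ik sum_Times)
 thus "(SUM i<dA. ?ik i i) = of_real (nsq (?R0) psi)"
  unfolding n2 by (simp only: cmod_sq of_real_sum)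
 define R' where "R' = (%((e2, f2), (e, f)). (e2 # e, f2 # f)) ` (G >< R)"
 \<comment> \<open>Places the new outputs behind the old registers and prepends the new environment
   indices to the two lists.\<close>
 define h :: "(nat * nat * nat * nat) * (nat * nat * nat) * nat list * nat list => (nat * nat * nat) * nat list * nat list"
  where "h = (%((y2, z2, e2, f2), (x, y, z), (e, f)). ((x, y * dB + y2, z * dC + z2), (e2 # e, f2 # f)))"
 define h' :: "(nat * nat * nat) * nat list * nat list => (nat * nat * nat * nat) * (nat * nat * nat) * nat list * nat list"
  where "h' = (%((x, Y, Z), (e, f)). ((Y mod dB, Z mod dC, hd e, hd f), (x, Y div dB, Z div dC), (tl e, tl f)))"
 define psi' where "psi' = (%k. apply_fst {..<dA} V psi2 (h' k))"
 have hh: "h' (h k) = k" if "k : J >< RR" for k using that by (auto simp: h_def h'_def J_def RR_def)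
 have h: "bij_betw h (J >< RR) (?b1 >< R')"
 proof (rule bij_betwI[where g=h'])
  show "h : J >< RR \<rightarrow> ?b1 >< R'" by (auto simp: h_def J_def RR_def boxl_def box_def flat_less2 R'_def image_iff intro!: bexI[rotated])
  show "h' : ?b1 >< R' \<rightarrow> J >< RR"
  proof
   fix k assume "k : ?b1 >< R'"
   then obtain x Y Z e2 f2 e f where k: "k = ((x, Y, Z), (e2 # e, f2 # f))" "x < a'" "Y < b * dB" "Z < c * dC" "(e2, f2) : G" "(e, f) : R"
    by (auto simp: R'_def boxl_def box_def)
   thus "h' k : J >< RR" using k by (auto simp: h'_def J_def RR_def box_def flat_split)
  qed
  show "h' (h k) = k" if "k : J >< RR" for k using hh that .
  show "h (h' k) = k" if "k : ?b1 >< R'" for k using that by (auto simp: h_def h'_def R'_def)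
 qed
 have fR': "finite R'" using fG fR by (simp add: R'_def)
 have psi': "apply_fst {..<dA} V psi2 k = psi' (h k)" if "k : J >< RR" for k unfolding psi'_def hh[OF that] ..
 have "nsq (?b1 >< R') psi' = nsq (J >< RR) (%k. psi' (h k))"
  by (rule sum.reindex_bij_betw[OF h, symmetric])
 also have "... = nsq (J >< RR) (%k. apply_fst {..<dA} V psi2 k)" by (intro sum.cong refl) (simp add: psi')
 also have "... = (SUM r:RR. SUM j:J. (cmod (SUM i<dA. V j i * psi2 (i, r)))^2)"
  unfolding sum_Times apply_fst_def prod.case by (rule sum.swap)
 also have "... = (SUM r:RR. SUM i<dA. (cmod (psi2 (i, r)))^2)" by (intro sum.cong refl isometry_norm fin iso)
 also have "... = (SUM k:{..<dA} >< RR. (cmod (psi2 k))^2)" unfolding sum_Times by (rule sum.swap)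
 also note n2[symmetric]
 finally have norm: "nsq (?b1 >< R') psi' = nsq (?R0) psi" .
 have q: "qty n (?b1) R' psi' <= qty n (?b0) R psi + dq n dA dB dC G V (?ik)" for n
 proof -
  let ?A = "%r. fst (fst r)" and ?B = "%r. fst (snd (fst r))" and ?C = "%r. snd (snd (fst r))" and ?E = "%r. fst (snd r)" and ?F = "%r. snd (snd r)"
  let ?B2 = fst and ?C2 = "%j. fst (snd j)" and ?E2 = "%j. fst (snd (snd j))" and ?F2 = "%j. snd (snd (snd j))"
  have "qty n (?b1) R' psi' = qv n (J >< RR) (%k. ?A (snd k)) (%k. (?B (snd k), ?B2 (fst k))) (%k. (?C (snd k), ?C2 (fst k))) (%k. (?E (snd k), ?E2 (fst k))) (%k. (?F (snd k), ?F2 (fst k))) (apply_fst {..<dA} V psi2)"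
   unfolding qty_def by (rule qv_transport[OF _ h, symmetric]) (use fR' psi' in "auto simp: boxl_def h_def J_def RR_def box_def flat_eq")
  also have "... <= qv n ({..<dA} >< RR) (%k. (fst k, ?A (snd k))) (%k. ?B (snd k)) (%k. ?C (snd k)) (%k. ?E (snd k)) (%k. ?F (snd k)) psi2 + kq n J ?B2 ?C2 ?E2 ?F2 out"
   by (rule qv_channel) (auto simp: inj_on_def prod_eq_iff)
  also have "qv n ({..<dA} >< RR) (%k. (fst k, ?A (snd k))) (%k. ?B (snd k)) (%k. ?C (snd k)) (%k. ?E (snd k)) (%k. ?F (snd k)) psi2 = qty n (?b0) R psi"
   unfolding qty_def by (rule qv_transport[OF _ g]) (use fR psi2 in "auto simp: boxl_def g_def RR_def box_def flat_eq")
  also have "kq n J ?B2 ?C2 ?E2 ?F2 out = dq n dA dB dC G V (?ik)"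
  proof -
   have "out = conj_kernel {..<dA} V (?ik)"
    unfolding out_def conj_kernel_def fun_eq_iff by (intro allI sum.cong refl) (simp add: ik)
   thus ?thesis by (simp add: dq_def J_def)
  qed
  finally show ?thesis .
 qed
 have ent: "?ch $$ (ix (b * dB) (c * dC) k, ix (b * dB) (c * dC) k') = (SUM r:R'. psi' (k, r) * cnj (psi' (k', r)))"
  if k: "k : box a' (b * dB) (c * dC)" "k' : box a' (b * dB) (c * dC)" for k k'
 proof -
  have dec: "EX x y z y2 z2. k = (x, y * dB + y2, z * dC + z2) & x < a' & y < b & z < c & y2 < dB & z2 < dC" if "k : box a' (b * dB) (c * dC)" for k
  proof -
   obtain x Y Z where k: "k = (x, Y, Z)" "x < a'" "Y < b * dB" "Z < c * dC" using \<open>k \<in> _\<close> by (auto simp: box_def)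
   have "Y div dB < b" "Y mod dB < dB" "Z div dC < c" "Z mod dC < dC" using k flat_split by blast+
   moreover have "k = (x, Y div dB * dB + Y mod dB, Z div dC * dC + Z mod dC)" using k by simp
   ultimately show ?thesis using k(2) by blast
  qed
  obtain x y z y2 z2 where k1: "k = (x, y * dB + y2, z * dC + z2)" "x < a'" "y < b" "z < c" "y2 < dB" "z2 < dC" using dec[OF k(1)] by blast
  obtain x' y' z' y2' z2' where k2: "k' = (x', y' * dB + y2', z' * dC + z2')" "x' < a'" "y' < b" "z' < c" "y2' < dB" "z2' < dC" using dec[OF k(2)] by blast
  let ?X = "mat dA dA (%(u, v). rho $$ (ix b c (u * a' + x, y, z), ix b c (v * a' + x', y', z')))"
  have "?ch $$ (ix (b * dB) (c * dC) k, ix (b * dB) (c * dC) k') = N ?X $$ (y2 * dC + z2, y2' * dC + z2')"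
   unfolding k1(1) k2(1) by (rule chan_step_entry) (use k1 k2 in auto)
  also have "... = (SUM (e2, f2):G. SUM i<dA. SUM i'<dA. V (y2, z2, e2, f2) i * ?X $$ (i, i') * cnj (V (y2', z2', e2, f2) i'))"
   using dil k1 k2 by (simp add: dilation_def)
  also have "... = (SUM (e2, f2):G. SUM i<dA. SUM i'<dA. V (y2, z2, e2, f2) i * (SUM r:R. psi2 (i, (x, y, z), r) * cnj (psi2 (i', (x', y', z'), r))) * cnj (V (y2', z2', e2, f2) i'))"
   by (intro sum.cong refl) (use k1 k2 flat_less2 in "auto simp: pu box_def psi2_def intro!: sum.cong")
  also have "... = (SUM (e2, f2):G. SUM r:R. apply_fst {..<dA} V psi2 ((y2, z2, e2, f2), (x, y, z), r) * cnj (apply_fst {..<dA} V psi2 ((y2', z2', e2, f2), (x', y', z'), r)))"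
   unfolding case_prod_unfold apply_fst_def fst_conv snd_conv by (intro sum.cong refl gram_apply)
  also have "... = (SUM (ef2, r):G >< R. psi' (k, (fst ef2 # fst r, snd ef2 # snd r)) * cnj (psi' (k', (fst ef2 # fst r, snd ef2 # snd r))))"
   unfolding sum_Times case_prod_unfold using k1 k2 by (simp add: psi'_def h'_def)
  also have "... = (SUM r:R'. psi' (k, r) * cnj (psi' (k', r)))"
   unfolding R'_def by (subst sum.reindex) (auto simp: inj_on_def case_prod_unfold)
  finally show ?thesis .
 qed
 have "repl [a', b * dB, c * dC] (?ch) R' psi'"
  using fR' ent by (auto simp: repl_def rep_def purifies_def chan_step_def perm_state_def Let_def algebra_simps)
 thus "EX R' psi'. repl [a', b * dB, c * dC] (?ch) R' psi' &
  (nsq (?b1 >< R') psi') = nsq (?R0) psi &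
  (ALL n. qty n (?b1) R' psi' <= qty n (?b0) R psi + dq n dA dB dC G V (?ik))"
  using norm q by blast
qed

lemma purifies_add:
 assumes P1: "purifies J P1 psi1 tau1" and P2: "purifies J P2 psi2 tau2"
 shows "EX n psi. purifies J {..<n::nat} psi (%j j'. tau1 j j' + tau2 j j')"
proof -
 define Psi where "Psi = (%(j, p). case p of Inl p => psi1 (j, p) | Inr p => psi2 (j, p))"
 have f: "finite P1" "finite P2" using P1 P2 by (auto simp: purifies_def)
 have "(SUM p:P1 <+> P2. Psi (j, p) * cnj (Psi (j', p))) = tau1 j j' + tau2 j j'" if "j : J" "j' : J" for j j'
  using P1 P2 that by (simp add: sum.Plus[OF f] Psi_def purifies_def)
 hence "purifies J (P1 <+> P2) Psi (%j j'. tau1 j j' + tau2 j j')" using f by (simp add: purifies_def)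
 thus ?thesis by (rule purifies_nat)
qed

lemma conj_kernel_add: "conj_kernel I V (%i i'. sigma i i' + sigma' i i') = (%j j'. conj_kernel I V sigma j j' + conj_kernel I V sigma' j j')"
 by (simp add: conj_kernel_def fun_eq_iff algebra_simps sum.distrib)

lemma kq_superadditive:
 assumes "finite J" "purifies J P1 psi1 tau1" "purifies J P2 psi2 tau2"
 shows "kq n J b c e f tau1 + kq n J b c e f tau2 <= kq n J b c e f (%j j'. tau1 j j' + tau2 j j')"
 using kbip_superadditive[OF assms, of b c e f] kbip_superadditive[OF assms, of c b e f]
  kbip_superadditive[OF assms, of "%j. (b j, c j)" "%_. ()" e f] ktri_superadditive[OF assms, of b c e f]
 by (simp add: kq_def)

lemma dq_superadditive:
 assumes "finite G" "purifies {..<dA} P1 psi1 sigma1" "purifies {..<dA} P2 psi2 sigma2"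
 shows "dq n dA dB dC G V sigma1 + dq n dA dB dC G V sigma2 <= dq n dA dB dC G V (%i i'. sigma1 i i' + sigma2 i i')"
 unfolding dq_def conj_kernel_add
 by (rule kq_superadditive[OF _ purifies_apply[OF assms(2)] purifies_apply[OF assms(3)]]) (use assms in simp)

lemma kH_0: "finite J ==> kH J b e q (%_ _. 0) = 0"
 using Hc_kH[of J "{}" "%_. 0" "%_ _. 0" b e q] by (simp add: purifies_def Hc_def Sv_def ent_empty)

lemma dq_0: "finite G ==> dq n dA dB dC G V (%_ _. 0) = 0"
proof -
 have "conj_kernel {..<dA} V (%_ _. 0) = (%_ _. 0)" by (simp add: conj_kernel_def fun_eq_iff)
 thus "finite G ==> ?thesis" by (simp add: dq_def kq_def kbip_def ktri_def kH_0)
qed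

lemma Sv_singleton: "cmod (psi k) = 1 ==> Sv {k} p q psi = 0"
 using Sv_view[of "{k}" p "%_. ()" q q psi] Sv_const[of "{k}" q "()" psi] by (simp add: eta_def)

text \<open>\<open>sigma\<close> is the sum of the input kernels of all uses. It depends on the
  protocol alone and is quantified before the dilation, whereas the purified final state may vary
  with the dilation.\<close>

lemma reach_monotone:
 assumes "reach N dA dB dC n ds rho"
 shows "EX sigma p phi. purifies {..<dA} {..<p::nat} phi sigma & (ALL G V. dilation N dA dB dC G V -->
  (EX R psi. repl ds rho R psi & nsq (boxl ds >< R) psi = 1 & (SUM i<dA. sigma i i) = of_nat n &
   (ALL j. qty j (boxl ds) R psi <= dq j dA dB dC G V sigma)))"
 using assms
proof (induction rule: reach.induct)
 case (reach_0 ds L)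
 define R :: "(nat list * nat list) set" where "R = {([], [])}"
 define psi :: "(nat * nat * nat) * nat list * nat list => complex" where "psi = (%_. 1)"
 have r: "repl [1, 1, 1] (1\<^sub>m 1) R psi" by (auto simp: repl_def rep_def purifies_def R_def psi_def box_def ix_def)
 have q: "qty j (boxl [1, 1, 1]) R psi = 0" for j
 proof -
  have K: "boxl [1, 1, 1] >< R = {((0, 0, 0), ([], []))}" by (auto simp: boxl_def box_def R_def)
  show ?thesis unfolding qty_def K by (simp add: qv_def bip_def tri_def Sv_singleton psi_def)
 qed
 obtain R' psi' where r': "repl ds (L (1\<^sub>m 1)) R' psi'" "!!j. qty j (boxl ds) R' psi' <= qty j (boxl [1, 1, 1]) R psi"
  using locc_monotone[OF reach_0 r] by blast
 have "cmtrace (L (1\<^sub>m 1)) = 1" using locc_trace[OF reach_0, of "1\<^sub>m 1"] by (simp add: cmtrace_def)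
 hence n: "nsq (boxl ds >< R') psi' = 1" using repl_trace[OF r'(1)] by (simp only: of_real_eq_1_iff)
 have "qty j (boxl ds) R' psi' <= dq j dA dB dC G V (%_ _. 0)" if "dilation N dA dB dC G V" for G V j
  using r'(2)[of j] dq_0[of G] that unfolding q by (simp add: dilation_def)
 moreover have "purifies {..<dA} {..<0::nat} (%_. 0) (%_ _. 0)" by (simp add: purifies_def)
 ultimately show ?case using r'(1) n by (intro exI[of _ "%_ _. 0"] exI[of _ "0::nat"] exI[of _ "%_. 0"] conjI allI impI exI[of _ R'] exI[of _ psi']) auto
next
 case (reach_Suc k a' b c rho ds L)
 let ?ds = "[dA * a', b, c]" and ?ds' = "[a', b * dB, c * dC]" and ?rho' = "chan_step N dA dB dC a' b c rho" and ?tau = "input_kernel a' b c rho"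
 obtain sigma p phi where sigma: "purifies {..<dA} {..<p::nat} phi sigma"
  and IH: "!!G V. dilation N dA dB dC G V ==> EX R psi. repl ?ds rho R psi & nsq (boxl ?ds >< R) psi = 1 & (SUM i<dA. sigma i i) = of_nat k &
   (ALL j. qty j (boxl ?ds) R psi <= dq j dA dB dC G V sigma)"
  using reach_Suc.IH by blast
 show ?case
 \<comment> \<open>Positivity of the new input kernel is read off a purified state, which the
   induction hypothesis supplies only for a given dilation. If there is none, the previous
   \<open>sigma\<close> serves and the remaining claim is vacuous.\<close>
 proof (cases "EX G V. dilation N dA dB dC G V")
  case False
  thus ?thesis using sigma by blast
 next
  case True
  then obtain G0 V0 where d0: "dilation N dA dB dC G0 V0" by blast
  obtain R0 psi0 where r0: "repl ?ds rho R0 psi0" using IH[OF d0] by blast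
  obtain P' phi' where pt: "purifies {..<dA} (P' :: ((nat * nat * nat) * nat list * nat list) set) phi' ?tau" using chan_monotone(2)[OF d0 r0] by blast
  obtain p' phi'' where ps: "purifies {..<dA} {..<p'::nat} phi'' (%i i'. sigma i i' + ?tau i i')" using purifies_add[OF sigma pt] by blast
  have "EX R psi. repl ds (L ?rho') R psi & nsq (boxl ds >< R) psi = 1 & (SUM i<dA. sigma i i + ?tau i i) = of_nat (Suc k) &
   (ALL j. qty j (boxl ds) R psi <= dq j dA dB dC G V (%i i'. sigma i i' + ?tau i i'))" if d: "dilation N dA dB dC G V" for G V
  proof -
   obtain R psi where r: "repl ?ds rho R psi" and n: "nsq (boxl ?ds >< R) psi = 1" and t: "(SUM i<dA. sigma i i) = of_nat k"
    and q: "!!j. qty j (boxl ?ds) R psi <= dq j dA dB dC G V sigma" using IH[OF d] by blast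
   obtain R' psi' where r': "repl ?ds' ?rho' R' psi'" and n': "nsq (boxl ?ds' >< R') psi' = 1"
    and q': "!!j. qty j (boxl ?ds') R' psi' <= qty j (boxl ?ds) R psi + dq j dA dB dC G V ?tau"
    using chan_monotone(1)[OF d r] unfolding n by blast
   obtain R'' psi'' where r'': "repl ds (L ?rho') R'' psi''" "!!j. qty j (boxl ds) R'' psi'' <= qty j (boxl ?ds') R' psi'"
    using locc_monotone[OF reach_Suc.hyps(2) r'] by blast
   have "?rho' : carrier_mat (prod_list ?ds') (prod_list ?ds')" using r' by (simp add: repl_def rep_def mult.assoc)
   hence "cmtrace (L ?rho') = cmtrace ?rho'" using locc_trace[OF reach_Suc.hyps(2)] by blast
   hence "nsq (boxl ds >< R'') psi'' = 1"
    unfolding repl_trace[OF r'] repl_trace[OF r''(1)] n' by (simp only: of_real_eq_1_iff of_real_1)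
   moreover have "(SUM i<dA. sigma i i + ?tau i i) = of_nat (Suc k)"
    using chan_monotone(3)[OF d r] by (simp add: sum.distrib t n)
   moreover have "qty j (boxl ds) R'' psi'' <= dq j dA dB dC G V (%i i'. sigma i i' + ?tau i i')" for j
   proof -
    have "finite G" using d by (simp add: dilation_def)
    thus ?thesis using r''(2)[of j] q'[of j] q[of j] dq_superadditive[OF _ sigma pt, of G j dB dC V] by linarith
   qed
   ultimately show ?thesis using r''(1) by blast
  qed
  thus ?thesis using ps by blast
 qed
qed

section \<open>Private target states\<close>

lemma spec_decomp_specd:
 assumes A: "A : carrier_mat n n" and s: "spec_decomp A lam U"
 shows "specd {..<n} (%i j. A $$ (i, j)) lam (%k x. U $$ (x, k))"
proof -
 have n: "dim_row A = n" using A by simp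
 have U: "U : carrier_mat n n" "adj U * U = 1\<^sub>m n" "U * adj U = 1\<^sub>m n" and AU: "A = U * mat_diag n (%i. complex_of_real (lam i)) * adj U"
  using s by (auto simp: spec_decomp_def unitary_def n Let_def)
 have aU: "adj U : carrier_mat n n" using U by (simp add: adj_def)
 have 1: "(SUM x<n. U $$ (x, i) * cnj (U $$ (x, j))) = dl i j" if ij: "i < n" "j < n" for i j
 proof -
  have "(adj U * U) $$ (j, i) = (SUM x<n. cnj (U $$ (x, j)) * U $$ (x, i))"
   using U(1) ij by (simp add: adj_def scalar_prod_def lessThan_atLeast0)
  thus ?thesis using ij unfolding U(2) by (auto simp: mult.commute split: if_splits)
 qed
 have 2: "(SUM k<n. U $$ (x, k) * cnj (U $$ (y, k))) = dl x y" if xy: "x < n" "y < n" for x y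
 proof -
  have "(U * adj U) $$ (x, y) = (SUM k<n. U $$ (x, k) * cnj (U $$ (y, k)))"
   using U(1) xy by (simp add: adj_def scalar_prod_def lessThan_atLeast0)
  thus ?thesis using xy unfolding U(3) by simp
 qed
 have 3: "A $$ (x, y) = (SUM k<n. of_real (lam k) * U $$ (x, k) * cnj (U $$ (y, k)))" if xy: "x < n" "y < n" for x y
 proof -
  have e: "U * mat_diag n (%i. complex_of_real (lam i)) = mat n n (%(i, j). U $$ (i, j) * of_real (lam j))"
   using U by (intro mat_diag_mult_right) simp
  show ?thesis unfolding AU e using U(1) xy by (simp add: adj_def scalar_prod_def lessThan_atLeast0 mult_ac)
 qed
 show ?thesis using 1 2 3 by (simp add: specd_def onb_def)
qed

lemma specd_spec_decomp:
 assumes A: "A : carrier_mat n n" and s: "specd {..<n} (%i j. A $$ (i, j)) lam u"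
 shows "spec_decomp A lam (mat n n (%(x, k). u k x))"
proof -
 note o = specdD(2)[OF s]
 let ?U = "mat n n (%(x, k). u k x)"
 have "adj ?U * ?U = 1\<^sub>m n"
 proof (rule eq_matI)
  fix i j assume "i < dim_row (1\<^sub>m n)" "j < dim_col (1\<^sub>m n)"
  thus "(adj ?U * ?U) $$ (i, j) = 1\<^sub>m n $$ (i, j)"
   using onb_orth[OF o, of j i] by (auto simp: adj_def scalar_prod_def lessThan_atLeast0 mult.commute)
 qed (auto simp: adj_def)
 moreover have "?U * adj ?U = 1\<^sub>m n"
 proof (rule eq_matI)
  fix i j assume "i < dim_row (1\<^sub>m n)" "j < dim_col (1\<^sub>m n)"
  thus "(?U * adj ?U) $$ (i, j) = 1\<^sub>m n $$ (i, j)"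
   using o by (simp add: onb_def adj_def scalar_prod_def lessThan_atLeast0)
 qed (auto simp: adj_def)
 moreover have "A = ?U * mat_diag n (%i. complex_of_real (lam i)) * adj ?U"
 proof -
  have e: "?U * mat_diag n (%i. complex_of_real (lam i)) = mat n n (%(i, j). ?U $$ (i, j) * of_real (lam j))"
   by (intro mat_diag_mult_right) simp
  show ?thesis unfolding e
  proof (rule eq_matI)
   fix i j assume "i < dim_row (mat n n (%(i, j). ?U $$ (i, j) * of_real (lam j)) * adj ?U)" "j < dim_col (mat n n (%(i, j). ?U $$ (i, j) * of_real (lam j)) * adj ?U)"
   hence ij: "i < n" "j < n" by (auto simp: adj_def)
   thus "A $$ (i, j) = (mat n n (%(i, j). ?U $$ (i, j) * of_real (lam j)) * adj ?U) $$ (i, j)"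
    using specdD(3)[OF s, of i j] by (simp add: adj_def scalar_prod_def lessThan_atLeast0 mult_ac)
  qed (use A in "auto simp: adj_def")
 qed
 ultimately show ?thesis using A by (simp add: spec_decomp_def unitary_def)
qed

lemma spec_decomp_exists:
 assumes A: "A : carrier_mat n n" and h: "!!i j. i < n ==> j < n ==> cnj (A $$ (i, j)) = A $$ (j, i)"
 shows "EX lam U. spec_decomp A lam U"
proof -
 have "ALL x:{..<n}. ALL y:{..<n}. cnj (A $$ (x, y)) = A $$ (y, x)" using h by simp
 hence "EX r u. specd {..<n} (%i j. A $$ (i, j)) r u" by (rule spectral_theorem[OF finite_lessThan])
 thus ?thesis using specd_spec_decomp[OF A] by blast
qed

lemma bessel:
 assumes fin: "finite S" "finite X" and o: "!!s s'. s : S ==> s' : S ==> ip X (tau s) (tau s') = dl s s'"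
 shows "nsq S (%s. ip X (tau s) v) <= nsq X v"
proof -
 define c where "c = (%s. ip X (tau s) v)"
 define w where "w = (%x. SUM s:S. c s * tau s x)"
 have wv: "ip X w v = (SUM s:S. cnj (c s) * c s)"
 proof -
  have "ip X w v = (SUM x:X. SUM s:S. cnj (c s) * (cnj (tau s x) * v x))" by (simp add: ip_def w_def sum_distribs mult_ac)
  also have "... = (SUM s:S. SUM x:X. cnj (c s) * (cnj (tau s x) * v x))" by (rule sum.swap)
  also have "... = (SUM s:S. cnj (c s) * c s)" by (simp add: c_def ip_def sum_distrib_left)
  finally show ?thesis .
 qed
 have ww: "ip X w w = (SUM s:S. cnj (c s) * c s)"
 proof -
  have "ip X w w = (SUM x:X. SUM s:S. SUM s':S. cnj (c s) * c s' * (cnj (tau s x) * tau s' x))"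
   unfolding ip_def w_def cnj_sum sum_product by (simp add: mult_ac)
  also have "... = (SUM s:S. SUM s':S. SUM x:X. cnj (c s) * c s' * (cnj (tau s x) * tau s' x))"
   by (intro sum.cong refl sum_perm)
  also have "... = (SUM s:S. SUM s':S. cnj (c s) * c s' * ip X (tau s) (tau s'))" by (simp add: ip_def sum_distrib_left)
  also have "... = (SUM s:S. SUM s':S. if s' = s then cnj (c s) * c s' else 0)" by (intro sum.cong refl) (auto simp: o)
  also have "... = (SUM s:S. cnj (c s) * c s)" using fin by simp
  finally show ?thesis .
 qed
 have vw: "ip X v w = cnj (ip X w v)" by (simp add: ip_def mult.commute)
 have "of_real (nsq X (%x. v x - w x)) = (SUM x:X. cnj (v x - w x) * (v x - w x))" by (simp only: cmod_sq of_real_sum)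
 also have "... = ip X v v - ip X v w - ip X w v + ip X w w" by (simp add: ip_def algebra_simps sum.distrib sum_subtractf)
 also have "... = ip X v v - (SUM s:S. cnj (c s) * c s)" unfolding vw wv ww by (simp add: mult.commute)
 also have "... = of_real (nsq X v - (nsq S c))" unfolding ip_def by (simp only: cmod_sq of_real_sum of_real_diff)
 finally have "nsq X (%x. v x - w x) = nsq X v - (nsq S c)" by (simp only: of_real_eq_iff)
 moreover have "0 <= nsq X (%x. v x - w x)" by (intro sum_nonneg) simp
 ultimately show ?thesis by (simp add: c_def)
qed

text \<open>Let u_k be an eigenbasis of the product of the adjoint of X with X; then X u_k has norm
  the square root of \<open>mu k\<close>. Expanding the forms in this basis, Cauchy-Schwarz and
  Bessel bound the k-th part by that root, whichever decomposition the choice in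
  \<open>trace_norm\<close> picks.\<close>

lemma trace_norm_bound:
 assumes X: "X : carrier_mat n n" and S: "finite S"
  and o: "!!s s'. s : S ==> s' : S ==> ip {..<n} (tau s) (tau s') = dl s s'"
 shows "cmod (SUM s:S. SUM i<n. SUM j<n. cnj (tau s i) * X $$ (i, j) * tau s j) <= trace_norm X"
proof -
 let ?A = "adj X * X"
 have "adj X : carrier_mat n n" using X by (simp add: adj_def)
 hence A: "?A : carrier_mat n n" using X by (rule mult_carrier_mat)
 have Ae: "?A $$ (i, j) = (SUM x<n. cnj (X $$ (x, i)) * X $$ (x, j))" if "i < n" "j < n" for i j
  using X that by (simp add: adj_def scalar_prod_def lessThan_atLeast0)
 have "EX lam U. spec_decomp ?A lam U" by (rule spec_decomp_exists[OF A]) (simp add: Ae mult.commute)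
 then obtain lam W where "spec_decomp ?A lam W" by (elim exE)
 hence "EX s mu U. spec_decomp ?A mu U & s = (SUM i<dim_col X. sqrt (mu i))" by (intro exI conjI) (assumption, rule refl)
 from someI_ex[OF this] have "EX mu U. spec_decomp ?A mu U & trace_norm X = (SUM i<dim_col X. sqrt (mu i))"
  unfolding trace_norm_def .
 then obtain mu U where "spec_decomp ?A mu U" and tn: "trace_norm X = (SUM k<n. sqrt (mu k))" using X by auto
 hence sp: "specd {..<n} (%i j. ?A $$ (i, j)) mu (%k x. U $$ (x, k))" using spec_decomp_specd[OF A] by blast
 define u where "u = (%k x. U $$ (x, k))"
 note sp = sp[folded u_def]
 define w where "w = (%k i. SUM j<n. X $$ (i, j) * u k j)"
 have w: "nsq {..<n} (w k) = mu k" if k: "k < n" for k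
 proof -
  have "complex_of_real (nsq {..<n} (w k)) = (SUM i<n. cnj (w k i) * w k i)" by (simp only: cmod_sq of_real_sum)
  also have "... = (SUM i<n. SUM x<n. SUM y<n. cnj (u k x) * (cnj (X $$ (i, x)) * X $$ (i, y)) * u k y)"
   unfolding w_def cnj_sum sum_product by (simp add: mult_ac)
  also have "... = (SUM x<n. SUM y<n. SUM i<n. cnj (u k x) * (cnj (X $$ (i, x)) * X $$ (i, y)) * u k y)"
   by (intro sum.cong refl sum_perm)
  also have "... = (SUM x<n. SUM y<n. cnj (u k x) * ?A $$ (x, y) * u k y)"
   by (intro sum.cong refl) (simp add: Ae sum_distribs)
  also have "... = of_real (mu k)" using specd_quadratic[OF sp] k by simp
  finally show ?thesis by (simp only: of_real_eq_iff)
 qed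
 define a where "a = (%s k. cnj (ip {..<n} (u k) (tau s)))"
 have "(SUM s:S. SUM i<n. SUM j<n. cnj (tau s i) * X $$ (i, j) * tau s j) = (SUM s:S. SUM k<n. cnj (a s k) * ip {..<n} (tau s) (w k))" (is "?L = _")
 proof (rule sum.cong[OF refl])
  fix s
  have "(SUM i<n. SUM j<n. cnj (tau s i) * X $$ (i, j) * tau s j) = ip {..<n} (%j. SUM i<n. cnj (X $$ (i, j)) * tau s i) (tau s)"
   unfolding ip_def cnj_sum sum_distrib_right by (subst sum.swap) (simp add: mult_ac)
  also have "... = (SUM k<n. ip {..<n} (%j. SUM i<n. cnj (X $$ (i, j)) * tau s i) (u k) * ip {..<n} (u k) (tau s))"
   using parseval[OF specdD(2)[OF sp]] by simp
  also have "... = (SUM k<n. cnj (a s k) * ip {..<n} (tau s) (w k))"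
  proof (intro sum.cong refl)
   fix k
   have "ip {..<n} (%j. SUM i<n. cnj (X $$ (i, j)) * tau s i) (u k) = ip {..<n} (tau s) (w k)"
    unfolding ip_def w_def cnj_sum sum_distrib_right sum_distrib_left by (subst sum.swap) (simp add: mult_ac)
   thus "ip {..<n} (%j. SUM i<n. cnj (X $$ (i, j)) * tau s i) (u k) * ip {..<n} (u k) (tau s) = cnj (a s k) * ip {..<n} (tau s) (w k)"
    by (simp add: a_def mult.commute)
  qed
  finally show "(SUM i<n. SUM j<n. cnj (tau s i) * X $$ (i, j) * tau s j) = (SUM k<n. cnj (a s k) * ip {..<n} (tau s) (w k))" .
 qed
 also have "... = (SUM k<n. SUM s:S. cnj (a s k) * ip {..<n} (tau s) (w k))" by (rule sum.swap)
 finally have L: "?L = (SUM k<n. SUM s:S. cnj (a s k) * ip {..<n} (tau s) (w k))" .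
 have "cmod ?L <= (SUM k<n. sqrt (mu k))"
  unfolding L
 proof (rule sum_norm_le)
  fix k assume "k : {..<n}"
  hence k: "k < n" by simp
  have "(SUM x<n. u k x * cnj (u k x)) = 1" using onb_orth[OF specdD(2)[OF sp], of k k] k by simp
  hence u1: "nsq {..<n} (u k) = 1" by (simp only: cmod_sq of_real_sum[symmetric] of_real_eq_1_iff)
  have "nsq S (%s. a s k) = nsq S (%s. ip {..<n} (tau s) (u k))"
   by (intro sum.cong refl) (simp add: a_def ip_def mult.commute)
  also have "... <= 1" using bessel[OF S finite_lessThan o, of "u k"] u1 by simp
  finally have 1: "nsq S (%s. a s k) <= 1" .
  have 2: "nsq S (%s. ip {..<n} (tau s) (w k)) <= mu k"
   using bessel[OF S finite_lessThan o, of "w k"] w[OF k] by simp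
  have "(cmod (SUM s:S. cnj (a s k) * ip {..<n} (tau s) (w k)))^2 <= 1 * mu k"
   by (rule order_trans[OF cauchy_schwarz_complex mult_mono[OF 1 2]]) (auto intro: sum_nonneg)
  thus "cmod (SUM s:S. cnj (a s k) * ip {..<n} (tau s) (w k)) <= sqrt (mu k)" by (simp add: real_le_rsqrt)
 qed
 thus ?thesis by (simp add: tn)
qed

text \<open>Two choices meet here, the one in \<open>vn_entropy\<close> and the one in
  \<open>ent\<close>. They agree because a purified matrix has a Gram kernel, whose entropy is the
  same for all decompositions.\<close>

lemma vn_entropy_ent:
 assumes A: "A : carrier_mat n n" and P: "purifies {..<n} P phi (%i j. A $$ (i, j))"
 shows "vn_entropy A = ent {..<n} (%i j. A $$ (i, j))"
proof -
 have P': "finite P" "!!i j. i < n ==> j < n ==> A $$ (i, j) = gram P (%i p. phi (i, p)) i j" using P by (auto simp: purifies_def gram_def)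
 have "EX lam U. spec_decomp A lam U" by (rule spec_decomp_exists[OF A]) (simp add: P' gram_def mult.commute)
 then obtain lam W where "spec_decomp A lam W" by (elim exE)
 hence "EX s lam U. spec_decomp A lam U & s = (SUM i<dim_row A. eta (lam i))" by (intro exI conjI) (assumption, rule refl)
 from someI_ex[OF this] have "EX lam U. spec_decomp A lam U & vn_entropy A = (SUM i<dim_row A. eta (lam i))"
  unfolding vn_entropy_def .
 then obtain lam U where s: "spec_decomp A lam U" and v: "vn_entropy A = (SUM i<n. eta (lam i))" using A by auto
 have "specd {..<n} (gram P (%i p. phi (i, p))) lam (%k x. U $$ (x, k))"
  using spec_decomp_specd[OF A s] specd_cong[of "{..<n}" "%i j. A $$ (i, j)" "gram P (%i p. phi (i, p))"] P'(2) by simp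
 hence "ent {..<n} (gram P (%i p. phi (i, p))) = (SUM k<n. eta (lam k))" by (rule ent_gram_eq) (rule P')
 moreover have "ent {..<n} (gram P (%i p. phi (i, p))) = ent {..<n} (%i j. A $$ (i, j))" by (rule ent_cong) (simp add: P'(2))
 ultimately show ?thesis using v by simp
qed

section \<open>Tensor products of private states\<close>

definition gv :: "nat => nat => nat => complex" where
 "gv k d u = (if EX i<d. digits (replicate k d) u = replicate k i then complex_of_real (1 / sqrt (real d)) else 0)"

lemma gv_norm:
 assumes k: "1 <= k" and d: "1 <= d"
 shows "nsq {..<d ^ k} (gv k d) = 1"
proof -
 let ?S = "{u:{..<d ^ k}. EX i<d. digits (replicate k d) u = replicate k i}"
 let ?f = "%i. undigits (replicate k d) (replicate k i)"
 have v: "list_all2 (<) (replicate k i) (replicate k d)" if "i < d" for i using that by (simp add: list_all2_conv_all_nth)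
 have dg: "digits (replicate k d) (?f i) = replicate k i" if "i < d" for i using digits_undigits[OF v[OF that], of 0] by simp
 have inj: "inj_on ?f {..<d}"
 proof (rule inj_onI)
  fix i j assume "i : {..<d}" "j : {..<d}" "?f i = ?f j"
  hence "replicate k i = replicate k j" using dg[of i] dg[of j] by simp
  thus "i = j" using k by (simp add: replicate_eq_replicate)
 qed
 have im: "?S = ?f ` {..<d}"
 proof (rule Set.set_eqI, rule iffI)
  fix u assume "u : ?S"
  then obtain i where "u < d ^ k" "i < d" "digits (replicate k d) u = replicate k i" by blast
  thus "u : ?f ` {..<d}" using undigits_digits[of "replicate k d" u] by (intro image_eqI[of _ _ i]) (auto simp: prod_list_replicate)
 next
  fix u assume "u : ?f ` {..<d}"
  then obtain i where i: "i < d" "u = ?f i" by blast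
  thus "u : ?S"
   using undigits_less[OF v[OF i(1)]] dg[OF i(1)] by (auto simp: prod_list_replicate)
 qed
 have "nsq {..<d ^ k} (gv k d) = (SUM u<d ^ k. if EX i<d. digits (replicate k d) u = replicate k i then 1 / real d else 0)"
  by (intro sum.cong refl) (auto simp: gv_def norm_divide power_divide)
 also have "... = (SUM u:?S. 1 / real d)" by (simp only: sum.inter_filter finite_lessThan)
 also have "... = 1" unfolding im using d by (simp add: card_image[OF inj])
 finally show ?thesis .
qed

lemma digits_length [simp]: "length (digits ds i) = length ds"
 by (induction ds) auto

text \<open>In a tensor product of \<open>m\<close> private states, \<open>T c s\<close> is the twisted image of the shield basis vector \<open>s\<close> of component
 \<open>c\<close>, as a function of the index of key and shield.\<close>

locale key_components =
 fixes m :: nat and k d sd :: "nat => nat" and rho T sigma :: "nat => nat => nat => complex"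
 assumes d: "c < m ==> 1 <= d c" and k: "c < m ==> 1 <= k c"
  and rows: "c < m ==> u < d c ^ k c ==> v < sd c ==> v' < sd c ==>
   (SUM s<sd c. T c s (u * sd c + v) * cnj (T c s (u * sd c + v'))) = dl v v'"
  and cols: "c < m ==> u < d c ^ k c ==> s < sd c ==> s' < sd c ==>
   (SUM v<sd c. cnj (T c s (u * sd c + v)) * T c s' (u * sd c + v)) = dl s s'"
  and state: "c < m ==> z < d c ^ k c * sd c ==> z' < d c ^ k c * sd c ==>
   rho c z z' = (SUM s<sd c. SUM s'<sd c. gv (k c) (d c) (z div sd c) * T c s z * sigma c s s' * cnj (gv (k c) (d c) (z' div sd c) * T c s' z'))"
  and tr: "c < m ==> (SUM s<sd c. sigma c s s) = 1"
begin

definition "cdim c = d c ^ k c * sd c"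
definition "t c s z = gv (k c) (d c) (z div sd c) * T c s z"

lemma t_orth:
 assumes c: "c < m" and s: "s < sd c" "s' < sd c"
 shows "(SUM z<cdim c. cnj (t c s z) * t c s' z) = dl s s'"
proof -
 have "(SUM z<cdim c. cnj (t c s z) * t c s' z) = (SUM u<d c ^ k c. SUM v<sd c. of_real ((cmod (gv (k c) (d c) u))^2) * (cnj (T c s (u * sd c + v)) * T c s' (u * sd c + v)))"
  unfolding cdim_def sum_flat2 t_def cmod_sq[symmetric] by (intro sum.cong refl) (simp add: mult_ac)
 also have "... = (SUM u<d c ^ k c. of_real ((cmod (gv (k c) (d c) u))^2) * dl s s')"
  unfolding sum_distrib_left[symmetric] by (intro sum.cong refl arg_cong2[of _ _ _ _ times]) (simp add: cols[OF c _ s])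
 also have "... = of_real (nsq {..<d c ^ k c} (gv (k c) (d c))) * dl s s'"
  unfolding of_real_sum sum_distrib_right ..
 finally show ?thesis unfolding gv_norm[OF k[OF c] d[OF c]] by simp
qed

lemma state': "c < m ==> z < cdim c ==> z' < cdim c ==> rho c z z' = (SUM s<sd c. SUM s'<sd c. t c s z * sigma c s s' * cnj (t c s' z'))"
 unfolding cdim_def t_def by (rule state)

lemma form_rho:
 assumes c: "c < m"
 shows "(SUM z<cdim c. SUM z'<cdim c. cnj (f z) * rho c z z' * g z') = (SUM s<sd c. SUM s'<sd c. sigma c s s' * (SUM z<cdim c. cnj (f z) * t c s z) * (SUM z'<cdim c. cnj (t c s' z') * g z'))"
proof -
 let ?h = "%s s' z z'. sigma c s s' * (cnj (f z) * t c s z) * (cnj (t c s' z') * g z')"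
 have "(SUM z<cdim c. SUM z'<cdim c. cnj (f z) * rho c z z' * g z') = (SUM z<cdim c. SUM z'<cdim c. SUM s<sd c. SUM s'<sd c. ?h s s' z z')"
  by (intro sum.cong refl) (simp add: state'[OF c] sum_distribs mult_ac)
 also have "... = (SUM s<sd c. SUM s'<sd c. SUM z<cdim c. SUM z'<cdim c. ?h s s' z z')"
  by (rule sum_swap4)
 also have "... = (SUM s<sd c. SUM s'<sd c. sigma c s s' * (SUM z<cdim c. cnj (f z) * t c s z) * (SUM z'<cdim c. cnj (t c s' z') * g z'))"
  by (simp add: sum_distribs mult_ac)
 finally show ?thesis .
qed


text \<open>Only the components in \<open>Act\<close> are untwisted; the others keep the computational basis.\<close>

definition "ids Act c = (if c : Act then {..<sd c} else {..<cdim c})"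
definition "basis Act c s z = (if c : Act then t c s z else if s = z then 1 else 0)"

lemma finite_ids [simp]: "finite (ids Act c)"
 by (simp add: ids_def)

lemma basis_orth:
 assumes c: "c < m" and s: "s : ids Act c" "s' : ids Act c"
 shows "(SUM z<cdim c. cnj (basis Act c s z) * basis Act c s' z) = dl s s'"
proof (cases "c : Act")
 case True
 thus ?thesis using t_orth[OF c] s by (simp add: ids_def basis_def)
next
 case False
 have "(SUM z<cdim c. cnj (basis Act c s z) * basis Act c s' z) = (SUM z<cdim c. if z = s then if s = s' then 1 else 0 else 0)"
  using False by (intro sum.cong refl) (auto simp: basis_def)
 thus ?thesis using s False by (simp add: ids_def)
qed

text \<open>The range of each ideal state lies in the span of the chosen vectors, so its weight on
  that span equals its trace.\<close>

lemma basis_overlap: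
 assumes c: "c < m"
 shows "(SUM s:ids Act c. SUM z<cdim c. SUM z'<cdim c. cnj (basis Act c s z) * rho c z z' * basis Act c s z') = 1"
proof (cases "c : Act")
 case True
 have "(SUM z<cdim c. SUM z'<cdim c. cnj (t c s z) * rho c z z' * t c s z') = sigma c s s" if s: "s < sd c" for s
 proof -
  have "(SUM z<cdim c. SUM z'<cdim c. cnj (t c s z) * rho c z z' * t c s z')
   = (SUM a<sd c. SUM b<sd c. sigma c a b * (SUM z<cdim c. cnj (t c s z) * t c a z) * (SUM z'<cdim c. cnj (t c b z') * t c s z'))"
   by (rule form_rho[OF c])
  also have "... = (SUM a<sd c. SUM b<sd c. if b = s then if a = s then sigma c s s else 0 else 0)"
   by (intro sum.cong refl) (use s in "auto simp: t_orth[OF c]")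
  also have "... = sigma c s s" using s by simp
  finally show ?thesis .
 qed
 thus ?thesis using True tr[OF c] by (simp add: ids_def basis_def)
next
 case False
 have "(SUM s:ids Act c. SUM z<cdim c. SUM z'<cdim c. cnj (basis Act c s z) * rho c z z' * basis Act c s z')
  = (SUM s<cdim c. SUM z<cdim c. SUM z'<cdim c. if z' = s then if z = s then rho c s s else 0 else 0)"
  using False by (intro sum.cong) (auto simp: basis_def ids_def)
 also have "... = (SUM s<cdim c. SUM z<cdim c. if z = s then rho c s s else 0)" by (intro sum.cong refl) simp
 also have "... = (SUM s<cdim c. rho c s s)" by (intro sum.cong refl) simp
 also have "... = (SUM s<cdim c. SUM a<sd c. SUM b<sd c. sigma c a b * (cnj (t c b s) * t c a s))"
  by (intro sum.cong refl) (simp add: state'[OF c] mult_ac)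
 also have "... = (SUM a<sd c. SUM b<sd c. SUM s<cdim c. sigma c a b * (cnj (t c b s) * t c a s))"
  by (intro sum.cong refl sum_perm)
 also have "... = (SUM a<sd c. SUM b<sd c. if b = a then sigma c a a else 0)"
  unfolding sum_distrib_left[symmetric] by (intro sum.cong refl) (auto simp: t_orth[OF c])
 also have "... = 1" using tr[OF c] by simp
 finally show ?thesis .
qed

definition "\<I> = PiE {..<m} (%c. {..<cdim c})"
definition "\<S> Act = PiE {..<m} (ids Act)"
definition "tau Act s z = (\<Prod>c<m. basis Act c (s c) (z c))"
definition "rhorho z z' = (\<Prod>c<m. rho c (z c) (z' c))"

lemma finite_\<I>: "finite \<I>" and finite_\<S>: "finite (\<S> Act)"
 by (auto simp: \<I>_def \<S>_def intro: finite_PiE)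

lemma tau_orth:
 assumes s: "s : \<S> Act" "s' : \<S> Act"
 shows "(SUM z:\<I>. cnj (tau Act s z) * tau Act s' z) = dl s s'"
proof -
 have "(SUM z:\<I>. cnj (tau Act s z) * tau Act s' z) = (SUM z:\<I>. \<Prod>c<m. cnj (basis Act c (s c) (z c)) * basis Act c (s' c) (z c))"
  by (simp add: tau_def prod.distrib)
 also have "... = (\<Prod>c<m. SUM z<cdim c. cnj (basis Act c (s c) z) * basis Act c (s' c) z)"
  unfolding \<I>_def by (rule prod_sum_PiE[symmetric]) auto
 also have "... = (\<Prod>c<m. if s c = s' c then 1 else 0)"
  by (intro prod.cong refl basis_orth) (use s in "auto simp: \<S>_def")
 also have "... = dl s s'"
 proof (cases "s = s'")
  case False
  then obtain c where "c < m" "s c ~= s' c" using s PiE_ext[of s "{..<m}" "ids Act" s'] unfolding \<S>_def by blast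
  hence "(\<Prod>c<m. if s c = s' c then 1 else 0::complex) = 0" by (intro prod_zero) auto
  thus ?thesis using False by simp
 qed simp
 finally show ?thesis .
qed

lemma tau_overlap: "(SUM s:\<S> Act. SUM z:\<I>. SUM z':\<I>. cnj (tau Act s z) * rhorho z z' * tau Act s z') = 1"
proof -
 let ?f = "%c s z z'. cnj (basis Act c s z) * rho c z z' * basis Act c s z'"
 have "(SUM s:\<S> Act. SUM z:\<I>. SUM z':\<I>. cnj (tau Act s z) * rhorho z z' * tau Act s z') = (SUM s:\<S> Act. SUM z:\<I>. SUM z':\<I>. \<Prod>c<m. ?f c (s c) (z c) (z' c))"
  by (simp add: tau_def rhorho_def prod.distrib)
 also have "... = (SUM s:\<S> Act. SUM z:\<I>. \<Prod>c<m. SUM z'<cdim c. ?f c (s c) (z c) z')"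
  unfolding \<I>_def by (intro sum.cong refl prod_sum_PiE[symmetric]) auto
 also have "... = (SUM s:\<S> Act. \<Prod>c<m. SUM z<cdim c. SUM z'<cdim c. ?f c (s c) z z')"
  unfolding \<I>_def by (intro sum.cong refl prod_sum_PiE[symmetric]) auto
 also have "... = (\<Prod>c<m. SUM s:ids Act c. SUM z<cdim c. SUM z'<cdim c. ?f c s z z')"
  unfolding \<S>_def by (intro prod_sum_PiE[symmetric]) auto
 also have "... = 1" by (intro prod.neutral ballI basis_overlap) simp
 finally show ?thesis .
qed

text \<open>Keys are functions of component and position, set to zero off the active entries, so
  that all choices of active components share one type.\<close>

definition key :: "nat set => (nat => nat) => nat * nat => nat" where
 "key Act z = (%(c, q). if c : Act & q < k c then digits (replicate (k c) (d c)) (z c div sd c) ! q else 0)"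

definition amp :: "nat set => (nat * nat => nat) => complex" where
 "amp Act u = (PROD c:Act. if EX i<d c. ALL q<k c. u (c, q) = i then of_real (1 / sqrt (real (d c))) else 0)"

definition twist :: "nat set => (nat => nat) => (nat => nat) => complex" where
 "twist Act s z = (\<Prod>c<m. if c : Act then cnj (T c (s c) (z c)) else if s c = z c then 1 else 0)"

lemma gv_key:
 assumes "c : Act"
 shows "gv (k c) (d c) (z c div sd c) = (if EX i<d c. ALL q<k c. key Act z (c, q) = i then of_real (1 / sqrt (real (d c))) else 0)"
proof -
 have "digits (replicate (k c) (d c)) (z c div sd c) = replicate (k c) i <-> (ALL q<k c. key Act z (c, q) = i)" for i
  using assms by (auto simp: key_def list_eq_iff_nth_eq)
 thus ?thesis by (simp add: gv_def)
qed

text \<open>Separates a twisted basis vector into the ideal key amplitude and the untwisting map,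
  the product form in which \<open>approx_private\<close> expresses fidelity.\<close>

lemma tau_twist:
 assumes "Act \<subseteq> {..<m}"
 shows "cnj (tau Act s z) = cnj (amp Act (key Act z)) * twist Act s z"
proof -
 have "amp Act (key Act z) = (PROD c:Act. gv (k c) (d c) (z c div sd c))"
  unfolding amp_def by (intro prod.cong refl gv_key[symmetric])
 also have "... = (\<Prod>c<m. if c : Act then gv (k c) (d c) (z c div sd c) else 1)"
  using assms by (intro prod.mono_neutral_cong_left) auto
 finally have amp: "amp Act (key Act z) = (\<Prod>c<m. if c : Act then gv (k c) (d c) (z c div sd c) else 1)" .
 show ?thesis unfolding tau_def twist_def amp cnj_prod prod.distrib[symmetric]
  by (intro prod.cong refl) (simp add: basis_def t_def)
qed

lemma key_eqD:
 assumes "c : Act" "c < m" "key Act z = key Act z'" "z : \<I>" "z' : \<I>"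
 shows "z c div sd c = z' c div sd c" "z c div sd c < d c ^ k c"
proof -
 have lt: "z c div sd c < d c ^ k c" if "z : \<I>" for z
  using that assms(2) flat_split(1)[of "z c" "d c ^ k c" "sd c"] by (auto simp: \<I>_def cdim_def)
 let ?ds = "replicate (k c) (d c)"
 have u: "undigits ?ds (digits ?ds (z c div sd c)) = z c div sd c" if "z : \<I>" for z
  using lt[OF that] by (simp add: undigits_digits)
 have "digits ?ds (z c div sd c) = digits ?ds (z' c div sd c)"
 proof (rule nth_equalityI)
  fix q assume "q < length (digits ?ds (z c div sd c))"
  thus "digits ?ds (z c div sd c) ! q = digits ?ds (z' c div sd c) ! q"
   using assms(1) fun_cong[OF assms(3), of "(c, q)"] by (simp add: key_def)
 qed simp
 hence "undigits ?ds (digits ?ds (z c div sd c)) = undigits ?ds (digits ?ds (z' c div sd c))" by (rule arg_cong)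
 thus "z c div sd c = z' c div sd c" unfolding u[OF assms(4)] u[OF assms(5)] .
 show "z c div sd c < d c ^ k c" by (rule lt[OF assms(4)])
qed

lemma twist_untwist:
 assumes A: "Act \<subseteq> {..<m}" and z: "z : \<I>" "z' : \<I>" and e: "key Act z = key Act z'"
 shows "(SUM s:\<S> Act. twist Act s z * cnj (twist Act s z')) = dl z z'"
proof -
 let ?f = "%c s x. if c : Act then cnj (T c s x) else if s = x then 1 else 0"
 have "(SUM s:\<S> Act. twist Act s z * cnj (twist Act s z')) = (SUM s:\<S> Act. \<Prod>c<m. ?f c (s c) (z c) * cnj (?f c (s c) (z' c)))"
  by (simp add: twist_def prod.distrib)
 also have "... = (\<Prod>c<m. SUM s:ids Act c. ?f c s (z c) * cnj (?f c s (z' c)))"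
  unfolding \<S>_def by (rule prod_sum_PiE[symmetric]) auto
 also have "... = (\<Prod>c<m. if z c = z' c then 1 else 0)"
 proof (intro prod.cong refl)
  fix c assume "c : {..<m}"
  hence c: "c < m" by simp
  have zc: "z c < cdim c" "z' c < cdim c" using z c by (auto simp: \<I>_def)
  show "(SUM s:ids Act c. ?f c s (z c) * cnj (?f c s (z' c))) = (if z c = z' c then 1 else 0)"
  proof (cases "c : Act")
   case True
   note u = key_eqD[OF True c e z]
   let ?u = "z c div sd c"
   have zs: "z c = ?u * sd c + z c mod sd c" "z' c = ?u * sd c + z' c mod sd c" by (simp only: div_mult_mod_eq, simp only: u(1) div_mult_mod_eq)
   have v: "z c mod sd c < sd c" "z' c mod sd c < sd c" using zc flat_split(2) unfolding cdim_def by blast+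
   have "(SUM s<sd c. T c s (?u * sd c + z' c mod sd c) * cnj (T c s (?u * sd c + z c mod sd c))) = (if z' c mod sd c = z c mod sd c then 1 else 0)"
    by (rule rows[OF c u(2) v(2,1)])
   hence "(SUM s<sd c. T c s (z' c) * cnj (T c s (z c))) = (if z' c mod sd c = z c mod sd c then 1 else 0)"
    unfolding zs(1)[symmetric] zs(2)[symmetric] .
   moreover have "z' c mod sd c = z c mod sd c <-> z c = z' c" using zs by metis
   ultimately show ?thesis using True by (simp add: ids_def mult.commute)
  next
   case False
   have "(SUM s:ids Act c. ?f c s (z c) * cnj (?f c s (z' c))) = (SUM s<cdim c. if s = z c then if z c = z' c then 1 else 0 else 0)"
    using False by (intro sum.cong) (auto simp: ids_def)
   thus ?thesis using zc by simp
  qed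
 qed
 also have "... = dl z z'"
 proof (cases "z = z'")
  case False
  then obtain c where "c < m" "z c ~= z' c" using z PiE_ext[of z "{..<m}" "%c. {..<cdim c}" z'] unfolding \<I>_def by blast
  hence "(\<Prod>c<m. if z c = z' c then 1 else 0::complex) = 0" by (intro prod_zero) auto
  thus ?thesis using False by simp
 qed simp
 finally show ?thesis .
qed

end

context key_components
begin

lemma amp_sq:
 assumes "finite Act"
 shows "(cmod (amp Act u))^2 = (if ALL c:Act. EX i<d c. ALL q<k c. u (c, q) = i then PROD c:Act. 1 / real (d c) else 0)"
proof (cases "ALL c:Act. EX i<d c. ALL q<k c. u (c, q) = i")
 case True
 hence "(cmod (amp Act u))^2 = (PROD c:Act. (1 / sqrt (real (d c)))^2)"
  unfolding amp_def prod_norm[symmetric] prod_power_distrib[symmetric]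
  by (intro arg_cong[of _ _ "%x. x^2"] prod.cong refl) (simp add: norm_divide)
 thus ?thesis using True by (simp add: power_divide)
next
 case False
 then obtain c where "c : Act" "~ (EX i<d c. ALL q<k c. u (c, q) = i)" by blast
 hence "amp Act u = 0" unfolding amp_def by (intro prod_zero[OF assms] bexI[of _ c]) auto
 thus ?thesis unfolding if_not_P[OF False] by simp
qed

text \<open>A key of nonzero amplitude is constant on every active component. Fixing one entry in
  each component of \<open>X\<close> leaves one free value for each other component, so at most the
  product of their dimensions many keys survive, each of weight the product of 1/d over all active
  components.\<close>

lemma marginal_bound:
 assumes A: "Act \<subseteq> {..<m}" and X: "X \<subseteq> Act" and q: "!!c. c : X ==> q c < k c"
  and P: "!!u c. u : key Act ` \<I> ==> P u ==> c : X ==> u (c, q c) = a c"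
 shows "(SUM u:{u:key Act ` \<I>. P u}. (cmod (amp Act u))^2) <= 1 / (PROD c:X. real (d c))"
proof -
 have fA: "finite Act" using A finite_subset by blast
 let ?D = "PROD c:Act. 1 / real (d c)"
 define C where "C = (%u::nat * nat => nat. ALL c:Act. EX i<d c. ALL q<k c. u (c, q) = i)"
 let ?U = "{u:key Act ` \<I>. P u}" and ?Z = "{u:key Act ` \<I>. P u & C u}"
 have fU: "finite ?U" using finite_\<I> by simp
 have ran: "restrict (%c. u (c, 0)) (Act - X) : PiE (Act - X) (%c. {..<d c})" if u: "u : ?Z" for u
 proof (rule restrict_PiE_iff[THEN iffD2], rule ballI)
  fix c assume c: "c : Act - X"
  hence "0 < k c" using k A by fastforce
  thus "u (c, 0) : {..<d c}" using u c unfolding C_def by fastforce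
 qed
 have inj: "inj_on (%u. restrict (%c. u (c, 0)) (Act - X)) ?Z"
 proof (rule inj_onI, rule ext)
  fix u v and cq :: "nat * nat" assume u: "u : ?Z" and v: "v : ?Z" and e: "restrict (%c. u (c, 0)) (Act - X) = restrict (%c. v (c, 0)) (Act - X)"
  obtain c i where cq: "cq = (c, i)" by fastforce
  show "u cq = v cq"
  proof (cases "c : Act & i < k c")
   case False
   thus ?thesis using u v unfolding cq key_def by auto
  next
   case True
   then obtain x y where x: "ALL q<k c. u (c, q) = x" and y: "ALL q<k c. v (c, q) = y" using u v unfolding C_def by blast
   have "x = y"
   proof (cases "c : X")
    case True
    have "u (c, q c) = a c" by (rule P) (use u True in auto)
    moreover have "v (c, q c) = a c" by (rule P) (use v True in auto)
    ultimately show ?thesis using x y q[OF True] by simp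
   next
    case False
    thus ?thesis using fun_cong[OF e, of c] x y True by auto
   qed
   thus ?thesis using x y True unfolding cq by simp
  qed
 qed
 have "card ?Z <= card (PiE (Act - X) (%c. {..<d c}))"
  by (rule card_inj_on_le[OF inj image_subsetI[OF ran]]) (auto intro: finite_PiE fA)
 also have "... = (PROD c:Act - X. d c)" using fA by (simp add: card_PiE)
 finally have cZ: "real (card ?Z) <= (PROD c:Act - X. real (d c))" by (simp only: of_nat_prod[symmetric] of_nat_le_iff)
 have pos: "0 < real (d c)" if "c : Act" for c using d[of c] A that by fastforce
 have "nsq ?U (amp Act) = (SUM u:?U. if C u then ?D else 0)"
  by (intro sum.cong refl) (simp add: amp_sq[OF fA] C_def)
 also have "... = (SUM u:{u:?U. C u}. ?D)" by (simp only: sum.inter_filter fU)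
 also have "{u:?U. C u} = ?Z" by auto
 also have "(SUM u:?Z. ?D) = real (card ?Z) * ?D" by simp
 also have "... <= (PROD c:Act - X. real (d c)) * ?D" by (rule mult_right_mono[OF cZ]) (use pos in "auto intro!: prod_nonneg")
 also have "?D = (PROD c:Act - X. 1 / real (d c)) * (PROD c:X. 1 / real (d c))" by (rule prod.subset_diff[OF X fA])
 also have "(PROD c:Act - X. real (d c)) * ((PROD c:Act - X. 1 / real (d c)) * (PROD c:X. 1 / real (d c))) = (PROD c:Act - X. real (d c) * (1 / real (d c))) * (PROD c:X. 1 / real (d c))"
  by (simp only: prod.distrib mult.assoc)
 also have "(PROD c:Act - X. real (d c) * (1 / real (d c))) = 1" by (intro prod.neutral ballI) (use pos in auto)
 also have "1 * (PROD c:X. 1 / real (d c)) = 1 / (PROD c:X. real (d c))" by (simp add: prod_dividef)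
 finally show ?thesis .
qed

lemma card_keys:
 assumes A: "Act \<subseteq> {..<m}"
 shows "real (card (key Act ` \<I>)) <= (\<Prod>c<m. real (d c) ^ k c)"
proof -
 have fA: "finite Act" using A finite_subset by blast
 let ?g = "%w (c, q). if c : Act & q < k c then digits (replicate (k c) (d c)) (w c) ! q else 0"
 have "key Act ` \<I> \<subseteq> ?g ` PiE Act (%c. {..<d c ^ k c})"
 proof
  fix u assume "u : key Act ` \<I>"
  then obtain z where z: "z : \<I>" "u = key Act z" by blast
  have "key Act z = ?g (restrict (%c. z c div sd c) Act)" by (auto simp: key_def fun_eq_iff)
  moreover have "restrict (%c. z c div sd c) Act : PiE Act (%c. {..<d c ^ k c})"
   using key_eqD(2)[OF _ _ refl z(1) z(1)] A by (auto simp: restrict_PiE_iff)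
  ultimately show "u : ?g ` PiE Act (%c. {..<d c ^ k c})" using z(2) by blast
 qed
 hence "card (key Act ` \<I>) <= card (PiE Act (%c. {..<d c ^ k c}))"
  by (rule surj_card_le[rotated]) (auto intro: finite_PiE fA)
 also have "... = (PROD c:Act. d c ^ k c)" using fA by (simp add: card_PiE)
 finally have "real (card (key Act ` \<I>)) <= real (PROD c:Act. d c ^ k c)" by (simp only: of_nat_le_iff)
 also have "... = (PROD c:Act. real (d c) ^ k c)" by simp
 also have "... <= (\<Prod>c<m. real (d c) ^ k c)" using A d by (intro prod_mono2) auto
 finally show ?thesis .
qed

text \<open>On the span of the test vectors the ideal state has weight 1. The trace norm bounds the
  change of this weight, so the actual state has at least 1 - eps there; rewritten by
  \<open>tau_twist\<close>, that weight is the fidelity of the untwisted key.\<close>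

lemma fidelity_lower:
 assumes A: "Act \<subseteq> {..<m}" and R: "finite R" and h: "bij_betw h \<I> {..<n}"
  and Om: "Om : carrier_mat n n" "!!z z'. z : \<I> ==> z' : \<I> ==> Om $$ (h z, h z') = (SUM r:R. chi (z, r) * cnj (chi (z', r)))"
  and Psi: "Psi : carrier_mat n n" "!!z z'. z : \<I> ==> z' : \<I> ==> Psi $$ (h z, h z') = rhorho z z'"
  and eps: "trace_norm (Om - Psi) <= eps"
 shows "1 - eps <= (SUM s:\<S> Act. SUM r:R. (cmod (SUM z:\<I>. cnj (amp Act (key Act z)) * twist Act s z * chi (z, r)))^2)" (is "_ <= ?F")
proof -
 define g where "g = the_inv_into \<I> h"
 have gh: "g (h z) = z" if "z : \<I>" for z using h that unfolding g_def bij_betw_def by (simp add: the_inv_into_f_f)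
 have hn: "h z < n" if "z : \<I>" for z using h that by (auto simp: bij_betw_def)
 define \<theta> where "\<theta> = (%s i. tau Act s (g i))"
 have re: "(SUM i<n. f i) = (SUM z:\<I>. f (h z))" for f :: "nat => complex" by (rule sum.reindex_bij_betw[OF h, symmetric])
 have "ip {..<n} (\<theta> s) (\<theta> s') = dl s s'" if "s : \<S> Act" "s' : \<S> Act" for s s'
  unfolding ip_def re \<theta>_def using tau_orth[OF that] by (simp add: gh cong: sum.cong)
 hence "cmod (SUM s:\<S> Act. SUM i<n. SUM j<n. cnj (\<theta> s i) * (Om - Psi) $$ (i, j) * \<theta> s j) <= trace_norm (Om - Psi)"
  by (intro trace_norm_bound finite_\<S>) (use Om Psi in auto)
 also have "(SUM s:\<S> Act. SUM i<n. SUM j<n. cnj (\<theta> s i) * (Om - Psi) $$ (i, j) * \<theta> s j)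
  = (SUM s:\<S> Act. SUM z:\<I>. SUM z':\<I>. cnj (tau Act s z) * (SUM r:R. chi (z, r) * cnj (chi (z', r))) * cnj (cnj (tau Act s z')))
   - (SUM s:\<S> Act. SUM z:\<I>. SUM z':\<I>. cnj (tau Act s z) * rhorho z z' * tau Act s z')"
  unfolding re sum_subtractf[symmetric]
  by (intro sum.cong refl) (use Om(1) Psi(1) in "simp add: \<theta>_def gh hn Om(2) Psi(2) algebra_simps")
 also have "(SUM s:\<S> Act. SUM z:\<I>. SUM z':\<I>. cnj (tau Act s z) * (SUM r:R. chi (z, r) * cnj (chi (z', r))) * cnj (cnj (tau Act s z'))) = of_real ?F"
  unfolding of_real_sum cmod_sq(1)[symmetric] tau_twist[OF A, symmetric] by (rule sum.cong[OF refl]) (rule gram_apply)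
 finally have "cmod (of_real ?F - 1) <= eps" using eps unfolding tau_overlap by linarith
 hence "\<bar>?F - 1\<bar> <= eps" unfolding of_real_1[where 'a=complex, symmetric] of_real_diff[symmetric] norm_of_real .
 thus ?thesis by linarith
qed

lemma key_private:
 assumes A: "Act \<subseteq> {..<m}" and R: "finite R" and n: "nsq (\<I> >< R) chi = 1" and eps: "0 <= eps"
  and F: "1 - eps <= (SUM s:\<S> Act. SUM r:R. (cmod (SUM z:\<I>. cnj (amp Act (key Act z)) * twist Act s z * chi (z, r)))^2)"
 shows "approx_private \<I> R chi (key Act) (\<S> Act) (twist Act) (amp Act) eps (\<Prod>c<m. real (d c) ^ k c)"
proof
 show "nsq (key Act ` \<I>) (amp Act) <= 1"
  using marginal_bound[OF A empty_subsetI, where P="%_. True"] by simp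
qed (use twist_untwist[OF A] finite_\<I> finite_\<S> R n eps F card_keys[OF A] in auto)

text \<open>\<open>X\<close> is the set of parties on one side of a cut, and a share keeps the
  entries they own. By \<open>cross\<close>, an active component with an entry inside
  \<open>X\<close> also has one outside, so on the ideal support the other side can compute the
  share.\<close>

lemma keyed_parties:
 assumes ap: "approx_private \<I> R chi (key Act) (\<S> Act) (twist Act) (amp Act) eps N" and A: "Act \<subseteq> {..<m}"
  and cross: "!!c q. c : Act ==> q < k c ==> ps c q : X ==> EX q<k c. ps c q ~: X"
  and alpha: "!!z z' c q. z : \<I> ==> z' : \<I> ==> alpha z = alpha z' ==> c : Act ==> q < k c ==> ps c q : X ==> key Act z (c, q) = key Act z' (c, q)"
  and omega: "!!z z' c q. z : \<I> ==> z' : \<I> ==> omega z = omega z' ==> c : Act ==> q < k c ==> ps c q ~: X ==> key Act z (c, q) = key Act z' (c, q)"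
 shows "approx_private.keyed \<I> (key Act) (amp Act) alpha omega (PROD c:{c:Act. EX q<k c. ps c q : X}. real (d c))"
proof -
 have fA: "finite Act" using A finite_subset by blast
 define sel where "sel = (%Y (u::nat * nat => nat) (c, q). if c : Act & q < k c & ps c q : Y then u (c, q) else 0)"
 define other where "other = (%c. SOME q. q < k c & ps c q ~: X)"
 define g where "g = (%(v::nat * nat => nat) (c, q). if c : Act & q < k c & ps c q : X then v (c, other c) else 0)"
 let ?Q = "{c:Act. EX q<k c. ps c q : X}"
 have kz: "key Act z (c, q) = 0" if "~ (c : Act & q < k c)" for z c q using that by (auto simp: key_def)
 have h1: "sel X (key Act z) = sel X (key Act z')" if "z : \<I>" "z' : \<I>" "alpha z = alpha z'" for z z'
  unfolding sel_def using alpha[OF that] by (auto simp: fun_eq_iff)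
 have h2: "sel (- X) (key Act z) = sel (- X) (key Act z')" if "z : \<I>" "z' : \<I>" "omega z = omega z'" for z z'
  unfolding sel_def using omega[OF that] by (auto simp: fun_eq_iff)
 have h3: "inj_on (%u. (sel X u, sel (- X) u)) (key Act ` \<I>)"
 proof (rule inj_onI, rule ext)
  fix u v and cq :: "nat * nat" assume u: "u : key Act ` \<I>" and v: "v : key Act ` \<I>" and e: "(sel X u, sel (- X) u) = (sel X v, sel (- X) v)"
  obtain c q where cq: "cq = (c, q)" by fastforce
  have "sel X u (c, q) = sel X v (c, q)" "sel (- X) u (c, q) = sel (- X) v (c, q)" using e by auto
  thus "u cq = v cq" using u v kz[of c q] unfolding cq sel_def by (cases "c : Act & q < k c"; cases "ps c q : X") auto
 qed
 have h4: "sel X u = g (sel (- X) u)" if u: "amp Act u ~= 0" for u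
 proof (rule ext)
  fix cq :: "nat * nat"
  obtain c q where cq: "cq = (c, q)" by fastforce
  show "sel X u cq = g (sel (- X) u) cq"
  proof (cases "c : Act & q < k c & ps c q : X")
   case True
   hence "EX q<k c. ps c q ~: X" using cross by blast
   hence o: "other c < k c & ps c (other c) ~: X" unfolding other_def by (rule someI_ex)
   have "(cmod (amp Act u))^2 ~= 0" using u by simp
   hence "ALL c:Act. EX i<d c. ALL q<k c. u (c, q) = i" unfolding amp_sq[OF fA] by (auto split: if_splits)
   hence "u (c, q) = u (c, other c)" using True o by fastforce
   thus ?thesis using True o unfolding cq sel_def g_def by simp
  qed (auto simp: cq sel_def g_def)
 qed
 have h5: "1 <= (PROD c:?Q. real (d c))" using A d by (intro prod_ge_1) auto
 have h6: "(SUM u:{u:key Act ` \<I>. sel X u = a}. (cmod (amp Act u))^2) <= 1 / (PROD c:?Q. real (d c))" for a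
 proof -
  define q where "q = (%c. SOME q. q < k c & ps c q : X)"
  have q: "q c < k c & ps c (q c) : X" if "c : ?Q" for c
   using that unfolding q_def by (intro someI_ex[of "%q. q < k c & ps c q : X"]) blast
  show ?thesis
  proof (rule marginal_bound[OF A, where q=q and a="%c. a (c, q c)"])
   fix u c assume u: "sel X u = a" and c: "c : ?Q"
   thus "u (c, q c) = a (c, q c)" using q[OF c] unfolding u[symmetric] by (simp add: sel_def)
  qed (use q in auto)
 qed
 show ?thesis unfolding approx_private.keyed_def[OF ap]
  by (rule exI[of _ "sel X"], rule exI[of _ "sel (- X)"], rule exI[of _ g])
   (intro conjI; (intro ballI allI impI)?; (rule h3 h5 h6 | (rule h4; assumption) | (rule h1; assumption) | (rule h2; assumption)))
qed

end

section \<open>Sorting tensor factors by owner\<close>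

lemma list_all2_concat_map:
 "(!!c. c : set l ==> list_all2 P (f c) (g c)) ==> list_all2 P (concat (map f l)) (concat (map g l))"
 by (induction l) (auto intro: list_all2_appendI)

lemma undigits_append: "length xs = length ds ==> undigits (ds @ ds') (xs @ xs') = undigits ds xs * prod_list ds' + undigits ds' xs'"
proof (induction ds arbitrary: xs)
 case (Cons d ds)
 then obtain y ys where "xs = y # ys" "length ys = length ds" by (cases xs) auto
 thus ?case using Cons.IH[of ys] by (simp add: algebra_simps)
qed simp

lemma flat_div_mod: "u < p ==> (x * p + u) div p = x" "u < p ==> (x * p + u) mod p = u" for p :: nat
 by simp_all

lemma kron_list_entry:
 assumes "!!c. c : set l ==> M c : carrier_mat (prod_list (f c)) (prod_list (f c)) & z c < prod_list (f c) & z' c < prod_list (f c)"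
 shows "kron_list (map M l) : carrier_mat (prod_list (concat (map f l))) (prod_list (concat (map f l))) &
  kron_list (map M l) $$ (undigits (concat (map f l)) (concat (map (%c. digits (f c) (z c)) l)), undigits (concat (map f l)) (concat (map (%c. digits (f c) (z' c)) l)))
   = prod_list (map (%c. M c $$ (z c, z' c)) l)"
 using assms
proof (induction l)
 case (Cons c l)
 let ?P = "prod_list (concat (map f l))" and ?K = "kron_list (map M l)"
 let ?u = "%z. undigits (concat (map f l)) (concat (map (%c. digits (f c) (z c)) l))"
 have IH: "?K : carrier_mat ?P ?P" "?K $$ (?u z, ?u z') = prod_list (map (%c. M c $$ (z c, z' c)) l)"
  using Cons.IH Cons.prems by auto
 have c: "M c : carrier_mat (prod_list (f c)) (prod_list (f c))" "z c < prod_list (f c)" "z' c < prod_list (f c)" using Cons.prems[of c] by auto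
 have e: "undigits (concat (map f (c # l))) (concat (map (%c. digits (f c) (w c)) (c # l))) = w c * ?P + ?u w" if "w c < prod_list (f c)" for w
  using that by (simp add: undigits_append undigits_digits)
 have u: "?u w < ?P" if "!!c. c : set l ==> w c < prod_list (f c)" for w
 proof (rule undigits_less, rule list_all2_concat_map, rule digits_valid)
  fix c' assume "c' : set l"
  thus "0 < prod_list (f c')" using that[of c'] by (cases "prod_list (f c') = 0") auto
 qed
 have uz: "?u z < ?P" "?u z' < ?P" using Cons.prems by (auto intro!: u)
 have lt: "z c * ?P + ?u z < prod_list (f c) * ?P" "z' c * ?P + ?u z' < prod_list (f c) * ?P" using uz c by (auto intro: flat_less2)
 have dm: "(z c * ?P + ?u z) div ?P = z c" "(z c * ?P + ?u z) mod ?P = ?u z" "(z' c * ?P + ?u z') div ?P = z' c" "(z' c * ?P + ?u z') mod ?P = ?u z'"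
  by (rule flat_div_mod uz)+
 have "kron (M c) ?K $$ (z c * ?P + ?u z, z' c * ?P + ?u z') = M c $$ (z c, z' c) * ?K $$ (?u z, ?u z')"
  using c(1) IH(1) lt dm by (simp add: kron_def)
 moreover have "kron (M c) ?K : carrier_mat (prod_list (f c) * ?P) (prod_list (f c) * ?P)" using c(1) IH(1) by (simp add: kron_def)
 ultimately show ?case unfolding e[of z, OF c(2)] e[of z', OF c(3)] using IH(2) by simp
qed simp

lemma concat_index:
 assumes "c : set l" "q < length (f c)" "!!c. c : set l ==> length (g c) = length (f c) & length (h c) = length (f c)"
 shows "EX j<length (concat (map f l)). concat (map f l) ! j = f c ! q & concat (map g l) ! j = g c ! q & concat (map h l) ! j = h c ! q"
 using assms
proof (induction l)
 case (Cons a l)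
 show ?case
 proof (cases "c = a")
  case True
  thus ?thesis using Cons.prems(2,3) by (intro exI[of _ q]) (auto simp: nth_append)
 next
  case False
  hence "EX j<length (concat (map f l)). concat (map f l) ! j = f c ! q & concat (map g l) ! j = g c ! q & concat (map h l) ! j = h c ! q"
   using Cons by auto
  then obtain j where j: "j < length (concat (map f l))" "concat (map f l) ! j = f c ! q" "concat (map g l) ! j = g c ! q" "concat (map h l) ! j = h c ! q" by blast
  have "length (g a) = length (f a)" "length (h a) = length (f a)" using Cons.prems(3) by auto
  thus ?thesis using j by (intro exI[of _ "length (f a) + j"]) (simp add: nth_append)
 qed
qed simp

lemma filter_zip:
 assumes "length D = length Os"
 shows "map fst (filter (%x. snd x = p) (zip D Os)) = map ((!) D) (filter (%j. Os ! j = p) [0..<length Os])"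
proof -
 have "zip D Os = map (%j. (D ! j, Os ! j)) [0..<length Os]" using assms by (intro nth_equalityI) auto
 thus ?thesis by (simp add: filter_map o_def)
qed

lemma mset_filter3:
 "(!!j. j : set l ==> f j < (3::nat)) ==> mset (filter (%j. f j = 0) l @ filter (%j. f j = 1) l @ filter (%j. f j = 2) l) = mset l"
proof (induction l)
 case (Cons a l)
 have "f a = 0 | f a = 1 | f a = 2" using Cons.prems[of a] by auto
 thus ?case using Cons by auto
qed simp

definition wf_comp :: "component => bool" where
 "wf_comp x <-> length (fst (snd x)) = length (fst x) & (ALL p:set (fst (snd x)). p < 3) & 0 < prod_list (fst x) &
   snd (snd x) : carrier_mat (prod_list (fst x)) (prod_list (fst x))"

definition party_view :: "component list => nat => (nat => nat) => nat" where
 "party_view cs p z = (let \<pi> = filter (%j. comp_owners cs ! j = p) [0..<length (comp_owners cs)] in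
   undigits (map ((!) (comp_dims cs)) \<pi>) (map ((!) (concat (map (%c. digits (fst (cs ! c)) (z c)) [0..<length cs]))) \<pi>))"

definition local_indices :: "component list => (nat => nat) set" where
 "local_indices cs = PiE {..<length cs} (%c. {..<prod_list (fst (cs ! c))})"

definition joint_index :: "component list => (nat => nat) => nat * nat * nat" where
 "joint_index cs z = (party_view cs 0 z, party_view cs 1 z, party_view cs 2 z)"

lemma map_index: "map g l = map (%c. g (l ! c)) [0..<length l]"
 by (rule nth_equalityI) auto

context
 fixes cs :: "component list"
 assumes wf: "ALL x:set cs. wf_comp x"
begin

abbreviation "D \<equiv> comp_dims cs"
abbreviation "Os \<equiv> comp_owners cs"
abbreviation "\<pi> p \<equiv> filter (%j. Os ! j = p) [0..<length Os]"
abbreviation "xs z \<equiv> concat (map (%c. digits (fst (cs ! c)) (z c)) [0..<length cs])"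

lemma D_concat: "D = concat (map (%c. fst (cs ! c)) [0..<length cs])" and Os_concat: "Os = concat (map (%c. fst (snd (cs ! c))) [0..<length cs])"
 and states: "map (snd \<circ> snd) cs = map (%c. snd (snd (cs ! c))) [0..<length cs]"
 unfolding comp_dims_def comp_owners_def map_index[of _ cs] by (simp_all only: o_apply)

lemma wf': "c < length cs ==> wf_comp (cs ! c)"
 using wf by simp

lemma len: "length D = length Os"
proof -
 have "list_all2 (%_ _. True) Os D" unfolding D_concat Os_concat
  by (rule list_all2_concat_map) (use wf' in "auto simp: wf_comp_def list_all2_conv_all_nth")
 thus ?thesis by (simp add: list_all2_lengthD)
qed

lemma owners_less: "j < length Os ==> Os ! j < 3"
proof -
 assume "j < length Os"
 hence "Os ! j : set Os" by simp
 thus "Os ! j < 3" using wf unfolding comp_owners_def wf_comp_def by auto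
qed

lemma order_mset: "mset (owner_order cs) = mset [0..<length D]"
 unfolding owner_order_def Let_def len by (rule mset_filter3) (use owners_less in auto)

lemma party_dim_view: "party_dim cs p = prod_list (map ((!) D) (\<pi> p))"
 unfolding party_dim_def filter_zip[OF len] ..

lemma xs_valid: "z : local_indices cs ==> list_all2 (<) (xs z) D"
 unfolding D_concat by (rule list_all2_concat_map, rule digits_valid) (use wf' in "auto simp: wf_comp_def")

lemma sub_valid:
 assumes z: "z : local_indices cs"
 shows "list_all2 (<) (map ((!) (xs z)) (\<pi> p)) (map ((!) D) (\<pi> p))"
 using xs_valid[OF z] len by (auto simp: list_all2_conv_all_nth in_set_conv_nth[symmetric] dest!: nth_mem)

lemma party_view_less: "z : local_indices cs ==> party_view cs p z < party_dim cs p"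
 unfolding party_view_def Let_def party_dim_view by (rule undigits_less[OF sub_valid])

lemma party_view_digits:
 assumes z: "z : local_indices cs" "z' : local_indices cs" and e: "party_view cs p z = party_view cs p z'"
  and c: "c < length cs" "q < length (fst (cs ! c))" "fst (snd (cs ! c)) ! q = p"
 shows "digits (fst (cs ! c)) (z c) ! q = digits (fst (cs ! c)) (z' c) ! q"
proof -
 have "map ((!) (xs z)) (\<pi> p) = map ((!) (xs z')) (\<pi> p)"
  using digits_undigits[OF sub_valid[OF z(1)], of p 0] digits_undigits[OF sub_valid[OF z(2)], of p 0] e
  unfolding party_view_def Let_def by simp
 hence *: "xs z ! j = xs z' ! j" if "j : set (\<pi> p)" for j using that unfolding map_eq_conv by blast
 have "EX j<length (concat (map (%c. fst (snd (cs ! c))) [0..<length cs])). concat (map (%c. fst (snd (cs ! c))) [0..<length cs]) ! j = fst (snd (cs ! c)) ! q &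
   xs z ! j = digits (fst (cs ! c)) (z c) ! q & xs z' ! j = digits (fst (cs ! c)) (z' c) ! q"
  by (rule concat_index) (use c wf' in "auto simp: wf_comp_def")
 then obtain j where j: "j < length Os" "Os ! j = p" "xs z ! j = digits (fst (cs ! c)) (z c) ! q" "xs z' ! j = digits (fst (cs ! c)) (z' c) ! q"
  unfolding Os_concat[symmetric] c(3) by blast
 have "j : set (\<pi> p)" using j by simp
 from *[OF this] show ?thesis unfolding j(3,4) .
qed

text \<open>Injective because each digit of each component is visible to its owner; onto because
  both sides have as many elements as the product of all factor dimensions.\<close>

lemma joint_index_bij: "bij_betw (joint_index cs) (local_indices cs) (boxl (party_dims cs))"
proof -
 have inj: "inj_on (joint_index cs) (local_indices cs)"
 proof (rule inj_onI)
  fix z z' assume z: "z : local_indices cs" "z' : local_indices cs" and e: "joint_index cs z = joint_index cs z'"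
  have v: "party_view cs p z = party_view cs p z'" if "p < 3" for p
   using e that by (auto simp: joint_index_def numeral_3_eq_3 less_Suc_eq numeral_2_eq_2)
  show "z = z'"
  proof (rule PiE_ext[OF z[unfolded local_indices_def]])
   fix c assume "c : {..<length cs}"
   hence c: "c < length cs" by simp
   have "digits (fst (cs ! c)) (z c) = digits (fst (cs ! c)) (z' c)"
   proof (rule nth_equalityI)
    fix q assume "q < length (digits (fst (cs ! c)) (z c))"
    hence q: "q < length (fst (cs ! c))" by simp
    hence "fst (snd (cs ! c)) ! q < 3" using wf'[OF c] by (simp add: wf_comp_def)
    thus "digits (fst (cs ! c)) (z c) ! q = digits (fst (cs ! c)) (z' c) ! q" using party_view_digits[OF z v c q] by blast
   qed simp
   hence "undigits (fst (cs ! c)) (digits (fst (cs ! c)) (z c)) = undigits (fst (cs ! c)) (digits (fst (cs ! c)) (z' c))" by simp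
   moreover have "z c < prod_list (fst (cs ! c))" "z' c < prod_list (fst (cs ! c))" using z c by (auto simp: local_indices_def)
   ultimately show "z c = z' c" by (simp only: undigits_digits mod_less)
  qed
 qed
 have sub: "joint_index cs ` local_indices cs \<subseteq> boxl (party_dims cs)"
  using party_view_less by (auto simp: boxl_def box_def party_dims_def joint_index_def)
 have "card (local_indices cs) = (\<Prod>c<length cs. prod_list (fst (cs ! c)))" by (simp add: local_indices_def card_PiE)
 also have "... = prod_list D"
 proof -
  have "prod_list (concat (map f l)) = prod_list (map (%c. prod_list (f c)) l)" for f :: "nat => nat list" and l by (induction l) auto
  thus ?thesis unfolding D_concat by (simp add: prod.distinct_set_conv_list[symmetric] lessThan_atLeast0)
 qed
 also have "... = prod_list (map ((!) D) (owner_order cs))" by (rule prod_list_perm[OF order_mset, symmetric])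
 also have "... = card (boxl (party_dims cs))"
  unfolding owner_order_def Let_def by (simp add: boxl_def box_def party_dims_def party_dim_view)
 finally have "card (joint_index cs ` local_indices cs) = card (boxl (party_dims cs))" by (simp add: card_image[OF inj])
 hence "joint_index cs ` local_indices cs = boxl (party_dims cs)" by (intro card_subset_eq sub) (auto simp: boxl_def)
 thus ?thesis using inj by (simp add: bij_betw_def)
qed

lemma joint_state_entry:
 assumes z: "z : local_indices cs" "z' : local_indices cs"
 shows "joint_state cs $$ (ix (party_dim cs 1) (party_dim cs 2) (joint_index cs z), ix (party_dim cs 1) (party_dim cs 2) (joint_index cs z'))
  = (\<Prod>c<length cs. snd (snd (cs ! c)) $$ (z c, z' c))"
proof -
 have e: "ix (party_dim cs 1) (party_dim cs 2) (joint_index cs z) = undigits (map ((!) D) (owner_order cs)) (map ((!) (xs z)) (owner_order cs))" for z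
  unfolding owner_order_def Let_def map_append party_dim_view joint_index_def party_view_def ix_def
  by (simp add: undigits_append algebra_simps)
 have "joint_state cs $$ (ix (party_dim cs 1) (party_dim cs 2) (joint_index cs z), ix (party_dim cs 1) (party_dim cs 2) (joint_index cs z'))
  = kron_list (map (snd \<circ> snd) cs) $$ (undigits D (xs z), undigits D (xs z'))"
  unfolding e joint_state_def by (rule perm_state_entry[OF order_mset xs_valid[OF z(1)] xs_valid[OF z(2)]])
 also have "... = prod_list (map (%c. snd (snd (cs ! c)) $$ (z c, z' c)) [0..<length cs])"
  unfolding D_concat states
  by (rule conjunct2[OF kron_list_entry]) (use z wf' in "auto simp: wf_comp_def local_indices_def")
 also have "... = (\<Prod>c<length cs. snd (snd (cs ! c)) $$ (z c, z' c))"
  by (simp add: prod.distinct_set_conv_list[symmetric] lessThan_atLeast0)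
 finally show ?thesis .
qed

lemma joint_state_carrier: "joint_state cs : carrier_mat (prod_list (party_dims cs)) (prod_list (party_dims cs))"
proof -
 have "prod_list D = prod_list (map ((!) D) (owner_order cs))" by (rule prod_list_perm[OF order_mset, symmetric])
 also have "... = prod_list (party_dims cs)" unfolding owner_order_def Let_def by (simp add: party_dims_def party_dim_view)
 finally show ?thesis by (simp add: joint_state_def perm_state_def Let_def)
qed

end

lemma digits_append: "digits (ds @ ds') x = digits ds (x div prod_list ds') @ digits ds' x"
 by (induction ds) (auto simp: div_mult2_eq[symmetric] mult.commute)

lemma ix_bij: "bij_betw (ix b c) (box a b c) {..<a * b * c}"
 by (rule bij_betwI[where g="%i. (i div c div b, i div c mod b, i mod c)"])
  (auto simp: box_def ix_def flat_less flat_div_mod flat_split intro: flat_split)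

text \<open>A common format for both kinds of resource: a GHZ state is a private state whose shield
  has dimension 1. \<open>T s\<close> is the twisted image of the shield vector \<open>s\<close>,
  laid out over key blocks of size \<open>sd\<close>.\<close>

definition private_comp :: "component => nat list => nat => nat => (nat => nat => complex) => (nat => nat => complex) => bool" where
 "private_comp x ps d sd T sigma <-> (let k = length ps in wf_comp x & 1 <= d & 1 <= k &
   take k (fst x) = replicate k d & prod_list (drop k (fst x)) = sd & take k (fst (snd x)) = ps &
   (ALL u<d ^ k. ALL v<sd. ALL v'<sd. (SUM s<sd. T s (u * sd + v) * cnj (T s (u * sd + v'))) = dl v v') &
   (ALL u<d ^ k. ALL s<sd. ALL s'<sd. (SUM v<sd. cnj (T s (u * sd + v)) * T s' (u * sd + v)) = dl s s') &
   (ALL z<d ^ k * sd. ALL z'<d ^ k * sd. snd (snd x) $$ (z, z') = (SUM s<sd. SUM s'<sd. gv k d (z div sd) * T s z * sigma s s' * cnj (gv k d (z' div sd) * T s' z'))) &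
   (SUM s<sd. sigma s s) = 1)"

lemma ghz_entry: "z < d ^ k ==> z' < d ^ k ==> ghz k d $$ (z, z') = gv k d z * cnj (gv k d z')"
 by (simp add: ghz_def outer_def ghz_vec_def gv_def)

lemma ghz_private:
 assumes "ps ~= []" "ALL p:set ps. p < 3" "1 <= d"
 shows "private_comp (ghz_comp ps d) ps d 1 (%_ _. 1) (%_ _. 1)"
proof -
 have "ghz (length ps) d : carrier_mat (d ^ length ps) (d ^ length ps)" by (simp add: ghz_def outer_def ghz_vec_def)
 thus ?thesis using assms
  by (simp add: private_comp_def ghz_comp_def wf_comp_def prod_list_replicate ghz_entry Suc_leI Let_def)
qed

lemma priv_private:
 assumes ps: "ps ~= []" "ALL p:set ps. p < 3" "1 <= d" and v: "valid_shield (length ps) d sh"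
 shows "EX sd T sigma. private_comp (priv_comp ps d sh) ps d sd T sigma"
proof -
 let ?pr = "priv_comp ps d sh"
 obtain ss sigma V where sh: "sh = (ss, sigma, V)" by (cases sh)
 define S where "S = prod_list ss"
 define k where "k = length ps"
 let ?D = "d ^ k"
 have ss: "length ss = k" and sigma: "sigma : carrier_mat S S" "(SUM s<S. sigma $$ (s, s)) = 1"
  and V: "!!i. i < ?D ==> V i : carrier_mat S S" "!!i. i < ?D ==> adj (V i) * V i = 1\<^sub>m S" "!!i. i < ?D ==> V i * adj (V i) = 1\<^sub>m S"
  using v by (auto simp: valid_shield_def sh S_def k_def density_def unitary_def cmtrace_def)
 have S0: "0 < S" using sigma(2) by (cases "S = 0") auto
 \<comment> \<open>Column \<open>s\<close> of the twisting unitary of the key block that contains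
   \<open>z\<close>.\<close>
 define T where "T = (%s z. V (z div S) $$ (z mod S, s))"
 have Tf: "T s (u * S + w) = V u $$ (w, s)" if "w < S" for s u w unfolding T_def using that by (simp add: flat_div_mod)
 have rows: "(SUM s<S. T s (u * S + w) * cnj (T s (u * S + w'))) = dl w w'" if u: "u < ?D" and w: "w < S" "w' < S" for u w w'
 proof -
  have "(V u * adj (V u)) $$ (w, w') = (SUM s<S. V u $$ (w, s) * cnj (V u $$ (w', s)))"
   using V(1)[OF u] w by (simp add: adj_def scalar_prod_def lessThan_atLeast0)
  thus ?thesis using w unfolding V(3)[OF u] by (simp add: Tf)
 qed
 have cols: "(SUM w<S. cnj (T s (u * S + w)) * T s' (u * S + w)) = dl s s'" if u: "u < ?D" and s: "s < S" "s' < S" for u s s'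
 proof -
  have "(adj (V u) * V u) $$ (s, s') = (SUM w<S. cnj (V u $$ (w, s)) * V u $$ (w, s'))"
   using V(1)[OF u] s by (simp add: adj_def scalar_prod_def lessThan_atLeast0)
  moreover have "(SUM w<S. cnj (T s (u * S + w)) * T s' (u * S + w)) = (SUM w<S. cnj (V u $$ (w, s)) * V u $$ (w, s'))"
   by (intro sum.cong refl) (simp add: Tf)
  ultimately show ?thesis using s unfolding V(2)[OF u] by simp
 qed
 define U where "U = mat (?D * S) (?D * S) (%(x, y). if x div S = y div S then V (x div S) $$ (x mod S, y mod S) else 0)"
 have P: "private_state k d sh = U * kron (ghz k d) sigma * adj U" unfolding private_state_def sh U_def S_def Let_def prod.case ..
 have gc: "ghz k d : carrier_mat ?D ?D" by (simp add: ghz_def outer_def ghz_vec_def)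
 have Kc: "kron (ghz k d) sigma : carrier_mat (?D * S) (?D * S)" using gc sigma by (simp add: kron_def)
 have Uc: "U : carrier_mat (?D * S) (?D * S)" by (simp add: U_def)
 have aUc: "adj U : carrier_mat (?D * S) (?D * S)" by (simp add: U_def adj_def)
 have entry: "private_state k d sh $$ (z, z') = (SUM s<S. SUM s'<S. gv k d (z div S) * T s z * sigma $$ (s, s') * cnj (gv k d (z' div S) * T s' z'))"
  if z: "z < ?D * S" "z' < ?D * S" for z z'
 proof -
  let ?K = "kron (ghz k d) sigma"
  have row: "(SUM y<?D * S. U $$ (z, y) * g y) = (SUM s<S. V (z div S) $$ (z mod S, s) * g (z div S * S + s))"
   if z: "z < ?D * S" for z and g :: "nat => complex"
  proof -
   have "(SUM y<?D * S. U $$ (z, y) * g y) = (SUM y<?D * S. (if z div S = y div S then V (z div S) $$ (z mod S, y mod S) else 0) * g y)"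
    by (intro sum.cong refl) (use z in "simp add: U_def")
   also have "... = (SUM u<?D. SUM s<S. if u = z div S then V (z div S) $$ (z mod S, s) * g (z div S * S + s) else 0)"
    unfolding sum_flat2 by (intro sum.cong refl) (auto simp: flat_div_mod)
   also have "... = (SUM u<?D. if u = z div S then SUM s<S. V (z div S) $$ (z mod S, s) * g (z div S * S + s) else 0)"
    by (intro sum.cong refl) auto
   finally show ?thesis using flat_split(1)[OF z] by simp
  qed
  have "private_state k d sh $$ (z, z') = (SUM y<?D * S. (SUM x<?D * S. U $$ (z, x) * ?K $$ (x, y)) * cnj (U $$ (z', y)))"
   unfolding P using Uc aUc Kc z by (simp add: scalar_prod_def adj_def lessThan_atLeast0)
  also have "... = (SUM y<?D * S. cnj (U $$ (z', y)) * (SUM s<S. V (z div S) $$ (z mod S, s) * ?K $$ (z div S * S + s, y)))"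
  proof (intro sum.cong refl)
   fix y
   have "(SUM x<?D * S. U $$ (z, x) * ?K $$ (x, y)) = (SUM s<S. V (z div S) $$ (z mod S, s) * ?K $$ (z div S * S + s, y))"
    by (rule row[OF z(1)])
   thus "(SUM x<?D * S. U $$ (z, x) * ?K $$ (x, y)) * cnj (U $$ (z', y)) = cnj (U $$ (z', y)) * (SUM s<S. V (z div S) $$ (z mod S, s) * ?K $$ (z div S * S + s, y))"
    by (simp add: mult.commute)
  qed
  also have "... = cnj (SUM y<?D * S. U $$ (z', y) * cnj (SUM s<S. V (z div S) $$ (z mod S, s) * ?K $$ (z div S * S + s, y)))" by simp
  also have "... = cnj (SUM s'<S. V (z' div S) $$ (z' mod S, s') * cnj (SUM s<S. V (z div S) $$ (z mod S, s) * ?K $$ (z div S * S + s, z' div S * S + s')))"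
   unfolding row[OF z(2)] ..
  also have "... = (SUM s'<S. SUM s<S. V (z div S) $$ (z mod S, s) * ?K $$ (z div S * S + s, z' div S * S + s') * cnj (V (z' div S) $$ (z' mod S, s')))"
   by (simp add: sum_distribs mult_ac)
  also have "... = (SUM s<S. SUM s'<S. V (z div S) $$ (z mod S, s) * ?K $$ (z div S * S + s, z' div S * S + s') * cnj (V (z' div S) $$ (z' mod S, s')))"
   by (rule sum.swap)
  also have "... = (SUM s<S. SUM s'<S. gv k d (z div S) * T s z * sigma $$ (s, s') * cnj (gv k d (z' div S) * T s' z'))"
  proof (intro sum.cong refl)
   fix s s' assume s: "s : {..<S}" "s' : {..<S}"
   have "z div S * S + s < ?D * S" "z' div S * S + s' < ?D * S" using flat_split(1)[OF z(1)] flat_split(1)[OF z(2)] s by (auto intro: flat_less2)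
   hence "?K $$ (z div S * S + s, z' div S * S + s') = gv k d (z div S) * cnj (gv k d (z' div S)) * sigma $$ (s, s')"
    using gc sigma(1) s flat_split(1)[OF z(1)] flat_split(1)[OF z(2)] by (simp add: kron_def flat_div_mod ghz_entry)
   thus "V (z div S) $$ (z mod S, s) * ?K $$ (z div S * S + s, z' div S * S + s') * cnj (V (z' div S) $$ (z' mod S, s'))
    = gv k d (z div S) * T s z * sigma $$ (s, s') * cnj (gv k d (z' div S) * T s' z')"
    by (simp add: T_def mult_ac)
  qed
  finally show ?thesis .
 qed
 have k1: "1 <= k" using ps(1) by (cases ps) (auto simp: k_def)
 have c: "private_state k d sh : carrier_mat (?D * S) (?D * S)" unfolding P using Uc Kc aUc by auto
 have "private_comp (?pr) ps d S T (%s s'. sigma $$ (s, s'))"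
  unfolding private_comp_def Let_def k_def[symmetric]
 proof (intro conjI)
  show "wf_comp (?pr)"
   using ps c S0 ss by (auto simp: wf_comp_def priv_comp_def sh k_def[symmetric] prod_list_replicate S_def[symmetric])
  have f: "fst (?pr) = replicate k d @ ss" "fst (snd (?pr)) = ps @ ps" "snd (snd (?pr)) = private_state k d sh"
   by (simp_all add: priv_comp_def sh k_def)
  show "take k (fst (?pr)) = replicate k d" "prod_list (drop k (fst (?pr))) = S" "take k (fst (snd (?pr))) = ps"
   unfolding f by (simp_all add: S_def k_def)
  show "ALL z<d ^ k * S. ALL z'<d ^ k * S. snd (snd (?pr)) $$ (z, z') =
   (SUM s<S. SUM s'<S. gv k d (z div S) * T s z * sigma $$ (s, s') * cnj (gv k d (z' div S) * T s' z'))"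
   unfolding f by (intro allI impI entry)
 qed (intro allI impI ps(3) k1 rows cols sigma(2); assumption)+
 thus ?thesis by blast
qed

lemma log_prod:
 fixes f :: "'a => real"
 assumes "finite X" "!!x. x : X ==> 0 < f x"
 shows "log b (PROD x:X. f x) = (SUM x:X. log b (f x))"
 using assms
proof (induction X rule: finite_induct)
 case (insert x X)
 have "0 < f x" "0 < (PROD x:X. f x)" using insert.prems by (auto intro: prod_pos)
 hence "log b (f x * (PROD x:X. f x)) = log b (f x) + log b (PROD x:X. f x)" by (intro log_mult_pos) auto
 thus ?case using insert by simp
qed simp

text \<open>For the cut between party p and the rest only the components involving p are untwisted:
  the others lie on one side and give no key across the cut. For the three-party quantity all
  components are active. \<open>L p\<close> adds up the key bits held by p, and \<open>multi\<close>
  guarantees that no component belongs to one party alone.\<close>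

lemma private_comps_lower:
 fixes cs :: "component list" and ps :: "nat => nat list" and d :: "nat => nat"
 assumes comps: "!!c. c < length cs ==> EX sd T sigma. private_comp (cs ! c) (ps c) (d c) sd T sigma"
  and multi: "!!c p. c < length cs ==> EX q<length (ps c). ps c ! q ~= p"
  and r: "repl (party_dims cs) Om R psi" and norm: "nsq (boxl (party_dims cs) >< R) psi = 1"
  and tn: "trace_norm (Om - joint_state cs) <= eps" and eps: "0 <= eps"
 defines "L \<equiv> %p. SUM c:{c. c < length cs & p : set (ps c)}. log 2 (real (d c))"
  and "N \<equiv> SUM c<length cs. real (length (ps c)) * log 2 (real (d c))"
 shows "qty 0 (boxl (party_dims cs)) R psi >= 2 * (1 - 4 * eps) * L 1 - 14 - 12 * (eps * N)"
  and "qty 1 (boxl (party_dims cs)) R psi >= 2 * (1 - 4 * eps) * L 2 - 14 - 12 * (eps * N)"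
  and "qty 2 (boxl (party_dims cs)) R psi >= 2 * (1 - 4 * eps) * L 0 - 14 - 12 * (eps * N)"
  and "qty 3 (boxl (party_dims cs)) R psi >= (1 - 4 * eps) * (L 0 + L 1 + L 2) - 21 - 18 * (eps * N)"
proof -
 define m where "m = length cs"
 have "ALL c:{..<m}. EX sd T sigma. private_comp (cs ! c) (ps c) (d c) sd T sigma" using comps by (simp add: m_def)
 then obtain sd T sigma where "ALL c:{..<m}. private_comp (cs ! c) (ps c) (d c) (sd c) (T c) (sigma c)"
  unfolding bchoice_iff by (elim exE)
 hence pc: "private_comp (cs ! c) (ps c) (d c) (sd c) (T c) (sigma c)" if "c < m" for c using that by simp
 define k where "k = (%c. length (ps c))"
 define rho where "rho = (%c z z'. snd (snd (cs ! c)) $$ (z, z'))"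
 interpret key_components m k d sd rho T sigma
  by unfold_locales (use pc in "auto simp: private_comp_def Let_def k_def rho_def")
 have wf: "ALL x:set cs. wf_comp x"
 proof
  fix y assume "y : set cs"
  then obtain c where "c < m" "cs ! c = y" by (metis in_set_conv_nth m_def)
  thus "wf_comp y" using conjunct1[OF pc[unfolded private_comp_def Let_def]] by blast
 qed
 have fd: "fst (cs ! c) = replicate (k c) (d c) @ drop (k c) (fst (cs ! c))" "prod_list (drop (k c) (fst (cs ! c))) = sd c"
  and fo: "take (k c) (fst (snd (cs ! c))) = ps c" if "c < m" for c
  using pc[OF that] append_take_drop_id[of "k c" "fst (cs ! c)"] by (auto simp: private_comp_def Let_def k_def)
 have pl: "prod_list (fst (cs ! c)) = cdim c" if "c < m" for c
  by (subst fd(1)[OF that]) (simp add: fd(2)[OF that] cdim_def prod_list_replicate)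
 have LI: "local_indices cs = \<I>" unfolding local_indices_def m_def[symmetric] \<I>_def by (rule PiE_cong) (simp add: pl)
 let ?pv = "party_view cs"
 have own: "key Act z (c, q) = key Act z' (c, q)"
  if "z : \<I>" "z' : \<I>" "?pv p z = ?pv p z'" "c : Act" "Act \<subseteq> {..<m}" "q < k c" "ps c ! q = p" for Act z z' c q p
 proof -
  have c: "c < m" using that by blast
  have lk: "k c <= length (fst (cs ! c))" by (subst fd(1)[OF c]) simp
  have "fst (snd (cs ! c)) ! q = p" using fo[OF c] that(6,7) by (metis nth_take)
  moreover have "q < length (fst (cs ! c))" using lk that(6) by simp
  ultimately have e: "digits (fst (cs ! c)) (z c) ! q = digits (fst (cs ! c)) (z' c) ! q"
   using party_view_digits[OF wf, of z z' p c q] that c unfolding LI m_def by simp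
  have "digits (fst (cs ! c)) w ! q = digits (replicate (k c) (d c)) (w div sd c) ! q" for w
   by (subst fd(1)[OF c]) (simp add: digits_append fd(2)[OF c] nth_append that(6))
  thus ?thesis using e that by (simp add: key_def)
 qed
 let ?P = "party_dims cs"
 define a b c where "a = party_dim cs 0" and "b = party_dim cs 1" and "c = party_dim cs 2"
 have abc: "?P = [a, b, c]" by (simp add: party_dims_def a_def b_def c_def)
 have R: "finite R" and Omc: "Om : carrier_mat (a * b * c) (a * b * c)"
  and Ome: "!!i i'. i : box a b c ==> i' : box a b c ==> Om $$ (ix b c i, ix b c i') = (SUM r:R. psi (i, r) * cnj (psi (i', r)))"
  using r by (auto simp: repl_def rep_def purifies_def abc)
 have bl: "boxl ?P = box a b c" by (simp add: boxl_def abc)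
 let ?j = "joint_index cs"
 have jb: "bij_betw ?j \<I> (box a b c)" using joint_index_bij[OF wf] unfolding LI bl .
 have jin: "?j z : box a b c" if "z : \<I>" for z using jb that by (auto simp: bij_betw_def)
 define chi where "chi = (%(z, r). psi (?j z, r))"
 define g where "g = (%(z, r::nat list * nat list). (?j z, r))"
 have gb: "bij_betw g (\<I> >< R) (box a b c >< R)"
  using jb unfolding bij_betw_def g_def by (force simp: inj_on_def image_iff)
 have chig: "chi k = psi (g k)" for k by (simp add: chi_def g_def case_prod_unfold)
 have norm': "nsq (\<I> >< R) chi = 1"
  using norm sum.reindex_bij_betw[OF gb, of "%k. (cmod (psi k))^2"] unfolding bl chig by simp
 have qt: "qty j (boxl ?P) R psi = qv j (\<I> >< R) (%k. ?pv 0 (fst k)) (%k. ?pv 1 (fst k)) (%k. ?pv 2 (fst k)) (%k. fst (snd k)) (%k. snd (snd k)) chi" for j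
  unfolding qty_def bl by (rule qv_transport[OF _ gb, symmetric]) (use R chig in "auto simp: g_def joint_index_def")
 have ap: "approx_private \<I> R chi (key Act) (\<S> Act) (twist Act) (amp Act) eps (\<Prod>c<m. real (d c) ^ k c)" if A: "Act \<subseteq> {..<m}" for Act
 proof (rule key_private[OF A R norm' eps], rule fidelity_lower[OF A R])
  show "bij_betw (%z. ix b c (?j z)) \<I> {..<a * b * c}" using bij_betw_trans[OF jb ix_bij] by (simp add: o_def)
  show "Om $$ (ix b c (?j z), ix b c (?j z')) = (SUM r:R. chi (z, r) * cnj (chi (z', r)))" if "z : \<I>" "z' : \<I>" for z z'
   using Ome[OF jin[OF that(1)] jin[OF that(2)]] by (simp add: chi_def)
  show "joint_state cs : carrier_mat (a * b * c) (a * b * c)" using joint_state_carrier[OF wf] by (simp add: abc mult.assoc)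
  show "joint_state cs $$ (ix b c (?j z), ix b c (?j z')) = rhorho z z'" if "z : \<I>" "z' : \<I>" for z z'
   using joint_state_entry[OF wf, of z z'] that unfolding rhorho_def unfolding LI b_def c_def m_def[symmetric] rho_def by simp
 qed (use Omc tn in auto)
 have inj3: "inj_on (%z. (?pv 0 z, ?pv 1 z, ?pv 2 z)) \<I>" using bij_betw_imp_inj_on[OF jb] by (simp add: inj_on_def joint_index_def)
 have i0: "inj_on (%z. (?pv 1 z, (?pv 0 z, ?pv 2 z))) \<I>" and i1: "inj_on (%z. (?pv 2 z, (?pv 0 z, ?pv 1 z))) \<I>"
  and i2: "inj_on (%z. (?pv 0 z, (?pv 1 z, ?pv 2 z))) \<I>" using inj3 by (auto simp: inj_on_def)
 have iR: "inj_on (%r. (fst r, snd r)) R" by (auto simp: inj_on_def)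
 define C where "C = (%p. {c. c < m & p : set (ps c)})"
 have Cm: "C p \<subseteq> {..<m}" for p by (auto simp: C_def)
 have C_iff: "{c : C p. EX q<k c. ps c ! q : {p}} = C p" "{c : C p. EX q<k c. ps c ! q : - {p}} = C p" "{c : {..<m}. EX q<k c. ps c ! q : {p}} = C p" for p
  using multi by (auto simp: C_def k_def in_set_conv_nth m_def)
 have ps3: "ps c ! q < 3" if "c < m" "q < k c" for c q
 proof -
  have "ps c ! q : set (fst (snd (cs ! c)))" using that fo[OF that(1)] by (metis in_set_takeD k_def nth_mem)
  thus ?thesis using wf that by (auto simp: wf_comp_def m_def)
 qed
 have alpha: "key Act z (c, q) = key Act z' (c, q)" if "Act \<subseteq> {..<m}" "z : \<I>" "z' : \<I>" "?pv p z = ?pv p z'" "c : Act" "q < k c" "ps c ! q : {p}" for Act p z z' c q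
  using own[OF that(2-5) that(1,6)] that(7) by simp
 have omega: "key Act z (c, q) = key Act z' (c, q)" if "Act \<subseteq> {..<m}" "{0, 1, 2} = {p, p1, p2}" "z : \<I>" "z' : \<I>" "(?pv p1 z, ?pv p2 z) = (?pv p1 z', ?pv p2 z')" "c : Act" "q < k c" "ps c ! q ~: {p}" for Act p p1 p2 z z' c q
 proof -
  have "c < m" using that(1,6) by blast
  hence "ps c ! q < 3" using ps3 that(7) by blast
  hence "ps c ! q : {0, 1, 2}" by auto
  hence "ps c ! q = p1 | ps c ! q = p2" using that(2,8) by blast
  thus ?thesis using own[OF that(3,4) _ that(6,1,7)] that(5) by blast
 qed
 have cross: "EX q<k c. ps c ! q ~: {p}" if "c < m" for c p using multi[of c p] that by (auto simp: k_def m_def)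
 have ked1: "approx_private.keyed \<I> (key Act) (amp Act) (?pv p) (%z. (?pv p1 z, ?pv p2 z)) (PROD c:{c : Act. EX q<k c. ps c ! q : {p}}. real (d c))"
  if A: "Act \<subseteq> {..<m}" and p: "{0, 1, 2} = {p, p1, p2}" for Act p p1 p2
 proof (rule keyed_parties[OF ap[OF A] A, where ps="%c q. ps c ! q"])
  show "EX q<k c. ps c ! q ~: {p}" if "c : Act" for c using cross that A by blast
 qed (erule (5) alpha[OF A], erule (5) omega[OF A p])
 have ked2: "approx_private.keyed \<I> (key (C p)) (amp (C p)) (%z. (?pv p1 z, ?pv p2 z)) (?pv p) (PROD c:{c : C p. EX q<k c. ps c ! q : - {p}}. real (d c))"
  if p: "{0, 1, 2} = {p, p1, p2}" for p p1 p2
 proof (rule keyed_parties[OF ap[OF Cm] Cm, where ps="%c q. ps c ! q"])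
  show "EX q<k c. ps c ! q ~: - {p}" if "c : C p" for c using that by (auto simp: C_def k_def in_set_conv_nth)
  show "key (C p) z (c, q) = key (C p) z' (c, q)" if "z : \<I>" "z' : \<I>" "(?pv p1 z, ?pv p2 z) = (?pv p1 z', ?pv p2 z')" "c : C p" "q < k c" "ps c ! q : - {p}" for z z' c q
   by (rule omega[OF Cm p that(1-5)]) (use that(6) in auto)
  show "key (C p) z (c, q) = key (C p) z' (c, q)" if "z : \<I>" "z' : \<I>" "?pv p z = ?pv p z'" "c : C p" "q < k c" "ps c ! q ~: - {p}" for z z' c q
   by (rule alpha[OF Cm that(1-5)]) (use that(6) in auto)
 qed
 have dpos: "0 < real (d c)" if "c < m" for c using d[OF that] by simp
 have LC: "log 2 (PROD c:C p. real (d c)) = L p" for p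
  using log_prod[of "C p" "%c. real (d c)" 2] dpos Cm[of p] finite_subset[OF Cm] by (auto simp: L_def C_def m_def)
 have "log 2 (\<Prod>c<m. real (d c) ^ k c) = (SUM c<m. log 2 (real (d c) ^ k c))" by (rule log_prod) (use dpos in auto)
 hence LN: "log 2 (\<Prod>c<m. real (d c) ^ k c) = N" using dpos by (simp add: N_def m_def k_def log_nat_power)
 have p0: "{0, 1, 2} = {1, 0, 2::nat}" and p1: "{0, 1, 2} = {2, 0, 1::nat}" and p2: "{0, 1, 2} = {0, 1, 2::nat}" by auto
 show "qty 0 (boxl ?P) R psi >= 2 * (1 - 4 * eps) * L 1 - 14 - 12 * (eps * N)"
  using approx_private.bip_lower[OF ap[OF Cm[of 1]] ked1[OF Cm[of 1] p0, unfolded C_iff] ked2[OF p0, unfolded C_iff] i0 iR] unfolding qt qv_def LC LN by simp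
 show "qty 1 (boxl ?P) R psi >= 2 * (1 - 4 * eps) * L 2 - 14 - 12 * (eps * N)"
  using approx_private.bip_lower[OF ap[OF Cm[of 2]] ked1[OF Cm[of 2] p1, unfolded C_iff] ked2[OF p1, unfolded C_iff] i1 iR] unfolding qt qv_def LC LN by simp
 show "qty 2 (boxl ?P) R psi >= 2 * (1 - 4 * eps) * L 0 - 14 - 12 * (eps * N)"
  using approx_private.bip_lower[OF ap[OF Cm[of 0]] ked1[OF Cm[of 0] p2, unfolded C_iff] ked2[OF p2, unfolded C_iff] i2 iR] unfolding qt qv_def LC LN by simp
 show "qty 3 (boxl ?P) R psi >= (1 - 4 * eps) * (L 0 + L 1 + L 2) - 21 - 18 * (eps * N)"
  using approx_private.tri_lower[OF ap[OF subset_refl] ked1[OF subset_refl p2, unfolded C_iff] ked1[OF subset_refl p0, unfolded C_iff] ked1[OF subset_refl p1, unfolded C_iff] inj3 iR]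
  unfolding qt qv_def LC LN by simp
qed

section \<open>The limit of many channel uses\<close>

definition rate :: "real list => nat => real" where
 "rate rt j = (if j = 0 then rt ! 0 + rt ! 4 + rt ! 2 + rt ! 6 + rt ! 3 + rt ! 7
   else if j = 1 then rt ! 1 + rt ! 5 + rt ! 2 + rt ! 6 + rt ! 3 + rt ! 7
   else if j = 2 then rt ! 0 + rt ! 4 + rt ! 1 + rt ! 5 + rt ! 3 + rt ! 7
   else rt ! 0 + rt ! 4 + rt ! 1 + rt ! 5 + rt ! 2 + rt ! 6 + 3/2 * (rt ! 3 + rt ! 7))"

text \<open>Rates are arbitrary reals, and a negative one still gives dimension at least 1, hence
  the absolute value; the extra bit pays for rounding up.\<close>

lemma bdim_bounds: "1 <= bdim n r" "real n * r <= log 2 (real (bdim n r))" "log 2 (real (bdim n r)) <= real n * \<bar>r\<bar> + 1"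
proof -
 have p: "0 < 2 powr (real n * r)" by simp
 hence c: "0 < \<lceil>2 powr (real n * r)\<rceil>" by simp
 thus b: "1 <= bdim n r" unfolding bdim_def by linarith
 have e: "real (bdim n r) = of_int \<lceil>2 powr (real n * r)\<rceil>" using c by (simp add: bdim_def)
 have "2 powr (real n * r) <= real (bdim n r)" unfolding e by linarith
 hence "log 2 (2 powr (real n * r)) <= log 2 (real (bdim n r))" by (subst log_le_cancel_iff) (use b in auto)
 thus "real n * r <= log 2 (real (bdim n r))" by simp
 have "2 powr (real n * r) <= 2 powr (real n * \<bar>r\<bar>)" by (intro powr_mono mult_left_mono) auto
 moreover have "(1::real) <= 2 powr (real n * \<bar>r\<bar>)" by (intro ge_one_powr_ge_zero) auto
 ultimately have "real (bdim n r) <= 2 powr (real n * \<bar>r\<bar>) + 2 powr (real n * \<bar>r\<bar>)" unfolding e by linarith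
 also have "... = 2 powr (real n * \<bar>r\<bar> + 1)" by (simp add: powr_add)
 finally have "log 2 (real (bdim n r)) <= log 2 (2 powr (real n * \<bar>r\<bar> + 1))" by (subst log_le_cancel_iff) (use b in auto)
 thus "log 2 (real (bdim n r)) <= real n * \<bar>r\<bar> + 1" by simp
qed

lemma sum_8: "(SUM c<8. f c) = f 0 + f 1 + f 2 + f 3 + f 4 + f 5 + f 6 + f (7::nat)" for f :: "nat => real"
 by (simp add: eval_nat_numeral)

lemma less_8: "c < 8 <-> c = 0 | c = 1 | c = 2 | c = 3 | c = 4 | c = 5 | c = 6 | c = (7::nat)"
 by auto

text \<open>The bipartite constants 14 and 12 are relaxed to 21 and 18, so that one inequality
  covers all four quantities. Apart from a constant, the loss is proportional to eps n, with a
  factor that depends on the rates alone.\<close>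

lemma target_lower:
 fixes eAB eAC eBC eABC kAB kAC kBC kABC :: real
 defines "rt \<equiv> [eAB, eAC, eBC, eABC, kAB, kAC, kBC, kABC]"
 assumes v: "valid_shields n kAB kAC kBC kABC sh" and n: "1 <= n"
  and cs: "cs = target_comps n eAB eAC eBC eABC kAB kAC kBC kABC sh"
  and r: "repl (party_dims cs) Om R psi" and norm: "nsq (boxl (party_dims cs) >< R) psi = 1"
  and tn: "trace_norm (Om - joint_state cs) <= eps" and eps: "0 <= eps" "eps <= 1 / 4" and j: "j <= 3"
 shows "qty j (boxl (party_dims cs)) R psi >= 2 * (1 - 4 * eps) * (real n * rate rt j) - 21 - 18 * (eps * (real n * (SUM c<8. 3 * (\<bar>rt ! c\<bar> + 1))))"
proof -
 define PL :: "nat list list" where "PL = [[0, 1], [0, 2], [1, 2], [0, 1, 2], [0, 1], [0, 2], [1, 2], [0, 1, 2]]"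
 define d where "d = (%c. bdim n (rt ! c))"
 have l: "length cs = 8" by (simp add: cs target_comps_def)
 have comps: "EX sd T sigma. private_comp (cs ! c) (PL ! c) (d c) sd T sigma" if "c < length cs" for c
 proof -
  have g: "EX sd T sigma. private_comp (ghz_comp ps (bdim n r)) ps (bdim n r) sd T sigma" if "ps ~= []" "ALL p:set ps. p < 3" for ps r
   using ghz_private[OF that bdim_bounds(1)] by blast
  have p: "EX sd T sigma. private_comp (priv_comp ps (bdim n r) s) ps (bdim n r) sd T sigma"
   if "ps ~= []" "ALL p:set ps. p < 3" "valid_shield (length ps) (bdim n r) s" for ps r s
   using priv_private[OF that(1,2) bdim_bounds(1) that(3)] .
  note vs = v[unfolded valid_shields_def]
  have p4: "EX sd T sigma. private_comp (priv_comp [0, 1] (bdim n kAB) (sh 0)) [0, 1] (bdim n kAB) sd T sigma"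
   "EX sd T sigma. private_comp (priv_comp [0, 2] (bdim n kAC) (sh 1)) [0, 2] (bdim n kAC) sd T sigma"
   "EX sd T sigma. private_comp (priv_comp [1, 2] (bdim n kBC) (sh 2)) [1, 2] (bdim n kBC) sd T sigma"
   "EX sd T sigma. private_comp (priv_comp [0, 1, 2] (bdim n kABC) (sh 3)) [0, 1, 2] (bdim n kABC) sd T sigma"
   by (rule p; use vs in "simp add: numeral_eq_Suc")+
  have g4: "EX sd T sigma. private_comp (ghz_comp [0, 1] (bdim n eAB)) [0, 1] (bdim n eAB) sd T sigma"
   "EX sd T sigma. private_comp (ghz_comp [0, 2] (bdim n eAC)) [0, 2] (bdim n eAC) sd T sigma"
   "EX sd T sigma. private_comp (ghz_comp [1, 2] (bdim n eBC)) [1, 2] (bdim n eBC) sd T sigma"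
   "EX sd T sigma. private_comp (ghz_comp [0, 1, 2] (bdim n eABC)) [0, 1, 2] (bdim n eABC) sd T sigma"
   by (rule g; simp)+
  have "c = 0 | c = 1 | c = 2 | c = 3 | c = 4 | c = 5 | c = 6 | c = 7" using that unfolding l less_8 .
  thus ?thesis unfolding cs target_comps_def d_def rt_def PL_def
   by (elim disjE) (use p4 g4 in simp_all)
 qed
 have multi: "EX q<length (PL ! c). PL ! c ! q ~= p" if "c < length cs" for c p
 proof -
  have "PL ! c ! 0 ~= PL ! c ! 1 & 1 < length (PL ! c)" using that unfolding l less_8 by (auto simp: PL_def)
  hence "PL ! c ! 0 ~= p | PL ! c ! 1 ~= p" "0 < length (PL ! c)" "1 < length (PL ! c)" by auto
  thus ?thesis by blast
 qed
 define lg where "lg = (%c. log 2 (real (d c)))"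
 define L where "L = (%p. SUM c:{c. c < length cs & p : set (PL ! c)}. lg c)"
 define N where "N = (SUM c<length cs. real (length (PL ! c)) * lg c)"
 have lgn: "real n * rt ! c <= lg c" "lg c <= real n * \<bar>rt ! c\<bar> + 1" "0 <= lg c" for c
  using bdim_bounds[of n "rt ! c"] by (auto simp: lg_def d_def intro!: zero_le_log_cancel_iff[THEN iffD2])
 have L': "L p = (SUM c<8. if p : set (PL ! c) then lg c else 0)" for p
 proof -
  have "{c. c < length cs & p : set (PL ! c)} = {c:{..<8}. p : set (PL ! c)}" by (auto simp: l)
  thus ?thesis unfolding L_def by (simp only: sum.inter_filter finite_lessThan)
 qed
 have Lv: "L 0 = lg 0 + lg 1 + lg 3 + lg 4 + lg 5 + lg 7" "L 1 = lg 0 + lg 2 + lg 3 + lg 4 + lg 6 + lg 7"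
  "L 2 = lg 1 + lg 2 + lg 3 + lg 5 + lg 6 + lg 7"
  unfolding L' sum_8 by (simp_all add: PL_def)
 \<comment> \<open>In \<open>L 0 + L 1 + L 2\<close> every two-party component is counted twice and
   every three-party one three times; halving gives the coefficient 3/2 of the fourth rate.\<close>
 have rb: "real n * rate rt 0 <= L 1" "real n * rate rt 1 <= L 2" "real n * rate rt 2 <= L 0" "2 * (real n * rate rt 3) <= L 0 + L 1 + L 2"
  using lgn(1)[of 0] lgn(1)[of 1] lgn(1)[of 2] lgn(1)[of 3] lgn(1)[of 4] lgn(1)[of 5] lgn(1)[of 6] lgn(1)[of 7]
  unfolding Lv by (simp_all add: rate_def algebra_simps)
 have "N = (SUM c<8. real (length (PL ! c)) * lg c)" by (simp add: N_def l)
 \<comment> \<open>A component has at most 3 parties, and \<open>n >= 1\<close> absorbs the rounding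
   bit into the term linear in \<open>n\<close>.\<close>
 also have "... <= (SUM c<8. 3 * (real n * (\<bar>rt ! c\<bar> + 1)))"
 proof (rule sum_mono)
  fix c :: nat assume "c : {..<8}"
  hence "length (PL ! c) <= 3" unfolding lessThan_iff less_8 by (auto simp: PL_def)
  hence "real (length (PL ! c)) * lg c <= 3 * (real n * \<bar>rt ! c\<bar> + 1)" using lgn(2,3)[of c] by (intro mult_mono) auto
  also have "... <= 3 * (real n * (\<bar>rt ! c\<bar> + 1))" using n by (simp add: algebra_simps)
  finally show "real (length (PL ! c)) * lg c <= 3 * (real n * (\<bar>rt ! c\<bar> + 1))" .
 qed
 also have "... = real n * (SUM c<8. 3 * (\<bar>rt ! c\<bar> + 1))" unfolding sum_distrib_left by (intro sum.cong refl) (simp add: algebra_simps)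
 finally have NN: "eps * N <= eps * (real n * (SUM c<8. 3 * (\<bar>rt ! c\<bar> + 1)))" using eps(1) by (intro mult_left_mono)
 have "0 <= N" unfolding N_def by (intro sum_nonneg mult_nonneg_nonneg lgn(3)) simp
 hence N0: "0 <= eps * N" using eps(1) by simp
 have e0: "0 <= 1 - 4 * eps" using eps by simp
 note low = private_comps_lower[where ps="%c. PL ! c" and d=d, OF comps multi r norm tn eps(1), unfolded mult.assoc]
 have q: "2 * ((1 - 4 * eps) * L 1) - 14 - 12 * (eps * N) <= qty 0 (boxl (party_dims cs)) R psi"
  "2 * ((1 - 4 * eps) * L 2) - 14 - 12 * (eps * N) <= qty 1 (boxl (party_dims cs)) R psi"
  "2 * ((1 - 4 * eps) * L 0) - 14 - 12 * (eps * N) <= qty 2 (boxl (party_dims cs)) R psi"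
  "(1 - 4 * eps) * (L 0 + L 1 + L 2) - 21 - 18 * (eps * N) <= qty 3 (boxl (party_dims cs)) R psi"
  unfolding L_def N_def lg_def by (rule low; assumption)+
 have m: "(1 - 4 * eps) * (real n * rate rt 0) <= (1 - 4 * eps) * L 1" "(1 - 4 * eps) * (real n * rate rt 1) <= (1 - 4 * eps) * L 2"
  "(1 - 4 * eps) * (real n * rate rt 2) <= (1 - 4 * eps) * L 0" "2 * ((1 - 4 * eps) * (real n * rate rt 3)) <= (1 - 4 * eps) * (L 0 + L 1 + L 2)"
  using mult_left_mono[OF rb(1) e0] mult_left_mono[OF rb(2) e0] mult_left_mono[OF rb(3) e0] mult_left_mono[OF rb(4) e0]
  by (simp_all only: mult.left_commute[of 2])
 have "j = 0 | j = 1 | j = 2 | j = 3" using j by auto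
 thus ?thesis unfolding mult.assoc
  by (elim disjE; hypsubst) (use q m NN N0 in linarith)+
qed

section \<open>Compactness and continuity of entropy\<close>

lemma bounded_subseq_real:
 fixes X :: "nat => real"
 assumes "!!n. \<bar>X n\<bar> <= B"
 shows "EX (r :: nat => nat) L. strict_mono r & (%n. X (r n)) ----> L"
proof -
 obtain r :: "nat => nat" where r: "strict_mono r" "monoseq (%n. X (r n))" using seq_monosub[of X] by blast
 have "Bseq (%n. X (r n))" by (rule BseqI'[of _ B]) (use assms in simp)
 hence "convergent (%n. X (r n))" by (rule Bseq_monoseq_convergent) (rule r)
 thus ?thesis using r(1) unfolding convergent_def by blast
qed

lemma bounded_subseq_complex:
 fixes X :: "nat => complex"
 assumes "!!n. cmod (X n) <= B"
 shows "EX (r :: nat => nat) L. strict_mono r & (%n. X (r n)) ----> L"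
proof -
 have "\<bar>Re (X n)\<bar> <= B" "\<bar>Im (X n)\<bar> <= B" for n using assms[of n] abs_Re_le_cmod[of "X n"] abs_Im_le_cmod[of "X n"] by linarith+
 note b = this
 obtain r a where r: "strict_mono r" "(%n. Re (X (r n))) ----> a" using bounded_subseq_real[of "%n. Re (X n)", OF b(1)] by blast
 obtain s c where s: "strict_mono s" "(%n. Im (X (r (s n)))) ----> c" using bounded_subseq_real[of "%n. Im (X (r n))", OF b(2)] by blast
 have "(%n. Re (X (r (s n)))) ----> a" using LIMSEQ_subseq_LIMSEQ[OF r(2) s(1)] by (simp add: o_def)
 hence "(%n. X (r (s n))) ----> Complex a c" using s(2) by (simp add: tendsto_complex_iff)
 moreover have "strict_mono (%n. r (s n))" using r(1) s(1) by (simp add: strict_mono_def)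
 ultimately show ?thesis by (intro exI[of _ "%n. r (s n)"] exI[of _ "Complex a c"]) simp
qed

lemma bounded_subseq_family:
 fixes X :: "nat => 'a => complex"
 assumes "finite A" and "!!n a. a : A ==> cmod (X n a) <= B"
 shows "EX (r :: nat => nat) L. strict_mono r & (ALL a:A. (%n. X (r n) a) ----> L a)"
 using assms
proof (induction A rule: finite_induct)
 case empty
 show ?case by (rule exI[of _ id]) (auto simp: strict_mono_def)
next
 case (insert b A)
 then obtain r L where r: "strict_mono r" "ALL a:A. (%n. X (r n) a) ----> L a" by auto
 obtain s l where s: "strict_mono s" "(%n. X (r (s n)) b) ----> l"
  using bounded_subseq_complex[of "%n. X (r n) b" B] insert.prems by auto
 have "(%n. X (r (s n)) a) ----> L a" if "a : A" for a
  using LIMSEQ_subseq_LIMSEQ[OF bspec[OF r(2) that] s(1)] by (simp add: o_def)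
 moreover have "strict_mono (%n. r (s n))" using r(1) s(1) by (simp add: strict_mono_def)
 ultimately show ?case using s(2) insert.hyps
  by (intro exI[of _ "%n. r (s n)"] exI[of _ "L(b := l)"]) auto
qed

lemma tendsto_subseq_subseq:
 fixes f :: "nat => real"
 assumes "!!r :: nat => nat. strict_mono r ==> EX s :: nat => nat. strict_mono s & (%n. f (r (s n))) ----> L"
 shows "f ----> L"
proof (rule LIMSEQ_I, rule ccontr)
 fix e :: real assume e: "0 < e" and n: "~ (EX no. ALL n>=no. norm (f n - L) < e)"
 hence "ALL m. EX n>=m. n : {n. e <= norm (f n - L)}" by (auto simp: not_less)
 hence "infinite {n. e <= norm (f n - L)}" unfolding infinite_nat_iff_unbounded_le by blast
 then obtain r :: "nat => nat" where r: "strict_mono r" "!!n. r n : {n. e <= norm (f n - L)}" by (metis infinite_enumerate)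
 obtain s :: "nat => nat" where "strict_mono s" "(%n. f (r (s n))) ----> L" using assms[OF r(1)] by blast
 from LIMSEQ_D[OF this(2) e] obtain no where "ALL n>=no. norm (f (r (s n)) - L) < e" by blast
 thus False using r(2)[of "s no"] by auto
qed

text \<open>A modulus of continuity at 0, obtained from ln z <= z - 1 at z = 1 / sqrt x.\<close>

lemma eta_bound: "x <= 1 ==> \<bar>eta x\<bar> <= 2 / ln 2 * sqrt \<bar>x\<bar>"
proof (cases "x <= 0")
 case False
 assume x1: "x <= 1"
 hence x: "0 < x" using False by simp
 define y where "y = sqrt x"
 have y: "0 < y" "x = y * y" using x by (auto simp: y_def)
 have "ln (1 / y) <= 1 / y - 1" using y(1) by (intro ln_le_minus_one) simp
 hence l: "- ln y <= 1 / y" using y(1) by (simp add: ln_div)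
 have "ln x = ln y + ln y" unfolding y(2) by (rule ln_mult_pos[OF y(1) y(1)])
 hence e: "eta x = 2 / ln 2 * (x * - ln y)" using x by (simp add: eta_def log_def)
 have "x * - ln y <= x * (1 / y)" by (rule mult_left_mono[OF l]) (use x in simp)
 also have "... = y" unfolding y(2) using y(1) by simp
 finally have u: "eta x <= 2 / ln 2 * y" unfolding e by (intro mult_left_mono) auto
 have "ln y <= 0" using x1 x by (simp add: y_def)
 hence "0 <= eta x" unfolding e using x by (intro mult_nonneg_nonneg) auto
 thus ?thesis using u x by (simp add: y_def)
qed (simp add: eta_def)

lemma eta_tendsto:
 assumes "f ----> (a::real)"
 shows "(%n. eta (f n)) ----> eta a"
proof -
 consider "a < 0" | "a = 0" | "0 < a" by linarith
 thus ?thesis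
 proof cases
  case 1
  have "eventually (%n. f n < 0) sequentially" by (rule order_tendstoD(2)[OF assms 1])
  hence "eventually (%n. eta (f n) = 0) sequentially" by eventually_elim (simp add: eta_def)
  thus ?thesis using 1 by (simp add: eta_def tendsto_eventually)
 next
  case 2
  have "eventually (%n. f n < 1) sequentially" by (rule order_tendstoD(2)[OF assms]) (simp add: 2)
  hence ev: "eventually (%n. norm (eta (f n)) <= 2 / ln 2 * sqrt \<bar>f n\<bar>) sequentially" by eventually_elim (simp only: real_norm_def eta_bound less_imp_le)
  have "(%n. 2 / ln 2 * sqrt \<bar>f n\<bar>) ----> 2 / ln 2 * sqrt \<bar>a\<bar>" by (intro tendsto_intros assms)
  hence "(%n. 2 / ln 2 * sqrt \<bar>f n\<bar>) ----> 0" by (simp add: 2)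
  from tendsto_sandwich[OF _ ev tendsto_const this] have "(%n. norm (eta (f n))) ----> 0" by simp
  hence "(%n. eta (f n)) ----> 0" by (rule tendsto_norm_zero_cancel)
  thus ?thesis by (simp add: 2 eta_def)
 next
  case 3
  have "eventually (%n. 0 < f n) sequentially" by (rule order_tendstoD(1)[OF assms 3])
  hence ev: "eventually (%n. - f n * log 2 (f n) = eta (f n)) sequentially" by eventually_elim (simp add: eta_def)
  have "(%n. - f n * log 2 (f n)) ----> - a * log 2 a" by (intro tendsto_intros assms) (use 3 in auto)
  thus ?thesis using 3 Lim_transform_eventually[OF _ ev] by (simp add: eta_def)
 qed
qed

text \<open>Eigenvalues and eigenvectors stay bounded, so along a subsequence whole spectral
  decompositions converge, and their limit decomposes the limit kernel. Since every subsequence has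
  such a further subsequence, the entropies themselves converge.\<close>

lemma ent_gram_tendsto:
 fixes X :: "'x set" and Y :: "'y set"
 assumes X: "finite X" and Y: "finite Y" and M: "!!x y. x : X ==> y : Y ==> (%n. M n x y) ----> M' x y"
 shows "(%n. ent X (gram Y (M n))) ----> ent X (gram Y M')"
proof (rule tendsto_subseq_subseq)
 fix q :: "nat => nat" assume q: "strict_mono q"
 have Mq: "(%n. M (q n) x y) ----> M' x y" if "x : X" "y : Y" for x y
  using LIMSEQ_subseq_LIMSEQ[OF M[OF that] q] by (simp add: o_def)
 have g: "(%n. gram Y (M (q n)) x x') ----> gram Y M' x x'" if "x : X" "x' : X" for x x'
  unfolding gram_def by (intro tendsto_intros Mq that)
 have "ALL n. EX ru. specd X (gram Y (M (q n))) (fst ru) (snd ru)" using specd_gram_exists[OF X, of Y] by (metis fst_conv snd_conv)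
 then obtain ru where ru: "!!n. specd X (gram Y (M (q n))) (fst (ru n)) (snd (ru n))" by metis
 define r where "r = (%n. fst (ru n))"
 define u where "u = (%n. snd (ru n))"
 have s: "specd X (gram Y (M (q n))) (r n) (u n)" for n using ru by (simp add: r_def u_def)
 have u1: "cmod (u n k x) <= 1" if "k : X" "x : X" for n k x
 proof -
  have "(SUM x:X. u n k x * cnj (u n k x)) = 1" using onb_orth[OF specdD(2)[OF s]] that by simp
  hence "nsq X (u n k) = 1" by (simp only: cmod_sq of_real_sum[symmetric] of_real_eq_1_iff)
  moreover have "(cmod (u n k x))^2 <= nsq X (u n k)" using that X by (intro member_le_sum) auto
  ultimately have "(cmod (u n k x))^2 <= 1^2" by simp
  thus ?thesis by (rule power2_le_imp_le) simp
 qed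
 define A where "A = Inl ` (X >< X) \<union> Inr ` (X >< X)"
 have bg: "EX B. ALL p:X >< X. ALL n. cmod (gram Y (M (q n)) (fst p) (snd p)) <= B"
 proof -
  have "EX B. ALL n. cmod (gram Y (M (q n)) (fst p) (snd p)) <= B" if "p : X >< X" for p
  proof -
   have "Bseq (%n. gram Y (M (q n)) (fst p) (snd p))" using g[of "fst p" "snd p"] that by (intro convergent_imp_Bseq) (auto simp: convergent_def)
   thus ?thesis unfolding Bseq_def by blast
  qed
  hence "ALL p:X >< X. EX B. ALL n. cmod (gram Y (M (q n)) (fst p) (snd p)) <= B" by blast
  then obtain B where B: "ALL p:X >< X. ALL n. cmod (gram Y (M (q n)) (fst p) (snd p)) <= B p" by (rule bchoice[THEN exE])
  have "cmod (gram Y (M (q n)) (fst p) (snd p)) <= (SUM p:X >< X. \<bar>B p\<bar>)" if "p : X >< X" for p n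
  proof -
   have "\<bar>B p\<bar> <= (SUM p:X >< X. \<bar>B p\<bar>)" using that X by (intro member_le_sum) auto
   moreover have "cmod (gram Y (M (q n)) (fst p) (snd p)) <= B p" using B that by blast
   ultimately show ?thesis by linarith
  qed
  thus ?thesis by blast
 qed
 then obtain B where B: "!!x y n. x : X ==> y : X ==> cmod (gram Y (M (q n)) x y) <= B" by fastforce
 have rB: "\<bar>r n k\<bar> <= (SUM x:X. SUM y:X. B)" if k: "k : X" for n k
 proof -
  have "\<bar>r n k\<bar> = cmod (SUM x:X. SUM y:X. cnj (u n k x) * gram Y (M (q n)) x y * u n k y)"
   unfolding specd_quadratic[OF s k] by simp
  also have "... <= (SUM x:X. SUM y:X. B)"
  proof (intro sum_norm_le)
   fix x y assume xy: "x : X" "y : X"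
   have "cmod (cnj (u n k x) * gram Y (M (q n)) x y * u n k y) <= 1 * B * 1"
    unfolding norm_mult using u1[OF k xy(1)] u1[OF k xy(2)] B[OF xy] norm_ge_zero order_trans[OF norm_ge_zero B[OF xy]]
    by (intro mult_mono) auto
   thus "cmod (cnj (u n k x) * gram Y (M (q n)) x y * u n k y) <= B" by simp
  qed
  finally show ?thesis .
 qed
 define Z :: "nat => 'x * 'x + 'x * 'x => complex" where "Z = (%n a. case a of Inl p => u n (fst p) (snd p) | Inr p => complex_of_real (r n (fst p)))"
 have "cmod (Z n a) <= max 1 (SUM x:X. SUM y:X. B)" if "a : A" for n a
  using that u1 rB unfolding A_def Z_def by (auto simp: le_max_iff_disj)
 moreover have "finite A" using X by (simp add: A_def)
 ultimately obtain t L where t: "strict_mono t" "!!a. a : A ==> (%n. Z (t n) a) ----> L a" using bounded_subseq_family[of A Z] by blast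
 have ul: "(%n. u (t n) k x) ----> L (Inl (k, x))" if "k : X" "x : X" for k x
  using t(2)[of "Inl (k, x)"] that by (simp add: A_def Z_def)
 have rl: "(%n. r (t n) k) ----> Re (L (Inr (k, k)))" if "k : X" for k
  using tendsto_Re[OF t(2)[of "Inr (k, k)"]] that by (simp add: A_def Z_def)
 define u' where "u' = (%k x. L (Inl (k, x)))"
 define r' where "r' = (%k. Re (L (Inr (k, k))))"
 have "specd X (gram Y M') r' u'"
  unfolding specd_def onb_def
 proof (intro conjI ballI X)
  fix i j assume ij: "i : X" "j : X"
  have "(%n. SUM x:X. u (t n) i x * cnj (u (t n) j x)) ----> (SUM x:X. u' i x * cnj (u' j x))"
   unfolding u'_def by (intro tendsto_intros ul ij)
  moreover have "(%n. SUM x:X. u (t n) i x * cnj (u (t n) j x)) = (%_. if i = j then 1 else 0)"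
   using onb_orth[OF specdD(2)[OF s] ij] by simp
  ultimately show "(SUM x:X. u' i x * cnj (u' j x)) = dl i j" by (simp add: LIMSEQ_const_iff)
 next
  fix x y assume xy: "x : X" "y : X"
  have "(%n. SUM k:X. u (t n) k x * cnj (u (t n) k y)) ----> (SUM k:X. u' k x * cnj (u' k y))"
   unfolding u'_def by (intro tendsto_intros ul xy)
  moreover have "(%n. SUM k:X. u (t n) k x * cnj (u (t n) k y)) = (%_. if x = y then 1 else 0)"
   using specdD(2)[OF s] xy unfolding onb_def by blast
  ultimately show "(SUM k:X. u' k x * cnj (u' k y)) = dl x y" by (simp add: LIMSEQ_const_iff)
 next
  fix x y assume xy: "x : X" "y : X"
  have "(%n. SUM k:X. of_real (r (t n) k) * u (t n) k x * cnj (u (t n) k y)) ----> (SUM k:X. of_real (r' k) * u' k x * cnj (u' k y))"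
   unfolding u'_def r'_def by (intro tendsto_intros ul rl xy)
  moreover have "(%n. SUM k:X. of_real (r (t n) k) * u (t n) k x * cnj (u (t n) k y)) = (%n. gram Y (M (q (t n))) x y)"
   using specdD(3)[OF s xy] by simp
  moreover have "(%n. gram Y (M (q (t n))) x y) ----> gram Y M' x y" using LIMSEQ_subseq_LIMSEQ[OF g[OF xy] t(1)] by (simp add: o_def)
  ultimately show "gram Y M' x y = (SUM k:X. of_real (r' k) * u' k x * cnj (u' k y))" using LIMSEQ_unique by fastforce
 qed
 hence e': "ent X (gram Y M') = (SUM k:X. eta (r' k))" by (rule ent_gram_eq) (rule Y)
 have e: "ent X (gram Y (M (q (t n)))) = (SUM k:X. eta (r (t n) k))" for n by (rule ent_gram_eq[OF s Y])
 have "(%n. SUM k:X. eta (r (t n) k)) ----> (SUM k:X. eta (r' k))" unfolding r'_def by (intro tendsto_sum eta_tendsto rl)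
 thus "EX s :: nat => nat. strict_mono s & (%n. ent X (gram Y (M (q (s n))))) ----> ent X (gram Y M')"
  using t(1) unfolding e' e[symmetric] by blast
qed

lemma Sv_tendsto:
 assumes K: "finite K" and psi: "!!k. k : K ==> (%n. psi n k) ----> psi' k"
 shows "(%n. Sv K p q (psi n)) ----> Sv K p q psi'"
 unfolding Sv_def by (rule ent_gram_tendsto) (use K psi in "auto simp: pf_def intro!: tendsto_intros")

lemma Hc_tendsto:
 assumes "finite K" "!!k. k : K ==> (%n. psi n k) ----> psi' k"
 shows "(%n. Hc K b e q (psi n)) ----> Hc K b e q psi'"
 unfolding Hc_def by (intro tendsto_diff Sv_tendsto assms)

text \<open>Besides the factor a^2, scaling adds a multiple of the trace. The two entropies in a
  conditional entropy have the same trace, so their difference is exactly homogeneous.\<close>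

lemma Sv_scale:
 assumes K: "finite K" and a: "0 < a"
 shows "Sv K p q (%k. of_real a * psi k)
  = a^2 * Sv K p q psi - a\<^sup>2 * log 2 (a^2) * Re (SUM k:K. SUM l:K. if p k = p l & q k = q l then psi k * cnj (psi l) else 0)"
proof -
 let ?n = "(SUM k:K. SUM l:K. if p k = p l & q k = q l then psi k * cnj (psi l) else 0)"
 let ?X = "p ` K" and ?Y = "q ` K"
 have fin: "finite ?X" "finite ?Y" using K by auto
 obtain r u where s: "specd ?X (gram ?Y (pf K p q psi)) r u" using specd_gram_exists[OF fin(1)] by blast
 have g: "gram ?Y (pf K p q (%k. of_real a * psi k)) x y = of_real (a^2) * gram ?Y (pf K p q psi) x y" for x y
  by (simp add: gram_def pf_def sum_distrib_left[symmetric] power2_eq_square) (simp add: sum_distrib_left mult_ac)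
 have s': "specd ?X (gram ?Y (pf K p q (%k. of_real a * psi k))) (%k. a^2 * r k) u"
  using s unfolding specd_def g by (simp add: sum_distrib_left mult_ac)
 have e: "eta (a^2 * r k) = a^2 * eta (r k) - a\<^sup>2 * log 2 (a^2) * r k" if "k : ?X" for k
 proof (cases "r k = 0")
  case False
  hence r: "0 < r k" using specd_gram_nonneg[OF s that fin(2)] by simp
  hence "~ a^2 * r k <= 0" "~ r k <= 0" using a by (simp_all add: not_le)
  thus ?thesis using a r by (simp add: eta_def log_mult_pos algebra_simps)
 qed (simp add: eta_def)
 have "(SUM k:?X. r k) = Re (SUM x:?X. gram ?Y (pf K p q psi) x x)" by (rule specd_trace[OF s])
 also have "(SUM x:?X. gram ?Y (pf K p q psi) x x) = (SUM x:?X. SUM k:K. SUM l:K. if p k = x then if p k = p l & q k = q l then psi k * cnj (psi l) else 0 else 0)"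
  unfolding gram_pf[OF K fin(2) order_refl] red_def by (intro sum.cong refl) auto
 also have "... = (SUM k:K. SUM l:K. SUM x:?X. if p k = x then if p k = p l & q k = q l then psi k * cnj (psi l) else 0 else 0)"
  by (intro sum.cong refl sum_perm)
 also have "... = ?n" using fin by (intro sum.cong refl) simp
 finally have t: "(SUM k:?X. r k) = Re ?n" .
 have "Sv K p q (%k. of_real a * psi k) = (SUM k:?X. eta (a^2 * r k))" unfolding Sv_def by (rule ent_gram_eq[OF s' fin(2)])
 also have "... = a^2 * (SUM k:?X. eta (r k)) - a\<^sup>2 * log 2 (a^2) * (SUM k:?X. r k)" by (simp add: e sum_subtractf sum_distrib_left)
 also have "(SUM k:?X. eta (r k)) = Sv K p q psi" unfolding Sv_def by (rule ent_gram_eq[OF s fin(2), symmetric])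
 finally show ?thesis unfolding t .
qed

lemma Hc_scale:
 assumes "finite K" "0 < a"
 shows "Hc K b e q (%k. of_real a * psi k) = a^2 * Hc K b e q psi"
proof -
 have "((b k, e k) = (b l, e l) & q k = q l) = (e k = e l & (b k, q k) = (b l, q l))" for k l by auto
 thus ?thesis unfolding Hc_def Sv_scale[OF assms] by (simp only: right_diff_distrib)
qed

definition gk :: "'p set => ('i * 'p => complex) => 'i => 'i => complex" where
 "gk P phi = (%i i'. SUM p:P. phi (i, p) * cnj (phi (i', p)))"

lemma kH_vec:
 assumes "finite J" "finite P"
 shows "kH J b e q (conj_kernel I V (gk P phi)) = Hc (J >< P) (%k. b (fst k)) (%k. e (fst k)) (%k. (q (fst k), snd k)) (apply_fst I V phi)"
 unfolding gk_def by (rule Hc_kH[OF assms(1) purifies_apply[OF purifies_self[OF assms(2)]], symmetric])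

lemma kH_tendsto:
 assumes f: "finite J" "finite P" and phi: "!!i p. i : I ==> p : P ==> (%n. phi n (i, p)) ----> phi' (i, p)"
 shows "(%n. kH J b e q (conj_kernel I V (gk P (phi n)))) ----> kH J b e q (conj_kernel I V (gk P phi'))"
 unfolding kH_vec[OF f] by (rule Hc_tendsto) (use f phi in "auto simp: apply_fst_def intro!: tendsto_intros")

lemma kH_scale:
 assumes f: "finite J" "finite P" and a: "0 < a"
 shows "kH J b e q (conj_kernel I V (gk P (%k. of_real a * phi k))) = a^2 * kH J b e q (conj_kernel I V (gk P phi))"
proof -
 have "apply_fst I V (%k. of_real a * phi k) = (%k. of_real a * apply_fst I V phi k)"
  by (simp add: apply_fst_def fun_eq_iff sum_distrib_left mult_ac)
 thus ?thesis unfolding kH_vec[OF f] using f a by (simp add: Hc_scale)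
qed

lemma dq_tendsto:
 assumes "finite G" "finite P" "!!i p. i < dA ==> p : P ==> (%n. phi n (i, p)) ----> phi' (i, p)"
 shows "(%n. dq j dA dB dC G V (gk P (phi n))) ----> dq j dA dB dC G V (gk P phi')"
proof -
 have J: "finite ({..<dB} >< {..<dC} >< G)" using assms(1) by simp
 have phi: "!!i p. i : {..<dA} ==> p : P ==> (%n. phi n (i, p)) ----> phi' (i, p)" using assms(3) by simp
 note t = kH_tendsto[where phi=phi and phi'=phi' and I="{..<dA}", OF J assms(2) phi]
 show ?thesis unfolding dq_def kq_def kbip_def ktri_def
  by (cases "j = 0"; cases "j = 1"; cases "j = 2"; simp only: if_True if_False simp_thms; intro tendsto_add t; assumption)
qed

lemma dq_scale:
 assumes "finite G" "finite P" "0 < a"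
 shows "dq j dA dB dC G V (gk P (%k. of_real a * phi k)) = a^2 * dq j dA dB dC G V (gk P phi)"
proof -
 have J: "finite ({..<dB} >< {..<dC} >< G)" using assms(1) by simp
 show ?thesis unfolding dq_def kq_def kbip_def ktri_def kH_scale[OF J assms(2,3)] by (simp add: algebra_simps)
qed

lemma dq_cong: "(!!i i'. i < dA ==> i' < dA ==> sigma i i' = sigma' i i') ==> dq j dA dB dC G V sigma = dq j dA dB dC G V sigma'"
proof -
 assume "!!i i'. i < dA ==> i' < dA ==> sigma i i' = sigma' i i'"
 hence "conj_kernel {..<dA} V sigma = conj_kernel {..<dA} V sigma'" unfolding conj_kernel_def fun_eq_iff by (intro allI sum.cong refl) simp
 thus ?thesis by (simp add: dq_def)
qed

text \<open>The Stinespring isometry of a Kraus decomposition, with E carrying the Kraus index and F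
  trivial.\<close>

lemma dilation_exists:
 assumes N: "cptp dA (dB * dC) N"
 shows "EX G V. dilation N dA dB dC G V"
proof -
 obtain n K where K: "!!X u v. X : carrier_mat dA dA ==> u < dB * dC ==> v < dB * dC ==>
   N X $$ (u, v) = (SUM y<(n::nat). SUM i<dA. SUM j<dA. K y u i * X $$ (i, j) * cnj (K y v j))"
  using kraus_exists[of dA "dB * dC" N] N unfolding cptp_def by blast
 define V where "V = (%(b, c, e, f::nat) i. K e (b * dC + c) i)"
 define G where "G = {..<n} >< {0::nat}"
 have c: "N X : carrier_mat (dB * dC) (dB * dC)" "cmtrace (N X) = cmtrace X" if "X : carrier_mat dA dA" for X
  using N that by (auto simp: cptp_def cp_map_def lin_map_def tp_map_def)
 have iso: "(SUM j:{..<dB} >< {..<dC} >< G. V j i * cnj (V j i')) = dl i i'" if i: "i < dA" "i' < dA" for i i'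
 proof -
  let ?X = "unit_mat dA (i, i')"
  have X: "?X : carrier_mat dA dA" by (simp add: unit_mat_def)
  have "(SUM j:{..<dB} >< {..<dC} >< G. V j i * cnj (V j i')) = (SUM b<dB. SUM c<dC. SUM y<n. K y (b * dC + c) i * cnj (K y (b * dC + c) i'))"
   by (simp add: sum_Times V_def G_def)
  also have "... = (SUM u<dB * dC. SUM y<n. K y u i * cnj (K y u i'))" by (simp add: sum_flat2)
  also have "... = (SUM u<dB * dC. SUM y<n. SUM k<dA. if k = i then K y u i * cnj (K y u i') else 0)" using i by simp
  also have "... = (SUM u<dB * dC. SUM y<n. SUM k<dA. SUM l<dA. if l = i' then if k = i then K y u i * cnj (K y u i') else 0 else 0)" using i by simp
  also have "... = (SUM u<dB * dC. SUM y<n. SUM k<dA. SUM l<dA. K y u k * ?X $$ (k, l) * cnj (K y u l))"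
   by (intro sum.cong refl) (auto simp: unit_mat_def)
  also have "... = cmtrace (N ?X)" using c(1)[OF X] by (simp add: cmtrace_def K[OF X])
  also have "... = cmtrace ?X" by (rule c(2)[OF X])
  also have "... = (SUM k<dA. if k = i then if i = i' then 1 else 0 else 0)" unfolding cmtrace_def by (rule sum.cong) (auto simp: unit_mat_def)
  finally show ?thesis using i by simp
 qed
 have "N X $$ (b * dC + c, b' * dC + c') = (SUM (e, f):G. SUM i<dA. SUM i'<dA. V (b, c, e, f) i * X $$ (i, i') * cnj (V (b', c', e, f) i'))"
  if "X : carrier_mat dA dA" "b < dB" "c < dC" "b' < dB" "c' < dC" for X b c b' c'
  using K[OF that(1) flat_less2[OF that(2,3)] flat_less2[OF that(4,5)]] by (simp add: G_def V_def sum_Times)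
 hence "dilation N dA dB dC G V" unfolding dilation_def using iso by (simp add: G_def)
 thus ?thesis by blast
qed

text \<open>The sum of the inputs, of trace \<open>n\<close>, is purified afresh with a reference of
  dimension dA, whatever the size of the protocol. This gives the dimension bound on R and puts the
  vectors for all \<open>m\<close> into one space. Accuracy x/4 turns 1 - 4 eps into 1 - x, and n >
  m gives 1/n <= x.\<close>

lemma achievable_bound:
 fixes eAB eAC eBC eABC kAB kAC kBC kABC :: real and m :: nat
 defines "rt \<equiv> [eAB, eAC, eBC, eABC, kAB, kAC, kBC, kABC]"
 defines "W \<equiv> SUM c<8. 3 * (\<bar>rt ! c\<bar> + 1)" and "x \<equiv> inverse (real (Suc m))"
 assumes N: "cptp dA (dB * dC) N" and ach: "achievable N dA dB dC eAB eAC eBC eABC kAB kAC kBC kABC"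
 shows "EX phi. (SUM k:{..<dA} >< {..<dA}. (cmod (phi k))^2) = 1 &
  (ALL G V j. dilation N dA dB dC G V --> j <= 3 --> 2 * (1 - x) * rate rt j - 21 * x - 18 * (x / 4 * W) <= dq j dA dB dC G V (gk {..<dA} phi))"
proof -
 have x: "0 < x" "x <= 1" by (auto simp: x_def inverse_le_1_iff)
 have e0: "0 < x / 4" using x by simp
 obtain n0 where n0: "!!n. n0 <= n ==> EX sh Om. valid_shields n kAB kAC kBC kABC sh &
    (let cs = target_comps n eAB eAC eBC eABC kAB kAC kBC kABC sh in
     reach N dA dB dC n (party_dims cs) Om & trace_norm (Om - joint_state cs) <= x / 4)"
  using ach e0 unfolding achievable_def by blast
 define n where "n = n0 + Suc m"
 have n: "Suc m <= n" "n0 <= n" by (auto simp: n_def)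
 have n1: "1 <= n" and rn: "0 < real n" using n by auto
 obtain sh Om cs where v: "valid_shields n kAB kAC kBC kABC sh" and cs: "cs = target_comps n eAB eAC eBC eABC kAB kAC kBC kABC sh"
  and re: "reach N dA dB dC n (party_dims cs) Om" and tn: "trace_norm (Om - joint_state cs) <= x / 4"
  using n0[OF n(2)] unfolding Let_def by blast
 obtain sigma p phi0 where sigma: "purifies {..<dA} {..<p::nat} phi0 sigma"
  and M: "!!G V. dilation N dA dB dC G V ==> EX R psi. repl (party_dims cs) Om R psi & nsq (boxl (party_dims cs) >< R) psi = 1 &
   (SUM i<dA. sigma i i) = of_nat n & (ALL j. qty j (boxl (party_dims cs)) R psi <= dq j dA dB dC G V sigma)"
  using reach_monotone[OF re] by blast
 have tr: "(SUM i<dA. sigma i i) = of_nat n" using dilation_exists[OF N] M by blast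
 let ?A = "mat dA dA (%(i, i'). sigma i i')"
 have A: "?A : carrier_mat dA dA" by simp
 have "purifies {..<dA} {..<p} phi0 (%i i'. ?A $$ (i, i'))" using sigma by (simp add: purifies_def)
 hence "psd ?A" by (rule purifies_psd[OF A])
 then obtain phi1 where "purifies {..<dA} {..<dA} phi1 (%i i'. ?A $$ (i, i'))" using psd_purifies[OF A] by blast
 hence phi1: "sigma i i' = gk {..<dA} phi1 i i'" if "i < dA" "i' < dA" for i i' using that by (auto simp: purifies_def gk_def)
 \<comment> \<open>Dividing the amplitudes by the square root of \<open>n\<close> divides all
   quantities by \<open>n\<close>, since they are homogeneous in the input operator.\<close>
 define phi where "phi = (%k. complex_of_real (1 / sqrt (real n)) * phi1 k)"
 have a: "0 < 1 / sqrt (real n)" "(1 / sqrt (real n))^2 = 1 / real n" using rn by (auto simp: power_divide)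
 have "complex_of_real (SUM k:{..<dA} >< {..<dA}. (cmod (phi1 k))^2) = (SUM i<dA. sigma i i)"
  unfolding of_real_sum cmod_sq(1)[symmetric] sum_Times by (intro sum.cong refl) (simp add: phi1 gk_def)
 also have "... = complex_of_real (real n)" unfolding tr by simp
 finally have nphi1: "(SUM k:{..<dA} >< {..<dA}. (cmod (phi1 k))^2) = real n" by (simp only: of_real_eq_iff)
 have "(cmod (phi k))^2 = 1 / real n * (cmod (phi1 k))^2" for k
  unfolding phi_def norm_mult power_mult_distrib norm_of_real power2_abs a(2) ..
 hence norm: "(SUM k:{..<dA} >< {..<dA}. (cmod (phi k))^2) = 1" using nphi1 rn by (simp add: sum_divide_distrib[symmetric])
 have "2 * (1 - x) * rate rt j - 21 * x - 18 * (x / 4 * W) <= dq j dA dB dC G V (gk {..<dA} phi)"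
  if d: "dilation N dA dB dC G V" and j: "j <= 3" for G V j
 proof -
  obtain R psi where r: "repl (party_dims cs) Om R psi" "nsq (boxl (party_dims cs) >< R) psi = 1"
   and q: "!!j. qty j (boxl (party_dims cs)) R psi <= dq j dA dB dC G V sigma" using M[OF d] by blast
  have "2 * (1 - 4 * (x / 4)) * (real n * rate rt j) - 21 - 18 * (x / 4 * (real n * W)) <= qty j (boxl (party_dims cs)) R psi"
   unfolding rt_def W_def by (rule target_lower[OF v n1 cs r tn _ _ j]) (use x in auto)
  also have "... <= dq j dA dB dC G V sigma" by (rule q)
  also have "... = dq j dA dB dC G V (gk {..<dA} phi1)" by (rule dq_cong) (rule phi1)
  finally have l: "2 * (1 - 4 * (x / 4)) * (real n * rate rt j) - 21 - 18 * (x / 4 * (real n * W)) <= dq j dA dB dC G V (gk {..<dA} phi1)" .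
  have fG: "finite G" using d by (simp add: dilation_def)
  have s: "dq j dA dB dC G V (gk {..<dA} phi) = 1 / real n * dq j dA dB dC G V (gk {..<dA} phi1)"
   unfolding phi_def dq_scale[OF fG finite_lessThan a(1)] a(2) ..
  have "real (Suc m) <= real n" using n(1) by simp
  hence nx: "1 / real n <= x" unfolding x_def by (simp add: inverse_eq_divide frac_le)
  have "2 * (1 - x) * rate rt j - 21 * x - 18 * (x / 4 * W) <= 2 * (1 - x) * rate rt j - 21 * (1 / real n) - 18 * (x / 4 * W)"
   using nx by linarith
  also have "... = 1 / real n * (2 * (1 - 4 * (x / 4)) * (real n * rate rt j) - 21 - 18 * (x / 4 * (real n * W)))"
   using rn by (simp add: field_simps)
  also have "... <= dq j dA dB dC G V (gk {..<dA} phi)" unfolding s by (rule mult_left_mono[OF l]) simp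
  finally show ?thesis .
 qed
 thus ?thesis using norm by blast
qed

text \<open>The unit vectors lie in a fixed finite-dimensional space, so a subsequence converges.
  Each inequality then passes to the limit separately, dilation by dilation, by continuity of
  \<open>dq\<close> in the input.\<close>

lemma achievable_limit:
 fixes eAB eAC eBC eABC kAB kAC kBC kABC :: real
 defines "rt \<equiv> [eAB, eAC, eBC, eABC, kAB, kAC, kBC, kABC]"
 assumes N: "cptp dA (dB * dC) N" and ach: "achievable N dA dB dC eAB eAC eBC eABC kAB kAC kBC kABC"
 shows "EX phi. (SUM k:{..<dA} >< {..<dA}. (cmod (phi k))^2) = 1 &
  (ALL G V j. dilation N dA dB dC G V --> j <= 3 --> 2 * rate rt j <= dq j dA dB dC G V (gk {..<dA} phi))"
proof -
 define x where "x = (%m. inverse (real (Suc m)))"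
 define W where "W = (SUM c<8. 3 * (\<bar>rt ! c\<bar> + 1))"
 let ?K = "{..<dA} >< {..<dA}"
 have "EX phi. (nsq ?K phi) = 1 &
  (ALL G V j. dilation N dA dB dC G V --> j <= 3 --> 2 * (1 - x m) * rate rt j - 21 * x m - 18 * (x m / 4 * W) <= dq j dA dB dC G V (gk {..<dA} phi))" for m
  unfolding rt_def x_def W_def by (rule achievable_bound[OF N ach])
 hence "ALL m. EX phi. (nsq ?K phi) = 1 &
  (ALL G V j. dilation N dA dB dC G V --> j <= 3 --> 2 * (1 - x m) * rate rt j - 21 * x m - 18 * (x m / 4 * W) <= dq j dA dB dC G V (gk {..<dA} phi))" by (rule allI)
 from choice[OF this] obtain phi where n: "!!m. (nsq ?K (phi m)) = 1"
  and q: "!!m G V j. dilation N dA dB dC G V ==> j <= 3 ==> 2 * (1 - x m) * rate rt j - 21 * x m - 18 * (x m / 4 * W) <= dq j dA dB dC G V (gk {..<dA} (phi m))"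
  by blast
 have "cmod (phi m k) <= 1" if "k : ?K" for m k
 proof -
  have "(cmod (phi m k))^2 <= nsq ?K (phi m)" using that by (intro member_le_sum) auto
  hence "(cmod (phi m k))^2 <= 1^2" by (simp add: n)
  thus ?thesis by (rule power2_le_imp_le) simp
 qed
 note b1 = this
 have "EX (r :: nat => nat) L. strict_mono r & (ALL k:?K. (%m. phi (r m) k) ----> L k)"
  by (rule bounded_subseq_family[where B=1]) (simp, rule b1)
 then obtain r psi where "strict_mono (r :: nat => nat)" "ALL k:?K. (%m. phi (r m) k) ----> psi k" by (elim exE conjE)
 note r = this(1) bspec[OF this(2)]
 have "(%m. SUM k:?K. (cmod (phi (r m) k))^2) ----> (nsq ?K psi)" by (intro tendsto_intros r(2))
 hence "nsq ?K psi = 1" unfolding n by (simp add: LIMSEQ_const_iff)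
 moreover have "2 * rate rt j <= dq j dA dB dC G V (gk {..<dA} psi)" if d: "dilation N dA dB dC G V" and j: "j <= 3" for G V j
 proof (rule LIMSEQ_le)
  have "x ----> 0" unfolding x_def by (rule LIMSEQ_inverse_real_of_nat)
  from LIMSEQ_subseq_LIMSEQ[OF this r(1)] have "(%m. x (r m)) ----> 0" by (simp add: o_def)
  hence "(%m. 2 * (1 - x (r m)) * rate rt j - 21 * x (r m) - 18 * (x (r m) / 4 * W)) ----> 2 * (1 - 0) * rate rt j - 21 * 0 - 18 * (0 / 4 * W)"
   by (intro tendsto_intros) auto
  thus "(%m. 2 * (1 - x (r m)) * rate rt j - 21 * x (r m) - 18 * (x (r m) / 4 * W)) ----> 2 * rate rt j" by simp
  show "(%m. dq j dA dB dC G V (gk {..<dA} (phi (r m)))) ----> dq j dA dB dC G V (gk {..<dA} psi)"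
   by (rule dq_tendsto) (use d r(2) in "auto simp: dilation_def")
  show "EX N. ALL m>=N. 2 * (1 - x (r m)) * rate rt j - 21 * x (r m) - 18 * (x (r m) / 4 * W) <= dq j dA dB dC G V (gk {..<dA} (phi (r m)))"
   using q[OF d j] by blast
 qed
 ultimately show ?thesis by blast
qed

section \<open>Extensions and dilations\<close>

lemma filter_upt_nth:
 assumes "j < n" "P j"
 shows "filter P [0..<n] ! card {k. k < j & P k} = j" "card {k. k < j & P k} < length (filter P [0..<n])"
proof -
 have "[0..<n] = [0..<j] @ j # [Suc j..<n]" using assms(1) by (metis le0 less_imp_le_nat upt_add_eq_append upt_conv_Cons add_diff_inverse_nat le_add_diff_inverse)
 hence f: "filter P [0..<n] = filter P [0..<j] @ j # filter P [Suc j..<n]" using assms(2) by simp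
 have l: "length (filter P [0..<j]) = card {k. k < j & P k}"
  by (subst distinct_card[symmetric]) (auto intro!: arg_cong[of _ _ card])
 show "filter P [0..<n] ! card {k. k < j & P k} = j" "card {k. k < j & P k} < length (filter P [0..<n])"
  unfolding f l[symmetric] by auto
qed

context
 fixes ds :: "nat list" and X :: "nat set"
 assumes pos: "0 < prod_list ds"
begin

definition "kd = map ((!) ds) (kept_pos ds X)"
definition "td = map ((!) ds) (traced_pos ds X)"
definition "kv k = map ((!) (digits ds k)) (kept_pos ds X)"
definition "tv k = map ((!) (digits ds k)) (traced_pos ds X)"
definition "mk i t = undigits ds (merge_digits ds X (digits kd i) (digits td t))"

lemma dpos: "j < length ds ==> 0 < ds ! j"
 using pos by (metis gr0I nth_mem prod_list_zero_iff)

lemma kd_pos: "0 < prod_list kd" "0 < prod_list td"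
proof -
 have "0 ~: set kd" "0 ~: set td" using dpos less_irrefl by (fastforce simp: kd_def td_def kept_pos_def traced_pos_def)+
 thus "0 < prod_list kd" "0 < prod_list td" by (metis gr0I prod_list_zero_iff)+
qed

lemma merge_nth:
 assumes j: "j < length ds"
 shows "j : X ==> kept_pos ds X ! card {k:X. k < j} = j & card {k:X. k < j} < length (kept_pos ds X)"
  "j ~: X ==> traced_pos ds X ! card {k. k < j & k ~: X} = j & card {k. k < j & k ~: X} < length (traced_pos ds X)"
proof -
 have e: "{k:X. k < j} = {k. k < j & k : X}" by auto
 show "j : X ==> kept_pos ds X ! card {k:X. k < j} = j & card {k:X. k < j} < length (kept_pos ds X)"
  unfolding e kept_pos_def using filter_upt_nth[of j "length ds" "%k. k : X"] j by simp
 show "j ~: X ==> traced_pos ds X ! card {k. k < j & k ~: X} = j & card {k. k < j & k ~: X} < length (traced_pos ds X)"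
  unfolding traced_pos_def using filter_upt_nth[of j "length ds" "%k. k ~: X"] j by simp
qed

lemma kv_valid: "list_all2 (<) (kv k) kd" "list_all2 (<) (tv k) td"
 using digits_valid[OF pos, of k] unfolding kv_def kd_def tv_def td_def kept_pos_def traced_pos_def
 by (auto simp: list_all2_conv_all_nth dest!: nth_mem)

lemma merge_valid: "list_all2 (<) (merge_digits ds X (digits kd i) (digits td t)) ds"
proof -
 have "merge_digits ds X (digits kd i) (digits td t) ! j < ds ! j" if j: "j < length ds" for j
 proof (cases "j : X")
  case True
  note m = merge_nth(1)[OF j True]
  have "ALL a<length (kept_pos ds X). digits kd i ! a < ds ! (kept_pos ds X ! a)"
   using digits_valid[OF kd_pos(1), of i] by (simp add: list_all2_conv_all_nth kd_def)
  from this[rule_format, OF conjunct2[OF m], unfolded conjunct1[OF m]] show ?thesis using True j by (simp add: merge_digits_def)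
 next
  case False
  note m = merge_nth(2)[OF j False]
  have "ALL a<length (traced_pos ds X). digits td t ! a < ds ! (traced_pos ds X ! a)"
   using digits_valid[OF kd_pos(2), of t] by (simp add: list_all2_conv_all_nth td_def)
  from this[rule_format, OF conjunct2[OF m], unfolded conjunct1[OF m]] show ?thesis using False j by (simp add: merge_digits_def)
 qed
 thus ?thesis by (simp add: list_all2_conv_all_nth merge_digits_def)
qed

lemma mk_less: "mk i t < prod_list ds"
 unfolding mk_def by (rule undigits_less[OF merge_valid])

lemma mk_digits: "digits ds (mk i t) = merge_digits ds X (digits kd i) (digits td t)"
 unfolding mk_def using digits_undigits[OF merge_valid, where k=0] by simp

lemma kv_mk: "kv (mk i t) = digits kd i" "tv (mk i t) = digits td t"
proof -
 show "kv (mk i t) = digits kd i"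
 proof (rule nth_equalityI)
  fix q assume "q < length (kv (mk i t))"
  hence q: "q < length (kept_pos ds X)" by (simp add: kv_def)
  define j where "j = kept_pos ds X ! q"
  have "j : set (kept_pos ds X)" using q by (simp add: j_def)
  hence j: "j < length ds" "j : X" by (auto simp: kept_pos_def)
  have "distinct (kept_pos ds X)" by (simp add: kept_pos_def)
  hence "card {k:X. k < j} = q" using merge_nth(1)[OF j] q unfolding j_def by (metis nth_eq_iff_index_eq)
  thus "kv (mk i t) ! q = digits kd i ! q" using q j by (simp add: kv_def mk_digits j_def[symmetric] merge_digits_def)
 qed (simp add: kv_def kd_def)
 show "tv (mk i t) = digits td t"
 proof (rule nth_equalityI)
  fix q assume "q < length (tv (mk i t))"
  hence q: "q < length (traced_pos ds X)" by (simp add: tv_def)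
  define j where "j = traced_pos ds X ! q"
  have "j : set (traced_pos ds X)" using q by (simp add: j_def)
  hence j: "j < length ds" "j ~: X" by (auto simp: traced_pos_def)
  have "distinct (traced_pos ds X)" by (simp add: traced_pos_def)
  hence "card {k. k < j & k ~: X} = q" using merge_nth(2)[OF j] q unfolding j_def by (metis nth_eq_iff_index_eq)
  thus "tv (mk i t) ! q = digits td t ! q" using q j by (simp add: tv_def mk_digits j_def[symmetric] merge_digits_def)
 qed (simp add: tv_def td_def)
qed

lemma mk_kv:
 assumes k: "k < prod_list ds"
 shows "mk (undigits kd (kv k)) (undigits td (tv k)) = k"
proof -
 have d: "digits kd (undigits kd (kv k)) = kv k" "digits td (undigits td (tv k)) = tv k"
  using digits_undigits[OF kv_valid(1), of k 0] digits_undigits[OF kv_valid(2), of k 0] by simp_all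
 have "merge_digits ds X (kv k) (tv k) = digits ds k"
 proof (rule nth_equalityI)
  fix j assume "j < length (merge_digits ds X (kv k) (tv k))"
  hence j: "j < length ds" by (simp add: merge_digits_def)
  show "merge_digits ds X (kv k) (tv k) ! j = digits ds k ! j"
   using merge_nth[OF j] j by (cases "j : X") (simp_all add: merge_digits_def kv_def tv_def)
 qed (simp add: merge_digits_def)
 thus ?thesis using k unfolding mk_def d by (simp add: undigits_digits)
qed

lemma ptrace_keep_entry:
 assumes "i < prod_list kd" "j < prod_list kd"
 shows "ptrace_keep ds X rho $$ (i, j) = (SUM t<prod_list td. rho $$ (mk i t, mk j t))"
 using assms unfolding ptrace_keep_def Let_def mk_def kd_def td_def by simp

lemma ptrace_keep_carrier: "ptrace_keep ds X rho : carrier_mat (prod_list kd) (prod_list kd)"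
 unfolding ptrace_keep_def Let_def kd_def by simp

text \<open>The bridge from matrices to index maps: the kept digits are one view of the
  purification, the traced digits together with the purifying index are the other.\<close>

lemma Hsub_Sv:
 assumes F: "finite F" and P: "purifies {..<prod_list ds} F chi (%k k'. rho $$ (k, k'))"
 shows "Hsub ds X rho = Sv ({..<prod_list ds} >< F) (%k. kv (fst k)) (%k. (tv (fst k), snd k)) chi"
proof -
 let ?K = "{..<prod_list ds} >< F" and ?p = "%k. undigits kd (kv (fst k))" and ?q = "%k. (undigits td (tv (fst k)), snd k)"
 let ?Y = "{..<prod_list td} >< F" and ?A = "ptrace_keep ds X rho"
 have K: "finite ?K" using F by simp
 have dg: "digits kd (undigits kd (kv k)) = kv k" "digits td (undigits td (tv k)) = tv k" for k
  using digits_undigits[OF kv_valid(1), of k 0] digits_undigits[OF kv_valid(2), of k 0] by simp_all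
 have pf: "pf ?K ?p ?q chi i (t, f) = chi (mk i t, f)" if i: "i < prod_list kd" and t: "t < prod_list td" and f: "f : F" for i t f
 proof -
  have "undigits kd (kv (mk i t)) = i" "undigits td (tv (mk i t)) = t" unfolding kv_mk using i t by (simp_all add: undigits_digits)
  hence "{k:?K. ?p k = i & ?q k = (t, f)} = {(mk i t, f)}" using mk_less f mk_kv by auto
  thus ?thesis by (simp add: pf_def)
 qed
 have g: "?A $$ (i, j) = gram ?Y (pf ?K ?p ?q chi) i j" if i: "i < prod_list kd" "j < prod_list kd" for i j
 proof -
  have "gram ?Y (pf ?K ?p ?q chi) i j = (SUM t<prod_list td. SUM f:F. chi (mk i t, f) * cnj (chi (mk j t, f)))"
   unfolding gram_def sum_Times by (intro sum.cong refl) (simp add: pf i)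
  also have "... = (SUM t<prod_list td. rho $$ (mk i t, mk j t))" using P mk_less by (intro sum.cong refl) (simp add: purifies_def)
  finally show ?thesis by (simp add: ptrace_keep_entry[OF i])
 qed
 have "purifies {..<prod_list kd} ?Y (%(i, y). pf ?K ?p ?q chi i y) (%i j. ?A $$ (i, j))"
  using F by (simp add: purifies_def g gram_def)
 from vn_entropy_ent[OF ptrace_keep_carrier this] have "Hsub ds X rho = ent {..<prod_list kd} (%i j. ?A $$ (i, j))" by (simp add: Hsub_def)
 also have "... = ent {..<prod_list kd} (gram ?Y (pf ?K ?p ?q chi))" by (rule ent_cong) (simp add: g)
 also have "... = Sv ?K ?p ?q chi"
  by (rule Sv_carrier[symmetric]) (use F undigits_less[OF kv_valid(1)] undigits_less[OF kv_valid(2)] in auto)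
 also have "... = Sv ?K (%k. kv (fst k)) (%k. (tv (fst k), snd k)) chi"
  by (rule Sv_view[OF K]) (metis dg(1), metis dg(2) prod.inject)
 finally show ?thesis .
qed

end

text \<open>\<open>h\<close> embeds the purification into a larger index set on which the amplitude
  vanishes elsewhere; this happens when it is matched with a channel output whose environment is
  larger.\<close>

lemma Hsub_view:
 fixes ds :: "nat list"
 assumes pos: "0 < prod_list ds" and F: "finite F" and P: "purifies {..<prod_list ds} F chi (%k k'. rho $$ (k, k'))"
  and X: "X \<subseteq> {..<length ds}" and K: "finite K" and h: "inj_on h ({..<prod_list ds} >< F)" "h ` ({..<prod_list ds} >< F) \<subseteq> K"
  and Xi: "!!k. k : {..<prod_list ds} >< F ==> Xi (h k) = chi k" "!!k. k : K - h ` ({..<prod_list ds} >< F) ==> Xi k = 0"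
  and p: "!!k l. p (h k) = p (h l) <-> (ALL j:X. digits ds (fst k) ! j = digits ds (fst l) ! j)"
  and q: "!!k l. q (h k) = q (h l) <-> (ALL j:{..<length ds} - X. digits ds (fst k) ! j = digits ds (fst l) ! j) & snd k = snd l"
 shows "Sv K p q Xi = Hsub ds X rho" "Sv K q p Xi = Hsub ds X rho"
proof -
 let ?K0 = "{..<prod_list ds} >< F"
 have "Sv K p q Xi = Sv (h ` ?K0) p q Xi"
 proof (rule Sv_red_cong[OF K])
  show "finite (h ` ?K0)" using F by simp
  show "red K p q Xi u v = red (h ` ?K0) p q Xi u v" for u v
   unfolding red_def using K h(2) Xi(2)
   by (intro sum.mono_neutral_cong_right) (auto intro!: sum.neutral sum.mono_neutral_right)
 qed
 also have "... = Sv ?K0 (%k. kv ds X (fst k)) (%k. (tv ds X (fst k), snd k)) chi"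
 proof (rule Sv_transport[symmetric])
  show "bij_betw h ?K0 (h ` ?K0)" using h(1) by (simp add: bij_betw_def)
  have sets: "set (kept_pos ds X) = X" "set (traced_pos ds X) = {..<length ds} - X" using X by (auto simp: kept_pos_def traced_pos_def)
  show "kv ds X (fst k) = kv ds X (fst l) <-> p (h k) = p (h l)" for k l
   unfolding p kv_def[OF pos] map_eq_conv sets ..
  show "(tv ds X (fst k), snd k) = (tv ds X (fst l), snd l) <-> q (h k) = q (h l)" for k l
   unfolding q tv_def[OF pos] prod.inject map_eq_conv sets ..
 qed (use F Xi(1) in auto)
 also have "... = Hsub ds X rho" by (rule Hsub_Sv[OF pos F P, symmetric])
 finally show "Sv K p q Xi = Hsub ds X rho" .
 thus "Sv K q p Xi = Hsub ds X rho" by (simp add: Sv_swap[OF K, of q p])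
qed

text \<open>Unitary freedom of purifications; \<open>Q\<close> completes the partial isometry \<open>W\<close> to an isometry and vanishes on the support
 of \<open>mu\<close>.\<close>

lemma purification_freedom:
 fixes chi :: "'x => 'z => complex" and mu :: "'x => 'y => complex"
 assumes fin: "finite X" "finite Y" "finite Z"
  and g: "!!x x'. x : X ==> x' : X ==> (SUM z:Z. chi x z * cnj (chi x' z)) = (SUM y:Y. mu x y * cnj (mu x' y))"
 shows "EX W Q. (ALL y:Y. ALL y':Y. (SUM z:Z. W z y * cnj (W z y')) + (SUM v:Y. Q v y * cnj (Q v y')) = dl y y') &
  (ALL x:X. ALL z:Z. (SUM y:Y. W z y * mu x y) = chi x z) & (ALL x:X. ALL v:Y. (SUM y:Y. Q v y * mu x y) = 0)"
proof -
 obtain r u where s: "specd X (gram Y mu) r u" using specd_gram_exists[OF fin(1)] by blast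
 have s': "specd X (gram Z chi) r u"
  using s specd_cong[of X "gram Z chi" "gram Y mu"] g by (simp add: gram_def)
 \<comment> \<open>\<open>t k\<close> is the root of the eigenvalue and \<open>e k\<close> indicates
   the support. Division by zero gives zero, so the quotients by \<open>t k\<close> below vanish off
   the support.\<close>
 define t where "t = (%k. complex_of_real (sqrt (r k)))"
 define e where "e = (%k. if r k = 0 then 0 else 1 :: complex)"
 have r0: "0 <= r k" if "k : X" for k by (rule specd_gram_nonneg[OF s that fin(2)])
 have tt: "t k * t k = of_real (r k)" "cnj (t k) = t k" "t k / t k = e k" if "k : X" for k
  using r0[OF that] by (auto simp: t_def e_def of_real_mult[symmetric] simp del: of_real_mult)
 define co where "co = (%(m :: 'x => complex) k. SUM x:X. cnj (u k x) * m x)"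
 have nrm: "(SUM w:Wt. co (%x. m x w) k * cnj (co (%x. m x w) l)) = (if k = l then of_real (r k) else 0)"
  if sp: "specd X (gram Wt m) r u" and k: "k : X" "l : X" for Wt :: "'w set" and m k l
 proof -
  have "(SUM w:Wt. co (%x. m x w) k * cnj (co (%x. m x w) l)) = (SUM x:X. SUM x':X. cnj (u k x) * gram Wt m x x' * cnj (cnj (u l x')))"
   unfolding co_def gram_def by (rule gram_apply[symmetric])
  also have "... = (SUM x:X. SUM x':X. SUM j:X. of_real (r j) * (cnj (u k x) * u j x) * (cnj (u j x') * u l x'))"
   by (intro sum.cong refl) (simp add: specdD(3)[OF sp] sum_distribs mult_ac)
  also have "... = (SUM j:X. SUM x:X. SUM x':X. of_real (r j) * (cnj (u k x) * u j x) * (cnj (u j x') * u l x'))"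
   by (intro sum.cong refl sum_perm)
  also have "... = (SUM j:X. of_real (r j) * (SUM x:X. u j x * cnj (u k x)) * (SUM x':X. u l x' * cnj (u j x')))"
   by (simp add: sum_distribs mult_ac)
  also have "... = (SUM j:X. if j = k then if k = l then of_real (r k) else 0 else 0)"
   by (intro sum.cong refl) (auto simp: onb_orth[OF specdD(2)[OF sp]] k)
  also have "... = (if k = l then of_real (r k) else 0)" using fin k by simp
  finally show ?thesis .
 qed
 have rec: "(SUM k:X. u k x * co m k) = m x" if x: "x : X" for m x
 proof -
  have "(SUM k:X. u k x * co m k) = (SUM k:X. SUM y:X. u k x * cnj (u k y) * m y)" by (simp add: co_def sum_distrib_left mult_ac)
  also have "... = (SUM y:X. (SUM k:X. u k x * cnj (u k y)) * m y)" by (subst sum.swap) (simp add: sum_distrib_right)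
  also have "... = (SUM y:X. if x = y then m x else 0)" using specdD(2)[OF s] x by (intro sum.cong refl) (auto simp: onb_def)
  finally show ?thesis using fin x by simp
 qed
 have van: "co (%x. m x w) k = 0" if sp: "specd X (gram Wt m) r u" and k: "k : X" "r k = 0" and w: "finite Wt" "w : Wt" for Wt :: "'w set" and m k w
 proof -
  have "(SUM w:Wt. co (%x. m x w) k * cnj (co (%x. m x w) k)) = 0" using nrm[OF sp k(1) k(1)] k(2) by simp
  hence "nsq Wt (%w. co (%x. m x w) k) = 0" by (simp only: cmod_sq of_real_sum[symmetric] of_real_eq_0_iff)
  thus ?thesis using w by (simp add: sum_nonneg_eq_0_iff)
 qed
 define a where "a = (%k y. co (%x. mu x y) k / t k)"
 define b where "b = (%k z. co (%x. chi x z) k / t k)"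
 have ca: "co (%x. mu x y) k = t k * a k y" if "k : X" "y : Y" for k y
  using van[OF s that(1) _ fin(2) that(2)] by (cases "r k = 0") (auto simp: a_def t_def)
 have cb: "co (%x. chi x z) k = t k * b k z" if "k : X" "z : Z" for k z
  using van[OF s' that(1) _ fin(3) that(2)] by (cases "r k = 0") (auto simp: b_def t_def)
 have orth: "(if k = l then of_real (r k) else 0) / (t k * t l) = (if k = l then e k else 0)" if "k : X" for k l
  using tt(1)[OF that] by (auto simp: e_def)
 have aa: "(SUM y:Y. a k y * cnj (a l y)) = (if k = l then e k else 0)" if k: "k : X" "l : X" for k l
  unfolding orth[OF k(1), of l, symmetric] nrm[OF s k, symmetric] a_def by (simp add: sum_divide_distrib tt(2)[OF k(2)])
 have bb: "(SUM z:Z. b k z * cnj (b l z)) = (if k = l then e k else 0)" if k: "k : X" "l : X" for k l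
  unfolding orth[OF k(1), of l, symmetric] nrm[OF s' k, symmetric] b_def by (simp add: sum_divide_distrib tt(2)[OF k(2)])
 have am: "(SUM y:Y. cnj (a k y) * mu x y) = u k x * t k" if k: "k : X" and x: "x : X" for k x
 proof -
  have "(SUM y:Y. cnj (a k y) * mu x y) = (SUM y:Y. SUM l:X. u l x * t l * (a l y * cnj (a k y)))"
  proof (intro sum.cong refl)
   fix y assume y: "y : Y"
   have "mu x y = (SUM l:X. u l x * (t l * a l y))" using rec[OF x, of "%x. mu x y"] by (simp add: ca y cong: sum.cong)
   thus "cnj (a k y) * mu x y = (SUM l:X. u l x * t l * (a l y * cnj (a k y)))" by (simp add: sum_distrib_left mult_ac)
  qed
  also have "... = (SUM l:X. u l x * t l * (SUM y:Y. a l y * cnj (a k y)))" by (subst sum.swap) (simp add: sum_distrib_left)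
  also have "... = (SUM l:X. if l = k then u k x * t k * e k else 0)" by (intro sum.cong refl) (auto simp: aa k)
  also have "... = u k x * t k" using fin k by (auto simp: e_def t_def)
  finally show ?thesis .
 qed
 \<comment> \<open>On the support the vectors a_k and b_k are orthonormal. \<open>W\<close> is the
   partial isometry sending a_k to b_k, \<open>Pj\<close> the projector onto the span of the a_k,
   and \<open>Q\<close> its complement.\<close>
 define W where "W = (%z y. SUM k:X. b k z * cnj (a k y))"
 define Pj where "Pj = (%v y. SUM k:X. a k v * cnj (a k y))"
 define Q where "Q = (%v y. (dl v y) - Pj v y)"
 have sq: "(SUM w:Wt. (SUM k:X. c k w * cnj (a k y)) * cnj (SUM k:X. c k w * cnj (a k y'))) = Pj y' y"
  if c: "!!k l. k : X ==> l : X ==> (SUM w:Wt. c k w * cnj (c l w)) = (if k = l then e k else 0)" and y: "y : Y" for c and Wt :: "'w set" and y y'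
 proof -
  have "(SUM w:Wt. (SUM k:X. c k w * cnj (a k y)) * cnj (SUM k:X. c k w * cnj (a k y'))) = (SUM k:X. SUM l:X. cnj (a k y) * (SUM w:Wt. c k w * cnj (c l w)) * cnj (cnj (a l y')))"
   by (subst gram_apply) (simp add: mult_ac)
  also have "... = (SUM k:X. SUM l:X. if l = k then cnj (a k y) * e k * a k y' else 0)" by (intro sum.cong refl) (auto simp: c)
  also have "... = (SUM k:X. cnj (a k y) * e k * a k y')" using fin by simp
  also have "... = Pj y' y" unfolding Pj_def by (intro sum.cong refl) (auto simp: e_def a_def t_def)
  finally show ?thesis .
 qed
 have WW: "(SUM z:Z. W z y * cnj (W z y')) = Pj y' y" if "y : Y" for y y' unfolding W_def by (rule sq[OF bb that])
 have PP: "(SUM v:Y. Pj v y * cnj (Pj v y')) = Pj y' y" if "y : Y" for y y' unfolding Pj_def by (rule sq[OF aa that, unfolded Pj_def])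
 have Ph: "cnj (Pj y y') = Pj y' y" for y y' by (simp add: Pj_def mult.commute)
 have QQ: "(SUM v:Y. Q v y * cnj (Q v y')) = dl y y' - Pj y' y" if y: "y : Y" "y' : Y" for y y'
 proof -
  have "(SUM v:Y. Q v y * cnj (Q v y')) = (SUM v:Y. (if v = y then (dl y y') - cnj (Pj y y') else 0) - (if v = y' then Pj y' y else 0) + Pj v y * cnj (Pj v y'))"
   by (intro sum.cong refl) (auto simp: Q_def algebra_simps)
  also have "... = dl y y' - cnj (Pj y y') - Pj y' y + (SUM v:Y. Pj v y * cnj (Pj v y'))"
   using fin y by (simp add: sum.distrib sum_subtractf)
  also have "(SUM v:Y. Pj v y * cnj (Pj v y')) = Pj y' y" by (rule PP[OF y(1)])
  finally show ?thesis by (simp add: Ph)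
 qed
 have Wm: "(SUM y:Y. (SUM k:X. c k * cnj (a k y)) * mu x y) = (SUM k:X. c k * (u k x * t k))" if x: "x : X" for c x
 proof -
  have "(SUM y:Y. (SUM k:X. c k * cnj (a k y)) * mu x y) = (SUM k:X. c k * (SUM y:Y. cnj (a k y) * mu x y))"
   unfolding sum_distribs by (subst sum.swap) (simp add: mult_ac)
  thus ?thesis by (simp add: am x cong: sum.cong)
 qed
 have "(SUM y:Y. W z y * mu x y) = chi x z" if "x : X" "z : Z" for x z
  unfolding W_def Wm[OF that(1)] using rec[OF that(1), of "%x. chi x z"] by (simp add: cb that(2) mult_ac cong: sum.cong)
 moreover have "(SUM y:Y. Q v y * mu x y) = 0" if "x : X" "v : Y" for x v
 proof -
  have "(SUM y:Y. Pj v y * mu x y) = mu x v"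
   unfolding Pj_def Wm[OF that(1)] using rec[OF that(1), of "%x. mu x v"] by (simp add: ca that(2) mult_ac cong: sum.cong)
  moreover have "(SUM y:Y. Q v y * mu x y) = (SUM y:Y. (if v = y then mu x v else 0) - Pj v y * mu x y)"
   by (intro sum.cong refl) (auto simp: Q_def algebra_simps)
  ultimately show ?thesis using fin that by (simp add: sum_subtractf)
 qed
 ultimately show ?thesis using WW QQ by (intro exI[of _ W] exI[of _ Q]) simp
qed

text \<open>A purification of an extension and any dilation applied to \<open>phi\<close> purify the
  same operator, so they differ by a partial isometry on the environment; completed to an isometry,
  it turns the dilation into a new one. The involution \<open>w\<close> decides whether the
  extending system becomes E or F.\<close>

lemma extension_dilation:
 fixes dR :: nat
 assumes N: "cptp dA (dB * dC) N" and w: "!!x :: nat * nat. w (w x) = x"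
  and ext: "!!r r' b b' c c'. r < dR ==> r' < dR ==> b < dB ==> b' < dB ==> c < dC ==> c' < dC ==>
   (SUM z:Z. chi (r, b, c) z * cnj (chi (r', b', c') z)) = N (mat dA dA (%(a, a'). phi (a, r) * cnj (phi (a', r')))) $$ (b * dC + c, b' * dC + c')"
  and Z: "finite Z" and dE: "!!z. z : Z ==> fst z < dE"
 shows "EX G V. dilation N dA dB dC G V & w ` Z \<subseteq> G &
  (ALL r<dR. ALL b<dB. ALL c<dC. ALL z. w z : G --> (SUM i<dA. V (b, c, w z) i * phi (i, r)) = (if z : Z then chi (r, b, c) z else 0))"
proof -
 obtain G0 V0 where d0: "dilation N dA dB dC G0 V0" using dilation_exists[OF N] by blast
 have G0: "finite G0" and iso0: "!!i i'. i < dA ==> i' < dA ==> (SUM j:{..<dB} >< {..<dC} >< G0. V0 j i * cnj (V0 j i')) = dl i i'"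
  and N0: "!!X b c b' c'. X : carrier_mat dA dA ==> b < dB ==> c < dC ==> b' < dB ==> c' < dC ==>
   N X $$ (b * dC + c, b' * dC + c') = (SUM y:G0. SUM i<dA. SUM i'<dA. V0 (b, c, y) i * X $$ (i, i') * cnj (V0 (b', c', y) i'))"
  using d0 by (auto simp: dilation_def case_prod_unfold)
 define mu where "mu = (%(r, b, c) y. SUM i<dA. V0 (b, c, y) i * phi (i, r))"
 let ?X = "{..<dR} >< {..<dB} >< {..<dC}"
 have "(SUM z:Z. chi x z * cnj (chi x' z)) = (SUM y:G0. mu x y * cnj (mu x' y))" if "x : ?X" "x' : ?X" for x x'
 proof -
  obtain r b c r' b' c' where x: "x = (r, b, c)" "x' = (r', b', c')" "r < dR" "r' < dR" "b < dB" "b' < dB" "c < dC" "c' < dC" using \<open>x \<in> ?X\<close> \<open>x' \<in> ?X\<close> by auto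
  let ?M = "mat dA dA (%(a, a'). phi (a, r) * cnj (phi (a', r')))"
  have "(SUM z:Z. chi x z * cnj (chi x' z)) = (SUM y:G0. SUM i<dA. SUM i'<dA. V0 (b, c, y) i * ?M $$ (i, i') * cnj (V0 (b', c', y) i'))"
   unfolding x(1,2) ext[OF x(3-8)] by (rule N0) (use x in auto)
  also have "... = (SUM y:G0. SUM i<dA. SUM i'<dA. (V0 (b, c, y) i * phi (i, r)) * cnj (V0 (b', c', y) i' * phi (i', r')))"
   by (intro sum.cong refl) simp
  also have "... = (SUM y:G0. mu x y * cnj (mu x' y))" unfolding mu_def x(1,2) prod.case cnj_sum sum_product ..
  finally show ?thesis .
 qed
 note gr = this
 have fX: "finite ?X" by simp
 have "EX W Q. (ALL y:G0. ALL y':G0. (SUM z:Z. W z y * cnj (W z y')) + (SUM v:G0. Q v y * cnj (Q v y')) = dl y y') &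
  (ALL x:?X. ALL z:Z. (SUM y:G0. W z y * mu x y) = chi x z) & (ALL x:?X. ALL v:G0. (SUM y:G0. Q v y * mu x y) = 0)"
  by (rule purification_freedom[OF fX G0 Z]) (rule gr)
 then obtain W Q where W: "ALL y:G0. ALL y':G0. (SUM z:Z. W z y * cnj (W z y')) + (SUM v:G0. Q v y * cnj (Q v y')) = dl y y'"
  "ALL x:?X. ALL z:Z. (SUM y:G0. W z y * mu x y) = chi x z" "ALL x:?X. ALL v:G0. (SUM y:G0. Q v y * mu x y) = 0"
  by (elim exE conjE)
 note WQ = W(1)[THEN bspec, THEN bspec] and Wm = W(2)[THEN bspec, THEN bspec] and Qm = W(3)[THEN bspec, THEN bspec]
 obtain f :: "nat * nat => nat" where f: "inj_on f G0" using finite_imp_inj_to_nat_seg[OF G0] by blast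
 \<comment> \<open>The extra environment states get first coordinate \<open>dE\<close>, which no
   pair in \<open>Z\<close> has.\<close>
 define ex where "ex = (%v. (dE, f v))"
 have exi: "inj_on ex G0" using f by (auto simp: ex_def inj_on_def)
 define U where "U = (%z y. if z : Z then W z y else Q (the_inv_into G0 ex z) y)"
 define G1 where "G1 = Z \<union> ex ` G0"
 have dis: "Z \<inter> ex ` G0 = {}" using dE by (fastforce simp: ex_def)
 have fG1: "finite G1" using Z G0 by (simp add: G1_def)
 have Uex: "U (ex v) y = Q v y" if "v : G0" for v y using that dis exi by (auto simp: U_def the_inv_into_f_f)
 have U: "(SUM z:G1. U z y * cnj (U z y')) = dl y y'" if "y : G0" "y' : G0" for y y'
 proof -
  have "(SUM z:G1. U z y * cnj (U z y')) = (SUM z:Z. U z y * cnj (U z y')) + (SUM z:ex ` G0. U z y * cnj (U z y'))"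
   unfolding G1_def by (rule sum.union_disjoint) (use Z G0 dis in auto)
  also have "(SUM z:Z. U z y * cnj (U z y')) = (SUM z:Z. W z y * cnj (W z y'))" by (simp add: U_def)
  also have "(SUM z:ex ` G0. U z y * cnj (U z y')) = (SUM v:G0. Q v y * cnj (Q v y'))" by (simp add: sum.reindex[OF exi] Uex)
  finally show ?thesis using WQ[OF that] by simp
 qed
 have wi: "inj_on w A" for A by (rule inj_on_inverseI[where g=w]) (rule w)
 define V where "V = (%(b, c, z) i. SUM y:G0. U (w z) y * V0 (b, c, y) i)"
 have key: "(SUM z:w ` G1. V (b, c, z) i * cnj (V (b', c', z) i')) = (SUM y:G0. V0 (b, c, y) i * cnj (V0 (b', c', y) i'))" for b c b' c' i i'
 proof -
  have "(SUM z:w ` G1. V (b, c, z) i * cnj (V (b', c', z) i')) = (SUM z:G1. (SUM y:G0. V0 (b, c, y) i * U z y) * cnj (SUM y:G0. V0 (b', c', y) i' * U z y))"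
   by (simp add: sum.reindex[OF wi] V_def w mult.commute)
  also have "... = (SUM y:G0. SUM y':G0. V0 (b, c, y) i * (SUM z:G1. U z y * cnj (U z y')) * cnj (V0 (b', c', y') i'))"
   by (rule gram_apply[symmetric])
  also have "... = (SUM y:G0. SUM y':G0. if y' = y then V0 (b, c, y) i * cnj (V0 (b', c', y) i') else 0)"
   by (intro sum.cong refl) (auto simp: U)
  finally show ?thesis using G0 by simp
 qed
 have "dilation N dA dB dC (w ` G1) V"
  unfolding dilation_def
 proof (intro conjI allI ballI impI)
  show "finite (w ` G1)" using fG1 by simp
  fix i i' assume i: "i < dA" "i' < dA"
  have "(SUM j:{..<dB} >< {..<dC} >< w ` G1. V j i * cnj (V j i')) = (SUM j:{..<dB} >< {..<dC} >< G0. V0 j i * cnj (V0 j i'))"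
   unfolding sum_Times key ..
  thus "(SUM j:{..<dB} >< {..<dC} >< w ` G1. V j i * cnj (V j i')) = dl i i'" using iso0[OF i] by simp
 next
  fix X :: "complex mat" and b c b' c' assume X: "X : carrier_mat dA dA" and b: "b < dB" "c < dC" "b' < dB" "c' < dC"
  have "(SUM (e, f):w ` G1. SUM i<dA. SUM i'<dA. V (b, c, e, f) i * X $$ (i, i') * cnj (V (b', c', e, f) i'))
   = (SUM z:w ` G1. SUM i<dA. SUM i'<dA. X $$ (i, i') * (V (b, c, z) i * cnj (V (b', c', z) i')))"
   by (simp add: case_prod_unfold mult_ac)
  also have "... = (SUM i<dA. SUM i'<dA. SUM z:w ` G1. X $$ (i, i') * (V (b, c, z) i * cnj (V (b', c', z) i')))"
   by (intro sum.cong refl sum_perm)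
  also have "... = (SUM i<dA. SUM i'<dA. SUM z:G0. X $$ (i, i') * (V0 (b, c, z) i * cnj (V0 (b', c', z) i')))" unfolding sum_distrib_left[symmetric] key ..
  also have "... = (SUM z:G0. SUM i<dA. SUM i'<dA. X $$ (i, i') * (V0 (b, c, z) i * cnj (V0 (b', c', z) i')))"
   by (intro sum.cong refl sum_perm)
  also have "... = N X $$ (b * dC + c, b' * dC + c')" unfolding N0[OF X b] by (simp add: mult_ac)
  finally show "N X $$ (b * dC + c, b' * dC + c') = (SUM (e, f):w ` G1. SUM i<dA. SUM i'<dA. V (b, c, e, f) i * X $$ (i, i') * cnj (V (b', c', e, f) i'))" ..
 qed
 moreover have "w ` Z \<subseteq> w ` G1" by (auto simp: G1_def)
 moreover have "(SUM i<dA. V (b, c, w z) i * phi (i, r)) = (if z : Z then chi (r, b, c) z else 0)"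
  if x: "r < dR" "b < dB" "c < dC" and z: "w z : w ` G1" for r b c z
 proof -
  have z1: "z : G1" using z w by (metis imageE)
  have "(SUM i<dA. V (b, c, w z) i * phi (i, r)) = (SUM i<dA. SUM y:G0. U z y * (V0 (b, c, y) i * phi (i, r)))"
   unfolding V_def prod.case w sum_distrib_right by (intro sum.cong refl) (simp add: mult_ac)
  also have "... = (SUM y:G0. U z y * mu (r, b, c) y)" by (subst sum.swap) (simp add: mu_def sum_distrib_left)
  also have "... = (if z : Z then chi (r, b, c) z else 0)"
  proof (cases "z : Z")
   case True
   thus ?thesis using Wm[of "(r, b, c)" z] x by (simp add: U_def)
  next
   case False
   then obtain v where "v : G0" "z = ex v" using z1 by (auto simp: G1_def)
   thus ?thesis using Qm[of "(r, b, c)" v] x False by (simp add: Uex)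
  qed
  finally show ?thesis .
 qed
 ultimately show ?thesis by blast
qed

text \<open>An index consists of b, c, an environment pair and r. \<open>Xi\<close> is the dilated
  channel state; it agrees with the purification \<open>chi\<close> of \<open>Om\<close> on the
  image of \<open>h\<close> and vanishes elsewhere.\<close>

locale four_party =
 fixes ds :: "nat list" and m :: nat and Om :: "complex mat" and chi :: "nat * nat => complex"
  and K :: "((nat * nat * nat * nat) * nat) set" and Xi and w :: "nat * nat => nat * nat" and h
 assumes len: "length ds = 4" and pos: "0 < prod_list ds" and P: "purifies {..<prod_list ds} {..<m} chi (%k k'. Om $$ (k, k'))"
  and K: "finite K" and w [simp]: "!!x. w (w x) = x"
  and h_def: "!!k f. h (k, f) = ((digits ds k ! 1, digits ds k ! 2, w (digits ds k ! 3, f)), digits ds k ! 0)"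
  and sub: "h ` ({..<prod_list ds} >< {..<m}) \<subseteq> K"
  and Xi: "!!k. k : {..<prod_list ds} >< {..<m} ==> Xi (h k) = chi k" "!!k. k : K - h ` ({..<prod_list ds} >< {..<m}) ==> Xi k = 0"
begin

abbreviation "S X \<equiv> Hsub ds X Om"
abbreviation "vb k \<equiv> fst (fst k)"
abbreviation "vc k \<equiv> fst (snd (fst k))"
abbreviation "ve k \<equiv> fst (w (snd (snd (fst k))))"
abbreviation "vf k \<equiv> snd (w (snd (snd (fst k))))"
abbreviation "vr k \<equiv> snd k"

lemma h_eq: "h k = ((digits ds (fst k) ! 1, digits ds (fst k) ! 2, w (digits ds (fst k) ! 3, snd k)), digits ds (fst k) ! 0)"
 using h_def[of "fst k" "snd k"] by simp

lemma h_inj: "inj_on h ({..<prod_list ds} >< {..<m})"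
proof (rule inj_onI)
 fix k l assume k: "k : {..<prod_list ds} >< {..<m}" "l : {..<prod_list ds} >< {..<m}" and e: "h k = h l"
 have "(digits ds (fst k) ! 3, snd k) = (digits ds (fst l) ! 3, snd l)" using e w unfolding h_eq by (metis prod.inject)
 hence "digits ds (fst k) ! j = digits ds (fst l) ! j" if "j < 4" for j
  using e that unfolding h_eq by (auto simp: eval_nat_numeral less_Suc_eq)
 hence "digits ds (fst k) = digits ds (fst l)" by (intro nth_equalityI) (simp_all add: len)
 hence "undigits ds (digits ds (fst k)) = undigits ds (digits ds (fst l))" by simp
 hence "fst k = fst l" using k unfolding undigits_digits by auto
 thus "k = l" using \<open>_ = (digits ds (fst l) ! 3, snd l)\<close> by (simp add: prod_eq_iff)
qed

lemma SV:
 assumes X: "X \<subseteq> {0, 1, 2, 3}"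
  and p: "!!k l. p (h k) = p (h l) <-> (ALL j:X. digits ds (fst k) ! j = digits ds (fst l) ! j)"
  and q: "!!k l. q (h k) = q (h l) <-> (ALL j:{0, 1, 2, 3} - X. digits ds (fst k) ! j = digits ds (fst l) ! j) & snd k = snd l"
 shows "Sv K p q Xi = S X" "Sv K q p Xi = S X"
proof -
 have l4: "{..<length ds} = {0, 1, 2, 3}" by (auto simp: len)
 note H = Hsub_view[OF pos finite_lessThan P _ K h_inj sub, where X=X and p=p and q=q, unfolded l4, OF X]
 show "Sv K p q Xi = S X" "Sv K q p Xi = S X" by (rule H; (rule Xi p q)?; assumption?)+
qed

text \<open>\<open>ve\<close> and \<open>vf\<close> undo \<open>w\<close>, so \<open>ve\<close> is
  always the extending system, factor 3, and \<open>vf\<close> its purifying partner. Entropies of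
  sets that contain \<open>vf\<close> are replaced by those of the complement.\<close>

lemma Hc_values:
 "Hc K vb ve (%k. ((vc k, vf k), vr k)) Xi = S {1, 3} - S {3}"
 "Hc K vb vf (%k. ((vc k, ve k), vr k)) Xi = S {0, 2, 3} - S {0, 1, 2, 3}"
 "Hc K vc ve (%k. ((vb k, vf k), vr k)) Xi = S {2, 3} - S {3}"
 "Hc K vc vf (%k. ((vb k, ve k), vr k)) Xi = S {0, 1, 3} - S {0, 1, 2, 3}"
 "Hc K (%k. (vb k, vc k)) ve (%k. (((), vf k), vr k)) Xi = S {1, 2, 3} - S {3}"
 "Hc K (%k. (vb k, vc k)) vf (%k. (((), ve k), vr k)) Xi = S {0, 3} - S {0, 1, 2, 3}"
 "Hc K (%k. (vb k, vc k)) ve (%k. (vf k, vr k)) Xi = S {1, 2, 3} - S {3}"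
 "Hc K (%k. (vb k, vc k)) vf (%k. (ve k, vr k)) Xi = S {0, 3} - S {0, 1, 2, 3}"
 unfolding Hc_def by (rule arg_cong2[where f=minus]; rule SV(1,2); auto simp: h_eq; fail)+

lemma information_values:
 "cmi ds [{0, 2}, {1}] 3 Om = S {0, 2, 3} + S {1, 3} - S {3} - S {0, 1, 2, 3}"
 "cmi ds [{0, 1}, {2}] 3 Om = S {0, 1, 3} + S {2, 3} - S {3} - S {0, 1, 2, 3}"
 "cmi ds [{0}, {1, 2}] 3 Om = S {0, 3} + S {1, 2, 3} - S {3} - S {0, 1, 2, 3}"
 "cmi ds [{0}, {1}, {2}] 3 Om = S {0, 3} + S {1, 3} + S {2, 3} - 2 * S {3} - S {0, 1, 2, 3}"
 "cmi_tilde ds [{0}, {1}, {2}] 3 Om = S {1, 2, 3} + S {0, 2, 3} + S {0, 1, 3} - S {3} - 2 * S {0, 1, 2, 3}"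
proof -
 have u: "{j. j < 3 & j ~= 0} = {1, 2::nat}" "{j. j < 3 & j ~= 1} = {0, 2::nat}" "{j. j < 3 & j ~= 2} = {0, 1::nat}" by auto
 have s: "insert 3 {0, 2} = {0, 2, 3::nat}" "insert 3 {0, 1} = {0, 1, 3::nat}" "insert 3 {1, 2} = {1, 2, 3::nat}" "insert 3 {0} = {0, 3::nat}" "insert 3 {1} = {1, 3::nat}" "insert 3 {2} = {2, 3::nat}"
  "insert 3 {0, 1, 2} = {0, 1, 2, 3::nat}" "insert 3 {0, 2, 1} = {0, 1, 2, 3::nat}" by auto
 have s2: "sum f {..<2} = f 0 + f 1" "sum f {..<3} = f 0 + f 1 + f 2" for f :: "nat => real" by (simp_all add: eval_nat_numeral)
 have m: "[{0::nat}, {1}, {2}] ! 0 = {0}" "[{0::nat}, {1}, {2}] ! 1 = {1}" "[{0::nat}, {1}, {2}] ! 2 = {2}" by simp_all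
 have un: "{0, 2} \<union> {1} = {0, 1, 2::nat}" "{0, 1} \<union> {2} = {0, 1, 2::nat}" "{0} \<union> {1, 2} = {0, 1, 2::nat}" "{0} \<union> ({1} \<union> {2}) = {0, 1, 2::nat}" "{1} \<union> {2} = {1, 2::nat}" "{0} \<union> {2} = {0, 2::nat}" "{0} \<union> {1} = {0, 1::nat}" by auto
 have l: "length [A, B] = 2" "length [A, B, C] = 3" "[A, B] ! 0 = A" "[A, B] ! 1 = B" for A B C :: "nat set" by simp_all
 have U: "\<Union> (set [A, B]) = A \<union> B" "\<Union> (set [A, B, C]) = A \<union> (B \<union> C)" for A B C :: "nat set" by auto
 have U': "(\<Union>j\<in>{1, 2}. [{0::nat}, {1}, {2}] ! j) = {1, 2}" "(\<Union>j\<in>{0, 2}. [{0::nat}, {1}, {2}] ! j) = {0, 2}" "(\<Union>j\<in>{0, 1}. [{0::nat}, {1}, {2}] ! j) = {0, 1}" by auto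
 have un3: "X \<union> {3} = insert 3 X" for X :: "nat set" by auto
 show "cmi ds [{0, 2}, {1}] 3 Om = S {0, 2, 3} + S {1, 3} - S {3} - S {0, 1, 2, 3}"
  "cmi ds [{0, 1}, {2}] 3 Om = S {0, 1, 3} + S {2, 3} - S {3} - S {0, 1, 2, 3}"
  "cmi ds [{0}, {1, 2}] 3 Om = S {0, 3} + S {1, 2, 3} - S {3} - S {0, 1, 2, 3}"
  "cmi ds [{0}, {1}, {2}] 3 Om = S {0, 3} + S {1, 3} + S {2, 3} - 2 * S {3} - S {0, 1, 2, 3}"
  unfolding cmi_def l s2 U un condH_def m un3 s by simp_all
 show "cmi_tilde ds [{0}, {1}, {2}] 3 Om = S {1, 2, 3} + S {0, 2, 3} + S {0, 1, 3} - S {3} - 2 * S {0, 1, 2, 3}"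
  unfolding cmi_tilde_def l s2 u U U' un condH_def un3 s by simp
qed

end

text \<open>The dilation is chosen twice: with the extending system as E for the four conditional
  informations, and with it as F for the tilde quantity, which is the three-party information with
  the environments exchanged.\<close>

lemma extension_bounds:
 assumes N: "cptp dA (dB * dC) N" and d: "0 < dA" "0 < dB" "0 < dC"
  and q: "!!G V j. dilation N dA dB dC G V ==> j <= 3 ==> R j <= dq j dA dB dC G V (gk {..<dA} phi)"
  and E: "(dE, Om) : extensions [dA, dB, dC] (apply_on [dA, dA] 1 N (dB * dC) (outer (vec (dA * dA) (%k. phi (k mod dA, k div dA)))))"
 defines "ds \<equiv> [dA, dB, dC, dE]"
 shows "R 0 <= cmi ds [{0, 2}, {1}] 3 Om" "R 1 <= cmi ds [{0, 1}, {2}] 3 Om" "R 2 <= cmi ds [{0}, {1, 2}] 3 Om"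
  "R 3 <= cmi ds [{0}, {1}, {2}] 3 Om" "R 3 <= cmi_tilde ds [{0}, {1}, {2}] 3 Om"
proof -
 let ?psi = "vec (dA * dA) (%k. phi (k mod dA, k div dA))"
 let ?omega = "apply_on [dA, dA] 1 N (dB * dC) (outer ?psi)"
 define n where "n = prod_list ds"
 have dE: "0 < dE" and Om: "Om : carrier_mat n n" "psd Om" and tr: "ptrace_keep ds {..<3} Om = ?omega"
  using E by (auto simp: extensions_def density_def n_def ds_def numeral_3_eq_3)
 have len: "length ds = 4" by (simp add: ds_def)
 have pos: "0 < prod_list ds" using d dE by (simp add: ds_def)
 obtain chi0 where P: "purifies {..<n} {..<n} chi0 (%k k'. Om $$ (k, k'))" using psd_purifies[OF Om] by blast
 define chi where "chi = (%(r, b, c) (e, f). chi0 (undigits ds [r, b, c, e], f))"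
 define Z where "Z = {..<dE} >< {..<n}"
 have fl: "undigits ds [r, b, c, e] < n" "digits ds (undigits ds [r, b, c, e]) = [r, b, c, e]" if "r < dA" "b < dB" "c < dC" "e < dE" for r b c e
 proof -
  have v: "list_all2 (<) [r, b, c, e] ds" using that by (simp add: ds_def)
  show "undigits ds [r, b, c, e] < n" unfolding n_def by (rule undigits_less[OF v])
  show "digits ds (undigits ds [r, b, c, e]) = [r, b, c, e]" using digits_undigits[OF v, of 0] by simp
 qed
 have kp: "kept_pos ds {..<3} = [0, 1, 2]" "traced_pos ds {..<3} = [3]" by (simp_all add: kept_pos_def traced_pos_def len upt_rec eval_nat_numeral)
 have kd: "kd ds {..<3} = [dA, dB, dC]" "td ds {..<3} = [dE]" unfolding kd_def[OF pos] td_def[OF pos] kp by (simp_all add: ds_def)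
 have mk: "mk ds {..<3} ((r * dB + b) * dC + c) e = undigits ds [r, b, c, e]" if x: "r < dA" "b < dB" "c < dC" "e < dE" for r b c e
 proof -
  let ?k = "undigits ds [r, b, c, e]"
  have "kv ds {..<3} ?k = [r, b, c]" "tv ds {..<3} ?k = [e]" unfolding kv_def[OF pos] tv_def[OF pos] kp fl(2)[OF x] by simp_all
  moreover have "undigits [dA, dB, dC] [r, b, c] = (r * dB + b) * dC + c" "undigits [dE] [e] = e" by (simp_all add: algebra_simps)
  ultimately show ?thesis using mk_kv[OF pos, of ?k "{..<3}"] fl(1)[OF x] unfolding kd n_def by (simp only: simp_thms)
 qed
 have ext: "(SUM z:Z. chi (r, b, c) z * cnj (chi (r', b', c') z)) = N (mat dA dA (%(a, a'). phi (a, r) * cnj (phi (a', r')))) $$ (b * dC + c, b' * dC + c')"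
  if x: "r < dA" "r' < dA" "b < dB" "b' < dB" "c < dC" "c' < dC" for r r' b b' c c'
 proof -
  let ?i = "(r * dB + b) * dC + c" and ?j = "(r' * dB + b') * dC + c'"
  have lt: "?i < prod_list (kd ds {..<3})" "?j < prod_list (kd ds {..<3})" unfolding kd using x flat_less by (simp_all add: mult.assoc[symmetric])
  have "(SUM z:Z. chi (r, b, c) z * cnj (chi (r', b', c') z)) = (SUM e<dE. SUM f<n. chi0 (undigits ds [r, b, c, e], f) * cnj (chi0 (undigits ds [r', b', c', e], f)))"
   by (simp add: Z_def chi_def sum_Times)
  also have "... = (SUM e<dE. Om $$ (undigits ds [r, b, c, e], undigits ds [r', b', c', e]))"
   using P fl(1) x by (intro sum.cong refl) (simp add: purifies_def)
  also have "... = (SUM e<prod_list (td ds {..<3}). Om $$ (mk ds {..<3} ?i e, mk ds {..<3} ?j e))"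
   unfolding kd by (intro sum.cong) (use x in "simp_all add: mk")
  also have "... = ?omega $$ (?i, ?j)" unfolding tr[symmetric] by (rule ptrace_keep_entry[OF pos lt, symmetric])
  also have "... = ?omega $$ ((r * (dB * dC) + (b * dC + c)) * 1 + 0, (r' * (dB * dC) + (b' * dC + c')) * 1 + 0)" by (simp add: algebra_simps)
  also have "... = N (mat dA dA (%(a, a'). outer ?psi $$ ((r * dA + a) * 1 + 0, (r' * dA + a') * 1 + 0))) $$ (b * dC + c, b' * dC + c')"
   by (rule apply_on_entry) (use x flat_less2 in auto)
  also have "mat dA dA (%(a, a'). outer ?psi $$ ((r * dA + a) * 1 + 0, (r' * dA + a') * 1 + 0)) = mat dA dA (%(a, a'). phi (a, r) * cnj (phi (a', r')))"
   by (rule eq_matI) (use x flat_less2 in "auto simp: outer_def flat_div_mod")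
  finally show ?thesis .
 qed
 have fZ: "finite Z" and Zd: "!!z. z : Z ==> fst z < dE" by (auto simp: Z_def)
 have state: "EX G V. dilation N dA dB dC G V & four_party ds n Om chi0 (({..<dB} >< {..<dC} >< G) >< {..<dA}) (apply_fst {..<dA} V phi) w
   (%(k, f). ((digits ds k ! 1, digits ds k ! 2, w (digits ds k ! 3, f)), digits ds k ! 0))" if w: "!!x. w (w x) = x" for w
 proof -
  have "EX G V. dilation N dA dB dC G V & w ` Z \<subseteq> G &
   (ALL r<dA. ALL b<dB. ALL c<dC. ALL z. w z : G --> (SUM i<dA. V (b, c, w z) i * phi (i, r)) = (if z : Z then chi (r, b, c) z else 0))"
   by (rule extension_dilation[OF N w ext fZ Zd])
  then obtain G V where dil: "dilation N dA dB dC G V" and sub: "w ` Z \<subseteq> G"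
   and V': "ALL r<dA. ALL b<dB. ALL c<dC. ALL z. w z : G --> (SUM i<dA. V (b, c, w z) i * phi (i, r)) = (if z : Z then chi (r, b, c) z else 0)"
   by (elim exE conjE)
  note V = V'[rule_format]
  let ?h = "%(k, f). ((digits ds k ! 1, digits ds k ! 2, w (digits ds k ! 3, f)), digits ds k ! 0)"
  have dv: "digits ds k ! 0 < dA" "digits ds k ! 1 < dB" "digits ds k ! 2 < dC" "digits ds k ! 3 < dE" for k
   using digits_valid[OF pos, of k] by (simp_all add: ds_def)
  have "four_party ds n Om chi0 (({..<dB} >< {..<dC} >< G) >< {..<dA}) (apply_fst {..<dA} V phi) w ?h"
  proof
   show "finite (({..<dB} >< {..<dC} >< G) >< {..<dA})" using dil by (simp add: dilation_def)
   show "purifies {..<prod_list ds} {..<n} chi0 (%k k'. Om $$ (k, k'))" using P by (simp add: n_def)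
   have zG: "w (digits ds k ! 3, f) : G" "(digits ds k ! 3, f) : Z" if "f < n" for k f using sub dv that by (auto simp: Z_def)
   show "?h ` ({..<prod_list ds} >< {..<n}) \<subseteq> ({..<dB} >< {..<dC} >< G) >< {..<dA}" using dv zG by auto
   show "apply_fst {..<dA} V phi (?h k) = chi0 k" if kk: "k : {..<prod_list ds} >< {..<n}" for k
   proof -
    obtain i f where k: "k = (i, f)" "i < prod_list ds" "f < n" using kk by auto
    have "[digits ds i ! 0, digits ds i ! 1, digits ds i ! 2, digits ds i ! 3] = digits ds i" by (simp add: ds_def)
    hence "undigits ds [digits ds i ! 0, digits ds i ! 1, digits ds i ! 2, digits ds i ! 3] = i" using k(2) by (simp add: undigits_digits)
    thus ?thesis using V[OF dv(1) dv(2) dv(3) zG(1)[OF k(3)], of i i i i] zG(2)[OF k(3)] by (simp add: k(1) apply_fst_def chi_def)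
   qed
   show "apply_fst {..<dA} V phi k = 0" if kk: "k : ({..<dB} >< {..<dC} >< G) >< {..<dA} - ?h ` ({..<prod_list ds} >< {..<n})" for k
   proof -
    obtain b c g r where k: "k = ((b, c, g), r)" "b < dB" "c < dC" "g : G" "r < dA" using kk by auto
    have "w g ~: Z"
    proof
     assume "w g : Z"
     then obtain e f where ef: "w g = (e, f)" "e < dE" "f < n" by (auto simp: Z_def)
     have "?h (undigits ds [r, b, c, e], f) = k" unfolding prod.case fl(2)[OF k(5,2,3) ef(2)] using ef(1) w[of g] k(1) by simp
     moreover have "(undigits ds [r, b, c, e], f) : {..<prod_list ds} >< {..<n}" using fl(1)[OF k(5,2,3) ef(2)] ef(3) by (simp add: n_def)
     ultimately show False using kk by blast
    qed
    thus ?thesis using V[OF k(5,2,3), of "w g"] k(4) by (simp add: k(1) apply_fst_def w)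
   qed
  qed (use len pos w in auto)
  thus ?thesis using dil by blast
 qed
 obtain G V where dil: "dilation N dA dB dC G V" and fp: "four_party ds n Om chi0 (({..<dB} >< {..<dC} >< G) >< {..<dA}) (apply_fst {..<dA} V phi) (%x. x)
   (%(k, f). ((digits ds k ! 1, digits ds k ! 2, (digits ds k ! 3, f)), digits ds k ! 0))" using state[of "%x. x"] by auto
 have J: "finite ({..<dB} >< {..<dC} >< G)" using dil by (simp add: dilation_def)
 note iv = four_party.information_values[OF fp] and hv = four_party.Hc_values[OF fp]
 show "R 0 <= cmi ds [{0, 2}, {1}] 3 Om" "R 1 <= cmi ds [{0, 1}, {2}] 3 Om" "R 2 <= cmi ds [{0}, {1, 2}] 3 Om" "R 3 <= cmi ds [{0}, {1}, {2}] 3 Om"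
  using q[OF dil, of 0] q[OF dil, of 1] q[OF dil, of 2] q[OF dil, of 3]
  unfolding iv dq_def kq_def kbip_def ktri_def kH_vec[OF J finite_lessThan] hv by simp_all
 obtain G V where dil: "dilation N dA dB dC G V" and fp: "four_party ds n Om chi0 (({..<dB} >< {..<dC} >< G) >< {..<dA}) (apply_fst {..<dA} V phi) prod.swap
   (%(k, f). ((digits ds k ! 1, digits ds k ! 2, prod.swap (digits ds k ! 3, f)), digits ds k ! 0))" using state[of prod.swap] by auto
 have J: "finite ({..<dB} >< {..<dC} >< G)" using dil by (simp add: dilation_def)
 note iv = four_party.information_values[OF fp] and hv = four_party.Hc_values[OF fp, unfolded fst_swap snd_swap]
 show "R 3 <= cmi_tilde ds [{0}, {1}, {2}] 3 Om"
  using q[OF dil, of 3] unfolding iv dq_def kq_def kbip_def ktri_def kH_vec[OF J finite_lessThan] hv by simp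
qed

text \<open>A lower bound on all extensions passes to the infimum only over a nonempty set; a
  one-dimensional E provides an element.\<close>

lemma trivial_extension:
 assumes N: "cptp dA (dB * dC) N" and d: "0 < dA" "0 < dB" "0 < dC" and psi: "unit_vector (dA * dA) psi"
 shows "(1, apply_on [dA, dA] 1 N (dB * dC) (outer psi)) : extensions [dA, dB, dC] (apply_on [dA, dA] 1 N (dB * dC) (outer psi))"
proof -
 let ?O = "outer psi" and ?omega = "apply_on [dA, dA] 1 N (dB * dC) (outer psi)" and ?ds = "[dA, dB, dC, 1]"
 have psic: "psi : carrier_vec (dA * dA)" and n: "nsq {..<dA * dA} (%i. psi $ i) = 1" using psi by (auto simp: unit_vector_def)
 have O: "?O : carrier_mat (dA * dA) (dA * dA)" using psic by (simp add: outer_def)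
 have "psd ?O"
  by (rule purifies_psd[OF O, where P="{()}" and phi="%(i, _). psi $ i"]) (use psic in "auto simp: purifies_def outer_def")
 hence "psd ?omega" using N O unfolding cptp_def cp_map_def by blast
 have omega: "?omega : carrier_mat (dA * (dB * dC)) (dA * (dB * dC))" by (simp add: apply_on_def Let_def)
 have "(SUM x<1::nat. cmtrace (apply_on [dA, dA] 1 N (dB * dC) ?O)) = cmtrace ?O"
  by (rule cmtrace_apply_on) (use N O in "auto simp: cptp_def cp_map_def lin_map_def tp_map_def")
 also have "cmtrace ?O = of_real (nsq {..<dA * dA} (%i. psi $ i))"
  unfolding of_real_sum cmod_sq(1)[symmetric] using psic by (simp add: cmtrace_def outer_def)
 finally have tr: "cmtrace ?omega = 1" by (simp add: n)
 have pos: "0 < prod_list ?ds" using d by simp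
 have kp: "kept_pos ?ds {..<3} = [0, 1, 2]" "traced_pos ?ds {..<3} = [3]" by (simp_all add: kept_pos_def traced_pos_def upt_rec eval_nat_numeral)
 have kd: "kd ?ds {..<3} = [dA, dB, dC]" "td ?ds {..<3} = [1]" unfolding kd_def[OF pos] td_def[OF pos] kp by simp_all
 have mk: "mk ?ds {..<3} i 0 = i" if i: "i < dA * (dB * dC)" for i
 proof -
  have "kv ?ds {..<3} i = digits [dA, dB, dC] i" "tv ?ds {..<3} i = [0]" unfolding kv_def[OF pos] tv_def[OF pos] kp by simp_all
  moreover have "undigits [dA, dB, dC] (digits [dA, dB, dC] i) = i" unfolding undigits_digits using i by simp
  ultimately show ?thesis using mk_kv[OF pos, of i "{..<3}"] i unfolding kd by simp
 qed
 have "ptrace_keep ?ds {..<3} ?omega = ?omega"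
 proof (rule eq_matI)
  have c: "ptrace_keep ?ds {..<3} ?omega : carrier_mat (dA * (dB * dC)) (dA * (dB * dC))"
   using ptrace_keep_carrier[OF pos, of "{..<3}"] unfolding kd by simp
  show "dim_row (ptrace_keep ?ds {..<3} ?omega) = dim_row ?omega" "dim_col (ptrace_keep ?ds {..<3} ?omega) = dim_col ?omega" using c omega by auto
  fix i j assume "i < dim_row ?omega" "j < dim_col ?omega"
  hence ij: "i < dA * (dB * dC)" "j < dA * (dB * dC)" using omega by auto
  have "ptrace_keep ?ds {..<3} ?omega $$ (i, j) = (SUM t<prod_list (td ?ds {..<3}). ?omega $$ (mk ?ds {..<3} i t, mk ?ds {..<3} j t))"
   by (rule ptrace_keep_entry[OF pos]; unfold kd) (use ij in simp_all)
  also have "... = ?omega $$ (mk ?ds {..<3} i 0, mk ?ds {..<3} j 0)" unfolding kd by simp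
  finally show "ptrace_keep ?ds {..<3} ?omega $$ (i, j) = ?omega $$ (i, j)" unfolding mk[OF ij(1)] mk[OF ij(2)] .
 qed
 thus ?thesis using \<open>psd ?omega\<close> omega tr by (simp add: extensions_def density_def numeral_3_eq_3)
qed

theorem theorem1:
  fixes N :: "complex mat \<Rightarrow> complex mat" and dA dB dC :: nat
    and eAB eAC eBC eABC kAB kAC kBC kABC :: real
  assumes "0 < dA" "0 < dB" "0 < dC"
    and "cptp dA (dB * dC) N"
    and "achievable N dA dB dC eAB eAC eBC eABC kAB kAC kBC kABC"
  shows "\<exists>dR \<psi>. 0 < dR \<and> dR \<le> dA \<and> unit_vector (dR * dA) \<psi> \<and>
    (let \<omega> = apply_on [dR, dA] 1 N (dB * dC) (outer \<psi>); ds = [dR, dB, dC] in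
       eAB + kAB + eBC + kBC + eABC + kABC \<le> Esq ds [{0, 2}, {1}] \<omega> \<and>
       eAC + kAC + eBC + kBC + eABC + kABC \<le> Esq ds [{0, 1}, {2}] \<omega> \<and>
       eAB + kAB + eAC + kAC + eABC + kABC \<le> Esq ds [{0}, {1, 2}] \<omega> \<and>
       eAB + kAB + eAC + kAC + eBC + kBC + 3/2 * (eABC + kABC)
         \<le> min (Esq ds [{0}, {1}, {2}] \<omega>) (Esq_tilde ds [{0}, {1}, {2}] \<omega>))"
proof -
 let ?rt = "[eAB, eAC, eBC, eABC, kAB, kAC, kBC, kABC]"
 obtain phi where n: "(SUM k:{..<dA} >< {..<dA}. (cmod (phi k))^2) = 1"
  and "ALL G V j. dilation N dA dB dC G V --> j <= 3 --> 2 * rate ?rt j <= dq j dA dB dC G V (gk {..<dA} phi)"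
  using achievable_limit[OF assms(4,5)] by (elim exE conjE)
 note q = this(2)[rule_format]
 \<comment> \<open>\<open>phi\<close> has the channel input as first and the reference as second
   argument, whereas in \<open>psi\<close> the reference is the leading factor.\<close>
 define psi where "psi = vec (dA * dA) (%k. phi (k mod dA, k div dA))"
 let ?omega = "apply_on [dA, dA] 1 N (dB * dC) (outer psi)" and ?ds = "[dA, dB, dC]"
 have "(nsq {..<dA * dA} (%i. psi $ i)) = (SUM r<dA. SUM a<dA. (cmod (phi (a, r)))^2)"
  unfolding sum_flat2 by (intro sum.cong refl) (use flat_less2 in "auto simp: psi_def flat_div_mod")
 also have "... = 1" unfolding n[symmetric] sum_Times by (rule sum.swap)
 finally have u: "unit_vector (dA * dA) psi" by (simp add: unit_vector_def psi_def)
 have ne: "extensions ?ds ?omega ~= {}" using trivial_extension[OF assms(4,1,2,3) u] by blast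
 have b: "2 * rate ?rt 0 <= cmi (?ds @ [dE]) [{0, 2}, {1}] (length ?ds) Om" "2 * rate ?rt 1 <= cmi (?ds @ [dE]) [{0, 1}, {2}] (length ?ds) Om"
  "2 * rate ?rt 2 <= cmi (?ds @ [dE]) [{0}, {1, 2}] (length ?ds) Om" "2 * rate ?rt 3 <= cmi (?ds @ [dE]) [{0}, {1}, {2}] (length ?ds) Om"
  "2 * rate ?rt 3 <= cmi_tilde (?ds @ [dE]) [{0}, {1}, {2}] (length ?ds) Om" if e: "(dE, Om) : extensions ?ds ?omega" for dE Om
 proof -
  have l: "?ds @ [dE] = [dA, dB, dC, dE]" "length ?ds = 3" by simp_all
  show "2 * rate ?rt 0 <= cmi (?ds @ [dE]) [{0, 2}, {1}] (length ?ds) Om" "2 * rate ?rt 1 <= cmi (?ds @ [dE]) [{0, 1}, {2}] (length ?ds) Om"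
   "2 * rate ?rt 2 <= cmi (?ds @ [dE]) [{0}, {1, 2}] (length ?ds) Om" "2 * rate ?rt 3 <= cmi (?ds @ [dE]) [{0}, {1}, {2}] (length ?ds) Om"
   "2 * rate ?rt 3 <= cmi_tilde (?ds @ [dE]) [{0}, {1}, {2}] (length ?ds) Om"
   unfolding l by (rule extension_bounds[OF assms(4,1,2,3) q e[unfolded psi_def]]; assumption)+
 qed
 have E: "x <= Esq ?ds parts ?omega" if "!!dE Om. (dE, Om) : extensions ?ds ?omega ==> 2 * x <= cmi (?ds @ [dE]) parts (length ?ds) Om" for x parts
 proof -
  have "2 * x <= Inf ((%(dE, Om). cmi (?ds @ [dE]) parts (length ?ds) Om) ` extensions ?ds ?omega)"
   by (rule cINF_greatest[OF ne]) (use that in auto)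
  thus ?thesis by (simp add: Esq_def)
 qed
 have E': "x <= Esq_tilde ?ds parts ?omega" if "!!dE Om. (dE, Om) : extensions ?ds ?omega ==> 2 * x <= cmi_tilde (?ds @ [dE]) parts (length ?ds) Om" for x parts
 proof -
  have "2 * x <= Inf ((%(dE, Om). cmi_tilde (?ds @ [dE]) parts (length ?ds) Om) ` extensions ?ds ?omega)"
   by (rule cINF_greatest[OF ne]) (use that in auto)
  thus ?thesis by (simp add: Esq_tilde_def)
 qed
 have r: "rate ?rt 0 = eAB + kAB + eBC + kBC + eABC + kABC" "rate ?rt 1 = eAC + kAC + eBC + kBC + eABC + kABC"
  "rate ?rt 2 = eAB + kAB + eAC + kAC + eABC + kABC" "rate ?rt 3 = eAB + kAB + eAC + kAC + eBC + kBC + 3/2 * (eABC + kABC)"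
  by (simp_all add: rate_def)
 show ?thesis
  unfolding r[symmetric] Let_def
  by (rule exI[of _ dA], rule exI[of _ psi]) (intro conjI assms(1) order_refl u min.boundedI E E' b; assumption)
qed

end
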